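(* Let $k$ be a field, $P_1=k[x_1,\ldots,x_n]$, $P_2=k[y_1,\ldots,y_m]$ and $P=k[x_1,\ldots,x_n,y_1,\ldots,y_m]$. Let $R_1=P_1/(a_1,\ldots,a_t)$ and $S_1=P_2/(b_1,\ldots,b_u)$ be non-Gorenstein rings with $\mathfrak m_{R_1}^3=0$ and $\mathfrak m_{S_1}^3=0$, where $a_1,\ldots,a_t$ and $b_1,\ldots,b_u$ are minimal systems of homogeneous generators of the defining ideals, and $f:=a_1$, $g:=b_1$ have degree two. Put $I_1=\mathfrak m_{P_1}a_1+(a_2,\ldots,a_t)$, $I_2=\mathfrak m_{P_2}b_1+(b_2,\ldots,b_u)$, $R_0=P_1/I_1$, $S_0=P_2/I_2$, and $$R=\frac{P}{I_1P+I_2P+(f-g)+(x_iy_j \mid 1\le i\le n,\ 1\le j\le m)}.$$ Assume that $R$ is not Gorenstein. Then $R$ has a minimal totally acyclic complex if and only if both of the following hold: (1) there is a minimal totally acyclic complex $\cdots\to R_1^{b}\xrightarrow{A_{i+1}}R_1^{b}\xrightarrow{A_i}R_1^{b}\to\cdots$ over $R_1$ such that $(f)R_0^{b}\subseteq \operatorname{im}(\tilde A_{i})$ for all $i$; (2) there is a minimal totally acyclic complex $\cdots\to S_1^{c}\xrightarrow{B_{i+1}}S_1^{c}\xrightarrow{B_i}S_1^{c}\to\cdots$ over $S_1$ such that $(g)S_0^{c}\subseteq \operatorname{im}(\tilde B_{i})$ for all $i$. Here $\tilde A_i:R_0^b\to R_0^b$ and $\tilde B_i:S_0^c\to S_0^c$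 are the liftings of $A_i$ and $B_i$.
   Context: All rings are Noetherian standard graded algebras over the field $k$; $[R]_i$ is the $i$th graded component of a ring $R$ and $\mathfrak m_R$ is its unique maximal homogeneous ideal. A complex of finitely generated free $R$-modules $\cdots\to R^{b_i}\xrightarrow{d_i}R^{b_{i-1}}\to\cdots$ (infinite in both directions) is minimal if $\operatorname{im}(d_i)\subseteq\mathfrak m_R R^{b_{i-1}}$ for all $i$. It is totally acyclic if it is exact and its dual, obtained by applying $\operatorname{Hom}_R(-,R)$, is also exact. Minimal totally acyclic complexes are understood to be nonzero. (Existence of one is equivalent to existence of a non-free totally reflexive $R$-module.) It is a known theorem of Yoshino that, over a non-Gorenstein ring with $\mathfrak m^3=0$, every minimal totally acyclic complex has free modules of constant rank and its maps are represented by matrices with entries of degree one; this is the convention used for the complexes above. Liftings: since $f$ has degree two, $[R_0]_1\to[R_1]_1$ is an isomorphism (note $R_1=R_0/(f)$). For a matrix $A_i$ with entries in $[R_1]_1$, the lifting $\tilde A_i$ is the matrix over $R_0$ whose entries are the unique degree-one lifts of the entries of $A_i$. The lifting $\tilde B_i$ is defined in the same way using $S_0\to S_1=S_0/(g)$. *)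

theory Defs
  imports "HOL-Library.Poly_Mapping" "HOL-Algebra.Algebra"
begin

section \<open>Polynomial rings and their homogeneous quotients\<close>

text \<open>
  \<open>('x, 'k) mpoly\<close> is the polynomial ring over \<open>'k\<close> whose variables are indexed by \<open>'x\<close>:
  finitely supported functions from exponent vectors to coefficients, with convolution as product.
  For a finite type \<open>'x\<close> with \<open>n\<close> elements it is \<open>k[x\<^sub>1, \<dots>, x\<^sub>n]\<close>, and
  \<open>('x + 'y, 'k) mpoly\<close> is the polynomial ring in the disjoint union of two sets of variables.
\<close>

type_synonym ('x, 'k) mpoly = "('x \<Rightarrow>\<^sub>0 nat) \<Rightarrow>\<^sub>0 'k"

definition mpoly_ring :: "('x, 'k::field) mpoly ring" where
  "mpoly_ring = \<lparr>carrier = UNIV, monoid.mult = (*), one = 1, ring.zero = 0, ring.add = (+)\<rparr>"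

definition mvar :: "'x \<Rightarrow> ('x, 'k::field) mpoly" where
  "mvar x = Poly_Mapping.single (Poly_Mapping.single x 1) 1"

text \<open>The \<open>d\<close>-th graded component of the polynomial ring (standard grading).\<close>

definition homog :: "nat \<Rightarrow> ('x, 'k::field) mpoly set" where
  "homog d = {p. \<forall>\<mu>\<in>Poly_Mapping.keys p.
                  (\<Sum>x\<in>Poly_Mapping.keys \<mu>. Poly_Mapping.lookup \<mu> x) = d}"

definition irrelevant_ideal :: "('x, 'k::field) mpoly set" where
  "irrelevant_ideal = Idl\<^bsub>mpoly_ring\<^esub> (range mvar)"

text \<open>The \<open>k\<close>-algebra homomorphism sending the variable \<open>x\<close> to the variable \<open>h x\<close>; for \<open>Inl\<close> and
  \<open>Inr\<close> these are the inclusions of the two smaller polynomial rings into the big one.\<close>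

definition rename :: "('x \<Rightarrow> 'z) \<Rightarrow> ('x, 'k::field) mpoly \<Rightarrow> ('z, 'k) mpoly" where
  "rename h p = (\<Sum>\<mu>\<in>Poly_Mapping.keys p.
     Poly_Mapping.single
       (\<Sum>x\<in>Poly_Mapping.keys \<mu>. Poly_Mapping.single (h x) (Poly_Mapping.lookup \<mu> x))
       (Poly_Mapping.lookup p \<mu>))"

text \<open>For a homogeneous ideal \<open>I\<close>: the \<open>d\<close>-th graded component and the maximal homogeneous ideal of
  \<open>mpoly_ring Quot I\<close>, whose elements are cosets.\<close>

definition quot_comp :: "('x, 'k::field) mpoly set \<Rightarrow> nat \<Rightarrow> ('x, 'k) mpoly set set" where
  "quot_comp I d = (\<lambda>p. I +>\<^bsub>mpoly_ring\<^esub> p) ` homog d"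

definition quot_max :: "('x, 'k::field) mpoly set \<Rightarrow> ('x, 'k) mpoly set set" where
  "quot_max I = (\<lambda>p. I +>\<^bsub>mpoly_ring\<^esub> p) ` irrelevant_ideal"

text \<open>For \<open>I \<subseteq> K\<close>, the natural map \<open>mpoly_ring Quot I \<rightarrow> mpoly_ring Quot K\<close>; on cosets it is
  \<open>I + p \<mapsto> K + (I + p) = K + p\<close>.\<close>

definition quot_proj ::
    "('x, 'k::field) mpoly set \<Rightarrow> ('x, 'k) mpoly set \<Rightarrow> ('x, 'k) mpoly set" where
  "quot_proj K s = K <+>\<^bsub>mpoly_ring\<^esub> s"

text \<open>Entrywise lift of a matrix of linear forms along \<open>mpoly_ring Quot I \<rightarrow> mpoly_ring Quot K\<close>,
  which is used only when this map is bijective in degree one.\<close>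

definition lift_matrix ::
    "('x, 'k::field) mpoly set \<Rightarrow> ('x, 'k) mpoly set \<Rightarrow>
     (nat \<Rightarrow> nat \<Rightarrow> ('x, 'k) mpoly set) \<Rightarrow> nat \<Rightarrow> nat \<Rightarrow> ('x, 'k) mpoly set" where
  "lift_matrix I K A = (\<lambda>p q. the_inv_into (quot_comp I 1) (quot_proj K) (A p q))"

text \<open>\<open>a 1, \<dots>, a t\<close> are homogeneous, and none of them can be omitted without changing the ideal they
  generate.  Indices rather than elements are removed, so repetitions are excluded.\<close>

definition minimal_homogeneous_generators :: "(nat \<Rightarrow> ('x, 'k::field) mpoly) \<Rightarrow> nat \<Rightarrow> bool" where
  "minimal_homogeneous_generators a t \<longleftrightarrow>
     (\<forall>i\<in>{1..t}. \<exists>d. a i \<in> homog d) \<and>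
     (\<forall>J. J \<subset> {1..t} \<longrightarrow> Idl\<^bsub>mpoly_ring\<^esub> (a ` J) \<noteq> Idl\<^bsub>mpoly_ring\<^esub> (a ` {1..t}))"


section \<open>Finitely generated free modules, duals and complexes\<close>

text \<open>In the module records below the ring multiplication and unit carry no meaning.\<close>

definition free_module :: "('r, 'm) ring_scheme \<Rightarrow> nat \<Rightarrow> ('r, nat \<Rightarrow> 'r) module" where
  "free_module R n =
     \<lparr>carrier = {..<n} \<rightarrow>\<^sub>E carrier R, monoid.mult = undefined, one = undefined,
      ring.zero = (\<lambda>i\<in>{..<n}. \<zero>\<^bsub>R\<^esub>), ring.add = (\<lambda>v w. \<lambda>i\<in>{..<n}. v i \<oplus>\<^bsub>R\<^esub> w i),
      smult = (\<lambda>r v. \<lambda>i\<in>{..<n}. r \<otimes>\<^bsub>R\<^esub> v i)\<rparr>"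

definition self_module :: "('r, 'm) ring_scheme \<Rightarrow> ('r, 'r) module" where
  "self_module R =
     \<lparr>carrier = carrier R, monoid.mult = undefined, one = undefined,
      ring.zero = \<zero>\<^bsub>R\<^esub>, ring.add = ring.add R, smult = monoid.mult R\<rparr>"

text \<open>Linear maps are taken extensional, so that equality is equality on the carrier.\<close>

definition linear_maps ::
    "('r, 'm) ring_scheme \<Rightarrow> ('r, 'a) module \<Rightarrow> ('r, 'b) module \<Rightarrow> ('a \<Rightarrow> 'b) set" where
  "linear_maps R M N =
     {h \<in> carrier M \<rightarrow>\<^sub>E carrier N.
        (\<forall>x\<in>carrier M. \<forall>y\<in>carrier M. h (x \<oplus>\<^bsub>M\<^esub> y) = h x \<oplus>\<^bsub>N\<^esub> h y) \<and>
        (\<forall>r\<in>carrier R. \<forall>x\<in>carrier M. h (r \<odot>\<^bsub>M\<^esub> x) = r \<odot>\<^bsub>N\<^esub> h x)}"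

text \<open>\<open>Hom\<^sub>R(M, R)\<close> as an \<open>R\<close>-module, and \<open>Hom\<^sub>R(h, R) : Hom\<^sub>R(N, R) \<rightarrow> Hom\<^sub>R(M, R)\<close> for a
  linear map \<open>h : M \<rightarrow> N\<close>.\<close>

definition dual_module ::
    "('r, 'm) ring_scheme \<Rightarrow> ('r, 'a) module \<Rightarrow> ('r, 'a \<Rightarrow> 'r) module" where
  "dual_module R M =
     \<lparr>carrier = linear_maps R M (self_module R), monoid.mult = undefined, one = undefined,
      ring.zero = (\<lambda>x\<in>carrier M. \<zero>\<^bsub>R\<^esub>), ring.add = (\<lambda>\<phi> \<psi>. \<lambda>x\<in>carrier M. \<phi> x \<oplus>\<^bsub>R\<^esub> \<psi> x),
      smult = (\<lambda>r \<phi>. \<lambda>x\<in>carrier M. r \<otimes>\<^bsub>R\<^esub> \<phi> x)\<rparr>"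

definition dual_map ::
    "('r, 'm) ring_scheme \<Rightarrow> ('r, 'a) module \<Rightarrow> ('r, 'b) module \<Rightarrow> ('a \<Rightarrow> 'b) \<Rightarrow>
     ('b \<Rightarrow> 'r) \<Rightarrow> 'a \<Rightarrow> 'r" where
  "dual_map R M N h = (\<lambda>\<phi>\<in>carrier (dual_module R N). compose (carrier M) \<phi> h)"

text \<open>The linear map \<open>R\<^sup>n \<rightarrow> R\<^sup>m\<close> given by an \<open>m \<times> n\<close> matrix acting on column vectors.\<close>

definition matrix_map ::
    "('r, 'm) ring_scheme \<Rightarrow> nat \<Rightarrow> nat \<Rightarrow> (nat \<Rightarrow> nat \<Rightarrow> 'r) \<Rightarrow> (nat \<Rightarrow> 'r) \<Rightarrow> nat \<Rightarrow> 'r" where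
  "matrix_map R m n A =
     (\<lambda>v\<in>carrier (free_module R n). \<lambda>p\<in>{..<m}. \<Oplus>\<^bsub>R\<^esub>q\<in>{..<n}. A p q \<otimes>\<^bsub>R\<^esub> v q)"

text \<open>The submodule \<open>J R\<^sup>n\<close> of \<open>R\<^sup>n\<close> for an ideal \<open>J\<close>: the vectors with all entries in \<open>J\<close>.\<close>

definition ideal_free :: "'r set \<Rightarrow> nat \<Rightarrow> (nat \<Rightarrow> 'r) set" where
  "ideal_free J n = {..<n} \<rightarrow>\<^sub>E J"

text \<open>Complexes are indexed homologically: \<open>d i\<close> maps \<open>F i\<close> to \<open>F (i - 1)\<close>.\<close>

definition exact_complex :: "(int \<Rightarrow> ('r, 'a) module) \<Rightarrow> (int \<Rightarrow> 'a \<Rightarrow> 'a) \<Rightarrow> bool" where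
  "exact_complex F d \<longleftrightarrow>
     (\<forall>i. d (i + 1) ` carrier (F (i + 1)) = a_kernel (F i) (F (i - 1)) (d i))"

text \<open>The dual complex has \<open>Hom\<^sub>R(F (-i), R)\<close> in homological degree \<open>i\<close>.\<close>

definition totally_acyclic ::
    "('r, 'm) ring_scheme \<Rightarrow> (int \<Rightarrow> nat) \<Rightarrow> (int \<Rightarrow> (nat \<Rightarrow> 'r) \<Rightarrow> nat \<Rightarrow> 'r) \<Rightarrow> bool" where
  "totally_acyclic R r d \<longleftrightarrow>
     (let F = (\<lambda>i. free_module R (r i)) in
       (\<forall>i. d i \<in> linear_maps R (F i) (F (i - 1))) \<and>
       exact_complex F d \<and>
       exact_complex (\<lambda>i. dual_module R (F (- i)))
                     (\<lambda>i. dual_map R (F (1 - i)) (F (- i)) (d (1 - i))))"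

text \<open>\<open>\<mm>\<close> is the maximal homogeneous ideal of \<open>R\<close>.  The complex is required to be nonzero.\<close>

definition minimal_totally_acyclic ::
    "('r, 'm) ring_scheme \<Rightarrow> 'r set \<Rightarrow> (int \<Rightarrow> nat) \<Rightarrow>
     (int \<Rightarrow> (nat \<Rightarrow> 'r) \<Rightarrow> nat \<Rightarrow> 'r) \<Rightarrow> bool" where
  "minimal_totally_acyclic R \<mm> r d \<longleftrightarrow>
     totally_acyclic R r d \<and>
     (\<forall>i. d i ` carrier (free_module R (r i)) \<subseteq> ideal_free \<mm> (r (i - 1))) \<and>
     (\<exists>i. r i > 0)"


section \<open>Gorenstein rings\<close>

text \<open>
  A Noetherian ring of finite Krull dimension is Gorenstein iff it has finite injective dimension
  over itself, that is, iff for some \<open>n\<close> one has \<open>Ext\<^sup>i\<^sub>R(M, R) = 0\<close> for all \<open>i > n\<close> and all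
  finitely generated \<open>M\<close>.  Such an \<open>M\<close> is given by a resolution
  \<open>\<cdots> \<rightarrow> F 2 \<rightarrow> F 1 \<rightarrow> F 0 \<rightarrow> M \<rightarrow> 0\<close> by finitely generated free modules, with
  \<open>d i : F (i + 1) \<rightarrow> F i\<close> and \<open>M = coker (d 0)\<close>; the last line of the definition states
  \<open>Ext\<^sup>i\<^sup>+\<^sup>1\<^sub>R(M, R) = 0\<close>.
\<close>

definition gorenstein :: "('r, 'm) ring_scheme \<Rightarrow> bool" where
  "gorenstein R \<longleftrightarrow>
     (\<exists>n. \<forall>(r :: nat \<Rightarrow> nat) d.
        let F = (\<lambda>i. free_module R (r i)) in
          (\<forall>i. d i \<in> linear_maps R (F (i + 1)) (F i)) \<longrightarrow>
          (\<forall>i. d (i + 1) ` carrier (F (i + 2)) = a_kernel (F (i + 1)) (F i) (d i)) \<longrightarrow>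
          (\<forall>i\<ge>n. dual_map R (F (i + 1)) (F i) (d i) ` carrier (dual_module R (F i)) =
                  a_kernel (dual_module R (F (i + 1))) (dual_module R (F (i + 2)))
                    (dual_map R (F (i + 2)) (F (i + 1)) (d (i + 1)))))"

end

theory Submission
  imports Defs
begin

text \<open>
  Over a non-Gorenstein ring \<open>A\<close> with \<open>\<mm>\<^sup>3 = 0\<close> the linear strands
  \<open>0 \<rightarrow> k\<^bsup>b (i+1)\<^esup> \<rightarrow> ([A]\<^sub>1)\<^bsup>b i\<^esup> \<rightarrow> ([A]\<^sub>2)\<^bsup>b (i-1)\<^esup> \<rightarrow> 0\<close> of a minimal totally acyclic complex are exact: if a vector with
  a unit entry were mapped into the socle, exactness of the dual complex would make every
  homomorphism \<open>\<mm> \<rightarrow> A\<close> a multiplication, and \<open>A\<close> would be self-injective by Baer's criterion.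
  Counting dimensions in the strands of the complex and of its dual shows that the ranks are constant
  and that \<open>dim [A]\<^sub>1 = dim [A]\<^sub>2 + 1\<close>.

  A complex over \<open>R\<close> has differentials \<open>X\<^sub>i + Y\<^sub>i\<close> with linear forms in the \<open>x\<close>- and \<open>y\<close>-variables.
  If \<open>X\<^sub>i\<close> kills a constant vector \<open>v \<noteq> 0\<close> and \<open>u\<close> is a linear form in the \<open>x\<close>-variables, then \<open>u v\<close> is a
  cycle, so that \<open>u v = X\<^sub>i\<^sub>+\<^sub>1 w\<close> and \<open>Y\<^sub>i\<^sub>+\<^sub>1 w = 0\<close> for a constant vector \<open>w\<close>.  Two independent forms
  \<open>u\<close> double the number of independent kernel vectors in each step, which is impossible in bounded
  rank.  Hence the strands of \<open>X\<close> and \<open>Y\<close> are exact on the left, and \<open>dim [R]\<^sub>1 = dim [R]\<^sub>2 + 1\<close> for the connected sum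
  \<open>R\<close> makes them exact everywhere; moreover \<open>X\<^sub>i X\<^sub>i\<^sub>+\<^sub>1 = f C\<^sub>i\<close> and \<open>Y\<^sub>i Y\<^sub>i\<^sub>+\<^sub>1 = - g C\<^sub>i\<close> with constant
  matrices \<open>C\<^sub>i\<close>.

  Conversely, if \<open>A\<close> and \<open>B\<close> are complexes over the summands, their lifts satisfy
  \<open>A\<^sub>i A\<^sub>i\<^sub>+\<^sub>1 = f C\<^sub>i\<close> and \<open>B\<^sub>i B\<^sub>i\<^sub>+\<^sub>1 = g E\<^sub>i\<close>, and the lifting condition says that the constant matrices
  \<open>C\<^sub>i\<close> and \<open>E\<^sub>i\<close> are invertible.  Choose invertible constant matrices with
  \<open>\<alpha>\<^sub>i \<alpha>\<^sub>i\<^sub>+\<^sub>1 = - E\<^sub>i\<close> and \<open>\<beta>\<^sub>i \<beta>\<^sub>i\<^sub>+\<^sub>1 = C\<^sub>i\<close>.  Then the matrices \<open>A\<^sub>i \<otimes> \<alpha>\<^sub>i + \<beta>\<^sub>i \<otimes> B\<^sub>i\<close> form a complex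
  over \<open>R\<close>, since \<open>f = g\<close> and all products of variables from different sets vanish there.
\<close>

section \<open>Polynomials\<close>

text \<open>Two obstacles shape the argument. Constant rank and linear entries are not assumed over
  \<open>R\<close>; they have to come out of the ring not being Gorenstein, used in the form that
  some homomorphism from the maximal ideal to the ring is not a multiplication
  (\<open>\<not> mult_ext\<close>). With \<open>e\<close> and \<open>\<rho>\<close> the dimensions
  in degrees one and two, the strands of a complex and of its dual give
  \<open>r (i+1) + \<rho> r (i-1) = e r i\<close> and the mirror image of this. These force constant
  rank unless \<open>\<rho> = 1\<close>, and then the socle is a line and the ring would be
  Gorenstein.

  In the converse the plain sum of two complexes does not work: the products of consecutive maps
  must be \<open>f C\<close> on one side and \<open>- g C\<close> on the other with the same
  \<open>C\<close>, while the summands come with unrelated matrices of different sizes. Tensoring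
  with constant matrices replaces both by \<open>- C \<otimes> E\<close>. Invertibility is then used
  twice: it provides the one quadric \<open>f = g\<close> that both summands miss, and it makes the
  preimages found on the two sides agree.\<close>

definition mdeg :: "('x::finite \<Rightarrow>\<^sub>0 nat) \<Rightarrow> nat" where
  "mdeg \<mu> = (\<Sum>x\<in>UNIV. Poly_Mapping.lookup \<mu> x)"

lemma mdeg_keys: "(\<Sum>x\<in>Poly_Mapping.keys \<mu>. Poly_Mapping.lookup \<mu> x) = mdeg \<mu>"
  unfolding mdeg_def by (rule sum.mono_neutral_left) (auto simp: in_keys_iff)

lemma mdeg_0 [simp]: "mdeg 0 = 0"
  by (simp add: mdeg_def)

lemma mdeg_add [simp]: "mdeg (\<mu> + \<nu>) = mdeg \<mu> + mdeg \<nu>"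
  by (simp add: mdeg_def lookup_add sum.distrib)

lemma mdeg_single [simp]: "mdeg (Poly_Mapping.single x n) = n"
proof -
  have "mdeg (Poly_Mapping.single x n) = (\<Sum>y\<in>UNIV. if y = x then n else 0)"
    unfolding mdeg_def by (rule sum.cong) (auto simp: lookup_single when_def)
  then show ?thesis by simp
qed

lemma mdeg_eq_0_iff [simp]: "mdeg \<mu> = 0 \<longleftrightarrow> \<mu> = 0"
  by (auto simp: mdeg_def intro!: poly_mapping_eqI)

lemma homog_iff: "p \<in> homog d \<longleftrightarrow> (\<forall>\<mu>. Poly_Mapping.lookup p \<mu> \<noteq> 0 \<longrightarrow> mdeg \<mu> = d)"
  by (auto simp: homog_def mdeg_keys in_keys_iff)

definition cst :: "'k \<Rightarrow> ('x, 'k::field) mpoly" where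
  "cst c = Poly_Mapping.single 0 c"

lemma cst_0 [simp]: "cst 0 = 0" by (simp add: cst_def)
lemma cst_1 [simp]: "cst 1 = 1" by (simp add: cst_def)
lemma cst_add: "cst (a + b) = cst a + cst b" by (simp add: cst_def single_add)
lemma cst_mult: "cst (a * b) = cst a * cst b" by (simp add: cst_def mult_single)
lemma cst_uminus: "cst (- a) = - cst a" by (simp add: cst_def single_uminus)
lemma cst_diff: "cst (a - b) = cst a - cst b" by (simp add: cst_def single_diff)
lemma cst_sum: "cst (sum f A) = (\<Sum>i\<in>A. cst (f i))"
  by (induct A rule: infinite_finite_induct) (simp_all add: cst_add)
lemma cst_eq_0_iff [simp]: "cst c = 0 \<longleftrightarrow> c = 0"
  by (metis cst_0 cst_def lookup_single_eq)
lemma cst_inject [simp]: "cst c = cst d \<longleftrightarrow> c = d"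
  by (metis cst_def lookup_single_eq)

lemma cst_inverse: "c \<noteq> 0 \<Longrightarrow> cst c * (cst (1 / c) * p) = p"
  by (simp add: cst_mult [symmetric] mult.assoc [symmetric])

lemma mpoly_expand:
  "p = (\<Sum>\<mu>\<in>Poly_Mapping.keys p. Poly_Mapping.single \<mu> (Poly_Mapping.lookup p \<mu>))"
proof (rule poly_mapping_eqI)
  fix \<nu>
  have "Poly_Mapping.lookup (\<Sum>\<mu>\<in>Poly_Mapping.keys p. Poly_Mapping.single \<mu> (Poly_Mapping.lookup p \<mu>)) \<nu>
      = (\<Sum>\<mu>\<in>Poly_Mapping.keys p. if \<mu> = \<nu> then Poly_Mapping.lookup p \<mu> else 0)"
    by (simp add: lookup_sum lookup_single when_def)
  also have "\<dots> = Poly_Mapping.lookup p \<nu>" by (simp add: in_keys_iff)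
  finally show "Poly_Mapping.lookup p \<nu> = Poly_Mapping.lookup
     (\<Sum>\<mu>\<in>Poly_Mapping.keys p. Poly_Mapping.single \<mu> (Poly_Mapping.lookup p \<mu>)) \<nu>" by simp
qed

lemma monomial_eq:
  "Poly_Mapping.single \<mu> (c::'k::field) = cst c * Poly_Mapping.single \<mu> 1"
  by (simp add: cst_def mult_single)

lemma mvar_power: "mvar x ^ n = Poly_Mapping.single (Poly_Mapping.single x n) (1::'k::field)"
  by (induct n) (simp_all add: mvar_def mult_single single_add [symmetric])

lemma prod_single:
  "finite A \<Longrightarrow> (\<Prod>x\<in>A. Poly_Mapping.single (f x) (1::'k::field)) = Poly_Mapping.single (\<Sum>x\<in>A. f x) 1"
  by (induct A rule: finite_induct) (simp_all add: mult_single)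

lemma exponent_nonzero_split:
  fixes \<mu> :: "'x \<Rightarrow>\<^sub>0 nat"
  assumes "\<mu> \<noteq> 0"
  obtains x \<nu> where "\<mu> = Poly_Mapping.single x 1 + \<nu>"
proof -
  obtain x where x: "Poly_Mapping.lookup \<mu> x \<noteq> 0"
    using assms by (metis lookup_zero poly_mapping_eqI)
  have "\<mu> = Poly_Mapping.single x 1 + (\<mu> - Poly_Mapping.single x 1)"
    using x by (intro poly_mapping_eqI) (auto simp: lookup_add lookup_minus lookup_single when_def)
  then show ?thesis using that by blast
qed

lemma monomial_induct [case_names one var]:
  fixes \<mu> :: "'x::finite \<Rightarrow>\<^sub>0 nat"
  assumes one: "P 0"
    and var: "\<And>x \<nu>. P \<nu> \<Longrightarrow> P (Poly_Mapping.single x 1 + \<nu>)"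
  shows "P \<mu>"
proof (induct "mdeg \<mu>" arbitrary: \<mu>)
  case 0 then show ?case using one by simp
next
  case (Suc n)
  then have "\<mu> \<noteq> 0" by auto
  then obtain x \<nu> where m: "\<mu> = Poly_Mapping.single x 1 + \<nu>" by (rule exponent_nonzero_split)
  with Suc(2) have "n = mdeg \<nu>" by simp
  then show ?case using Suc(1) var m by blast
qed

text \<open>Multiplying by one variable at a time suits both algebra homomorphisms and ideals, so
  that identities and memberships can be checked without mentioning monomials.\<close>

lemma mpoly_induct [case_names cst add var]:
  fixes p :: "('x::finite, 'k::field) mpoly"
  assumes cst: "\<And>c. P (cst c)"
    and add: "\<And>p q. P p \<Longrightarrow> P q \<Longrightarrow> P (p + q)"
    and var: "\<And>x p. P p \<Longrightarrow> P (mvar x * p)"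
  shows "P p"
proof -
  have mono: "P (Poly_Mapping.single \<mu> c)" for \<mu> c
  proof (induct \<mu> rule: monomial_induct)
    case one then show ?case using cst by (simp add: cst_def)
  next
    case (var x \<nu>)
    have "Poly_Mapping.single (Poly_Mapping.single x 1 + \<nu>) c = mvar x * Poly_Mapping.single \<nu> c"
      by (simp add: mvar_def mult_single)
    then show ?case using assms(3) var by simp
  qed
  have "P (\<Sum>\<mu>\<in>A. Poly_Mapping.single \<mu> (Poly_Mapping.lookup p \<mu>))" if "finite A" for A
    using that
  proof (induct A rule: finite_induct)
    case empty then show ?case using cst [of 0] by simp
  qed (simp add: add mono)
  then show ?thesis by (subst mpoly_expand) simp
qed

subsection \<open>Evaluation\<close>

definition meval :: "('x::finite \<Rightarrow> ('z, 'k) mpoly) \<Rightarrow> ('x, 'k::field) mpoly \<Rightarrow> ('z, 'k) mpoly" where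
  "meval h p = (\<Sum>\<mu>\<in>Poly_Mapping.keys p.
     cst (Poly_Mapping.lookup p \<mu>) * (\<Prod>x\<in>UNIV. h x ^ Poly_Mapping.lookup \<mu> x))"

text \<open>The support of a sum may shrink by cancellation; a common finite index set for all
  summands is what makes additivity provable.\<close>

lemma meval_superset:
  assumes "finite A" "Poly_Mapping.keys p \<subseteq> A"
  shows "meval h p = (\<Sum>\<mu>\<in>A.
     cst (Poly_Mapping.lookup p \<mu>) * (\<Prod>x\<in>UNIV. h x ^ Poly_Mapping.lookup \<mu> x))"
  unfolding meval_def using assms by (intro sum.mono_neutral_left) (auto simp: in_keys_iff)

lemma meval_add [simp]: "meval h (p + q) = meval h p + meval h q"
proof -
  let ?A = "Poly_Mapping.keys p \<union> Poly_Mapping.keys q"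
  have k: "Poly_Mapping.keys (p + q) \<subseteq> ?A" by (rule keys_add)
  show ?thesis
    by (subst (1 2 3) meval_superset [of ?A])
       (use k in \<open>simp_all add: lookup_add cst_add distrib_right sum.distrib\<close>)
qed

lemma meval_single:
  "meval h (Poly_Mapping.single \<mu> c) = cst c * (\<Prod>x\<in>UNIV. h x ^ Poly_Mapping.lookup \<mu> x)"
  by (subst meval_superset [of "{\<mu>}"]) (simp_all add: lookup_single)

lemma meval_cst [simp]: "meval h (cst c) = cst c"
  by (simp add: cst_def meval_single)

lemma meval_0 [simp]: "meval h 0 = 0" using meval_cst [of h 0] by simp
lemma meval_1 [simp]: "meval h 1 = 1" using meval_cst [of h 1] by simp

lemma meval_mvar_mult: "meval h (mvar x * p) = h x * meval h p"
proof -
  have mono: "meval h (mvar x * Poly_Mapping.single \<mu> c) = h x * meval h (Poly_Mapping.single \<mu> c)" for \<mu> c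
  proof -
    have "(\<Prod>y\<in>UNIV. h y ^ Poly_Mapping.lookup (Poly_Mapping.single x 1 + \<mu>) y)
       = (\<Prod>y\<in>UNIV. (if y = x then h x else 1) * h y ^ Poly_Mapping.lookup \<mu> y)"
      by (rule prod.cong) (auto simp: lookup_add lookup_single when_def)
    also have "\<dots> = h x * (\<Prod>y\<in>UNIV. h y ^ Poly_Mapping.lookup \<mu> y)"
      by (simp add: prod.distrib)
    finally show ?thesis
      by (simp add: mvar_def mult_single meval_single ac_simps)
  qed
  have "meval h (mvar x * (\<Sum>\<mu>\<in>A. Poly_Mapping.single \<mu> (c \<mu>))) = h x * meval h (\<Sum>\<mu>\<in>A. Poly_Mapping.single \<mu> (c \<mu>))"
    if "finite A" for A c
    using that by (induct A rule: finite_induct) (simp_all add: mono distrib_left)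
  then show ?thesis by (subst (1 2) mpoly_expand [of p]) simp
qed

lemma meval_mvar [simp]: "meval h (mvar x) = h x"
  using meval_mvar_mult [of h x 1] by simp

lemma meval_cst_mult: "meval h (cst c * q) = cst c * meval h q"
proof (induct q rule: mpoly_induct)
  case (cst d) then show ?case by (simp add: cst_mult [symmetric])
next
  case (add p q) then show ?case by (simp add: distrib_left)
next
  case (var x p)
  then show ?case by (simp add: mult.left_commute [of "cst c"] meval_mvar_mult)
qed

lemma meval_mult [simp]: "meval h (p * q) = meval h p * meval h q"
proof (induct p rule: mpoly_induct)
  case (cst c) then show ?case by (simp add: meval_cst_mult)
next
  case (add p q) then show ?case by (simp add: distrib_right)
next
  case (var x p) then show ?case by (simp add: meval_mvar_mult mult.assoc)
qed

lemma meval_meval: "meval h (meval g p) = meval (\<lambda>x. meval h (g x)) p"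
  by (induct p rule: mpoly_induct) (simp_all add: meval_mvar_mult)

lemma meval_ident: "meval mvar p = p"
  by (induct p rule: mpoly_induct) (simp_all add: meval_mvar_mult)

text \<open>Makes the inclusions of polynomial rings instances of substitution, so that
  multiplicativity and composition with other substitutions come from \<open>meval\<close>.\<close>

lemma rename_eq_meval:
  fixes p :: "('x::finite, 'k::field) mpoly"
  shows "rename h p = meval (\<lambda>x. mvar (h x)) p"
  unfolding rename_def meval_def
proof (rule sum.cong [OF refl])
  fix \<mu> :: "'x \<Rightarrow>\<^sub>0 nat"
  have "(\<Sum>x\<in>Poly_Mapping.keys \<mu>. Poly_Mapping.single (h x) (Poly_Mapping.lookup \<mu> x)) =
    (\<Sum>x\<in>UNIV. Poly_Mapping.single (h x) (Poly_Mapping.lookup \<mu> x))"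
    by (rule sum.mono_neutral_left) (auto simp: in_keys_iff)
  then show "Poly_Mapping.single (\<Sum>x\<in>Poly_Mapping.keys \<mu>. Poly_Mapping.single (h x) (Poly_Mapping.lookup \<mu> x))
      (Poly_Mapping.lookup p \<mu>) =
      cst (Poly_Mapping.lookup p \<mu>) * (\<Prod>x\<in>UNIV. mvar (h x) ^ Poly_Mapping.lookup \<mu> x)"
    by (simp add: mvar_power prod_single) (rule monomial_eq)
qed

subsection \<open>Homogeneous components\<close>

definition hpart :: "nat \<Rightarrow> ('x::finite, 'k::field) mpoly \<Rightarrow> ('x, 'k) mpoly" where
  "hpart d p = Poly_Mapping.mapp (\<lambda>\<mu> c. if mdeg \<mu> = d then c else 0) p"

lemma lookup_hpart:
  "Poly_Mapping.lookup (hpart d p) \<mu> = (if mdeg \<mu> = d then Poly_Mapping.lookup p \<mu> else 0)"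
  by (auto simp: hpart_def lookup_mapp in_keys_iff when_def)

lemma hpart_add [simp]: "hpart d (p + q) = hpart d p + hpart d q"
  by (intro poly_mapping_eqI) (simp add: lookup_hpart lookup_add)
lemma hpart_0 [simp]: "hpart d 0 = 0"
  by (intro poly_mapping_eqI) (simp add: lookup_hpart)
lemma hpart_diff [simp]: "hpart d (p - q) = hpart d p - hpart d q"
  by (intro poly_mapping_eqI) (simp add: lookup_hpart lookup_minus)
lemma hpart_sum: "hpart d (sum f A) = (\<Sum>i\<in>A. hpart d (f i))"
  by (induct A rule: infinite_finite_induct) simp_all

lemma hpart_homog [simp]: "hpart d p \<in> homog d"
  by (auto simp: homog_iff lookup_hpart)

lemma homog_hpart: "p \<in> homog e \<Longrightarrow> hpart d p = (if d = e then p else 0)"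
  by (auto simp: homog_iff lookup_hpart intro!: poly_mapping_eqI)

lemma hpart_hpart [simp]: "hpart d (hpart e p) = (if d = e then hpart e p else 0)"
  by (rule homog_hpart) simp

lemma homog_iff_hpart: "p \<in> homog d \<longleftrightarrow> hpart d p = p"
  by (metis homog_hpart hpart_homog)

lemma homog_zero [simp]: "(0 :: ('x::finite, 'k::field) mpoly) \<in> homog d" by (simp add: homog_iff_hpart)
lemma homog_add [intro]:
  fixes p :: "('x::finite, 'k::field) mpoly"
  shows "p \<in> homog d \<Longrightarrow> q \<in> homog d \<Longrightarrow> p + q \<in> homog d"
  by (simp add: homog_iff_hpart)
lemma homog_diff [intro]:
  fixes p :: "('x::finite, 'k::field) mpoly"
  shows "p \<in> homog d \<Longrightarrow> q \<in> homog d \<Longrightarrow> p - q \<in> homog d"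
  by (simp add: homog_iff_hpart)
lemma homog_sum [intro]:
  fixes f :: "'i \<Rightarrow> ('x::finite, 'k::field) mpoly"
  shows "(\<And>i. i \<in> A \<Longrightarrow> f i \<in> homog d) \<Longrightarrow> sum f A \<in> homog d"
  by (induct A rule: infinite_finite_induct) auto

lemma homog_mult [intro]:
  fixes p :: "('x::finite, 'k::field) mpoly"
  assumes "p \<in> homog d" "q \<in> homog e" shows "p * q \<in> homog (d + e)"
  unfolding homog_def mdeg_keys
proof safe
  fix \<mu> assume "\<mu> \<in> Poly_Mapping.keys (p * q)"
  then obtain \<alpha> \<beta> where "\<mu> = \<alpha> + \<beta>" "\<alpha> \<in> Poly_Mapping.keys p" "\<beta> \<in> Poly_Mapping.keys q"
    using keys_mult [of p q] by blast
  then show "mdeg \<mu> = d + e" using assms by (auto simp: homog_iff in_keys_iff)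
qed

lemma homog_single: "(Poly_Mapping.single \<mu> c :: ('x::finite, 'k::field) mpoly) \<in> homog (mdeg \<mu>)"
  by (auto simp: homog_iff lookup_single when_def)

lemma homog_cst [simp]: "(cst c :: ('x::finite, 'k::field) mpoly) \<in> homog 0"
  using homog_single [of 0 c] by (simp add: cst_def)

lemma hpart_cst [simp]: "hpart d (cst c :: ('x::finite, 'k::field) mpoly) = (if d = 0 then cst c else 0)"
  by (rule homog_hpart) simp

lemma homog_mvar [simp]: "(mvar x :: ('x::finite, 'k::field) mpoly) \<in> homog (Suc 0)"
  using homog_single [of "Poly_Mapping.single x 1" "1::'k"] by (simp add: mvar_def)

lemma homog_0E:
  fixes p :: "('x::finite, 'k::field) mpoly"
  assumes "p \<in> homog 0" obtains c where "p = cst c"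
proof -
  have "p = cst (Poly_Mapping.lookup p 0)"
    using assms by (intro poly_mapping_eqI) (auto simp: homog_iff cst_def lookup_single when_def)
  then show ?thesis using that by blast
qed

lemma homog_cst_mult [intro]:
  fixes p :: "('x::finite, 'k::field) mpoly"
  shows "p \<in> homog d \<Longrightarrow> cst c * p \<in> homog d"
  using homog_mult [OF homog_cst, of p d c] by simp

lemma hpart_mult_homog:
  fixes p :: "('x::finite, 'k::field) mpoly"
  assumes q: "q \<in> homog e"
  shows "hpart d (p * q) = (if e \<le> d then hpart (d - e) p * q else 0)"
proof -
  have mono: "hpart d (Poly_Mapping.single \<mu> c * q) =
      (if e \<le> d then hpart (d - e) (Poly_Mapping.single \<mu> c) * q else 0)" for \<mu> :: "'x \<Rightarrow>\<^sub>0 nat" and c :: 'k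
    using homog_hpart [OF homog_mult [OF homog_single [of \<mu> c] q], of d]
      homog_hpart [OF homog_single [of \<mu> c], of "d - e"] by auto
  have "hpart d ((\<Sum>\<mu>\<in>A. Poly_Mapping.single \<mu> (c \<mu>)) * q) =
     (if e \<le> d then hpart (d - e) (\<Sum>\<mu>\<in>A. Poly_Mapping.single \<mu> (c \<mu>)) * q else 0)"
    if "finite A" for A and c :: "('x \<Rightarrow>\<^sub>0 nat) \<Rightarrow> 'k"
    using that
  proof (induct A rule: finite_induct)
    case (insert x F)
    then show ?case by (simp add: distrib_right mono)
  qed simp
  from this [OF finite_keys [of p], of "Poly_Mapping.lookup p"] show ?thesis
    by (simp only: mpoly_expand [symmetric])
qed

lemma hpart_0_mult [simp]: "hpart 0 (p * q) = hpart 0 p * hpart 0 q"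
proof (induct p rule: mpoly_induct)
  case (cst c)
  have "hpart 0 (q * cst c) = hpart 0 q * cst c"
    using hpart_mult_homog [of "cst c" 0 0 q] by simp
  then show ?case by (simp add: mult.commute)
next
  case (add p q) then show ?case by (simp add: distrib_right)
next
  case (var x p)
  then show ?case
    using hpart_mult_homog [of "mvar x" "Suc 0" 0 "p * q"] hpart_mult_homog [of "mvar x" "Suc 0" 0 p]
    by (simp add: ac_simps)
qed

lemma hpart_expand:
  fixes p :: "('x::finite, 'k::field) mpoly"
  obtains N where "p = (\<Sum>d<N. hpart d p)"
proof -
  \<comment> \<open>For \<open>p = 0\<close> this is the maximum of the empty set and hence an
    unspecified number; any bound will do then, because the support is empty.\<close>
  define N where "N = Suc (Max (mdeg ` Poly_Mapping.keys p))"
  have "p = (\<Sum>d<N. hpart d p)"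
  proof (rule poly_mapping_eqI)
    fix \<mu>
    have "Poly_Mapping.lookup (\<Sum>d<N. hpart d p) \<mu> =
       (\<Sum>d<N. if mdeg \<mu> = d then Poly_Mapping.lookup p \<mu> else 0)"
      by (simp add: lookup_sum lookup_hpart)
    also have "\<dots> = (if mdeg \<mu> < N then Poly_Mapping.lookup p \<mu> else 0)" by simp
    also have "\<dots> = Poly_Mapping.lookup p \<mu>"
    proof (cases "\<mu> \<in> Poly_Mapping.keys p")
      case True
      then have "mdeg \<mu> \<le> Max (mdeg ` Poly_Mapping.keys p)" by simp
      then show ?thesis by (simp add: N_def)
    qed (simp add: in_keys_iff)
    finally show "Poly_Mapping.lookup p \<mu> = Poly_Mapping.lookup (\<Sum>d<N. hpart d p) \<mu>" by simp
  qed
  then show ?thesis by (rule that)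
qed

section \<open>Finite systems of linear equations\<close>

text \<open>Dimension theory in coordinates, for the map \<open>k^I \<rightarrow> k^J\<close> that
  sends \<open>c\<close> to the combination of the rows of \<open>M\<close>. The equations are
  eliminated one by one: either \<open>j0\<close> is vacuous, or a row \<open>i0\<close> with a
  nonzero entry there is used as pivot and removed.\<close>

lemma injective_matrix_card:
  fixes M :: "'i \<Rightarrow> 'j \<Rightarrow> 'k::field"
  assumes "finite J" "finite I"
    and "\<And>c. (\<forall>j\<in>J. (\<Sum>i\<in>I. c i * M i j) = 0) \<Longrightarrow> \<forall>i\<in>I. c i = 0"
  shows "card I \<le> card J"
  using assms
proof (induct J arbitrary: I M rule: finite_induct)
  case empty
  then have "I = {}" using empty(2) [of "\<lambda>_. 1"] by auto
  then show ?case by simp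
next
  case (insert j0 J)
  show ?case
  proof (cases "\<forall>i\<in>I. M i j0 = 0")
    case True
    have "card I \<le> card J"
    proof (rule insert(3) [of I M])
      fix c assume "\<forall>j\<in>J. (\<Sum>i\<in>I. c i * M i j) = 0"
      with True show "\<forall>i\<in>I. c i = 0" by (intro insert(5)) auto
    qed (fact insert)
    then show ?thesis using insert by simp
  next
    case False
    then obtain i0 where i0: "i0 \<in> I" "M i0 j0 \<noteq> 0" by blast
    define N where "N i j = M i j - M i j0 / M i0 j0 * M i0 j" for i j
    have "card (I - {i0}) \<le> card J"
    proof (rule insert(3) [of _ N])
      fix c assume c: "\<forall>j\<in>J. (\<Sum>i\<in>I - {i0}. c i * N i j) = 0"
      \<comment> \<open>The coefficient of the pivot row is dictated by equation \<open>j0\<close>;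
        the rows of \<open>N\<close> are those of \<open>M\<close> with their entry at
        \<open>j0\<close> cleared.\<close>
      define s where "s = - (\<Sum>i\<in>I - {i0}. c i * M i j0) / M i0 j0"
      have eq: "(\<Sum>i\<in>I. (c(i0 := s)) i * M i j) = (\<Sum>i\<in>I - {i0}. c i * N i j)" for j
      proof -
        have "(\<Sum>i\<in>I. (c(i0 := s)) i * M i j) = s * M i0 j + (\<Sum>i\<in>I - {i0}. c i * M i j)"
          by (subst sum.remove [OF insert(4) i0(1)]) (auto intro!: sum.cong)
        also have "\<dots> = (\<Sum>i\<in>I - {i0}. c i * M i j - c i * M i j0 * (M i0 j / M i0 j0))"
          by (simp add: s_def sum_subtractf sum_distrib_right sum_divide_distrib)
        also have "\<dots> = (\<Sum>i\<in>I - {i0}. c i * N i j)"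
          by (simp add: N_def right_diff_distrib mult.assoc)
        finally show ?thesis .
      qed
      have "\<forall>j\<in>insert j0 J. (\<Sum>i\<in>I. (c(i0 := s)) i * M i j) = 0"
        using c i0 by (simp only: eq) (auto simp: N_def)
      then have "\<forall>i\<in>I. (c(i0 := s)) i = 0" by (rule insert(5))
      then show "\<forall>i\<in>I - {i0}. c i = 0" by (metis Diff_iff fun_upd_other singletonI)
    qed (use insert in auto)
    then show ?thesis using insert i0 by (simp add: card_Diff_singleton)
  qed
qed

text \<open>If \<open>t\<close> is not in the image, it can be added as a further independent row,
  here with index \<open>None\<close>, and there are more independent rows than columns.\<close>

lemma injective_matrix_surj:
  fixes M :: "'i \<Rightarrow> 'j \<Rightarrow> 'k::field"
  assumes fin: "finite J" "finite I"
    and inj: "\<And>c. (\<forall>j\<in>J. (\<Sum>i\<in>I. c i * M i j) = 0) \<Longrightarrow> \<forall>i\<in>I. c i = 0"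
    and card: "card J \<le> card I"
  shows "\<exists>c. \<forall>j\<in>J. (\<Sum>i\<in>I. c i * M i j) = t j"
proof (rule ccontr)
  assume no: "\<nexists>c. \<forall>j\<in>J. (\<Sum>i\<in>I. c i * M i j) = t j"
  define N where "N i = (case i of None \<Rightarrow> t | Some i \<Rightarrow> M i)" for i
  have sum: "(\<Sum>i\<in>insert None (Some ` I). c i * N i j) = c None * t j + (\<Sum>i\<in>I. c (Some i) * M i j)"
    for c j using fin by (simp add: N_def sum.reindex)
  have "card (insert None (Some ` I)) \<le> card J"
  proof (rule injective_matrix_card [of _ _ N])
    fix c assume c: "\<forall>j\<in>J. (\<Sum>i\<in>insert None (Some ` I). c i * N i j) = 0"
    have 0: "c None = 0"
    proof (rule ccontr)
      assume nz: "c None \<noteq> 0"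
      have "(\<Sum>i\<in>I. (- c (Some i) / c None) * M i j) = t j" if "j \<in> J" for j
      proof -
        have "(\<Sum>i\<in>I. (- c (Some i) / c None) * M i j) = - (\<Sum>i\<in>I. c (Some i) * M i j) / c None"
          by (subst sum_negf [symmetric], subst sum_divide_distrib, rule sum.cong) simp_all
        moreover have "(\<Sum>i\<in>I. c (Some i) * M i j) = - (c None * t j)"
          using c that sum [of c j] by (metis add_eq_0_iff)
        ultimately show ?thesis using nz by simp
      qed
      then have "\<forall>j\<in>J. (\<Sum>i\<in>I. (- c (Some i) / c None) * M i j) = t j" by blast
      with no show False by (elim notE) (rule exI)
    qed
    with c have "\<forall>i\<in>I. c (Some i) = 0" by (intro inj) (simp add: sum)
    with 0 show "\<forall>i\<in>insert None (Some ` I). c i = 0" by auto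
  qed (use fin in auto)
  moreover have "card (insert None (Some ` I)) = Suc (card I)"
    using fin by (subst card_insert_disjoint) (auto simp: card_image)
  ultimately show False using card by simp
qed

text \<open>Preimages of the unit vectors are linearly independent, so the bound for injective maps
  applies to them.\<close>

lemma surjective_matrix_card:
  fixes M :: "'i \<Rightarrow> 'j \<Rightarrow> 'k::field"
  assumes fin: "finite J" "finite I"
    and surj: "\<And>t. \<exists>c. \<forall>j\<in>J. (\<Sum>i\<in>I. c i * M i j) = t j"
  shows "card J \<le> card I"
proof -
  have "\<forall>j. \<exists>c. \<forall>j'\<in>J. (\<Sum>i\<in>I. c i * M i j') = (if j' = j then 1 else 0)"
    by (intro allI surj)
  then obtain c where c: "\<And>j j'. j' \<in> J \<Longrightarrow> (\<Sum>i\<in>I. c j i * M i j') = (if j' = j then 1 else 0)"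
    by metis
  show ?thesis
  proof (rule injective_matrix_card [of _ _ c])
    fix a assume a: "\<forall>i\<in>I. (\<Sum>j\<in>J. a j * c j i) = 0"
    show "\<forall>j\<in>J. a j = 0"
    proof
      fix j' assume j': "j' \<in> J"
      have "(\<Sum>i\<in>I. (\<Sum>j\<in>J. a j * c j i) * M i j') = (\<Sum>j\<in>J. \<Sum>i\<in>I. a j * (c j i * M i j'))"
        by (subst sum.swap) (simp add: sum_distrib_right mult.assoc)
      also have "\<dots> = (\<Sum>j\<in>J. a j * (if j' = j then 1 else 0))"
        using c [OF j'] by (simp add: sum_distrib_left [symmetric])
      also have "\<dots> = (\<Sum>j\<in>J. if j' = j then a j else 0)" by (rule sum.cong) auto
      also have "\<dots> = a j'" using fin j' by simp
      finally show "a j' = 0" using a by simp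
    qed
  qed (use fin in auto)
qed

section \<open>Congruences modulo an ideal\<close>

text \<open>Matrices and vectors are total functions on \<open>nat\<close>, and only the length
  \<open>n\<close> of the summation is stored. Statements therefore bound the row index
  \<open>p\<close> whenever the entries of that row matter.\<close>

definition mv :: "nat \<Rightarrow> (nat \<Rightarrow> nat \<Rightarrow> 'r) \<Rightarrow> (nat \<Rightarrow> 'r) \<Rightarrow> nat \<Rightarrow> 'r::comm_ring_1" where
  "mv n D v p = (\<Sum>q<n. D p q * v q)"

definition mm :: "nat \<Rightarrow> (nat \<Rightarrow> nat \<Rightarrow> 'r) \<Rightarrow> (nat \<Rightarrow> nat \<Rightarrow> 'r) \<Rightarrow> nat \<Rightarrow> nat \<Rightarrow> 'r::comm_ring_1" where
  "mm n D E p s = (\<Sum>q<n. D p q * E q s)"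

lemma mv_add: "mv n D (\<lambda>q. v q + w q) p = mv n D v p + mv n D w p"
  by (simp add: mv_def distrib_left sum.distrib)
lemma mv_diff: "mv n D (\<lambda>q. v q - w q) p = mv n D v p - mv n D w p"
  by (simp add: mv_def right_diff_distrib sum_subtractf)
lemma mv_scale: "mv n D (\<lambda>q. a * v q) p = a * mv n D v p"
  by (simp add: mv_def sum_distrib_left mult.left_commute)
lemma mv_zero [simp]: "mv n D (\<lambda>q. 0) p = 0"
  by (simp add: mv_def)
lemma mv_sum: "mv n D (\<lambda>q. \<Sum>i\<in>A. v i q) p = (\<Sum>i\<in>A. mv n D (v i) p)"
  by (simp add: mv_def sum_distrib_left) (rule sum.swap)
lemma mv_mv: "mv n D (mv m E v) p = mv m (mm n D E) v p"
  by (simp add: mv_def mm_def sum_distrib_left sum_distrib_right mult.assoc) (rule sum.swap)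
lemma mv_unit:
  assumes "j < n" shows "mv n D (\<lambda>q. if q = j then a else 0) p = D p j * a"
proof -
  have "mv n D (\<lambda>q. if q = j then a else 0) p = (\<Sum>q<n. if q = j then D p j * a else 0)"
    unfolding mv_def by (rule sum.cong) auto
  then show ?thesis using assms by simp
qed
lemma mv_cong: "(\<And>q. q < n \<Longrightarrow> v q = w q) \<Longrightarrow> mv n D v p = mv n D w p"
  by (simp add: mv_def)
text \<open>Ideals of a type-class ring, so that congruences are simplified in the arithmetic of the
  type and not in that of a record; \<open>ideal_iff_cring_ideal\<close> translates for polynomial
  rings.\<close>

locale cring_ideal =
  fixes J :: "'r::comm_ring_1 set"
  assumes zero_in [simp, intro]: "0 \<in> J"
    and add_in: "p \<in> J \<Longrightarrow> q \<in> J \<Longrightarrow> p + q \<in> J"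
    and mult_in: "p \<in> J \<Longrightarrow> a * p \<in> J"
begin

lemma mult_in': "p \<in> J \<Longrightarrow> p * a \<in> J"
  using mult_in [of p a] by (simp add: mult.commute)
lemma uminus_in: "p \<in> J \<Longrightarrow> - p \<in> J"
  using mult_in [of p "- 1"] by simp
lemma uminus_in_iff [simp]: "- p \<in> J \<longleftrightarrow> p \<in> J"
  using uminus_in [of p] uminus_in [of "- p"] by auto
lemma diff_in: "p \<in> J \<Longrightarrow> q \<in> J \<Longrightarrow> p - q \<in> J"
  using add_in [of p "- q"] by simp
lemma sum_in: "(\<And>i. i \<in> A \<Longrightarrow> f i \<in> J) \<Longrightarrow> sum f A \<in> J"
  by (induct A rule: infinite_finite_induct) (auto intro: add_in)

definition cng :: "'r \<Rightarrow> 'r \<Rightarrow> bool" where "cng p q \<longleftrightarrow> p - q \<in> J"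

lemma cng_refl [simp, intro]: "cng p p" by (simp add: cng_def)
lemma cng_0: "cng p 0 \<longleftrightarrow> p \<in> J" by (simp add: cng_def)
lemma cng_sym: "cng p q \<Longrightarrow> cng q p"
  unfolding cng_def using uminus_in [of "p - q"] by simp
lemma cng_trans [trans]: "cng p q \<Longrightarrow> cng q r \<Longrightarrow> cng p r"
  unfolding cng_def using add_in [of "p - q" "q - r"] by simp
lemma cng_add: "cng p q \<Longrightarrow> cng r s \<Longrightarrow> cng (p + r) (q + s)"
  unfolding cng_def using add_in [of "p - q" "r - s"] by (simp add: algebra_simps)
lemma cng_uminus: "cng p q \<Longrightarrow> cng (- p) (- q)"
  unfolding cng_def using uminus_in [of "p - q"] by (simp add: algebra_simps)
lemma cng_diff: "cng p q \<Longrightarrow> cng r s \<Longrightarrow> cng (p - r) (q - s)"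
  using cng_add [of p q "- r" "- s"] cng_uminus [of r s] by simp
lemma cng_mult_left: "cng p q \<Longrightarrow> cng (a * p) (a * q)"
  unfolding cng_def using mult_in [of "p - q" a] by (simp add: algebra_simps)
lemma cng_mult_right: "cng p q \<Longrightarrow> cng (p * a) (q * a)"
  using cng_mult_left [of p q a] by (simp add: mult.commute)
lemma cng_mult: "cng p q \<Longrightarrow> cng r s \<Longrightarrow> cng (p * r) (q * s)"
  using cng_trans [OF cng_mult_right cng_mult_left] by blast
lemma cng_sum: "(\<And>i. i \<in> A \<Longrightarrow> cng (f i) (g i)) \<Longrightarrow> cng (sum f A) (sum g A)"
  by (induct A rule: infinite_finite_induct) (auto intro: cng_add)
lemma cng_in: "cng p q \<Longrightarrow> q \<in> J \<Longrightarrow> p \<in> J"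
  unfolding cng_def using add_in [of "p - q" q] by simp
lemma cng_in_iff: "cng p q \<Longrightarrow> p \<in> J \<longleftrightarrow> q \<in> J"
  using cng_in cng_sym by blast
lemma cng_mv: "(\<And>q. q < n \<Longrightarrow> cng (v q) (w q)) \<Longrightarrow> cng (mv n D v p) (mv n D w p)"
  unfolding mv_def by (intro cng_sum cng_mult_left) simp
lemma cng_mv2:
  "(\<And>q. q < n \<Longrightarrow> cng (D p q) (E p q)) \<Longrightarrow> (\<And>q. q < n \<Longrightarrow> cng (v q) (w q))
    \<Longrightarrow> cng (mv n D v p) (mv n E w p)"
  unfolding mv_def by (intro cng_sum cng_mult) auto
lemma mv_in: "(\<And>q. q < n \<Longrightarrow> v q \<in> J) \<Longrightarrow> mv n D v p \<in> J"
  unfolding mv_def by (intro sum_in mult_in) simp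
lemma mv_mat_in: "(\<And>q. q < n \<Longrightarrow> D p q \<in> J) \<Longrightarrow> mv n D v p \<in> J"
  unfolding mv_def by (intro sum_in mult_in') simp

end

text \<open>The defining ideals of the standard graded rings with \<open>\<mm>\<^sup>3 = 0\<close>.\<close>

locale short_ideal = cring_ideal J for J :: "('x::finite, 'k::field) mpoly set" +
  assumes hpart_in: "p \<in> J \<Longrightarrow> hpart d p \<in> J"
    and proper: "p \<in> J \<Longrightarrow> hpart 0 p = 0"
    and deg3: "p \<in> homog d \<Longrightarrow> 3 \<le> d \<Longrightarrow> p \<in> J"
begin

lemma cng_hpart: "cng p q \<Longrightarrow> cng (hpart d p) (hpart d q)"
  unfolding cng_def using hpart_in [of "p - q" d] by simp

text \<open>Components of degree at least three lie in \<open>J\<close>. Every condition on classes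
  thus splits into conditions in degrees 0, 1 and 2, and in degree 0 congruence is equality.\<close>

lemma cng_expand: "cng p (hpart 0 p + hpart 1 p + hpart 2 p)"
proof -
  obtain N where N: "p = (\<Sum>d<N. hpart d p)" by (rule hpart_expand)
  have "cng (\<Sum>d<N. hpart d p) (\<Sum>d<N. if d < 3 then hpart d p else 0)"
    by (rule cng_sum) (auto simp: cng_0 intro: deg3 [OF hpart_homog])
  \<comment> \<open>The range is enlarged so that it contains the degrees 0, 1 and 2 even if
    \<open>N\<close> is small; the added components vanish.\<close>
  also have "(\<Sum>d<N. if d < 3 then hpart d p else 0) = (\<Sum>d<N + 3. if d < 3 then hpart d p else 0)"
  proof (rule sum.mono_neutral_left)
    show "\<forall>i\<in>{..<N + 3} - {..<N}. (if i < 3 then hpart i p else 0) = 0"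
    proof
      fix i assume i: "i \<in> {..<N + 3} - {..<N}"
      have "hpart i p = hpart i (\<Sum>d<N. hpart d p)" using N by simp
      also have "\<dots> = 0" using i by (simp add: hpart_sum)
      finally show "(if i < 3 then hpart i p else 0) = 0" by simp
    qed
  qed auto
  also have "\<dots> = (\<Sum>d<3. hpart d p)"
    by (rule sum.mono_neutral_cong_right) auto
  finally show ?thesis using N by (simp add: eval_nat_numeral)
qed

lemma in_iff_hpart: "p \<in> J \<longleftrightarrow> hpart 0 p = 0 \<and> hpart 1 p \<in> J \<and> hpart 2 p \<in> J"
  using cng_in [OF cng_expand [of p]] proper [of p] hpart_in [of p] add_in [of "hpart 1 p" "hpart 2 p"]
  by auto

lemma cng_iff_hpart:
  "cng p q \<longleftrightarrow> hpart 0 p = hpart 0 q \<and> cng (hpart 1 p) (hpart 1 q) \<and> cng (hpart 2 p) (hpart 2 q)"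
  unfolding cng_def using in_iff_hpart [of "p - q"] by simp

end


section \<open>Components of degree one and two of a product\<close>

lemma hpart_1_mult:
  fixes p q :: "('x::finite, 'k::field) mpoly"
  shows "hpart (Suc 0) (p * q) = hpart 0 p * hpart (Suc 0) q + hpart (Suc 0) p * hpart 0 q"
proof (induct p rule: mpoly_induct)
  case (cst c)
  have "hpart (Suc 0) (q * cst c) = hpart (Suc 0) q * cst c"
    using hpart_mult_homog [of "cst c" 0 "Suc 0" q] by simp
  then show ?case by (simp add: mult.commute)
next
  case (add p q) then show ?case by (simp add: algebra_simps)
next
  case (var x p)
  have a: "hpart (Suc 0) (r * mvar x) = hpart 0 r * mvar x" for r :: "('x, 'k) mpoly"
    using hpart_mult_homog [of "mvar x" "Suc 0" "Suc 0" r] by simp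
  show ?case
    using a [of "p * q"] a [of p] homog_hpart [of "mvar x" "Suc 0" 0]
      hpart_mult_homog [of "mvar x" "Suc 0" 0 p] by (simp add: ac_simps)
qed

lemma hpart_2_mult:
  fixes p q :: "('x::finite, 'k::field) mpoly"
  shows "hpart 2 (p * q) = hpart 0 p * hpart 2 q + hpart (Suc 0) p * hpart (Suc 0) q + hpart 2 p * hpart 0 q"
proof (induct p rule: mpoly_induct)
  case (cst c)
  have "hpart 2 (q * cst c) = hpart 2 q * cst c"
    using hpart_mult_homog [of "cst c" 0 2 q] by simp
  then show ?case by (simp add: mult.commute)
next
  case (add p q) then show ?case by (simp add: algebra_simps)
next
  case (var x p)
  have a: "hpart 2 (r * mvar x) = hpart (Suc 0) r * mvar x" for r :: "('x, 'k) mpoly"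
    using hpart_mult_homog [of "mvar x" "Suc 0" 2 r] by simp
  have b: "hpart (Suc 0) (r * mvar x) = hpart 0 r * mvar x" for r :: "('x, 'k) mpoly"
    using hpart_mult_homog [of "mvar x" "Suc 0" "Suc 0" r] by simp
  show ?case
    using a [of "p * q"] a [of p] b [of p] hpart_mult_homog [of "mvar x" "Suc 0" 0 p]
    by (simp add: hpart_1_mult algebra_simps)
qed

section \<open>Modules over the quotient ring in terms of polynomials\<close>

lemma mpoly_ring_simps [simp]:
  "carrier mpoly_ring = UNIV" "p \<otimes>\<^bsub>mpoly_ring\<^esub> q = p * q" "\<one>\<^bsub>mpoly_ring\<^esub> = 1"
  "\<zero>\<^bsub>mpoly_ring\<^esub> = 0" "p \<oplus>\<^bsub>mpoly_ring\<^esub> q = p + q"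
  by (simp_all add: mpoly_ring_def)

lemma mpoly_cring: "cring (mpoly_ring :: ('x, 'k::field) mpoly ring)"
proof (rule cringI)
  show "abelian_group (mpoly_ring :: ('x, 'k::field) mpoly ring)"
  proof (rule abelian_groupI)
    fix x :: "('x, 'k) mpoly"
    show "\<exists>y\<in>carrier mpoly_ring. y \<oplus>\<^bsub>mpoly_ring\<^esub> x = \<zero>\<^bsub>mpoly_ring\<^esub>"
      by (rule bexI [of _ "- x"]) auto
  qed (simp_all add: add.assoc add.commute)
  show "Group.comm_monoid (mpoly_ring :: ('x, 'k::field) mpoly ring)"
    by (rule comm_monoidI) (simp_all add: mult.assoc mult.commute)
qed (simp add: distrib_right)

lemma mpoly_a_inv [simp]: "\<ominus>\<^bsub>mpoly_ring\<^esub> p = - (p :: ('x, 'k::field) mpoly)"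
proof -
  interpret cring "mpoly_ring :: ('x, 'k) mpoly ring" by (rule mpoly_cring)
  show ?thesis using minus_equality [of "- p" p] by simp
qed

lemma ideal_iff_cring_ideal:
  "ideal J mpoly_ring \<longleftrightarrow> cring_ideal (J :: ('x, 'k::field) mpoly set)"
proof
  assume "ideal J mpoly_ring"
  then interpret I: ideal J "mpoly_ring" .
  show "cring_ideal J"
  proof
    show "0 \<in> J" using additive_subgroup.zero_closed [OF I.is_additive_subgroup] by simp
    show "p + q \<in> J" if "p \<in> J" "q \<in> J" for p q
      using additive_subgroup.a_closed [OF I.is_additive_subgroup that] by simp
    show "a * p \<in> J" if "p \<in> J" for a p
      using I.I_l_closed [OF that, of a] by simp
  qed
next
  assume "cring_ideal J"
  then interpret cring_ideal J .
  interpret R: cring "mpoly_ring :: ('x, 'k) mpoly ring" by (rule mpoly_cring)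
  show "ideal J mpoly_ring"
  proof (rule idealI)
    show "ring (mpoly_ring :: ('x, 'k) mpoly ring)" by (rule R.ring_axioms)
    show "subgroup J (add_monoid (mpoly_ring :: ('x, 'k) mpoly ring))"
    proof (rule R.add.subgroupI)
      fix p :: "('x, 'k) mpoly" assume "p \<in> J"
      then show "\<ominus>\<^bsub>mpoly_ring\<^esub> p \<in> J" by simp
    qed (auto intro: add_in)
  qed (auto intro: mult_in mult_in')
qed

definition free_vec ::
    "('x, 'k::field) mpoly set \<Rightarrow> nat \<Rightarrow> (nat \<Rightarrow> ('x, 'k) mpoly) \<Rightarrow> nat \<Rightarrow> ('x, 'k) mpoly set" where
  "free_vec J n v = (\<lambda>i\<in>{..<n}. J +>\<^bsub>mpoly_ring\<^esub> v i)"

definition row_map ::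
    "('x, 'k::field) mpoly set \<Rightarrow> nat \<Rightarrow> (nat \<Rightarrow> ('x, 'k) mpoly) \<Rightarrow>
     (nat \<Rightarrow> ('x, 'k) mpoly set) \<Rightarrow> ('x, 'k) mpoly set" where
  "row_map J n c = (\<lambda>x\<in>carrier (free_module (mpoly_ring Quot J) n).
     \<Oplus>\<^bsub>mpoly_ring Quot J\<^esub>q\<in>{..<n}. (J +>\<^bsub>mpoly_ring\<^esub> c q) \<otimes>\<^bsub>mpoly_ring Quot J\<^esub> x q)"

locale mpoly_ideal = cring_ideal J for J :: "('x, 'k::field) mpoly set"
begin

abbreviation Q :: "('x, 'k) mpoly set ring" where "Q \<equiv> mpoly_ring Quot J"
abbreviation coset :: "('x, 'k) mpoly \<Rightarrow> ('x, 'k) mpoly set" where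
  "coset p \<equiv> J +>\<^bsub>mpoly_ring\<^esub> p"
abbreviation mat :: "nat \<Rightarrow> nat \<Rightarrow> (nat \<Rightarrow> nat \<Rightarrow> ('x, 'k) mpoly) \<Rightarrow>
    (nat \<Rightarrow> ('x, 'k) mpoly set) \<Rightarrow> nat \<Rightarrow> ('x, 'k) mpoly set" where
  "mat m n D \<equiv> matrix_map Q m n (\<lambda>p q. coset (D p q))"

lemma ideal_J: "ideal J mpoly_ring"
  by (simp add: ideal_iff_cring_ideal cring_ideal_axioms)

sublocale id: ideal J "mpoly_ring" by (rule ideal_J)

sublocale Q: cring Q
  by (rule id.quotient_is_cring [OF mpoly_cring])

lemma hom_coset: "coset \<in> ring_hom mpoly_ring Q"
  by (rule id.rcos_ring_hom)

lemma coset_add: "coset p \<oplus>\<^bsub>Q\<^esub> coset q = coset (p + q)"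
  using ring_hom_add [OF hom_coset, of p q] by simp
lemma coset_mult: "coset p \<otimes>\<^bsub>Q\<^esub> coset q = coset (p * q)"
  using ring_hom_mult [OF hom_coset, of p q] by simp
lemma coset_zero: "\<zero>\<^bsub>Q\<^esub> = coset 0"
  using ring_hom_zero [OF hom_coset cring.axioms(1) [OF mpoly_cring] Q.ring_axioms] by simp
lemma coset_in [simp]: "coset p \<in> carrier Q"
  using ring_hom_closed [OF hom_coset, of p] by simp
lemma carrier_Q: "carrier Q = range coset"
  by (auto simp: FactRing_def A_RCOSETS_def')
lemma coset_sum: "(\<Oplus>\<^bsub>Q\<^esub>i\<in>A. coset (f i)) = coset (\<Sum>i\<in>A. f i)" if "finite A"
  using that
  by (induct A rule: finite_induct) (simp_all add: coset_zero Q.finsum_insert coset_add)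

lemma mem_coset: "q \<in> coset p \<longleftrightarrow> cng q p"
proof -
  have "q \<in> coset p \<longleftrightarrow> (\<exists>j\<in>J. q = j + p)" by (simp add: a_r_coset_def')
  also have "\<dots> \<longleftrightarrow> cng q p" by (auto simp: cng_def intro: bexI [of _ "q - p"])
  finally show ?thesis .
qed

lemma coset_eq_iff: "coset p = coset q \<longleftrightarrow> cng p q"
proof
  assume "coset p = coset q"
  then have "p \<in> coset q" using mem_coset [of p p] by simp
  then show "cng p q" by (simp add: mem_coset)
next
  assume c: "cng p q"
  have "r \<in> coset p \<longleftrightarrow> r \<in> coset q" for r
    unfolding mem_coset using cng_trans [OF _ c, of r] cng_trans [OF _ cng_sym [OF c], of r] by blast
  then show "coset p = coset q" by blast
qed

lemma coset_eq_zero_iff: "coset p = \<zero>\<^bsub>Q\<^esub> \<longleftrightarrow> p \<in> J"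
  by (simp add: coset_zero coset_eq_iff cng_0)

abbreviation fvec :: "nat \<Rightarrow> (nat \<Rightarrow> ('x, 'k) mpoly) \<Rightarrow> nat \<Rightarrow> ('x, 'k) mpoly set" where
  "fvec \<equiv> free_vec J"

lemma carrier_free: "carrier (free_module Q n) = range (fvec n)"
proof
  show "range (fvec n) \<subseteq> carrier (free_module Q n)"
    by (auto simp: free_module_def free_vec_def)
  show "carrier (free_module Q n) \<subseteq> range (fvec n)"
  proof
    fix x assume "x \<in> carrier (free_module Q n)"
    then have x: "x \<in> {..<n} \<rightarrow>\<^sub>E range coset" by (simp add: free_module_def carrier_Q)
    then have "\<forall>i\<in>{..<n}. \<exists>p. x i = coset p" by (auto simp: PiE_iff)
    then obtain v where v: "\<And>i. i < n \<Longrightarrow> x i = coset (v i)" by (metis lessThan_iff)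
    have "x = fvec n v" using x v by (auto simp: free_vec_def PiE_iff extensional_def fun_eq_iff restrict_def)
    then show "x \<in> range (fvec n)" by blast
  qed
qed

lemma fvec_in [simp]: "fvec n v \<in> carrier (free_module Q n)" by (simp add: carrier_free)

lemma fvec_eq_iff: "fvec n v = fvec n w \<longleftrightarrow> (\<forall>i<n. cng (v i) (w i))"
proof -
  have "(\<lambda>i\<in>{..<n}. f i) = (\<lambda>i\<in>{..<n}. g i) \<longleftrightarrow> (\<forall>i<n. f i = g i)" for f g :: "nat \<Rightarrow> ('x, 'k) mpoly set"
    by (metis lessThan_iff restrict_apply' restrict_ext)
  then show ?thesis by (simp add: free_vec_def coset_eq_iff)
qed

lemma fvec_cong: "(\<And>i. i < n \<Longrightarrow> v i = w i) \<Longrightarrow> fvec n v = fvec n w"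
  by (simp add: fvec_eq_iff)

lemma free_zero: "\<zero>\<^bsub>free_module Q n\<^esub> = fvec n (\<lambda>_. 0)"
  by (simp add: free_module_def free_vec_def coset_zero)

lemma free_add: "fvec n v \<oplus>\<^bsub>free_module Q n\<^esub> fvec n w = fvec n (\<lambda>i. v i + w i)"
  unfolding free_module_def free_vec_def by simp (rule restrict_ext, simp add: coset_add)

lemma free_smult: "coset a \<odot>\<^bsub>free_module Q n\<^esub> fvec n v = fvec n (\<lambda>i. a * v i)"
  unfolding free_module_def free_vec_def by simp (rule restrict_ext, simp add: coset_mult)

lemma mat_fvec: "mat m n D (fvec n v) = fvec m (mv n D v)"
proof -
  have "(\<Oplus>\<^bsub>Q\<^esub>q\<in>{..<n}. coset (D p q) \<otimes>\<^bsub>Q\<^esub> fvec n v q) = coset (mv n D v p)" for p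
  proof -
    have "(\<Oplus>\<^bsub>Q\<^esub>q\<in>{..<n}. coset (D p q) \<otimes>\<^bsub>Q\<^esub> fvec n v q) = (\<Oplus>\<^bsub>Q\<^esub>q\<in>{..<n}. coset (D p q * v q))"
      by (rule Q.finsum_cong') (auto simp: free_vec_def coset_mult)
    then show ?thesis by (simp add: coset_sum mv_def)
  qed
  then show ?thesis by (auto simp: matrix_map_def free_vec_def [of J m])
qed

lemma mat_eqI:
  assumes "h \<in> extensional (carrier (free_module Q n))"
    and "\<And>v. h (fvec n v) = fvec m (mv n D v)"
  shows "h = mat m n D"
proof
  fix x show "h x = mat m n D x"
  proof (cases "x \<in> carrier (free_module Q n)")
    case True
    then obtain v where "x = fvec n v" by (auto simp: carrier_free)
    then show ?thesis using assms by (simp add: mat_fvec)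
  next
    case False
    then show ?thesis using assms by (simp add: matrix_map_def extensional_def)
  qed
qed

lemma mat_linear: "mat m n D \<in> linear_maps Q (free_module Q n) (free_module Q m)"
  unfolding linear_maps_def
proof (intro CollectI conjI ballI)
  show "mat m n D \<in> carrier (free_module Q n) \<rightarrow>\<^sub>E carrier (free_module Q m)"
  proof (rule PiE_I)
    fix x assume "x \<in> carrier (free_module Q n)"
    then show "mat m n D x \<in> carrier (free_module Q m)" by (auto simp: carrier_free mat_fvec)
  qed (simp add: matrix_map_def)
next
  fix x y assume "x \<in> carrier (free_module Q n)" "y \<in> carrier (free_module Q n)"
  then show "mat m n D (x \<oplus>\<^bsub>free_module Q n\<^esub> y) =
      mat m n D x \<oplus>\<^bsub>free_module Q m\<^esub> mat m n D y"
    by (auto simp: carrier_free mat_fvec free_add fvec_eq_iff mv_add)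
next
  fix r x assume "r \<in> carrier Q" "x \<in> carrier (free_module Q n)"
  then show "mat m n D (r \<odot>\<^bsub>free_module Q n\<^esub> x) = r \<odot>\<^bsub>free_module Q m\<^esub> mat m n D x"
    by (auto simp: carrier_free carrier_Q mat_fvec free_smult fvec_eq_iff mv_scale)
qed

lemma linear_obtain_mat:
  assumes h: "h \<in> linear_maps Q (free_module Q n) (free_module Q m)"
  obtains D where "h = mat m n D"
proof -
  let ?F = "free_module Q n" and ?G = "free_module Q m"
  have ext: "h \<in> extensional (carrier ?F)" and cl: "\<And>v. h (fvec n v) \<in> carrier ?G"
    and add: "\<And>v w. h (fvec n (\<lambda>i. v i + w i)) = h (fvec n v) \<oplus>\<^bsub>?G\<^esub> h (fvec n w)"
    and sm: "\<And>a v. h (fvec n (\<lambda>i. a * v i)) = coset a \<odot>\<^bsub>?G\<^esub> h (fvec n v)"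
    using h by (auto simp: linear_maps_def PiE_iff free_add [symmetric] free_smult [symmetric])
  have "\<forall>q. \<exists>c. h (fvec n (\<lambda>i. if i = q then 1 else 0)) = fvec m c"
    using cl by (auto simp: carrier_free)
  then obtain C where C: "\<And>q. h (fvec n (\<lambda>i. if i = q then 1 else 0)) = fvec m (C q)" by metis
  define D where "D p q = C q p" for p q
  have zero: "h (fvec n (\<lambda>i. 0)) = fvec m (\<lambda>i. 0)"
  proof -
    obtain c where c: "h (fvec n (\<lambda>i. 0)) = fvec m c" using cl by (auto simp: carrier_free)
    show ?thesis using sm [of 0 "\<lambda>i. 0"] by (simp add: c free_smult)
  qed
  \<comment> \<open>The coordinates are switched on one at a time; a sum inside the free module
    would need the module axioms for its record.\<close>
  have part: "h (fvec n (\<lambda>i. if i < k then v i else 0)) = fvec m (mv k D v)" if "k \<le> n" for k v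
    using that
  proof (induct k)
    case 0 then show ?case by (simp add: zero mv_def)
  next
    case (Suc k)
    have "fvec n (\<lambda>i. if i < Suc k then v i else 0) =
       fvec n (\<lambda>i. (if i < k then v i else 0) + v k * (if i = k then 1 else 0))"
      by (rule fvec_cong) (auto simp: less_Suc_eq)
    then have "h (fvec n (\<lambda>i. if i < Suc k then v i else 0)) =
       fvec m (mv k D v) \<oplus>\<^bsub>?G\<^esub> (coset (v k) \<odot>\<^bsub>?G\<^esub> fvec m (C k))"
      using Suc by (simp add: add sm C)
    then show ?case by (simp add: free_add free_smult mv_def D_def mult.commute)
  qed
  have "h (fvec n v) = fvec m (mv n D v)" for v
  proof -
    have "fvec n v = fvec n (\<lambda>i. if i < n then v i else 0)" by (rule fvec_cong) simp
    then show ?thesis using part [of n v] by simp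
  qed
  then show ?thesis using that mat_eqI [OF ext] by blast
qed

text \<open>Kernel and image both consist of vectors of cosets, so they are compared on polynomial
  representatives. From here on, exactness is a statement about congruences, without cosets or
  module records.\<close>

lemma exact_free_iff:
  "mat n s E ` carrier (free_module Q s) = a_kernel (free_module Q n) (free_module Q m) (mat m n D)
   \<longleftrightarrow> (\<forall>v. (\<forall>p<m. mv n D v p \<in> J) \<longleftrightarrow> (\<exists>w. \<forall>q<n. cng (v q) (mv s E w q)))"
proof -
  have 1: "fvec n v \<in> mat n s E ` carrier (free_module Q s) \<longleftrightarrow> (\<exists>w. \<forall>q<n. cng (v q) (mv s E w q))" for v
    by (auto simp: carrier_free image_iff mat_fvec fvec_eq_iff)
  have 2: "fvec n v \<in> a_kernel (free_module Q n) (free_module Q m) (mat m n D) \<longleftrightarrow>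
      (\<forall>p<m. mv n D v p \<in> J)" for v
    by (simp add: a_kernel_def' mat_fvec free_zero fvec_eq_iff cng_0)
  have 3: "mat n s E ` carrier (free_module Q s) \<subseteq> range (fvec n)"
    by (auto simp: carrier_free mat_fvec)
  have 4: "a_kernel (free_module Q n) (free_module Q m) (mat m n D) \<subseteq> range (fvec n)"
    by (auto simp: a_kernel_def' carrier_free)
  have "A = B \<longleftrightarrow> (\<forall>v. fvec n v \<in> A \<longleftrightarrow> fvec n v \<in> B)"
    if "A \<subseteq> range (fvec n)" "B \<subseteq> range (fvec n)" for A B
    using that by blast
  from this [OF 3 4] show ?thesis unfolding 1 2 by blast
qed

subsection \<open>Duals\<close>

abbreviation row :: "nat \<Rightarrow> (nat \<Rightarrow> ('x, 'k) mpoly) \<Rightarrow> (nat \<Rightarrow> ('x, 'k) mpoly set) \<Rightarrow> ('x, 'k) mpoly set"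
  where "row \<equiv> row_map J"

lemma row_fvec: "row n c (fvec n v) = coset (\<Sum>q<n. c q * v q)"
proof -
  have "row n c (fvec n v) = (\<Oplus>\<^bsub>Q\<^esub>q\<in>{..<n}. coset (c q) \<otimes>\<^bsub>Q\<^esub> fvec n v q)"
    by (simp add: row_map_def)
  also have "\<dots> = (\<Oplus>\<^bsub>Q\<^esub>q\<in>{..<n}. coset (c q * v q))"
    by (rule Q.finsum_cong') (auto simp: free_vec_def coset_mult)
  finally show ?thesis by (simp add: coset_sum)
qed

lemma row_eqI:
  assumes "h \<in> extensional (carrier (free_module Q n))"
    and "\<And>v. h (fvec n v) = coset (\<Sum>q<n. c q * v q)"
  shows "h = row n c"
proof
  fix x show "h x = row n c x"
  proof (cases "x \<in> carrier (free_module Q n)")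
    case True
    then obtain v where "x = fvec n v" by (auto simp: carrier_free)
    then show ?thesis using assms by (simp add: row_fvec)
  next
    case False
    then show ?thesis using assms by (simp add: row_map_def extensional_def)
  qed
qed

lemma row_eq_iff: "row n c = row n c' \<longleftrightarrow> (\<forall>q<n. cng (c q) (c' q))"
proof
  assume e: "row n c = row n c'"
  show "\<forall>q<n. cng (c q) (c' q)"
  proof (intro allI impI)
    fix q assume q: "q < n"
    have u: "(\<Sum>i<n. a i * (if i = q then 1 else 0)) = (a q :: ('x, 'k) mpoly)" for a
      using mv_unit [OF q, of "\<lambda>_. a" 1] by (simp add: mv_def)
    have "coset (\<Sum>i<n. c i * (if i = q then 1 else 0)) = coset (\<Sum>i<n. c' i * (if i = q then 1 else 0))"
      using e by (simp only: row_fvec [symmetric])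
    then show "cng (c q) (c' q)" by (simp only: coset_eq_iff u)
  qed
next
  assume c: "\<forall>q<n. cng (c q) (c' q)"
  show "row n c = row n c'"
  proof (rule row_eqI)
    show "row n c \<in> extensional (carrier (free_module Q n))" by (simp add: row_map_def)
    fix v show "row n c (fvec n v) = coset (\<Sum>q<n. c' q * v q)"
      unfolding row_fvec coset_eq_iff using c by (intro cng_sum cng_mult_right) simp
  qed
qed

lemma self_zero [simp]: "\<zero>\<^bsub>self_module Q\<^esub> = \<zero>\<^bsub>Q\<^esub>"
  and self_add [simp]: "x \<oplus>\<^bsub>self_module Q\<^esub> y = x \<oplus>\<^bsub>Q\<^esub> y"
  and self_smult [simp]: "x \<odot>\<^bsub>self_module Q\<^esub> y = x \<otimes>\<^bsub>Q\<^esub> y"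
  and self_carrier [simp]: "carrier (self_module Q) = carrier Q"
  by (simp_all add: self_module_def)

lemma carrier_dual: "carrier (dual_module Q (free_module Q n)) = range (row n)"
proof -
  let ?F = "free_module Q n"
  have "row n c \<in> linear_maps Q ?F (self_module Q)" for c
    unfolding linear_maps_def
  proof (intro CollectI conjI ballI)
    show "row n c \<in> carrier ?F \<rightarrow>\<^sub>E carrier (self_module Q)"
    proof (rule PiE_I)
      fix x assume "x \<in> carrier ?F"
      then show "row n c x \<in> carrier (self_module Q)" by (auto simp: carrier_free row_fvec)
    qed (simp add: row_map_def)
  next
    fix x y assume "x \<in> carrier ?F" "y \<in> carrier ?F"
    then show "row n c (x \<oplus>\<^bsub>?F\<^esub> y) = row n c x \<oplus>\<^bsub>self_module Q\<^esub> row n c y"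
      by (auto simp: carrier_free row_fvec free_add coset_add distrib_left sum.distrib)
  next
    fix r x assume "r \<in> carrier Q" "x \<in> carrier ?F"
    then show "row n c (r \<odot>\<^bsub>?F\<^esub> x) = r \<odot>\<^bsub>self_module Q\<^esub> row n c x"
      by (auto simp: carrier_free carrier_Q row_fvec free_smult coset_mult sum_distrib_left
          mult.left_commute)
  qed
  moreover have "h \<in> range (row n)" if h: "h \<in> linear_maps Q ?F (self_module Q)" for h
  proof -
    \<comment> \<open>A functional is a linear map to the free module of rank one, so its
      coefficients are read off from a matrix with a single row.\<close>
    define h' where "h' = (\<lambda>x\<in>carrier ?F. \<lambda>i\<in>{..<1::nat}. h x)"
    have cl: "h x \<in> carrier Q" if "x \<in> carrier ?F" for x
      using h that by (auto simp: linear_maps_def PiE_iff)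
    have ac: "x \<oplus>\<^bsub>?F\<^esub> y \<in> carrier ?F" if "x \<in> carrier ?F" "y \<in> carrier ?F" for x y
      using that by (auto simp: carrier_free free_add)
    have sc: "r \<odot>\<^bsub>?F\<^esub> x \<in> carrier ?F" if "r \<in> carrier Q" "x \<in> carrier ?F" for r x
      using that by (auto simp: carrier_free free_smult carrier_Q)
    have "h' \<in> linear_maps Q ?F (free_module Q 1)"
      unfolding linear_maps_def
    proof (intro CollectI conjI ballI)
      show "h' \<in> carrier ?F \<rightarrow>\<^sub>E carrier (free_module Q 1)"
      proof (rule PiE_I)
        fix x assume "x \<in> carrier ?F"
        then show "h' x \<in> carrier (free_module Q 1)"
          using cl [of x] by (simp add: h'_def free_module_def [of Q "Suc 0"])
      qed (simp add: h'_def)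
    next
      fix x y assume xy: "x \<in> carrier ?F" "y \<in> carrier ?F"
      then have "h (x \<oplus>\<^bsub>?F\<^esub> y) = h x \<oplus>\<^bsub>Q\<^esub> h y" using h by (auto simp: linear_maps_def)
      then show "h' (x \<oplus>\<^bsub>?F\<^esub> y) = h' x \<oplus>\<^bsub>free_module Q 1\<^esub> h' y"
        using xy ac [OF xy] by (simp add: h'_def free_module_def [of Q "Suc 0"] fun_eq_iff restrict_def)
    next
      fix r x assume rx: "r \<in> carrier Q" "x \<in> carrier ?F"
      then have "h (r \<odot>\<^bsub>?F\<^esub> x) = r \<otimes>\<^bsub>Q\<^esub> h x" using h by (auto simp: linear_maps_def)
      then show "h' (r \<odot>\<^bsub>?F\<^esub> x) = r \<odot>\<^bsub>free_module Q 1\<^esub> h' x"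
        using rx sc [OF rx] by (simp add: h'_def free_module_def [of Q "Suc 0"] fun_eq_iff restrict_def)
    qed
    then obtain D where D: "h' = mat 1 n D" by (rule linear_obtain_mat)
    have "h = row n (D 0)"
    proof (rule row_eqI)
      show "h \<in> extensional (carrier ?F)" using h by (auto simp: linear_maps_def PiE_iff)
      fix v
      have "h (fvec n v) = h' (fvec n v) 0" by (simp add: h'_def)
      also have "\<dots> = coset (\<Sum>q<n. D 0 q * v q)"
        unfolding D mat_fvec by (simp add: free_vec_def mv_def)
      finally show "h (fvec n v) = coset (\<Sum>q<n. D 0 q * v q)" .
    qed
    then show ?thesis by blast
  qed
  ultimately show ?thesis by (auto simp: dual_module_def)
qed

lemma row_in [simp]: "row n c \<in> carrier (dual_module Q (free_module Q n))"
  by (simp add: carrier_dual)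

lemma dual_zero: "\<zero>\<^bsub>dual_module Q (free_module Q n)\<^esub> = row n (\<lambda>_. 0)"
  by (rule row_eqI) (auto simp: dual_module_def coset_zero)

lemma dual_map_row:
  "dual_map Q (free_module Q n) (free_module Q m) (mat m n D) (row m c) = row n (mv m (\<lambda>q p. D p q) c)"
proof (rule row_eqI)
  fix v
  have "(\<Sum>p<m. c p * mv n D v p) = (\<Sum>q<n. mv m (\<lambda>q p. D p q) c q * v q)"
    unfolding mv_def sum_distrib_left sum_distrib_right
    by (subst sum.swap) (simp add: ac_simps)
  then show "dual_map Q (free_module Q n) (free_module Q m) (mat m n D) (row m c) (fvec n v) =
      coset (\<Sum>q<n. mv m (\<lambda>q p. D p q) c q * v q)"
    by (simp add: dual_map_def compose_def mat_fvec row_fvec)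
qed (simp add: dual_map_def compose_def)

lemma exact_dual_iff:
  "dual_map Q (free_module Q n) (free_module Q m) (mat m n D) ` carrier (dual_module Q (free_module Q m)) =
   a_kernel (dual_module Q (free_module Q n)) (dual_module Q (free_module Q s))
     (dual_map Q (free_module Q s) (free_module Q n) (mat n s E)) \<longleftrightarrow>
   (\<forall>c. (\<forall>j<s. mv n (\<lambda>j q. E q j) c j \<in> J) \<longleftrightarrow> (\<exists>x. \<forall>q<n. cng (c q) (mv m (\<lambda>q p. D p q) x q)))"
  (is "?A = ?B \<longleftrightarrow> _")
proof -
  have 1: "row n c \<in> ?A \<longleftrightarrow> (\<exists>x. \<forall>q<n. cng (c q) (mv m (\<lambda>q p. D p q) x q))" for c
    by (auto simp: carrier_dual image_iff dual_map_row row_eq_iff)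
  have 2: "row n c \<in> ?B \<longleftrightarrow> (\<forall>j<s. mv n (\<lambda>j q. E q j) c j \<in> J)" for c
    by (simp add: a_kernel_def' dual_map_row dual_zero row_eq_iff cng_0)
  have 3: "?A \<subseteq> range (row n)"
    by (auto simp: carrier_dual dual_map_row)
  have 4: "?B \<subseteq> range (row n)"
    by (auto simp: a_kernel_def' carrier_dual)
  have "A = B \<longleftrightarrow> (\<forall>v. row n v \<in> A \<longleftrightarrow> row n v \<in> B)"
    if "A \<subseteq> range (row n)" "B \<subseteq> range (row n)" for A B
    using that by blast
  from this [OF 3 4] show ?thesis unfolding 1 2 by blast
qed

end

section \<open>Totally acyclic complexes in terms of polynomial matrices\<close>

lemma hpart_0_mvar [simp]: "hpart 0 (mvar x :: ('x::finite, 'k::field) mpoly) = 0"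
  using homog_hpart [of "mvar x :: ('x, 'k) mpoly" "Suc 0" 0] by simp

text \<open>Stated for an arbitrary ideal because it is applied to three of them: the maximal ideal,
  the combinations of the variables, and the multipliers that carry a vector into the domain of a
  partial homomorphism.\<close>

lemma positive_part_in:
  fixes p :: "('x::finite, 'k::field) mpoly"
  assumes S: "cring_ideal S" and var: "\<And>x. mvar x \<in> S"
  shows "p - hpart 0 p \<in> S"
proof -
  interpret cring_ideal S by (rule S)
  show ?thesis
  proof (induct p rule: mpoly_induct)
    case (add p q)
    have "p + q - hpart 0 (p + q) = (p - hpart 0 p) + (q - hpart 0 q)" by simp
    then show ?case using add add_in by metis
  next
    case (var x p)
    show ?case using mult_in' [OF assms(2)] by simp
  qed simp
qed

lemma irrelevant_ideal_eq:
  "(irrelevant_ideal :: ('x::finite, 'k::field) mpoly set) = {p. hpart 0 p = 0}"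
proof
  interpret R: cring "mpoly_ring :: ('x, 'k) mpoly ring" by (rule mpoly_cring)
  have "ideal {p :: ('x, 'k) mpoly. hpart 0 p = 0} mpoly_ring"
    unfolding ideal_iff_cring_ideal by unfold_locales auto
  then show "irrelevant_ideal \<subseteq> {p :: ('x, 'k) mpoly. hpart 0 p = 0}"
    unfolding irrelevant_ideal_def by (rule R.genideal_minimal) auto
  have i: "ideal (irrelevant_ideal :: ('x, 'k) mpoly set) mpoly_ring"
    unfolding irrelevant_ideal_def by (rule R.genideal_ideal) simp
  have v: "mvar x \<in> (irrelevant_ideal :: ('x, 'k) mpoly set)" for x
    unfolding irrelevant_ideal_def using R.genideal_self [of "range mvar"] by auto
  show "{p :: ('x, 'k) mpoly. hpart 0 p = 0} \<subseteq> irrelevant_ideal"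
  proof
    fix p :: "('x, 'k) mpoly" assume "p \<in> {p. hpart 0 p = 0}"
    then show "p \<in> irrelevant_ideal"
      using positive_part_in [OF i [unfolded ideal_iff_cring_ideal] v, of p] by simp
  qed
qed

definition rev_rank :: "(int \<Rightarrow> nat) \<Rightarrow> int \<Rightarrow> nat" where
  "rev_rank r = (\<lambda>i. r (- i))"

text \<open>The matrices of the dual complex: its differential from degree \<open>i\<close> to
  degree \<open>i - 1\<close> is dual to the original one from \<open>1 - i\<close> to
  \<open>- i\<close>, whence the shift and the transposition. Doing this twice gives
  \<open>D\<close> back.\<close>

definition rev_mat :: "(int \<Rightarrow> nat \<Rightarrow> nat \<Rightarrow> 'r) \<Rightarrow> int \<Rightarrow> nat \<Rightarrow> nat \<Rightarrow> 'r" where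
  "rev_mat D = (\<lambda>i p q. D (1 - i) q p)"

context cring_ideal
begin

text \<open>The equivalence comprises both properties, that composites vanish and that cycles are
  boundaries; \<open>acyclic_at_zero\<close> and \<open>acyclic_at_exact\<close> separate
  them.\<close>

definition acyclic_at :: "nat \<Rightarrow> nat \<Rightarrow> nat \<Rightarrow> (nat \<Rightarrow> nat \<Rightarrow> 'r) \<Rightarrow> (nat \<Rightarrow> nat \<Rightarrow> 'r) \<Rightarrow> bool" where
  "acyclic_at m n s D E \<longleftrightarrow>
     (\<forall>v. (\<forall>p<m. mv n D v p \<in> J) \<longleftrightarrow> (\<exists>w. \<forall>q<n. cng (v q) (mv s E w q)))"

definition acyc :: "(int \<Rightarrow> nat) \<Rightarrow> (int \<Rightarrow> nat \<Rightarrow> nat \<Rightarrow> 'r) \<Rightarrow> bool" where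
  "acyc r D \<longleftrightarrow> (\<forall>i. acyclic_at (r (i - 1)) (r i) (r (i + 1)) (D i) (D (i + 1)))"

lemma acyclic_at_zero:
  assumes "acyclic_at m n s D E" "p < m" shows "mv n D (mv s E w) p \<in> J"
  using assms unfolding acyclic_at_def by blast

lemma acyclic_at_exact:
  assumes "acyclic_at m n s D E" "\<And>p. p < m \<Longrightarrow> mv n D v p \<in> J"
  obtains w where "\<And>q. q < n \<Longrightarrow> cng (v q) (mv s E w q)"
  using assms unfolding acyclic_at_def by blast

end

context short_ideal
begin

sublocale mpoly_ideal J ..

text \<open>Such an element is a nonzero constant times \<open>1 + n\<close>, where \<open>n\<close>
  has no constant term. The cube of \<open>n\<close> lies in \<open>J\<close>, so the geometric
  series stops and \<open>1 - n + n * n\<close> is an inverse of \<open>1 + n\<close>.\<close>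

lemma unit_mod:
  assumes "hpart 0 a \<noteq> 0" obtains b where "cng (b * a) 1"
proof -
  obtain c where c: "hpart 0 a = cst c" using homog_0E [OF hpart_homog] .
  with assms have c0: "c \<noteq> 0" by auto
  define n where "n = cst (1 / c) * a - 1"
  have n0: "hpart 0 n = 0"
    using c c0 by (simp add: n_def cst_mult [symmetric] homog_hpart [OF homog_cst, of _ 0, folded cst_1]
        flip: cst_1)
  have "n * (n * n) \<in> J"
    using n0 by (subst in_iff_hpart) (simp add: hpart_1_mult hpart_2_mult)
  then have "cng ((1 - n + n * n) * cst (1 / c) * a) 1"
    by (simp add: cng_def n_def algebra_simps)
  then show ?thesis by (rule that)
qed

text \<open>Minimality is expressed by the absence of constant terms only; linear entries are
  obtained later by passing to linear parts. That the complex is nonzero is stated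
  separately.\<close>

definition pta :: "(int \<Rightarrow> nat) \<Rightarrow> (int \<Rightarrow> nat \<Rightarrow> nat \<Rightarrow> ('x, 'k) mpoly) \<Rightarrow> bool" where
  "pta r D \<longleftrightarrow> acyc r D \<and> acyc (rev_rank r) (rev_mat D) \<and>
     (\<forall>i. \<forall>p<r (i - 1). \<forall>q<r i. hpart 0 (D i p q) = 0)"

lemma pta_rev: "pta r D \<Longrightarrow> pta (rev_rank r) (rev_mat D)"
  unfolding pta_def by (auto simp: rev_rank_def rev_mat_def)

lemma coset_in_quot_max: "coset p \<in> quot_max J \<longleftrightarrow> hpart 0 p = 0"
proof
  assume "coset p \<in> quot_max J"
  then obtain q where "cng p q" "hpart 0 q = 0"
    by (auto simp: quot_max_def irrelevant_ideal_eq coset_eq_iff)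
  then show "hpart 0 p = 0" using cng_hpart [of p q 0] by (simp add: cng_0 proper [of "hpart 0 p", simplified])
qed (auto simp: quot_max_def irrelevant_ideal_eq)

lemma minimal_iff:
  "mat m n D ` carrier (free_module Q n) \<subseteq> ideal_free (quot_max J) m \<longleftrightarrow>
     (\<forall>p<m. \<forall>q<n. hpart 0 (D p q) = 0)"
proof -
  have 1: "fvec m w \<in> ideal_free (quot_max J) m \<longleftrightarrow> (\<forall>p<m. hpart 0 (w p) = 0)" for w
    by (auto simp: ideal_free_def free_vec_def PiE_iff coset_in_quot_max)
  have "mat m n D ` carrier (free_module Q n) \<subseteq> ideal_free (quot_max J) m \<longleftrightarrow>
      (\<forall>v. fvec m (mv n D v) \<in> ideal_free (quot_max J) m)"
    by (simp add: carrier_free image_subset_iff mat_fvec)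
  also have "\<dots> \<longleftrightarrow> (\<forall>v. \<forall>p<m. hpart 0 (mv n D v p) = 0)" by (simp only: 1)
  also have "\<dots> \<longleftrightarrow> (\<forall>p<m. \<forall>q<n. hpart 0 (D p q) = 0)"
  proof
    assume h: "\<forall>v. \<forall>p<m. hpart 0 (mv n D v p) = 0"
    show "\<forall>p<m. \<forall>q<n. hpart 0 (D p q) = 0"
    proof (intro allI impI)
      fix p q assume "p < m" "q < n"
      then show "hpart 0 (D p q) = 0"
        using h [rule_format, of p "\<lambda>i. if i = q then 1 else 0"] by (simp add: mv_unit)
    qed
  qed (simp add: mv_def hpart_sum)
  finally show ?thesis .
qed

lemma mta_mat_iff:
  "minimal_totally_acyclic Q (quot_max J) r (\<lambda>i. mat (r (i - 1)) (r i) (D i)) \<longleftrightarrow>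
     pta r D \<and> (\<exists>i. r i > 0)"
proof -
  have 1: "exact_complex (\<lambda>i. free_module Q (r i)) (\<lambda>i. mat (r (i - 1)) (r i) (D i)) \<longleftrightarrow> acyc r D"
    unfolding exact_complex_def acyc_def acyclic_at_def by (simp add: exact_free_iff)
  have e: "1 - (i + 1) = - i" "- (i + 1) = - i - 1" "1 - i - 1 = - i" "- (i - 1) = 1 - i" for i :: int
    by simp_all
  have 2: "exact_complex (\<lambda>i. dual_module Q (free_module Q (r (- i))))
             (\<lambda>i. dual_map Q (free_module Q (r (1 - i))) (free_module Q (r (- i)))
               (mat (r (1 - i - 1)) (r (1 - i)) (D (1 - i)))) \<longleftrightarrow> acyc (rev_rank r) (rev_mat D)"
    unfolding exact_complex_def acyc_def acyclic_at_def rev_rank_def rev_mat_def e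
    by (simp add: exact_dual_iff)
  show ?thesis
    unfolding minimal_totally_acyclic_def totally_acyclic_def Let_def pta_def 1 2 minimal_iff
    by (simp add: mat_linear)
qed

lemma mta_obtain:
  assumes "minimal_totally_acyclic Q (quot_max J) r d"
  obtains D where "d = (\<lambda>i. mat (r (i - 1)) (r i) (D i))"
proof -
  have "\<forall>i. \<exists>D. d i = mat (r (i - 1)) (r i) D"
    using assms unfolding minimal_totally_acyclic_def totally_acyclic_def Let_def
    by (blast elim: linear_obtain_mat)
  then show ?thesis using that by metis
qed

section \<open>Baer's criterion\<close>

text \<open>Homomorphisms from the maximal ideal of the quotient ring to the ring, as functions on
  representatives. The last clause makes them descend to cosets, and values at polynomials with a
  constant term are arbitrary.\<close>

definition pos_hom :: "(('x, 'k) mpoly \<Rightarrow> ('x, 'k) mpoly) \<Rightarrow> bool" where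
  "pos_hom \<phi> \<longleftrightarrow>
     (\<forall>p q. hpart 0 p = 0 \<longrightarrow> hpart 0 q = 0 \<longrightarrow> cng (\<phi> (p + q)) (\<phi> p + \<phi> q)) \<and>
     (\<forall>a p. hpart 0 p = 0 \<longrightarrow> cng (\<phi> (a * p)) (a * \<phi> p)) \<and>
     (\<forall>p\<in>J. \<phi> p \<in> J)"

text \<open>This amounts to \<open>Ext\<^sup>1(k, Q) = 0\<close>.\<close>

definition mult_ext :: bool where
  "mult_ext \<longleftrightarrow> (\<forall>\<phi>. pos_hom \<phi> \<longrightarrow> (\<exists>c. \<forall>p. hpart 0 p = 0 \<longrightarrow> cng (\<phi> p) (p * c)))"

lemma pos_hom_add: "pos_hom \<phi> \<Longrightarrow> hpart 0 p = 0 \<Longrightarrow> hpart 0 q = 0 \<Longrightarrow> cng (\<phi> (p + q)) (\<phi> p + \<phi> q)"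
  by (simp add: pos_hom_def)
lemma pos_hom_smult: "pos_hom \<phi> \<Longrightarrow> hpart 0 p = 0 \<Longrightarrow> cng (\<phi> (a * p)) (a * \<phi> p)"
  by (simp add: pos_hom_def)
lemma pos_hom_null: "pos_hom \<phi> \<Longrightarrow> p \<in> J \<Longrightarrow> \<phi> p \<in> J"
  by (simp add: pos_hom_def)

lemma pos_hom_cng:
  assumes \<phi>: "pos_hom \<phi>" and p: "hpart 0 p = 0" and pq: "cng p q"
  shows "cng (\<phi> p) (\<phi> q)"
proof -
  have q: "hpart 0 q = 0" using p cng_iff_hpart [THEN iffD1, OF pq] by simp
  have "cng (\<phi> (q + (p - q))) (\<phi> q + \<phi> (p - q))" using p q by (intro pos_hom_add \<phi>) simp_all
  also have "cng (\<phi> q + \<phi> (p - q)) (\<phi> q + 0)"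
    by (rule cng_add [OF cng_refl]) (simp add: cng_0 pos_hom_null [OF \<phi>] pq [unfolded cng_def])
  finally show ?thesis by simp
qed

lemma pos_hom_sum:
  assumes \<phi>: "pos_hom \<phi>"
  shows "(\<And>q. q \<in> A \<Longrightarrow> hpart 0 (f q) = 0) \<Longrightarrow> cng (\<phi> (\<Sum>q\<in>A. f q)) (\<Sum>q\<in>A. \<phi> (f q))"
proof (induct A rule: infinite_finite_induct)
  case (insert x A)
  have "cng (\<phi> (f x + (\<Sum>q\<in>A. f q))) (\<phi> (f x) + \<phi> (\<Sum>q\<in>A. f q))"
    using insert by (intro pos_hom_add \<phi>) (simp_all add: hpart_sum)
  also have "cng \<dots> (\<phi> (f x) + (\<Sum>q\<in>A. \<phi> (f q)))"
    using insert by (intro cng_add cng_refl) simp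
  finally show ?case using insert by simp
qed (simp_all add: cng_0 pos_hom_null [OF \<phi>])

text \<open>Graphs of homomorphisms to the quotient ring from submodules of its \<open>m\<close>-th power.\<close>

definition partial_hom :: "nat \<Rightarrow> ((nat \<Rightarrow> ('x, 'k) mpoly) \<times> ('x, 'k) mpoly) set \<Rightarrow> bool" where
  "partial_hom m \<Gamma> \<longleftrightarrow>
     (\<forall>v c w d. (v, c) \<in> \<Gamma> \<longrightarrow> (w, d) \<in> \<Gamma> \<longrightarrow> ((\<lambda>i. v i + w i), c + d) \<in> \<Gamma>) \<and>
     (\<forall>a v c. (v, c) \<in> \<Gamma> \<longrightarrow> ((\<lambda>i. a * v i), a * c) \<in> \<Gamma>) \<and>
     (\<forall>v c. (\<forall>i<m. v i \<in> J) \<longrightarrow> c \<in> J \<longrightarrow> (v, c) \<in> \<Gamma>) \<and>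
     (\<forall>v c. (v, c) \<in> \<Gamma> \<longrightarrow> (\<forall>i<m. v i \<in> J) \<longrightarrow> c \<in> J)"

lemma partial_hom_add:
  assumes "partial_hom m \<Gamma>" "(v, c) \<in> \<Gamma>" "(w, d) \<in> \<Gamma>"
  shows "((\<lambda>i. v i + w i), c + d) \<in> \<Gamma>"
  using assms(1) [unfolded partial_hom_def, THEN conjunct1, rule_format, OF assms(2,3)] .

lemma partial_hom_smult:
  assumes "partial_hom m \<Gamma>" "(v, c) \<in> \<Gamma>"
  shows "((\<lambda>i. a * v i), a * c) \<in> \<Gamma>"
  using assms(1) [unfolded partial_hom_def, THEN conjunct2, THEN conjunct1, rule_format, OF assms(2)] .

lemma partial_hom_null:
  assumes "partial_hom m \<Gamma>" "\<And>i. i < m \<Longrightarrow> v i \<in> J" "c \<in> J"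
  shows "(v, c) \<in> \<Gamma>"
  using assms unfolding partial_hom_def by simp

lemma partial_hom_fun:
  assumes "partial_hom m \<Gamma>" "(v, c) \<in> \<Gamma>" "\<And>i. i < m \<Longrightarrow> v i \<in> J"
  shows "c \<in> J"
  using assms(1) [unfolded partial_hom_def, THEN conjunct2, THEN conjunct2, THEN conjunct2,
      rule_format, OF assms(2)] assms(3) by blast

text \<open>The step in Baer's criterion. Unless \<open>v\<close> is in the domain already, its
  multipliers into the domain form the maximal ideal; \<open>a \<mapsto> \<Gamma>(a v)\<close> is a
  homomorphism there, and the \<open>c\<close> of which it is the multiplication serves as value at
  \<open>v\<close>.\<close>

lemma partial_hom_extend1:
  assumes ext: mult_ext and \<Gamma>: "partial_hom m \<Gamma>"
    and v: "\<And>x. \<exists>c. ((\<lambda>i. mvar x * v i), c) \<in> \<Gamma>"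
  shows "\<exists>\<Gamma>'. partial_hom m \<Gamma>' \<and> \<Gamma> \<subseteq> \<Gamma>' \<and> (\<exists>c. (v, c) \<in> \<Gamma>')"
proof (cases "\<exists>c. (v, c) \<in> \<Gamma>")
  case True
  then show ?thesis using \<Gamma> by blast
next
  case False
  note add = partial_hom_add [OF \<Gamma>] and sm = partial_hom_smult [OF \<Gamma>]
    and null = partial_hom_null [OF \<Gamma>] and fn = partial_hom_fun [OF \<Gamma>]
  have fn2: "cng c d" if w: "(w, c) \<in> \<Gamma>" and u: "(u, d) \<in> \<Gamma>" and wu: "\<And>i. i < m \<Longrightarrow> cng (w i) (u i)"
    for w c u d
  proof -
    have "((\<lambda>i. w i + (- 1) * u i), c + (- 1) * d) \<in> \<Gamma>" by (intro add w sm u)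
    from fn [OF this] show ?thesis using wu by (simp add: cng_def)
  qed
  have "cring_ideal {a. \<exists>c. ((\<lambda>i. a * v i), c) \<in> \<Gamma>}"
  proof
    show "0 \<in> {a. \<exists>c. ((\<lambda>i. a * v i), c) \<in> \<Gamma>}" using null [of "\<lambda>i. 0 * v i" 0] by auto
  next
    fix p q assume "p \<in> {a. \<exists>c. ((\<lambda>i. a * v i), c) \<in> \<Gamma>}" "q \<in> {a. \<exists>c. ((\<lambda>i. a * v i), c) \<in> \<Gamma>}"
    then obtain c d where "((\<lambda>i. p * v i), c) \<in> \<Gamma>" "((\<lambda>i. q * v i), d) \<in> \<Gamma>" by blast
    from add [OF this] show "p + q \<in> {a. \<exists>c. ((\<lambda>i. a * v i), c) \<in> \<Gamma>}"
      unfolding distrib_right [symmetric] by blast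
  next
    fix p a assume "p \<in> {a. \<exists>c. ((\<lambda>i. a * v i), c) \<in> \<Gamma>}"
    then obtain c where "((\<lambda>i. p * v i), c) \<in> \<Gamma>" by blast
    from sm [OF this, of a] show "a * p \<in> {a. \<exists>c. ((\<lambda>i. a * v i), c) \<in> \<Gamma>}"
      unfolding mult.assoc [symmetric] by blast
  qed
  from positive_part_in [OF this] v
  have positive: "p - hpart 0 p \<in> {a. \<exists>c. ((\<lambda>i. a * v i), c) \<in> \<Gamma>}" for p by blast
  have dom: "\<exists>c. ((\<lambda>i. p * v i), c) \<in> \<Gamma>" if "hpart 0 p = 0" for p
    using positive [of p] that by simp
  \<comment> \<open>The chosen values are unique only modulo \<open>J\<close>; by \<open>fn2\<close>
    this suffices for a homomorphism in the sense of \<open>pos_hom\<close>.\<close>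
  define \<phi> where "\<phi> p = (SOME c. ((\<lambda>i. p * v i), c) \<in> \<Gamma>)" for p
  have \<phi>: "((\<lambda>i. p * v i), \<phi> p) \<in> \<Gamma>" if "hpart 0 p = 0" for p
    unfolding \<phi>_def using someI_ex [OF dom [OF that]] .
  have "\<exists>c. \<forall>p. hpart 0 p = 0 \<longrightarrow> cng (\<phi> p) (p * c)"
  proof (rule ext [unfolded mult_ext_def, rule_format], unfold pos_hom_def, intro conjI allI impI ballI)
    fix p q :: "('x, 'k) mpoly" assume pq: "hpart 0 p = 0" "hpart 0 q = 0"
    show "cng (\<phi> (p + q)) (\<phi> p + \<phi> q)"
      by (rule fn2 [OF \<phi> add [OF \<phi> \<phi>]]) (use pq in \<open>simp_all add: distrib_right\<close>)
  next
    fix a p :: "('x, 'k) mpoly" assume p: "hpart 0 p = 0"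
    show "cng (\<phi> (a * p)) (a * \<phi> p)"
      by (rule fn2 [OF \<phi> sm [OF \<phi>]]) (use p in \<open>simp_all add: mult.assoc\<close>)
  next
    fix p assume p: "p \<in> J"
    show "\<phi> p \<in> J"
      by (rule fn [OF \<phi>]) (use p proper mult_in' in auto)
  qed
  then obtain c where c: "\<And>p. hpart 0 p = 0 \<Longrightarrow> cng (\<phi> p) (p * c)" by blast
  define \<Gamma>' where "\<Gamma>' = {((\<lambda>i. w i + a * v i), d + a * c) |w d a. (w, d) \<in> \<Gamma>}"
  have I: "((\<lambda>i. w i + a * v i), d + a * c) \<in> \<Gamma>'" if "(w, d) \<in> \<Gamma>" for w d a
    unfolding \<Gamma>'_def using that by blast
  have sub: "\<Gamma> \<subseteq> \<Gamma>'"
  proof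
    fix x assume "x \<in> \<Gamma>"
    then show "x \<in> \<Gamma>'" using I [of "fst x" "snd x" 0] by simp
  qed
  have "partial_hom m \<Gamma>'"
    unfolding partial_hom_def
  proof (intro conjI allI impI)
    fix w1 c1 w2 c2 assume "(w1, c1) \<in> \<Gamma>'" "(w2, c2) \<in> \<Gamma>'"
    then obtain u1 d1 a1 u2 d2 a2 where u: "(u1, d1) \<in> \<Gamma>" "(u2, d2) \<in> \<Gamma>"
      and eq: "w1 = (\<lambda>i. u1 i + a1 * v i)" "c1 = d1 + a1 * c" "w2 = (\<lambda>i. u2 i + a2 * v i)" "c2 = d2 + a2 * c"
      unfolding \<Gamma>'_def by blast
    have "((\<lambda>i. (u1 i + u2 i) + (a1 + a2) * v i), (d1 + d2) + (a1 + a2) * c) \<in> \<Gamma>'"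
      by (intro I add u)
    then show "((\<lambda>i. w1 i + w2 i), c1 + c2) \<in> \<Gamma>'"
      by (simp add: eq algebra_simps)
  next
    fix b w1 c1 assume "(w1, c1) \<in> \<Gamma>'"
    then obtain u1 d1 a1 where u: "(u1, d1) \<in> \<Gamma>"
      and eq: "w1 = (\<lambda>i. u1 i + a1 * v i)" "c1 = d1 + a1 * c"
      unfolding \<Gamma>'_def by blast
    have "((\<lambda>i. b * u1 i + (b * a1) * v i), b * d1 + (b * a1) * c) \<in> \<Gamma>'"
      by (intro I sm u)
    then show "((\<lambda>i. b * w1 i), b * c1) \<in> \<Gamma>'"
      by (simp add: eq algebra_simps)
  next
    fix w1 c1 assume "\<forall>i<m. w1 i \<in> J" "c1 \<in> J"
    then show "(w1, c1) \<in> \<Gamma>'" using null sub by blast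
  next
    fix w1 c1 assume "(w1, c1) \<in> \<Gamma>'" and z: "\<forall>i<m. w1 i \<in> J"
    then obtain w d a where w: "(w, d) \<in> \<Gamma>"
      and eq: "w1 = (\<lambda>i. w i + a * v i)" "c1 = d + a * c"
      unfolding \<Gamma>'_def by blast
    show "c1 \<in> J"
    proof (cases "hpart 0 a = 0")
      case True
      have "d + \<phi> a \<in> J"
        by (rule fn [OF add [OF w \<phi> [OF True]]]) (use z eq in auto)
      moreover have "cng (d + a * c) (d + \<phi> a)"
        by (rule cng_add [OF cng_refl cng_sym [OF c [OF True]]])
      ultimately show ?thesis unfolding eq by (rule cng_in [rotated])
    next
      case False
      then obtain b where b: "cng (b * a) 1" by (rule unit_mod)
      \<comment> \<open>With \<open>a\<close> a unit, \<open>v\<close> is congruent to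
        \<open>- b w\<close> and would already lie in the domain. The part \<open>v + b w\<close>,
        which vanishes modulo \<open>J\<close>, is added with the value \<open>0\<close>.\<close>
      have "((\<lambda>i. (v i + b * w i) + (- b) * w i), 0 + (- b) * d) \<in> \<Gamma>"
      proof (rule add [OF null sm [OF w]])
        fix i assume i: "i < m"
        have "cng (v i + b * w i) (b * a * v i + b * w i)"
          using cng_add [OF cng_sym [OF cng_mult_right [OF b, of "v i"]] cng_refl [of "b * w i"]] by simp
        also have "b * a * v i + b * w i = b * w1 i" by (simp add: eq algebra_simps)
        finally show "v i + b * w i \<in> J" using z i by (blast intro: mult_in cng_in)
      qed simp
      then show ?thesis using False \<open>\<nexists>c. (v, c) \<in> \<Gamma>\<close> by simp
    qed
  qed
  moreover have "(v, c) \<in> \<Gamma>'"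
    using I [OF null [of "\<lambda>_. 0" 0], of 1] by simp
  ultimately show ?thesis using sub by blast
qed

lemma partial_hom_extend:
  assumes ext: mult_ext and "finite G" and \<Gamma>: "partial_hom m \<Gamma>"
    and v: "\<And>v x. v \<in> G \<Longrightarrow> \<exists>c. ((\<lambda>i. mvar x * v i), c) \<in> \<Gamma>"
  shows "\<exists>\<Gamma>'. partial_hom m \<Gamma>' \<and> \<Gamma> \<subseteq> \<Gamma>' \<and> (\<forall>v\<in>G. \<exists>c. (v, c) \<in> \<Gamma>')"
  using assms(2) v
proof (induct G rule: finite_induct)
  case empty
  then show ?case using \<Gamma> by blast
next
  case (insert u G)
  then obtain \<Gamma>1 where 1: "partial_hom m \<Gamma>1" "\<Gamma> \<subseteq> \<Gamma>1" "\<forall>v\<in>G. \<exists>c. (v, c) \<in> \<Gamma>1" by auto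
  have "\<exists>c. ((\<lambda>i. mvar x * u i), c) \<in> \<Gamma>1" for x
    using insert(4) [of u x] 1(2) by blast
  from partial_hom_extend1 [OF ext 1(1) this]
  obtain \<Gamma>2 where "partial_hom m \<Gamma>2" "\<Gamma>1 \<subseteq> \<Gamma>2" "\<exists>c. (u, c) \<in> \<Gamma>2" by blast
  with 1 show ?case by (intro exI [of _ \<Gamma>2]) blast
qed

text \<open>A functional on the image of \<open>D\<close> is extended to the whole free module. A
  generator can be adjoined only when the variables carry it into the domain, so the domain grows
  along powers of the maximal ideal: quadratic multiples of unit vectors (\<open>G2\<close>,
  annihilated by the variables), then linear ones (\<open>G1\<close>), then the unit vectors
  (\<open>G0\<close>).\<close>

lemma baer_extend:
  assumes ext: mult_ext
    and h: "\<And>v. (\<And>p. p < m \<Longrightarrow> mv n D v p \<in> J) \<Longrightarrow> (\<Sum>q<n. \<psi> q * v q) \<in> J"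
  shows "\<exists>\<chi>. \<forall>q<n. cng (\<psi> q) (\<Sum>p<m. D p q * \<chi> p)"
proof -
  \<comment> \<open>The functional that \<open>\<psi>\<close> induces on the image of
    \<open>D\<close>; assumption \<open>h\<close> says that it is well defined.\<close>
  define \<Gamma>0 where "\<Gamma>0 = {(v, c). \<exists>w. (\<forall>i<m. cng (v i) (mv n D w i)) \<and> cng c (\<Sum>q<n. \<psi> q * w q)}"
  have g0: "partial_hom m \<Gamma>0"
    unfolding partial_hom_def
  proof (intro conjI allI impI)
    fix v c w d assume "(v, c) \<in> \<Gamma>0" "(w, d) \<in> \<Gamma>0"
    then obtain v' w' where
      1: "\<forall>i<m. cng (v i) (mv n D v' i)" "cng c (\<Sum>q<n. \<psi> q * v' q)" and
      2: "\<forall>i<m. cng (w i) (mv n D w' i)" "cng d (\<Sum>q<n. \<psi> q * w' q)"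
      unfolding \<Gamma>0_def by auto
    show "((\<lambda>i. v i + w i), c + d) \<in> \<Gamma>0"
      unfolding \<Gamma>0_def using 1 2
      by (auto intro!: exI [of _ "\<lambda>i. v' i + w' i"] cng_add simp: mv_add distrib_left sum.distrib)
  next
    fix a v c assume "(v, c) \<in> \<Gamma>0"
    then obtain v' where
      1: "\<forall>i<m. cng (v i) (mv n D v' i)" "cng c (\<Sum>q<n. \<psi> q * v' q)"
      unfolding \<Gamma>0_def by auto
    have "(\<Sum>q<n. \<psi> q * (a * v' q)) = a * (\<Sum>q<n. \<psi> q * v' q)"
      by (simp add: sum_distrib_left mult.left_commute)
    then show "((\<lambda>i. a * v i), a * c) \<in> \<Gamma>0"
      unfolding \<Gamma>0_def using 1
      by (auto intro!: exI [of _ "\<lambda>i. a * v' i"] cng_mult_left simp: mv_scale)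
  next
    fix v c assume "\<forall>i<m. v i \<in> J" "c \<in> J"
    then show "(v, c) \<in> \<Gamma>0"
      unfolding \<Gamma>0_def by (auto intro!: exI [of _ "\<lambda>_. 0"] simp: cng_0)
  next
    fix v c assume "(v, c) \<in> \<Gamma>0" and z: "\<forall>i<m. v i \<in> J"
    then obtain v' where
      1: "\<forall>i<m. cng (v i) (mv n D v' i)" "cng c (\<Sum>q<n. \<psi> q * v' q)"
      unfolding \<Gamma>0_def by auto
    have "(\<Sum>q<n. \<psi> q * v' q) \<in> J" by (rule h) (use 1 z cng_in_iff in blast)
    with 1 show "c \<in> J" by (blast intro: cng_in)
  qed
  define e where "e a p = (\<lambda>i. if i = p then a else 0)" for a :: "('x, 'k) mpoly" and p :: nat
  have me: "(\<lambda>i. b * e a p i) = e (b * a) p" for a b p by (auto simp: e_def)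
  define G2 where "G2 = (\<lambda>(x, y, p). e (mvar x * mvar y) p) ` (UNIV \<times> UNIV \<times> {..<m})"
  define G1 where "G1 = (\<lambda>(x, p). e (mvar x) p) ` (UNIV \<times> {..<m})"
  define G0 where "G0 = e 1 ` {..<m}"
  have fin: "finite G2" "finite G1" "finite G0" by (simp_all add: G2_def G1_def G0_def)
  have d3: "mvar x * (mvar y * mvar z) \<in> J" for x y z
    using deg3 [OF homog_mult [OF homog_mvar homog_mult [OF homog_mvar homog_mvar]], of x y z] by simp
  have "\<exists>c. ((\<lambda>i. mvar x * v i), c) \<in> \<Gamma>0" if "v \<in> G2" for v x
  proof -
    from that obtain y z p where "v = e (mvar y * mvar z) p" by (auto simp: G2_def)
    then have "((\<lambda>i. mvar x * v i), 0) \<in> \<Gamma>0"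
      using g0 d3 unfolding partial_hom_def by (simp add: e_def)
    then show ?thesis by blast
  qed
  from partial_hom_extend [OF ext fin(1) g0 this]
  obtain \<Gamma>1 where 1: "partial_hom m \<Gamma>1" "\<Gamma>0 \<subseteq> \<Gamma>1" "\<forall>v\<in>G2. \<exists>c. (v, c) \<in> \<Gamma>1" by blast
  have "\<exists>c. ((\<lambda>i. mvar x * v i), c) \<in> \<Gamma>1" if "v \<in> G1" for v x
  proof -
    from that obtain y p where v: "v = e (mvar y) p" "p < m" by (auto simp: G1_def)
    have "(\<lambda>i. mvar x * v i) \<in> G2"
      unfolding G2_def v(1) me by (rule image_eqI [of _ _ "(x, y, p)"]) (use v(2) in simp_all)
    then show ?thesis using 1(3) by blast
  qed
  from partial_hom_extend [OF ext fin(2) 1(1) this]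
  obtain \<Gamma>2 where 2: "partial_hom m \<Gamma>2" "\<Gamma>1 \<subseteq> \<Gamma>2" "\<forall>v\<in>G1. \<exists>c. (v, c) \<in> \<Gamma>2" by blast
  have "\<exists>c. ((\<lambda>i. mvar x * v i), c) \<in> \<Gamma>2" if "v \<in> G0" for v x
  proof -
    from that obtain p where v: "v = e 1 p" "p < m" by (auto simp: G0_def)
    have "(\<lambda>i. mvar x * v i) \<in> G1"
      unfolding G1_def v(1) me by (rule image_eqI [of _ _ "(x, p)"]) (use v(2) in simp_all)
    then show ?thesis using 2(3) by blast
  qed
  from partial_hom_extend [OF ext fin(3) 2(1) this]
  obtain \<Gamma>3 where 3: "partial_hom m \<Gamma>3" "\<Gamma>2 \<subseteq> \<Gamma>3" "\<forall>v\<in>G0. \<exists>c. (v, c) \<in> \<Gamma>3" by blast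
  have "\<forall>p. \<exists>c. p < m \<longrightarrow> (e 1 p, c) \<in> \<Gamma>3" using 3(3) by (auto simp: G0_def)
  then obtain \<chi> where \<chi>: "\<And>p. p < m \<Longrightarrow> (e 1 p, \<chi> p) \<in> \<Gamma>3" by metis
  note add = partial_hom_add [OF 3(1)] and sm = partial_hom_smult [OF 3(1)]
    and null = partial_hom_null [OF 3(1)] and fn = partial_hom_fun [OF 3(1)]
  have "cng (\<psi> q) (\<Sum>p<m. D p q * \<chi> p)" if q: "q < n" for q
  proof -
    have "((\<lambda>i. D i q), \<psi> q) \<in> \<Gamma>0"
      unfolding \<Gamma>0_def using q mv_unit [OF q, of "\<lambda>_ q. \<psi> q" 1]
      by (auto intro!: exI [of _ "\<lambda>i. if i = q then 1 else 0"] simp: mv_unit mv_def [of n "\<lambda>_ q. \<psi> q"])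
    then have col: "((\<lambda>i. D i q), \<psi> q) \<in> \<Gamma>3" using 1(2) 2(2) 3(2) by blast
    have "((\<lambda>i. if i < k then D i q else 0), \<Sum>p<k. D p q * \<chi> p) \<in> \<Gamma>3" if "k \<le> m" for k
      using that
    proof (induct k)
      case 0 then show ?case using null by simp
    next
      case (Suc k)
      then have "((\<lambda>i. (if i < k then D i q else 0) + D k q * e 1 k i), (\<Sum>p<k. D p q * \<chi> p) + D k q * \<chi> k) \<in> \<Gamma>3"
        by (intro add sm \<chi>) auto
      moreover have "(\<lambda>i. (if i < k then D i q else 0) + D k q * e 1 k i) = (\<lambda>i. if i < Suc k then D i q else 0)"
        by (auto simp: e_def less_Suc_eq)
      ultimately show ?case by simp
    qed
    from this [of m] have "((\<lambda>i. D i q + (- 1) * (if i < m then D i q else 0)), \<psi> q + (- 1) * (\<Sum>p<m. D p q * \<chi> p)) \<in> \<Gamma>3"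
      by (intro add col sm) simp
    from fn [OF this] show ?thesis by (simp add: cng_def)
  qed
  then show ?thesis by blast
qed

text \<open>The ring is then injective over itself, so every exact sequence of free modules has an
  exact dual, and the bound \<open>n = 0\<close> works in the definition.\<close>

theorem gorenstein_if_mult_ext:
  assumes ext: mult_ext shows "gorenstein Q"
  unfolding gorenstein_def Let_def
proof (intro exI [of _ 0] allI impI)
  fix r :: "nat \<Rightarrow> nat" and d and i :: nat
  assume lin: "\<forall>i. d i \<in> linear_maps Q (free_module Q (r (i + 1))) (free_module Q (r i))"
    and ex: "\<forall>i. d (i + 1) ` carrier (free_module Q (r (i + 2))) =
      a_kernel (free_module Q (r (i + 1))) (free_module Q (r i)) (d i)"
  let ?m = "r i" and ?n = "r (i + 1)" and ?s = "r (i + 2)"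
  obtain D where D: "d i = mat ?m ?n D" using linear_obtain_mat lin by blast
  obtain E where E: "d (i + 1) = mat ?n ?s E"
    using linear_obtain_mat [of "d (i + 1)" ?s ?n] lin [rule_format, of "i + 1"] by auto
  have A: "acyclic_at ?m ?n ?s D E"
    using ex [rule_format, of i] unfolding D E exact_free_iff acyclic_at_def .
  show "dual_map Q (free_module Q ?n) (free_module Q ?m) (d i) ` carrier (dual_module Q (free_module Q ?m)) =
    a_kernel (dual_module Q (free_module Q ?n)) (dual_module Q (free_module Q ?s))
      (dual_map Q (free_module Q ?s) (free_module Q ?n) (d (i + 1)))"
    unfolding D E exact_dual_iff
  proof (rule allI, rule iffI)
    fix c assume c: "\<forall>j<?s. mv ?n (\<lambda>j q. E q j) c j \<in> J"
    \<comment> \<open>The functional \<open>c\<close> vanishes on the image of \<open>E\<close>,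
      which is the kernel of \<open>D\<close>. It is therefore a functional on the image of
      \<open>D\<close>, to be extended to the target of \<open>D\<close>.\<close>
    have "\<exists>\<chi>. \<forall>q<?n. cng (c q) (\<Sum>p<?m. D p q * \<chi> p)"
    proof (rule baer_extend [OF ext])
      fix v assume "\<And>p. p < ?m \<Longrightarrow> mv ?n D v p \<in> J"
      then obtain w where w: "\<And>q. q < ?n \<Longrightarrow> cng (v q) (mv ?s E w q)"
        using acyclic_at_exact [OF A] by blast
      have "cng (\<Sum>q<?n. c q * v q) (\<Sum>q<?n. c q * mv ?s E w q)"
        by (intro cng_sum cng_mult_left w) simp
      also have "(\<Sum>q<?n. c q * mv ?s E w q) = (\<Sum>j<?s. mv ?n (\<lambda>j q. E q j) c j * w j)"
        unfolding mv_def sum_distrib_left sum_distrib_right by (subst sum.swap) (simp add: ac_simps)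
      finally show "(\<Sum>q<?n. c q * v q) \<in> J"
        by (rule cng_in) (use c in \<open>auto intro!: sum_in mult_in'\<close>)
    qed
    then show "\<exists>x. \<forall>q<?n. cng (c q) (mv ?m (\<lambda>q p. D p q) x q)" by (simp add: mv_def)
  next
    fix c assume "\<exists>x. \<forall>q<?n. cng (c q) (mv ?m (\<lambda>q p. D p q) x q)"
    then obtain x where x: "\<And>q. q < ?n \<Longrightarrow> cng (c q) (mv ?m (\<lambda>q p. D p q) x q)" by blast
    have "mv ?n (\<lambda>j q. E q j) c j \<in> J" if j: "j < ?s" for j
    proof -
      have z: "(\<Sum>p<?m. mm ?n D E p j * x p) \<in> J"
      proof (intro sum_in mult_in')
        fix p assume "p \<in> {..<?m}"
        then show "mm ?n D E p j \<in> J"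
          using acyclic_at_zero [OF A, of p "\<lambda>i. if i = j then 1 else 0"] j
          by (simp add: mv_mv mv_unit)
      qed
      have "cng (mv ?n (\<lambda>j q. E q j) c j) (mv ?n (\<lambda>j q. E q j) (mv ?m (\<lambda>q p. D p q) x) j)"
        by (rule cng_mv) (rule x)
      also have "\<dots> = (\<Sum>p<?m. mm ?n D E p j * x p)"
        unfolding mv_mv by (simp add: mv_def mm_def mult.commute)
      finally show "mv ?n (\<lambda>j q. E q j) c j \<in> J" using z by (rule cng_in)
    qed
    then show "\<forall>j<?s. mv ?n (\<lambda>j q. E q j) c j \<in> J" by blast
  qed
qed

end

section \<open>The linear strand\<close>

lemma cst_lookup_0: "cst (Poly_Mapping.lookup p 0) = hpart 0 (p :: ('x::finite, 'k::field) mpoly)"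
  by (rule poly_mapping_eqI) (auto simp: cst_def lookup_hpart lookup_single when_def)

lemma homog_mult_1_1:
  fixes p q :: "('x::finite, 'k::field) mpoly"
  assumes "p \<in> homog 1" "q \<in> homog 1" shows "p * q \<in> homog 2"
  using homog_mult [OF assms] by (simp add: numeral_2_eq_2)

definition cvec :: "(nat \<Rightarrow> 'k) \<Rightarrow> nat \<Rightarrow> ('x, 'k::field) mpoly" where
  "cvec v = (\<lambda>q. cst (v q))"

definition lin_mat :: "nat \<Rightarrow> nat \<Rightarrow> (nat \<Rightarrow> nat \<Rightarrow> ('x, 'k::field) mpoly) \<Rightarrow> bool" where
  "lin_mat m n D \<longleftrightarrow> (\<forall>p<m. \<forall>q<n. D p q \<in> homog 1)"

lemma hpart_mv_homog:
  fixes D :: "nat \<Rightarrow> nat \<Rightarrow> ('x::finite, 'k::field) mpoly"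
  assumes "\<And>q. q < n \<Longrightarrow> D p q \<in> homog 1"
  shows "hpart 0 (mv n D v p) = 0"
    and "hpart (Suc 0) (mv n D v p) = mv n D (\<lambda>q. hpart 0 (v q)) p"
    and "hpart 2 (mv n D v p) = mv n D (\<lambda>q. hpart (Suc 0) (v q)) p"
proof -
  have "hpart d (D p q) = (if d = Suc 0 then D p q else 0)" if "q < n" for q d
    using homog_hpart [OF assms [OF that], of d] by simp
  then show "hpart 0 (mv n D v p) = 0"
    and "hpart (Suc 0) (mv n D v p) = mv n D (\<lambda>q. hpart 0 (v q)) p"
    and "hpart 2 (mv n D v p) = mv n D (\<lambda>q. hpart (Suc 0) (v q)) p"
    by (simp_all add: mv_def hpart_sum hpart_1_mult hpart_2_mult)
qed

lemma hpart_mv: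
  fixes D :: "nat \<Rightarrow> nat \<Rightarrow> ('x::finite, 'k::field) mpoly"
  assumes "\<And>q. q < n \<Longrightarrow> hpart 0 (D p q) = 0"
  shows "hpart 0 (mv n D v p) = 0"
    and "hpart (Suc 0) (mv n D v p) = mv n (\<lambda>p q. hpart 1 (D p q)) (\<lambda>q. hpart 0 (v q)) p"
    and "hpart 2 (mv n D v p) = mv n (\<lambda>p q. hpart 1 (D p q)) (\<lambda>q. hpart 1 (v q)) p
           + mv n (\<lambda>p q. hpart 2 (D p q)) (\<lambda>q. hpart 0 (v q)) p"
  using assms
  by (simp_all add: mv_def hpart_sum hpart_1_mult hpart_2_mult sum.distrib)

lemma mv_homog_1:
  fixes D :: "nat \<Rightarrow> nat \<Rightarrow> ('x::finite, 'k::field) mpoly"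
  assumes "\<And>q. q < n \<Longrightarrow> D p q \<in> homog 1"
  shows "mv n D (cvec v) p \<in> homog 1"
  unfolding mv_def cvec_def using assms
  by (intro homog_sum) (metis homog_cst_mult lessThan_iff mult.commute)

lemma mv_homog_2:
  fixes D :: "nat \<Rightarrow> nat \<Rightarrow> ('x::finite, 'k::field) mpoly"
  assumes "\<And>q. q < n \<Longrightarrow> D p q \<in> homog 1" "\<And>q. q < n \<Longrightarrow> v q \<in> homog 1"
  shows "mv n D v p \<in> homog 2"
  unfolding mv_def using assms by (intro homog_sum homog_mult_1_1) auto

context short_ideal
begin

lemma pta_acyclic_at: "pta r D \<Longrightarrow> acyclic_at (r (i - 1)) (r i) (r (i + 1)) (D i) (D (i + 1))"
  by (simp add: pta_def acyc_def)

lemma pta_minimal: "pta r D \<Longrightarrow> p < r (i - 1) \<Longrightarrow> q < r i \<Longrightarrow> hpart 0 (D i p q) = 0"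
  by (simp add: pta_def)

lemma pta_acyclic_dual:
  assumes "pta r D"
  shows "acyclic_at (r (i + 1)) (r i) (r (i - 1)) (\<lambda>p q. D (i + 1) q p) (\<lambda>p q. D i q p)"
proof -
  have "acyclic_at (rev_rank r (- i - 1)) (rev_rank r (- i)) (rev_rank r (- i + 1))
      (rev_mat D (- i)) (rev_mat D (- i + 1))"
    using assms unfolding pta_def acyc_def by blast
  then show ?thesis by (simp add: rev_rank_def rev_mat_def algebra_simps)
qed

text \<open>If \<open>D\<^sub>i v\<close> is killed by the maximal ideal and \<open>v\<close> has a unit entry, then every
  homomorphism on the maximal ideal factors through the syzygy \<open>ker D\<^sub>i\<close>, where it is the
  restriction of a linear form because the dual complex is exact.\<close>

lemma mult_ext_if_socle:
  assumes pta: "pta r D" and j: "j < r i" "hpart 0 (v j) \<noteq> 0"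
    and soc: "\<And>a p. hpart 0 a = 0 \<Longrightarrow> p < r (i - 1) \<Longrightarrow> a * mv (r i) (D i) v p \<in> J"
  shows mult_ext
  unfolding mult_ext_def
proof (intro allI impI)
  fix \<phi> :: "('x, 'k) mpoly \<Rightarrow> ('x, 'k) mpoly"
  assume \<phi>: "pos_hom \<phi>"
  note sm = pos_hom_smult [OF \<phi>] and null = pos_hom_null [OF \<phi>] and \<phi>_cng = pos_hom_cng [OF \<phi>]
  obtain s where s: "cng (s * v j) 1" using unit_mod [OF j(2)] .
  let ?n = "r i" and ?m = "r (i + 1)"
  define E where "E = D (i + 1)"
  have E0: "hpart 0 (E p q) = 0" if "p < ?n" "q < ?m" for p q
    using pta_minimal [OF pta, of p "i + 1" q] that by (simp add: E_def)
  \<comment> \<open>Since \<open>s\<close> inverts \<open>v j\<close>, the functional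
    \<open>w \<mapsto> \<phi> (s * (E w) j)\<close> gives the value of \<open>\<phi>\<close> at
    \<open>a\<close> whenever \<open>E w\<close> is congruent to \<open>a v\<close>.\<close>
  define \<psi> where "\<psi> q = \<phi> (s * E j q)" for q
  have \<psi>: "cng (\<phi> (s * mv ?m E w j)) (\<Sum>q<?m. \<psi> q * w q)" for w
  proof -
    have "s * mv ?m E w j = (\<Sum>q<?m. w q * (s * E j q))"
      by (simp add: mv_def sum_distrib_left ac_simps)
    also have "cng (\<phi> \<dots>) (\<Sum>q<?m. \<phi> (w q * (s * E j q)))"
      by (rule pos_hom_sum [OF \<phi>]) (simp add: E0 j(1))
    also have "cng \<dots> (\<Sum>q<?m. w q * \<phi> (s * E j q))"
      by (intro cng_sum sm) (simp add: E0 j(1))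
    also have "\<dots> = (\<Sum>q<?m. \<psi> q * w q)"
      by (simp add: \<psi>_def mult.commute)
    finally show ?thesis .
  qed
  have zero: "mv ?n (D i) (mv ?m E w) p \<in> J" if "p < r (i - 1)" for p w
    using acyclic_at_zero [OF pta_acyclic_at [OF pta, of i] that] by (simp add: E_def)
  have zero': "mv ?m E (mv (r (i + 1 + 1)) (D (i + 1 + 1)) w) p \<in> J" if "p < ?n" for p w
    using acyclic_at_zero [OF pta_acyclic_at [OF pta, of "i + 1"], of p w] that by (simp add: E_def)
  \<comment> \<open>\<open>\<psi>\<close> is a cocycle of the dual complex: on boundaries the vector
    \<open>E w\<close> vanishes modulo \<open>J\<close>, and \<open>\<phi>\<close> respects
    \<open>J\<close>.\<close>
  have "mv ?m (\<lambda>p q. D (i + 1 + 1) q p) \<psi> p \<in> J" if p: "p < r (i + 1 + 1)" for p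
  proof -
    have "cng (\<phi> (s * mv ?m E (\<lambda>q. D (i + 1 + 1) q p) j)) (\<Sum>q<?m. \<psi> q * D (i + 1 + 1) q p)"
      by (rule \<psi>)
    moreover
    have "s * mv ?m E (\<lambda>q. D (i + 1 + 1) q p) j \<in> J"
    proof (rule mult_in)
      have "mv ?m E (mv (r (i + 1 + 1)) (D (i + 1 + 1)) (\<lambda>q. if q = p then 1 else 0)) j
          = mv ?m E (\<lambda>q. D (i + 1 + 1) q p) j"
        by (rule mv_cong) (rule trans [OF mv_unit [OF p] mult_1_right])
      then show "mv ?m E (\<lambda>q. D (i + 1 + 1) q p) j \<in> J"
        using zero' [OF j(1), of "\<lambda>q. if q = p then 1 else 0"] by simp
    qed
    then have "\<phi> (s * mv ?m E (\<lambda>q. D (i + 1 + 1) q p) j) \<in> J" by (rule null)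
    ultimately have "(\<Sum>q<?m. \<psi> q * D (i + 1 + 1) q p) \<in> J" using cng_in cng_sym by blast
    then show ?thesis by (simp add: mv_def mult.commute)
  qed
  then obtain \<chi> where \<chi>: "\<And>q. q < ?m \<Longrightarrow> cng (\<psi> q) (mv ?n (\<lambda>q p. E p q) \<chi> q)"
    using acyclic_at_exact [OF pta_acyclic_dual [OF pta, of "i + 1"]] by (auto simp: E_def)
  show "\<exists>c. \<forall>p. hpart 0 p = 0 \<longrightarrow> cng (\<phi> p) (p * c)"
  proof (intro exI allI impI)
    fix a :: "('x, 'k) mpoly" assume a: "hpart 0 a = 0"
    have "mv ?n (D i) (\<lambda>q. a * v q) p \<in> J" if "p < r (i - 1)" for p
      using soc [OF a that] by (simp add: mv_scale)
    then obtain w where w: "\<And>q. q < ?n \<Longrightarrow> cng (a * v q) (mv ?m E w q)"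
      using acyclic_at_exact [OF pta_acyclic_at [OF pta, of i]] by (auto simp: E_def)
    have "cng (\<phi> a) (\<phi> (s * (a * v j)))"
    proof (rule \<phi>_cng [OF a])
      show "cng a (s * (a * v j))"
        using cng_mult_left [OF cng_sym [OF s], of a] by (simp add: mult.left_commute)
    qed
    also have "cng (\<phi> (s * (a * v j))) (\<phi> (s * mv ?m E w j))"
      by (rule \<phi>_cng) (simp_all add: a cng_mult_left w j(1))
    also have "cng (\<phi> (s * mv ?m E w j)) (\<Sum>q<?m. \<psi> q * w q)" by (rule \<psi>)
    also have "cng (\<Sum>q<?m. \<psi> q * w q) (\<Sum>q<?m. mv ?n (\<lambda>q p. E p q) \<chi> q * w q)"
      by (intro cng_sum cng_mult_right \<chi>) simp
    also have "(\<Sum>q<?m. mv ?n (\<lambda>q p. E p q) \<chi> q * w q) = (\<Sum>p<?n. \<chi> p * mv ?m E w p)"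
      unfolding mv_def sum_distrib_left sum_distrib_right by (subst sum.swap) (simp add: ac_simps)
    also have "cng (\<Sum>p<?n. \<chi> p * mv ?m E w p) (\<Sum>p<?n. \<chi> p * (a * v p))"
      by (intro cng_sum cng_mult_left cng_sym [OF w]) simp
    also have "(\<Sum>p<?n. \<chi> p * (a * v p)) = a * (\<Sum>p<?n. \<chi> p * v p)"
      by (simp add: sum_distrib_left mult.left_commute)
    finally show "cng (\<phi> a) (a * (\<Sum>p<?n. \<chi> p * v p))" .
  qed
qed

definition strand_inj :: "nat \<Rightarrow> nat \<Rightarrow> (nat \<Rightarrow> nat \<Rightarrow> ('x, 'k) mpoly) \<Rightarrow> bool" where
  "strand_inj m n D \<longleftrightarrow> (\<forall>v. (\<forall>p<m. mv n D (cvec v) p \<in> J) \<longrightarrow> (\<forall>q<n. v q = 0))"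

definition strand_surj :: "nat \<Rightarrow> nat \<Rightarrow> (nat \<Rightarrow> nat \<Rightarrow> ('x, 'k) mpoly) \<Rightarrow> bool" where
  "strand_surj m n D \<longleftrightarrow> (\<forall>z. (\<forall>p<m. z p \<in> homog 2) \<longrightarrow>
     (\<exists>u. (\<forall>q<n. u q \<in> homog 1) \<and> (\<forall>p<m. cng (z p) (mv n D u p))))"

definition strand_mid :: "nat \<Rightarrow> nat \<Rightarrow> nat \<Rightarrow> (nat \<Rightarrow> nat \<Rightarrow> ('x, 'k) mpoly) \<Rightarrow>
    (nat \<Rightarrow> nat \<Rightarrow> ('x, 'k) mpoly) \<Rightarrow> bool" where
  "strand_mid m n s D E \<longleftrightarrow> (\<forall>u. (\<forall>q<n. u q \<in> homog 1) \<longrightarrow> (\<forall>p<m. mv n D u p \<in> J) \<longrightarrow>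
     (\<exists>v. \<forall>q<n. cng (u q) (mv s E (cvec v) q)))"

definition strand_zero :: "nat \<Rightarrow> nat \<Rightarrow> nat \<Rightarrow> (nat \<Rightarrow> nat \<Rightarrow> ('x, 'k) mpoly) \<Rightarrow>
    (nat \<Rightarrow> nat \<Rightarrow> ('x, 'k) mpoly) \<Rightarrow> bool" where
  "strand_zero m n s D E \<longleftrightarrow> (\<forall>p<m. \<forall>j<s. mm n D E p j \<in> J)"

text \<open>Exactness of \<open>0 \<rightarrow> k\<^bsup>r (i+1)\<^esup> \<rightarrow> ([Q]\<^sub>1)\<^bsup>r i\<^esup> \<rightarrow> ([Q]\<^sub>2)\<^bsup>r (i-1)\<^esup> \<rightarrow> 0\<close> for all \<open>i\<close>,
  where \<open>[Q]\<^sub>d\<close> is the component of degree \<open>d\<close>.\<close>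

definition strand :: "(int \<Rightarrow> nat) \<Rightarrow> (int \<Rightarrow> nat \<Rightarrow> nat \<Rightarrow> ('x, 'k) mpoly) \<Rightarrow> bool" where
  "strand r D \<longleftrightarrow> (\<forall>i. lin_mat (r (i - 1)) (r i) (D i) \<and> strand_inj (r (i - 1)) (r i) (D i) \<and>
     strand_surj (r (i - 1)) (r i) (D i) \<and>
     strand_mid (r (i - 1)) (r i) (r (i + 1)) (D i) (D (i + 1)) \<and>
     strand_zero (r (i - 1)) (r i) (r (i + 1)) (D i) (D (i + 1)))"

lemma strandD:
  assumes "strand r D"
  shows "lin_mat (r (i - 1)) (r i) (D i)" "strand_inj (r (i - 1)) (r i) (D i)"
    "strand_surj (r (i - 1)) (r i) (D i)"
    "strand_mid (r (i - 1)) (r i) (r (i + 1)) (D i) (D (i + 1))"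
    "strand_zero (r (i - 1)) (r i) (r (i + 1)) (D i) (D (i + 1))"
  using assms by (simp_all add: strand_def)

text \<open>When the ring is not Gorenstein, a vector that is mapped into the socle has no constant
  terms. So preimages of quadrics have none, and the quadratic part of the matrix, which could only
  act on constants, does not interfere; the linear part alone is exact in each degree.\<close>

lemma strand_if_pta:
  assumes pta: "pta r D" and ng: "\<not> mult_ext"
  shows "strand r (\<lambda>i p q. hpart 1 (D i p q))"
  unfolding strand_def
proof (intro allI conjI)
  fix i
  let ?m = "r (i - 1)" and ?n = "r i" and ?s = "r (i + 1)"
  let ?L = "\<lambda>i p q. hpart 1 (D i p q)"
  have D0: "hpart 0 (D i p q) = 0" if "p < ?m" "q < ?n" for p q
    by (rule pta_minimal [OF pta that])
  have E0: "hpart 0 (D (i + 1) p q) = 0" if "p < ?n" "q < ?s" for p q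
    using pta_minimal [OF pta, of p "i + 1"] that by simp
  have soc: "hpart 0 (v q) = 0"
    if "q < ?n" "\<And>a p. hpart 0 a = 0 \<Longrightarrow> p < ?m \<Longrightarrow> a * mv ?n (D i) v p \<in> J" for v q
    using mult_ext_if_socle [OF pta that(1) _ that(2)] ng by blast
  show "lin_mat ?m ?n (?L i)" by (simp add: lin_mat_def)
  show "strand_inj ?m ?n (?L i)"
    unfolding strand_inj_def
  proof (intro allI impI)
    fix v q assume v: "\<forall>p<?m. mv ?n (?L i) (cvec v) p \<in> J" and q: "q < ?n"
    have "hpart 0 (cvec v q :: ('x, 'k) mpoly) = 0"
    proof (rule soc [OF q])
      fix a :: "('x, 'k) mpoly" and p assume a: "hpart 0 a = 0" and p: "p < ?m"
      show "a * mv ?n (D i) (cvec v) p \<in> J"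
        using a hpart_mv [of ?n "D i" p "cvec v", OF D0] p v
        by (subst in_iff_hpart) (simp add: hpart_1_mult hpart_2_mult cvec_def mult_in)
    qed
    then show "v q = 0" by (simp add: cvec_def)
  qed
  show "strand_surj ?m ?n (?L i)"
    unfolding strand_surj_def
  proof (intro allI impI)
    fix z :: "nat \<Rightarrow> ('x, 'k) mpoly" assume z: "\<forall>p<?m. z p \<in> homog 2"
    have z': "hpart 0 (z p) = 0" "hpart (Suc 0) (z p) = 0" "hpart 2 (z p) = z p" if "p < ?m" for p
      using homog_hpart [OF z [rule_format, OF that]] by simp_all
    have "mv ?m (D (i - 1)) z p \<in> J" if "p < r (i - 1 - 1)" for p
    proof -
      have "hpart 0 (D (i - 1) p q) = 0" if "q < ?m" for q
        using pta_minimal [OF pta, of p "i - 1" q] that \<open>p < r (i - 1 - 1)\<close> by simp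
      from hpart_mv [of ?m "D (i - 1)" p z, OF this] z' show ?thesis
        by (subst in_iff_hpart) (simp add: mv_def)
    qed
    then obtain v where v: "\<And>p. p < ?m \<Longrightarrow> cng (z p) (mv ?n (D i) v p)"
      using acyclic_at_exact [OF pta_acyclic_at [OF pta, of "i - 1"]] by auto
    have v0: "hpart 0 (v q) = 0" if "q < ?n" for q
    proof (rule soc [OF that])
      fix a :: "('x, 'k) mpoly" and p assume a: "hpart 0 a = 0" and p: "p < ?m"
      have "a * z p \<in> J"
        using a z' [OF p] by (subst in_iff_hpart) (simp add: hpart_1_mult hpart_2_mult)
      then show "a * mv ?n (D i) v p \<in> J"
        using cng_in [OF cng_mult_left [OF cng_sym [OF v [OF p]]]] by blast
    qed
    show "\<exists>u. (\<forall>q<?n. u q \<in> homog 1) \<and> (\<forall>p<?m. cng (z p) (mv ?n (?L i) u p))"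
    proof (intro exI [of _ "\<lambda>q. hpart 1 (v q)"] conjI allI impI)
      fix p assume p: "p < ?m"
      have "cng (hpart 2 (z p)) (hpart 2 (mv ?n (D i) v p))" by (intro cng_hpart v p)
      moreover have "mv ?n (\<lambda>p q. hpart 2 (D i p q)) (\<lambda>q. hpart 0 (v q)) p = 0"
        using v0 by (simp add: mv_def)
      ultimately show "cng (z p) (mv ?n (?L i) (\<lambda>q. hpart 1 (v q)) p)"
        using hpart_mv(3) [of ?n "D i" p v, OF D0] p z' [OF p] by simp
    qed simp
  qed
  show "strand_mid ?m ?n ?s (?L i) (?L (i + 1))"
    unfolding strand_mid_def
  proof (intro allI impI)
    fix u :: "nat \<Rightarrow> ('x, 'k) mpoly" assume u: "\<forall>q<?n. u q \<in> homog 1" and k: "\<forall>p<?m. mv ?n (?L i) u p \<in> J"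
    have u': "hpart 0 (u q) = 0" "hpart (Suc 0) (u q) = u q" if "q < ?n" for q
      using homog_hpart [OF u [rule_format, OF that]] by simp_all
    have "mv ?n (D i) u p \<in> J" if p: "p < ?m" for p
    proof -
      have "mv ?n (?L i) (\<lambda>q. hpart 1 (u q)) p = mv ?n (?L i) u p"
        by (rule mv_cong) (simp add: u')
      moreover have "mv ?n (?L i) (\<lambda>q. hpart 0 (u q)) p = 0" "mv ?n (\<lambda>p q. hpart 2 (D i p q)) (\<lambda>q. hpart 0 (u q)) p = 0"
        using u' by (simp_all add: mv_def)
      ultimately show ?thesis
        using hpart_mv [of ?n "D i" p u, OF D0] p k by (subst in_iff_hpart) simp
    qed
    then obtain w where w: "\<And>q. q < ?n \<Longrightarrow> cng (u q) (mv ?s (D (i + 1)) w q)"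
      using acyclic_at_exact [OF pta_acyclic_at [OF pta, of i]] by auto
    show "\<exists>v. \<forall>q<?n. cng (u q) (mv ?s (?L (i + 1)) (cvec v) q)"
    proof (intro exI [of _ "\<lambda>j. Poly_Mapping.lookup (w j) 0"] allI impI)
      fix q assume q: "q < ?n"
      have "cng (hpart (Suc 0) (u q)) (hpart (Suc 0) (mv ?s (D (i + 1)) w q))" by (intro cng_hpart w q)
      moreover have "mv ?s (?L (i + 1)) (cvec (\<lambda>j. Poly_Mapping.lookup (w j) 0)) q =
          mv ?s (?L (i + 1)) (\<lambda>j. hpart 0 (w j)) q"
        by (rule mv_cong) (simp add: cvec_def cst_lookup_0)
      ultimately show "cng (u q) (mv ?s (?L (i + 1)) (cvec (\<lambda>j. Poly_Mapping.lookup (w j) 0)) q)"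
        using hpart_mv(2) [of ?s "D (i + 1)" q w, OF E0] q u' by simp
    qed
  qed
  show "strand_zero ?m ?n ?s (?L i) (?L (i + 1))"
    unfolding strand_zero_def
  proof (intro allI impI)
    fix p j assume p: "p < ?m" and j: "j < ?s"
    let ?e = "\<lambda>t. if t = j then 1 else 0 :: ('x, 'k) mpoly"
    let ?v = "mv ?s (D (i + 1)) ?e"
    have v: "?v q = D (i + 1) q j" for q using j by (simp add: mv_unit)
    have "mv ?n (D i) ?v p \<in> J"
      using acyclic_at_zero [OF pta_acyclic_at [OF pta, of i]] p by simp
    then have "hpart 2 (mv ?n (D i) ?v p) \<in> J" by (rule hpart_in)
    moreover have "mv ?n (\<lambda>p q. hpart 2 (D i p q)) (\<lambda>q. hpart 0 (?v q)) p = 0"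
      using E0 j by (simp add: mv_def [of ?n] v)
    moreover have "mv ?n (?L i) (\<lambda>q. hpart 1 (?v q)) p = mm ?n (?L i) (?L (i + 1)) p j"
      by (simp add: v mv_def [of ?n] mm_def)
    ultimately show "mm ?n (?L i) (?L (i + 1)) p j \<in> J"
      using hpart_mv(3) [of ?n "D i" p ?v, OF D0] p by simp
  qed
qed

text \<open>A cycle is treated degree by degree: its constant part vanishes by injectivity, its
  linear part has a constant preimage by exactness in the middle, and its quadratic part has a
  linear preimage by surjectivity one step further.\<close>

lemma acyc_if_strand:
  assumes st: "strand r D"
  shows "acyc r D"
  unfolding acyc_def acyclic_at_def
proof (intro allI)
  fix i v
  let ?m = "r (i - 1)" and ?n = "r i" and ?s = "r (i + 1)"
  have lD: "D i p q \<in> homog 1" if "p < ?m" "q < ?n" for p q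
    using strandD(1) [OF st, of i] that by (simp add: lin_mat_def)
  have lE: "D (i + 1) p q \<in> homog 1" if "p < ?n" "q < ?s" for p q
    using strandD(1) [OF st, of "i + 1"] that by (simp add: lin_mat_def)
  show "(\<forall>p<?m. mv ?n (D i) v p \<in> J) \<longleftrightarrow> (\<exists>w. \<forall>q<?n. cng (v q) (mv ?s (D (i + 1)) w q))"
  proof
    assume k: "\<forall>p<?m. mv ?n (D i) v p \<in> J"
    have k1: "mv ?n (D i) (\<lambda>q. hpart 0 (v q)) p \<in> J" and k2: "mv ?n (D i) (\<lambda>q. hpart 1 (v q)) p \<in> J"
      if p: "p < ?m" for p
      using hpart_in [of "mv ?n (D i) v p" 1] hpart_in [of "mv ?n (D i) v p" 2] k p
        hpart_mv_homog [of ?n "D i" p v, OF lD [OF p]] by simp_all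
    have "\<forall>p<?m. mv ?n (D i) (cvec (\<lambda>q. Poly_Mapping.lookup (v q) 0)) p \<in> J"
      using k1 by (simp add: cvec_def cst_lookup_0 mv_def)
    then have v0: "hpart 0 (v q) = 0" if "q < ?n" for q
      using strandD(2) [OF st, of i, unfolded strand_inj_def, rule_format, of "\<lambda>q. Poly_Mapping.lookup (v q) 0" q]
        that cst_lookup_0 [of "v q", symmetric] by simp
    obtain w0 where w0: "\<And>q. q < ?n \<Longrightarrow> cng (hpart 1 (v q)) (mv ?s (D (i + 1)) (cvec w0) q)"
      using strandD(4) [OF st, of i] k2 unfolding strand_mid_def
      by (elim allE [of _ "\<lambda>q. hpart 1 (v q)"]) auto
    have "strand_surj ?n ?s (D (i + 1))" using strandD(3) [OF st, of "i + 1"] by simp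
    then obtain w1 where w1: "\<And>q. q < ?n \<Longrightarrow> cng (hpart 2 (v q)) (mv ?s (D (i + 1)) w1 q)"
      unfolding strand_surj_def by (elim allE [of _ "\<lambda>q. hpart 2 (v q)"]) auto
    show "\<exists>w. \<forall>q<?n. cng (v q) (mv ?s (D (i + 1)) w q)"
    proof (intro exI [of _ "\<lambda>j. cvec w0 j + w1 j"] allI impI)
      fix q assume q: "q < ?n"
      have "cng (v q) (hpart 1 (v q) + hpart 2 (v q))" using cng_expand [of "v q"] v0 [OF q] by simp
      also have "cng \<dots> (mv ?s (D (i + 1)) (cvec w0) q + mv ?s (D (i + 1)) w1 q)"
        by (intro cng_add w0 w1 q)
      finally show "cng (v q) (mv ?s (D (i + 1)) (\<lambda>j. cvec w0 j + w1 j) q)" by (simp add: mv_add)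
    qed
  next
    assume "\<exists>w. \<forall>q<?n. cng (v q) (mv ?s (D (i + 1)) w q)"
    then obtain w where w: "\<And>q. q < ?n \<Longrightarrow> cng (v q) (mv ?s (D (i + 1)) w q)" by blast
    show "\<forall>p<?m. mv ?n (D i) v p \<in> J"
    proof (intro allI impI)
      fix p assume p: "p < ?m"
      have "cng (mv ?n (D i) v p) (mv ?n (D i) (mv ?s (D (i + 1)) w) p)" by (intro cng_mv w)
      moreover have "mv ?n (D i) (mv ?s (D (i + 1)) w) p \<in> J"
        unfolding mv_mv
        by (rule mv_mat_in) (use strandD(5) [OF st, of i] p in \<open>simp add: strand_zero_def\<close>)
      ultimately show "mv ?n (D i) v p \<in> J" by (rule cng_in)
    qed
  qed
qed

definition bistrand :: "(int \<Rightarrow> nat) \<Rightarrow> (int \<Rightarrow> nat \<Rightarrow> nat \<Rightarrow> ('x, 'k) mpoly) \<Rightarrow> bool" where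
  "bistrand r D \<longleftrightarrow> strand r D \<and> strand (rev_rank r) (rev_mat D)"

lemma pta_if_bistrand:
  assumes "bistrand r D" shows "pta r D"
  unfolding pta_def
proof (intro conjI allI impI)
  show "acyc r D" "acyc (rev_rank r) (rev_mat D)"
    using assms by (auto simp: bistrand_def intro: acyc_if_strand)
  fix i p q assume "p < r (i - 1)" "q < r i"
  then have "D i p q \<in> homog 1"
    using assms strandD(1) [of r D i] by (auto simp: bistrand_def lin_mat_def)
  then show "hpart 0 (D i p q) = 0" by (simp add: homog_hpart)
qed

lemma bistrand_if_pta:
  assumes "pta r D" "\<not> mult_ext"
  shows "bistrand r (\<lambda>i p q. hpart 1 (D i p q))"
  using strand_if_pta [OF assms] strand_if_pta [OF pta_rev [OF assms(1)] assms(2)]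
  by (simp add: bistrand_def rev_mat_def)

end

section \<open>Counting dimensions\<close>

lemma finite_exponents: "finite {\<mu> :: 'x::finite \<Rightarrow>\<^sub>0 nat. mdeg \<mu> = d}"
proof -
  have "finite (Poly_Mapping.lookup -` {f :: 'x \<Rightarrow> nat. \<forall>x. f x \<le> d})"
  proof (rule finite_vimageI)
    have "{f :: 'x \<Rightarrow> nat. \<forall>x. f x \<le> d} = (\<Pi>\<^sub>E x\<in>UNIV. {..d})" by (auto simp: PiE_iff)
    then show "finite {f :: 'x \<Rightarrow> nat. \<forall>x. f x \<le> d}" by (simp add: finite_PiE)
    show "inj (Poly_Mapping.lookup :: ('x \<Rightarrow>\<^sub>0 nat) \<Rightarrow> 'x \<Rightarrow> nat)"
      by (rule injI, rule poly_mapping_eqI) simp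
  qed
  moreover have "{\<mu> :: 'x \<Rightarrow>\<^sub>0 nat. mdeg \<mu> = d} \<subseteq> Poly_Mapping.lookup -` {f. \<forall>x. f x \<le> d}"
  proof
    fix \<mu> :: "'x \<Rightarrow>\<^sub>0 nat" assume "\<mu> \<in> {\<mu>. mdeg \<mu> = d}"
    then have d: "mdeg \<mu> = d" by simp
    have "Poly_Mapping.lookup \<mu> x \<le> d" for x
      unfolding d [symmetric] mdeg_def by (rule member_le_sum) simp_all
    then show "\<mu> \<in> Poly_Mapping.lookup -` {f. \<forall>x. f x \<le> d}" by simp
  qed
  ultimately show ?thesis by (rule finite_subset [rotated])
qed

context short_ideal
begin

definition hbasis :: "nat \<Rightarrow> nat \<Rightarrow> (nat \<Rightarrow> ('x, 'k) mpoly) \<Rightarrow> bool" where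
  "hbasis d n \<beta> \<longleftrightarrow> (\<forall>j<n. \<beta> j \<in> homog d) \<and>
     (\<forall>p\<in>homog d. \<exists>c. cng p (\<Sum>j<n. cst (c j) * \<beta> j)) \<and>
     (\<forall>c. (\<Sum>j<n. cst (c j) * \<beta> j) \<in> J \<longrightarrow> (\<forall>j<n. c j = 0))"

lemma hbasis_homog: "hbasis d n \<beta> \<Longrightarrow> j < n \<Longrightarrow> \<beta> j \<in> homog d"
  by (simp add: hbasis_def)
lemma hbasis_span:
  assumes "hbasis d n \<beta>" "p \<in> homog d" obtains c where "cng p (\<Sum>j<n. cst (c j) * \<beta> j)"
  using assms unfolding hbasis_def by blast
lemma hbasis_indep: "hbasis d n \<beta> \<Longrightarrow> (\<Sum>j<n. cst (c j) * \<beta> j) \<in> J \<Longrightarrow> j < n \<Longrightarrow> c j = 0"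
  by (simp add: hbasis_def)

lemma hbasis_unique:
  assumes "hbasis d n \<beta>" "cng (\<Sum>j<n. cst (c j) * \<beta> j) (\<Sum>j<n. cst (c' j) * \<beta> j)" "j < n"
  shows "c j = c' j"
  using hbasis_indep [OF assms(1), of "\<lambda>j. c j - c' j" j] assms(2,3)
  by (simp add: cng_def cst_diff left_diff_distrib sum_subtractf)

text \<open>Greedy selection of a basis: a further generator is kept exactly if it is not congruent
  to a combination of those kept before.\<close>

lemma independent_spanning:
  assumes "finite G"
  shows "\<exists>(n::nat) \<beta>. (\<forall>j<n. \<beta> j \<in> G) \<and> (\<forall>c. (\<Sum>j<n. cst (c j) * \<beta> j) \<in> J \<longrightarrow> (\<forall>j<n. c j = 0)) \<and>
     (\<forall>g\<in>G. \<exists>c. cng g (\<Sum>j<n. cst (c j) * \<beta> j))"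
  using assms
proof (induct G rule: finite_induct)
  case empty
  show ?case by (rule exI [of _ "0::nat"]) simp
next
  case (insert g G)
  then obtain n :: nat and \<beta> where \<beta>: "\<And>j. j < n \<Longrightarrow> \<beta> j \<in> G"
    and ind: "\<And>c j. (\<Sum>j<n. cst (c j) * \<beta> j) \<in> J \<Longrightarrow> j < n \<Longrightarrow> c j = 0"
    and span: "\<And>g. g \<in> G \<Longrightarrow> \<exists>c. cng g (\<Sum>j<n. cst (c j) * \<beta> j)" by blast
  show ?case
  proof (cases "\<exists>c. cng g (\<Sum>j<n. cst (c j) * \<beta> j)")
    case True
    then show ?thesis using \<beta> ind span by (intro exI [of _ n] exI [of _ \<beta>]) blast
  next
    case no: False
    define \<gamma> where "\<gamma> = \<beta>(n := g)"
    have sum: "(\<Sum>j<Suc n. cst (c j) * \<gamma> j) = (\<Sum>j<n. cst (c j) * \<beta> j) + cst (c n) * g" for c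
      by (simp add: \<gamma>_def)
    show ?thesis
    proof (intro exI [of _ "Suc n"] exI [of _ \<gamma>] conjI allI impI ballI)
      fix j assume "j < Suc n"
      then show "\<gamma> j \<in> insert g G" using \<beta> by (auto simp: \<gamma>_def less_Suc_eq)
    next
      fix c j assume c: "(\<Sum>j<Suc n. cst (c j) * \<gamma> j) \<in> J" and j: "j < Suc n"
      have cn: "c n = 0"
      proof (rule ccontr)
        assume nz: "c n \<noteq> 0"
        have "cst (1 / c n) * ((\<Sum>j<n. cst (c j) * \<beta> j) + cst (c n) * g) \<in> J"
          using c unfolding sum by (rule mult_in)
        moreover have "cst (1 / c n) * (cst (c n) * g) = g"
          using cst_inverse [OF nz, of g] by (simp add: mult.left_commute)
        moreover have "cst (1 / c n) * (\<Sum>j<n. cst (c j) * \<beta> j) = - (\<Sum>j<n. cst (- (c j / c n)) * \<beta> j)"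
          by (simp add: sum_distrib_left sum_negf [symmetric] cst_uminus mult.assoc [symmetric]
              cst_mult [symmetric])
        ultimately have "cng g (\<Sum>j<n. cst (- (c j / c n)) * \<beta> j)"
          by (simp add: cng_def distrib_left)
        then show False using no by (elim notE) (rule exI)
      qed
      then have "c j = 0" if "j < n" for j using c ind that unfolding sum by simp
      with cn j show "c j = 0" by (cases "j = n") auto
    next
      fix h assume "h \<in> insert g G"
      then show "\<exists>c. cng h (\<Sum>j<Suc n. cst (c j) * \<gamma> j)"
      proof
        assume "h = g"
        then show ?thesis unfolding sum by (intro exI [of _ "\<lambda>j. if j = n then 1 else 0"]) simp
      next
        assume "h \<in> G"
        then obtain c where c: "cng h (\<Sum>j<n. cst (c j) * \<beta> j)" using span by blast
        have "(\<Sum>j<n. cst (if j = n then 0 else c j) * \<beta> j) = (\<Sum>j<n. cst (c j) * \<beta> j)"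
          by (rule sum.cong) auto
        then show ?thesis unfolding sum using c by (intro exI [of _ "\<lambda>j. if j = n then 0 else c j"]) simp
      qed
    qed
  qed
qed

lemma hbasis_exists: obtains n \<beta> where "hbasis d n \<beta>"
proof -
  define G :: "('x, 'k) mpoly set" where "G = (\<lambda>\<mu>. Poly_Mapping.single \<mu> 1) ` {\<mu>. mdeg \<mu> = d}"
  have "finite G" unfolding G_def by (intro finite_imageI finite_exponents)
  from independent_spanning [OF this] obtain n :: nat and \<beta> where \<beta>: "\<And>j. j < n \<Longrightarrow> \<beta> j \<in> G"
    and ind: "\<And>c. (\<Sum>j<n. cst (c j) * \<beta> j) \<in> J \<Longrightarrow> (\<forall>j<n. c j = 0)"
    and span: "\<And>g. g \<in> G \<Longrightarrow> \<exists>c. cng g (\<Sum>j<n. cst (c j) * \<beta> j)" by blast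
  have "hbasis d n \<beta>"
    unfolding hbasis_def
  proof (intro conjI allI impI ballI)
    fix j assume "j < n"
    then show "\<beta> j \<in> homog d" using \<beta> [of j] homog_single by (auto simp: G_def)
  next
    fix p :: "('x, 'k) mpoly" assume p: "p \<in> homog d"
    have "\<forall>\<mu>. \<exists>c. mdeg \<mu> = d \<longrightarrow> cng (Poly_Mapping.single \<mu> 1) (\<Sum>j<n. cst (c j) * \<beta> j)"
      using span by (auto simp: G_def)
    then obtain C where C: "\<And>\<mu>. mdeg \<mu> = d \<Longrightarrow> cng (Poly_Mapping.single \<mu> 1) (\<Sum>j<n. cst (C \<mu> j) * \<beta> j)"
      by metis
    have "p = (\<Sum>\<mu>\<in>Poly_Mapping.keys p. cst (Poly_Mapping.lookup p \<mu>) * Poly_Mapping.single \<mu> 1)"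
      by (subst mpoly_expand) (simp add: cst_def mult_single)
    also have "cng \<dots> (\<Sum>\<mu>\<in>Poly_Mapping.keys p. cst (Poly_Mapping.lookup p \<mu>) * (\<Sum>j<n. cst (C \<mu> j) * \<beta> j))"
      using p by (intro cng_sum cng_mult_left C) (auto simp: homog_iff in_keys_iff)
    also have "\<dots> = (\<Sum>j<n. cst (\<Sum>\<mu>\<in>Poly_Mapping.keys p. Poly_Mapping.lookup p \<mu> * C \<mu> j) * \<beta> j)"
      unfolding sum_distrib_left cst_sum sum_distrib_right
      by (subst sum.swap) (simp add: cst_mult mult.assoc)
    finally show "\<exists>c. cng p (\<Sum>j<n. cst (c j) * \<beta> j)"
      by (intro exI [of _ "\<lambda>j. \<Sum>\<mu>\<in>Poly_Mapping.keys p. Poly_Mapping.lookup p \<mu> * C \<mu> j"])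
  next
    fix c j assume "(\<Sum>j<n. cst (c j) * \<beta> j) \<in> J" "j < n"
    then show "c j = 0" using ind by blast
  qed
  then show ?thesis by (rule that)
qed

text \<open>The map \<open>k\<^sup>s \<oplus> k\<^sup>m\<^sup>\<times>\<^sup>\<rho> \<rightarrow> ([Q]\<^sub>1)\<^sup>n\<close> given by \<open>L'\<close> and by lifts of a basis of \<open>([Q]\<^sub>2)\<^sup>m\<close> along \<open>L\<close>
  is injective, and it is surjective iff the strand is exact in the middle.\<close>

lemma strand_count:
  assumes \<beta>: "hbasis 1 e \<beta>" and \<gamma>: "hbasis 2 \<rho> \<gamma>"
    and lL: "lin_mat m n L" and lL': "lin_mat n s L'"
    and inj: "strand_inj n s L'" and surj: "strand_surj m n L" and zero: "strand_zero m n s L L'"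
  shows "s + \<rho> * m \<le> e * n"
    and "strand_mid m n s L L' \<Longrightarrow> s + \<rho> * m = e * n"
    and "s + \<rho> * m = e * n \<Longrightarrow> strand_mid m n s L L'"
proof -
  have "\<forall>p l. \<exists>u. l < \<rho> \<longrightarrow> (\<forall>q<n. u q \<in> homog 1) \<and>
      (\<forall>p'<m. cng (if p' = p then \<gamma> l else 0) (mv n L u p'))"
  proof (intro allI)
    fix p l
    show "\<exists>u. l < \<rho> \<longrightarrow> (\<forall>q<n. u q \<in> homog 1) \<and>
      (\<forall>p'<m. cng (if p' = p then \<gamma> l else 0) (mv n L u p'))"
    proof (cases "l < \<rho>")
      case True
      then have "\<forall>p'<m. (if p' = p then \<gamma> l else 0) \<in> homog 2" using hbasis_homog [OF \<gamma>] by simp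
      then show ?thesis
        using surj [unfolded strand_surj_def, rule_format, of "\<lambda>p'. if p' = p then \<gamma> l else 0"] by auto
    qed simp
  qed
  then obtain U where U1: "\<And>p l q. l < \<rho> \<Longrightarrow> q < n \<Longrightarrow> U p l q \<in> homog 1"
    and U2: "\<And>p l p'. l < \<rho> \<Longrightarrow> p' < m \<Longrightarrow> cng (if p' = p then \<gamma> l else 0) (mv n L (U p l) p')"
    by metis
  have "\<forall>u. \<exists>c. u \<in> homog 1 \<longrightarrow> cng u (\<Sum>t<e. cst (c t) * \<beta> t)"
    using hbasis_span [OF \<beta>] by metis
  then obtain co where co: "\<And>u. u \<in> homog 1 \<Longrightarrow> cng u (\<Sum>t<e. cst (co u t) * \<beta> t)" by metis
  \<comment> \<open>\<open>A\<close> indexes the basis of the source, \<open>s\<close> unit vectors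
    and \<open>\<rho>\<close> lifts for each of \<open>m\<close> positions; \<open>B\<close> indexes
    the \<open>e\<close> coordinates in each of the \<open>n\<close> entries of the target.
    \<open>M\<close> is the matrix of the map, \<open>co\<close> giving the coordinates of a linear
    form.\<close>
  define A where "A = {..<s} <+> ({..<m} \<times> {..<\<rho>})"
  define B where "B = {..<n} \<times> {..<e}"
  define W where "W i q = (case i of Inl j \<Rightarrow> L' q j | Inr (p, l) \<Rightarrow> U p l q)" for i q
  define M where "M i = (\<lambda>(q, t). co (W i q) t)" for i
  have finA: "finite A" and finB: "finite B" by (simp_all add: A_def B_def)
  have cardA: "card A = s + \<rho> * m" by (simp add: A_def card_Plus card_cartesian_product)
  have cardB: "card B = e * n" by (simp add: B_def card_cartesian_product)
  have W1: "W i q \<in> homog 1" if "i \<in> A" "q < n" for i q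
    using that lL' U1 by (auto simp: A_def W_def lin_mat_def)
  have combine: "(\<Sum>i\<in>A. cst (c i) * W i q) =
      mv s L' (cvec (\<lambda>j. c (Inl j))) q + (\<Sum>p<m. \<Sum>l<\<rho>. cst (c (Inr (p, l))) * U p l q)" for c q
    by (simp add: A_def sum.Plus W_def mv_def cvec_def mult.commute sum.cartesian_product split_def)
  have coord: "cng (\<Sum>i\<in>A. cst (c i) * W i q) (\<Sum>t<e. cst (\<Sum>i\<in>A. c i * M i (q, t)) * \<beta> t)"
    if q: "q < n" for c q
  proof -
    have "cng (\<Sum>i\<in>A. cst (c i) * W i q) (\<Sum>i\<in>A. cst (c i) * (\<Sum>t<e. cst (co (W i q) t) * \<beta> t))"
      by (intro cng_sum cng_mult_left co W1 q)
    also have "\<dots> = (\<Sum>t<e. cst (\<Sum>i\<in>A. c i * M i (q, t)) * \<beta> t)"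
      unfolding M_def prod.case sum_distrib_left cst_sum sum_distrib_right
      by (subst sum.swap) (simp add: cst_mult mult.assoc)
    finally show ?thesis .
  qed
  have image: "cng (mv n L (\<lambda>q. \<Sum>i\<in>A. cst (c i) * W i q) p) (\<Sum>l<\<rho>. cst (c (Inr (p, l))) * \<gamma> l)"
    if p: "p < m" for c p
  proof -
    have "mv n L (mv s L' (cvec (\<lambda>j. c (Inl j)))) p \<in> J"
      unfolding mv_mv by (rule mv_mat_in) (use zero p in \<open>simp add: strand_zero_def\<close>)
    moreover have "cng (\<Sum>p'<m. \<Sum>l<\<rho>. cst (c (Inr (p', l))) * mv n L (U p' l) p)
        (\<Sum>p'<m. \<Sum>l<\<rho>. cst (c (Inr (p', l))) * (if p = p' then \<gamma> l else 0))"
      by (intro cng_sum cng_mult_left cng_sym [OF U2] p) simp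
    moreover have "(\<Sum>l<\<rho>. cst (c (Inr (p', l))) * (if p = p' then \<gamma> l else 0)) =
        (if p = p' then \<Sum>l<\<rho>. cst (c (Inr (p', l))) * \<gamma> l else 0)" for p'
      by (cases "p = p'") simp_all
    ultimately show ?thesis
      using cng_add [of "mv n L (mv s L' (cvec (\<lambda>j. c (Inl j)))) p" 0] p
      unfolding combine by (simp add: mv_add mv_sum mv_scale cng_0)
  qed
  have Inr0: "c (Inr (p, l)) = 0"
    if "\<And>p. p < m \<Longrightarrow> mv n L (\<lambda>q. \<Sum>i\<in>A. cst (c i) * W i q) p \<in> J" "p < m" "l < \<rho>" for c p l
    using hbasis_indep [OF \<gamma> cng_in [OF cng_sym [OF image [OF that(2)]] that(1) [OF that(2)]] that(3)] .
  have Minj: "\<forall>i\<in>A. c i = 0" if c: "\<forall>b\<in>B. (\<Sum>i\<in>A. c i * M i b) = 0" for c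
  proof -
    have z: "(\<Sum>i\<in>A. cst (c i) * W i q) \<in> J" if "q < n" for q
      using c that by (intro cng_in [OF coord [OF that]]) (simp add: B_def)
    have r: "c (Inr (p, l)) = 0" if "p < m" "l < \<rho>" for p l
      by (rule Inr0 [OF _ that]) (intro mv_in z)
    have "mv s L' (cvec (\<lambda>j. c (Inl j))) q \<in> J" if "q < n" for q
      using z [OF that] unfolding combine by (simp add: r)
    then have "c (Inl j) = 0" if "j < s" for j
      using inj that unfolding strand_inj_def by (elim allE [of _ "\<lambda>j. c (Inl j)"]) simp
    with r show ?thesis by (auto simp: A_def)
  qed
  have "card A \<le> card B" by (rule injective_matrix_card [OF finB finA, of M]) (rule Minj)
  then show le: "s + \<rho> * m \<le> e * n" by (simp only: cardA cardB)
  { assume mid: "strand_mid m n s L L'"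
    have "card B \<le> card A"
    proof (rule surjective_matrix_card [OF finB finA, of M])
      fix t :: "nat \<times> nat \<Rightarrow> 'k"
      define u where "u q = (\<Sum>j<e. cst (t (q, j)) * \<beta> j)" for q
      have u1: "u q \<in> homog 1" for q unfolding u_def using hbasis_homog [OF \<beta>] by (intro homog_sum homog_cst_mult) auto
      have "\<forall>p. \<exists>d. p < m \<longrightarrow> cng (mv n L u p) (\<Sum>l<\<rho>. cst (d l) * \<gamma> l)"
      proof (intro allI)
        fix p
        show "\<exists>d. p < m \<longrightarrow> cng (mv n L u p) (\<Sum>l<\<rho>. cst (d l) * \<gamma> l)"
        proof (cases "p < m")
          case True
          then have "mv n L u p \<in> homog 2" using lL u1 by (intro mv_homog_2) (auto simp: lin_mat_def)
          then show ?thesis using hbasis_span [OF \<gamma>] by metis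
        qed simp
      qed
      then obtain d where d: "\<And>p. p < m \<Longrightarrow> cng (mv n L u p) (\<Sum>l<\<rho>. cst (d p l) * \<gamma> l)" by metis
      \<comment> \<open>\<open>c0\<close> combines lifts to the same image as that of
        \<open>u\<close>, so the remainder \<open>w\<close> is a cycle and exactness in the middle
        applies to it.\<close>
      define c0 where "c0 i = (case i of Inl j \<Rightarrow> 0 | Inr (p, l) \<Rightarrow> d p l)" for i :: "nat + nat \<times> nat"
      define w where "w q = u q - (\<Sum>i\<in>A. cst (c0 i) * W i q)" for q
      have "w q \<in> homog 1" if "q < n" for q
        unfolding w_def using W1 that by (intro homog_diff u1 homog_sum homog_cst_mult)
      moreover have "mv n L w p \<in> J" if p: "p < m" for p
      proof -
        have "mv n L w p = mv n L u p - mv n L (\<lambda>q. \<Sum>i\<in>A. cst (c0 i) * W i q) p"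
          unfolding w_def by (rule mv_diff)
        moreover have "cng (mv n L u p) (mv n L (\<lambda>q. \<Sum>i\<in>A. cst (c0 i) * W i q) p)"
          using cng_trans [OF d [OF p] cng_sym [OF image [OF p, of c0, simplified c0_def sum.case prod.case]]]
          by (simp add: c0_def)
        ultimately show ?thesis by (simp add: cng_def)
      qed
      ultimately obtain v where v: "\<And>q. q < n \<Longrightarrow> cng (w q) (mv s L' (cvec v) q)"
        using mid unfolding strand_mid_def by blast
      define c where "c i = (case i of Inl j \<Rightarrow> v j | Inr (p, l) \<Rightarrow> d p l)" for i
      have "cng (u q) (\<Sum>i\<in>A. cst (c i) * W i q)" if q: "q < n" for q
      proof -
        have "u q = w q + (\<Sum>i\<in>A. cst (c0 i) * W i q)" by (simp add: w_def)
        also have "cng \<dots> (mv s L' (cvec v) q + (\<Sum>i\<in>A. cst (c0 i) * W i q))"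
          by (intro cng_add v q cng_refl)
        also have "\<dots> = (\<Sum>i\<in>A. cst (c i) * W i q)"
          unfolding combine by (simp add: c_def c0_def cvec_def mv_def)
        finally show ?thesis .
      qed
      then have E: "cng (\<Sum>j<e. cst (t (q, j)) * \<beta> j) (\<Sum>j<e. cst (\<Sum>i\<in>A. c i * M i (q, j)) * \<beta> j)"
        if "q < n" for q
        using cng_trans [OF _ coord [OF that]] that by (simp add: u_def)
      have "t (q, j) = (\<Sum>i\<in>A. c i * M i (q, j))" if "q < n" "j < e" for q j
        by (rule hbasis_unique [OF \<beta> E [OF that(1)] that(2)])
      then have "\<forall>b\<in>B. (\<Sum>i\<in>A. c i * M i b) = t b" by (auto simp: B_def)
      then show "\<exists>c. \<forall>b\<in>B. (\<Sum>i\<in>A. c i * M i b) = t b" by (intro exI [of _ c])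
    qed
    then show "s + \<rho> * m = e * n" using le by (simp only: cardA cardB) }
  { assume "s + \<rho> * m = e * n"
    then have card: "card B \<le> card A" by (simp only: cardA cardB)
    show "strand_mid m n s L L'"
      unfolding strand_mid_def
    proof (intro allI impI)
      fix u assume u: "\<forall>q<n. u q \<in> homog 1" and k: "\<forall>p<m. mv n L u p \<in> J"
      obtain c where c: "\<forall>b\<in>B. (\<Sum>i\<in>A. c i * M i b) = (\<lambda>(q, t). co (u q) t) b"
        using injective_matrix_surj [where M = M and t = "\<lambda>(q, t). co (u q) t", OF finB finA Minj card] by (rule exE)
      have uc: "cng (u q) (\<Sum>i\<in>A. cst (c i) * W i q)" if q: "q < n" for q
      proof -
        have "cng (u q) (\<Sum>t<e. cst (co (u q) t) * \<beta> t)" using u q by (intro co) simp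
        also have "\<dots> = (\<Sum>t<e. cst (\<Sum>i\<in>A. c i * M i (q, t)) * \<beta> t)"
          using c q by (simp add: B_def)
        also have "cng \<dots> (\<Sum>i\<in>A. cst (c i) * W i q)" by (rule cng_sym [OF coord [OF q]])
        finally show ?thesis .
      qed
      \<comment> \<open>An injective square system is solvable, so \<open>u\<close> is a combination
        of all columns. Applying \<open>L\<close> to the cycle \<open>u\<close> shows that the lifts
        do not occur in it.\<close>
      have r: "c (Inr (p, l)) = 0" if "p < m" "l < \<rho>" for p l
      proof (rule Inr0 [OF _ that])
        fix p assume p: "p < m"
        have "cng (mv n L (\<lambda>q. \<Sum>i\<in>A. cst (c i) * W i q) p) (mv n L u p)"
          by (intro cng_mv cng_sym [OF uc])
        then show "mv n L (\<lambda>q. \<Sum>i\<in>A. cst (c i) * W i q) p \<in> J" using k p by (blast intro: cng_in)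
      qed
      show "\<exists>v. \<forall>q<n. cng (u q) (mv s L' (cvec v) q)"
      proof (intro exI allI impI)
        fix q assume "q < n"
        from uc [OF this] show "cng (u q) (mv s L' (cvec (\<lambda>j. c (Inl j))) q)"
          unfolding combine by (simp add: r)
      qed
    qed }
qed

end

section \<open>Ranks of minimal totally acyclic complexes\<close>

lemma positive_expand:
  fixes p :: "('x::finite, 'k::field) mpoly"
  assumes "hpart 0 p = 0" obtains l where "p = (\<Sum>x\<in>UNIV. mvar x * l x)"
proof -
  let ?S = "{p :: ('x, 'k) mpoly. \<exists>l. p = (\<Sum>x\<in>UNIV. mvar x * l x)}"
  have "cring_ideal ?S"
  proof
    show "0 \<in> ?S" by (intro CollectI exI [of _ "\<lambda>_. 0"]) simp
  next
    fix p q assume "p \<in> ?S" "q \<in> ?S"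
    then obtain l l' where "p = (\<Sum>x\<in>UNIV. mvar x * l x)" "q = (\<Sum>x\<in>UNIV. mvar x * l' x)" by blast
    then show "p + q \<in> ?S"
      by (intro CollectI exI [of _ "\<lambda>x. l x + l' x"]) (simp add: distrib_left sum.distrib)
  next
    fix p a assume "p \<in> ?S"
    then obtain l where "p = (\<Sum>x\<in>UNIV. mvar x * l x)" by blast
    then show "a * p \<in> ?S"
      by (intro CollectI exI [of _ "\<lambda>x. a * l x"]) (simp add: sum_distrib_left mult.left_commute)
  qed
  moreover have "mvar x \<in> ?S" for x
  proof (intro CollectI exI [of _ "\<lambda>y. if y = x then 1 else 0"])
    have "(\<Sum>y\<in>UNIV. mvar y * (if y = x then 1 else 0)) = (\<Sum>y\<in>UNIV. if y = x then mvar y else (0 :: ('x, 'k) mpoly))"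
      by (rule sum.cong) auto
    then show "mvar x = (\<Sum>y\<in>UNIV. mvar y * (if y = x then 1 else (0 :: ('x, 'k) mpoly)))" by simp
  qed
  ultimately have "p - hpart 0 p \<in> ?S" by (rule positive_part_in)
  with assms that show ?thesis by auto
qed

lemma homog_2_expand:
  fixes p :: "('x::finite, 'k::field) mpoly"
  assumes "p \<in> homog 2" obtains l where "p = (\<Sum>x\<in>UNIV. mvar x * l x)" "\<And>x. l x \<in> homog 1"
proof -
  have "hpart 0 p = 0" using assms by (simp add: homog_hpart)
  then obtain l where l: "p = (\<Sum>x\<in>UNIV. mvar x * l x)" by (rule positive_expand)
  have "p = hpart 2 p" using assms by (simp add: homog_hpart)
  also have "\<dots> = (\<Sum>x\<in>UNIV. hpart 2 (mvar x * l x))" by (subst l) (rule hpart_sum)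
  also have "\<dots> = (\<Sum>x\<in>UNIV. mvar x * hpart 1 (l x))"
  proof (rule sum.cong [OF refl])
    fix x
    have "hpart d (mvar x :: ('x, 'k) mpoly) = (if d = Suc 0 then mvar x else 0)" for d
      by (rule homog_hpart) simp
    then show "hpart 2 (mvar x * l x) = mvar x * hpart 1 (l x)" by (simp add: hpart_2_mult)
  qed
  finally show ?thesis using that [of "\<lambda>x. hpart 1 (l x)"] by simp
qed

lemma homog_positive: "0 < d \<Longrightarrow> p \<in> homog d \<Longrightarrow> hpart 0 (p :: ('x::finite, 'k::field) mpoly) = 0"
  using homog_hpart [of p d 0] by simp

context short_ideal
begin

lemma pos_hom_comb:
  assumes \<phi>: "pos_hom \<phi>" and f: "\<And>j. j \<in> A \<Longrightarrow> hpart 0 (f j) = 0"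
    and p: "cng p (\<Sum>j\<in>A. a j * f j)"
  shows "cng (\<phi> p) (\<Sum>j\<in>A. a j * \<phi> (f j))"
proof -
  have 0: "hpart 0 (\<Sum>j\<in>A. a j * f j) = 0" using f by (simp add: hpart_sum)
  then have "hpart 0 p = 0" using cng_iff_hpart [THEN iffD1, OF p] by simp
  then have "cng (\<phi> p) (\<phi> (\<Sum>j\<in>A. a j * f j))" by (rule pos_hom_cng [OF \<phi> _ p])
  also have "cng (\<phi> (\<Sum>j\<in>A. a j * f j)) (\<Sum>j\<in>A. \<phi> (a j * f j))"
    by (rule pos_hom_sum [OF \<phi>]) (simp add: f)
  also have "cng (\<Sum>j\<in>A. \<phi> (a j * f j)) (\<Sum>j\<in>A. a j * \<phi> (f j))"
    by (rule cng_sum, rule pos_hom_smult [OF \<phi>]) (simp add: f)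
  finally show ?thesis .
qed

text \<open>The ring is \<open>k\<close> or \<open>k[b]/(b * b)\<close>. In the second case
  \<open>b \<phi>(b)\<close> is congruent to \<open>\<phi>(b * b)\<close> and vanishes, so
  \<open>\<phi>(b)\<close> has no constant term and is a constant multiple of
  \<open>b\<close>.\<close>

lemma mult_ext_if_small:
  assumes \<beta>: "hbasis 1 e \<beta>" and e: "e \<le> 1" and sq: "\<And>p. p \<in> homog 2 \<Longrightarrow> p \<in> J"
  shows mult_ext
  unfolding mult_ext_def
proof (intro allI impI)
  fix \<phi> assume \<phi>: "pos_hom \<phi>"
  have \<beta>0: "hpart 0 (\<beta> j) = 0" if "j < e" for j
    using hbasis_homog [OF \<beta> that] by (intro homog_positive [of 1]) simp_all
  have span: "\<exists>c. cng p (\<Sum>j<e. cst (c j) * \<beta> j)" if "hpart 0 p = 0" for p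
  proof -
    obtain c where "cng (hpart 1 p) (\<Sum>j<e. cst (c j) * \<beta> j)" using hbasis_span [OF \<beta> hpart_homog] .
    moreover have "cng (hpart 2 p) 0" by (simp add: cng_0 sq)
    ultimately have 1: "cng (hpart 1 p + hpart 2 p) ((\<Sum>j<e. cst (c j) * \<beta> j) + 0)" by (rule cng_add)
    have "cng p (hpart 1 p + hpart 2 p)" using cng_expand [of p] that by simp
    from cng_trans [OF this 1] show ?thesis by auto
  qed
  consider "e = 0" | "e = 1" using e by linarith
  then show "\<exists>c. \<forall>p. hpart 0 p = 0 \<longrightarrow> cng (\<phi> p) (p * c)"
  proof cases
    case 1
    then have "p \<in> J" if "hpart 0 p = 0" for p using span [OF that] by (simp add: cng_0)
    then show ?thesis using pos_hom_null [OF \<phi>] by (intro exI [of _ 0]) (simp add: cng_0)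
  next
    case 2
    let ?b = "\<beta> 0"
    have b1: "?b \<in> homog 1" using hbasis_homog [OF \<beta>, of 0] 2 by simp
    have b0: "hpart 0 ?b = 0" using \<beta>0 2 by simp
    have bn: "cst c * ?b \<in> J \<Longrightarrow> c = 0" for c
      using hbasis_indep [OF \<beta>, of "\<lambda>_. c" 0] 2 by simp
    have "?b * ?b \<in> J" by (intro sq homog_mult_1_1 b1)
    then have "\<phi> (?b * ?b) \<in> J" by (rule pos_hom_null [OF \<phi>])
    then have "?b * \<phi> ?b \<in> J" using pos_hom_smult [OF \<phi> b0, of ?b] cng_in cng_sym by blast
    then have "hpart 1 (?b * \<phi> ?b) \<in> J" by (rule hpart_in)
    then have "cst (Poly_Mapping.lookup (\<phi> ?b) 0) * ?b \<in> J"
      using b1 b0 homog_hpart [OF b1, of "Suc 0"] by (simp add: hpart_1_mult cst_lookup_0 mult.commute)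
    then have "hpart 0 (\<phi> ?b) = 0" using bn by (metis cst_0 cst_lookup_0)
    from span [OF this] obtain t where t: "cng (\<phi> ?b) (cst (t 0) * ?b)" using 2 by auto
    show ?thesis
    proof (intro exI [of _ "cst (t 0)"] allI impI)
      fix p :: "('x, 'k) mpoly" assume "hpart 0 p = 0"
      from span [OF this] obtain d where d: "cng p (\<Sum>j<1. cst (d j) * \<beta> j)" using 2 by auto
      have "cng (\<phi> p) (\<Sum>j<1. cst (d j) * \<phi> (\<beta> j))"
        by (rule pos_hom_comb [OF \<phi> _ d]) (simp add: b0)
      then have "cng (\<phi> p) (cst (d 0) * \<phi> ?b)" by simp
      also have "cng \<dots> (cst (d 0) * (cst (t 0) * ?b))" by (rule cng_mult_left [OF t])
      also have "\<dots> = cst (d 0) * ?b * cst (t 0)" by (simp add: ac_simps)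
      also have "cng \<dots> (p * cst (t 0))" using cng_mult_right [OF cng_sym [OF d], of "cst (t 0)"] by simp
      finally show "cng (\<phi> p) (p * cst (t 0))" .
    qed
  qed
qed

text \<open>A socle element placed in one coordinate is a cycle by minimality, hence a boundary
  \<open>D w\<close>. Here \<open>w\<close> is mapped into the socle and so has no constant terms,
  and \<open>D w\<close> has no linear part: the socle lives in degree two.\<close>

lemma socle_degree:
  assumes pta: "pta r D" and ng: "\<not> mult_ext" and r: "r i > 0"
    and a: "hpart 0 a = 0" and soc: "\<And>x. hpart 0 x = 0 \<Longrightarrow> x * a \<in> J"
  shows "hpart 1 a \<in> J"
proof -
  let ?v = "\<lambda>q. if q = 0 then a else 0"
  have "mv (r i) (D i) ?v p \<in> J" if "p < r (i - 1)" for p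
    using soc [OF pta_minimal [OF pta that r]] r by (simp add: mv_unit)
  then obtain w where w: "\<And>q. q < r i \<Longrightarrow> cng (?v q) (mv (r (i + 1)) (D (i + 1)) w q)"
    using acyclic_at_exact [OF pta_acyclic_at [OF pta, of i]] by blast
  have w0: "hpart 0 (w j) = 0" if "j < r (i + 1)" for j
  proof (rule ccontr)
    assume "hpart 0 (w j) \<noteq> 0"
    have "mult_ext"
    proof (rule mult_ext_if_socle [where i = "i + 1" and v = w, OF pta that \<open>hpart 0 (w j) \<noteq> 0\<close>])
      fix x :: "('x, 'k) mpoly" and p assume x: "hpart 0 x = 0" and p: "p < r (i + 1 - 1)"
      have "x * ?v p \<in> J" using soc [OF x] by simp
      then show "x * mv (r (i + 1)) (D (i + 1)) w p \<in> J"
        using cng_in [OF cng_mult_left [OF cng_sym [OF w]]] p by simp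
    qed
    with ng show False ..
  qed
  have "cng (hpart 1 a) (hpart 1 (mv (r (i + 1)) (D (i + 1)) w 0))"
    using cng_hpart [OF w [OF r], of 1] by simp
  moreover have "hpart 1 (mv (r (i + 1)) (D (i + 1)) w 0) = 0"
    using hpart_mv(2) [of "r (i + 1)" "D (i + 1)" 0 w] pta_minimal [OF pta, of 0 "i + 1"] r w0
    by (simp add: mv_def)
  ultimately show ?thesis by (simp add: cng_0)
qed

text \<open>A one-dimensional socle \<open>[Q]\<^sub>2\<close> makes multiplication a perfect pairing on \<open>[Q]\<^sub>1\<close>.\<close>

lemma mult_ext_if_socle_line:
  assumes \<beta>: "hbasis 1 e \<beta>" and \<gamma>: "hbasis 2 1 \<gamma>"
    and soc: "\<And>a. hpart 0 a = 0 \<Longrightarrow> (\<And>x. hpart 0 x = 0 \<Longrightarrow> x * a \<in> J) \<Longrightarrow> hpart 1 a \<in> J"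
  shows mult_ext
  unfolding mult_ext_def
proof (intro allI impI)
  fix \<phi> assume \<phi>: "pos_hom \<phi>"
  define \<sigma> where "\<sigma> = \<gamma> 0"
  have \<sigma>2: "\<sigma> \<in> homog 2" using hbasis_homog [OF \<gamma>, of 0] by (simp add: \<sigma>_def)
  have \<sigma>0: "hpart 0 \<sigma> = 0" using \<sigma>2 by (rule homog_positive [rotated]) simp
  have \<sigma>span: "\<exists>c. cng p (cst c * \<sigma>)" if p: "p \<in> homog 2" for p
  proof -
    obtain c where "cng p (\<Sum>j<1. cst (c j) * \<gamma> j)" using hbasis_span [OF \<gamma> p] .
    then show ?thesis by (auto simp: \<sigma>_def)
  qed
  have \<sigma>ind: "cst c * \<sigma> \<in> J \<Longrightarrow> c = 0" for c
    using hbasis_indep [OF \<gamma>, of "\<lambda>_. c" 0] by (simp add: \<sigma>_def)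
  have \<beta>1: "\<beta> j \<in> homog 1" if "j < e" for j using hbasis_homog [OF \<beta> that] .
  have \<beta>0: "hpart 0 (\<beta> j) = 0" if "j < e" for j
    using \<beta>1 [OF that] by (intro homog_positive [of 1]) simp_all
  have deg2: "\<exists>c. cng p (cst c * \<sigma>)" if "hpart 0 p = 0" "hpart 1 p \<in> J" for p
  proof -
    obtain c where "cng (hpart 2 p) (cst c * \<sigma>)" using \<sigma>span [OF hpart_homog] by blast
    then have 1: "cng (hpart 1 p + hpart 2 p) (0 + cst c * \<sigma>)"
      by (rule cng_add [OF that(2) [folded cng_0]])
    have "cng p (hpart 1 p + hpart 2 p)" using cng_expand [of p] that by simp
    from cng_trans [OF this 1] show ?thesis by auto
  qed
  have prod: "\<exists>c. cng (p * q) (cst c * \<sigma>)" if "hpart 0 p = 0" "hpart 0 q = 0" for p q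
    using that by (intro deg2) (simp_all add: hpart_1_mult)
  have \<sigma>J: "\<sigma> * p \<in> J" if "hpart 0 p = 0" for p
    using that \<sigma>0 homog_hpart [OF \<sigma>2, of "Suc 0"] by (subst in_iff_hpart) (simp add: hpart_1_mult hpart_2_mult)
  \<comment> \<open>\<open>\<sigma>\<close> annihilates the maximal ideal, so
    \<open>\<sigma> \<phi>(a) = \<phi>(\<sigma> a)\<close> is zero, and a constant term of
    \<open>\<phi>(a)\<close> would contradict \<open>\<sigma> \<noteq> 0\<close>.\<close>
  have \<phi>0: "hpart 0 (\<phi> a) = 0" if a: "hpart 0 a = 0" for a
  proof -
    have "\<phi> (\<sigma> * a) \<in> J" by (rule pos_hom_null [OF \<phi> \<sigma>J [OF a]])
    then have "\<sigma> * \<phi> a \<in> J" using pos_hom_smult [OF \<phi> a, of \<sigma>] cng_in cng_sym by blast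
    then have "hpart 2 (\<sigma> * \<phi> a) \<in> J" by (rule hpart_in)
    then have "cst (Poly_Mapping.lookup (\<phi> a) 0) * \<sigma> \<in> J"
      using \<sigma>0 homog_hpart [OF \<sigma>2, of "Suc 0"] homog_hpart [OF \<sigma>2, of 2]
      by (simp add: hpart_2_mult cst_lookup_0 mult.commute)
    then show ?thesis using \<sigma>ind by (metis cst_0 cst_lookup_0)
  qed
  obtain \<tau> where \<tau>: "cng (\<phi> \<sigma>) (cst \<tau> * \<sigma>)"
  proof -
    obtain l where l: "\<sigma> = (\<Sum>x\<in>UNIV. mvar x * l x)" "\<And>x. l x \<in> homog 1" by (rule homog_2_expand [OF \<sigma>2]) blast
    have l0: "hpart 0 (l x) = 0" for x by (rule homog_positive [OF _ l(2)]) simp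
    have 1: "cng (\<phi> \<sigma>) (\<Sum>x\<in>UNIV. mvar x * \<phi> (l x))"
      by (rule pos_hom_comb [OF \<phi>]) (simp_all add: l0 l(1) [symmetric])
    have "\<exists>c. cng (\<Sum>x\<in>UNIV. mvar x * \<phi> (l x)) (cst c * \<sigma>)"
    proof (rule deg2)
      have "hpart 1 (\<Sum>x\<in>UNIV. mvar x * \<phi> (l x)) = 0"
        by (simp add: hpart_sum hpart_1_mult \<phi>0 l0)
      then show "hpart 1 (\<Sum>x\<in>UNIV. mvar x * \<phi> (l x)) \<in> J" by simp
    qed (simp add: hpart_sum)
    then obtain c where 2: "cng (\<Sum>x\<in>UNIV. mvar x * \<phi> (l x)) (cst c * \<sigma>)" by blast
    from that [OF cng_trans [OF 1 2]] show ?thesis .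
  qed
  \<comment> \<open>Removing the multiplication by \<open>\<tau>\<close> makes the homomorphism
    vanish at \<open>\<sigma>\<close>. Then \<open>x \<phi>'(a) = \<phi>'(x a) = 0\<close> for all
    \<open>x\<close> in the maximal ideal, so that all values lie in the socle and are multiples of
    \<open>\<sigma>\<close>.\<close>
  define \<phi>' where "\<phi>' p = \<phi> p - cst \<tau> * p" for p
  have \<phi>': "pos_hom \<phi>'"
    unfolding pos_hom_def
  proof (intro conjI allI impI ballI)
    fix p q :: "('x, 'k) mpoly" assume "hpart 0 p = 0" "hpart 0 q = 0"
    then have "cng (\<phi> (p + q) - cst \<tau> * (p + q)) ((\<phi> p + \<phi> q) - cst \<tau> * (p + q))"
      by (intro cng_diff pos_hom_add [OF \<phi>] cng_refl)
    then show "cng (\<phi>' (p + q)) (\<phi>' p + \<phi>' q)" by (simp add: \<phi>'_def algebra_simps)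
  next
    fix a p :: "('x, 'k) mpoly" assume "hpart 0 p = 0"
    then have "cng (\<phi> (a * p) - cst \<tau> * (a * p)) (a * \<phi> p - cst \<tau> * (a * p))"
      by (intro cng_diff pos_hom_smult [OF \<phi>] cng_refl)
    then show "cng (\<phi>' (a * p)) (a * \<phi>' p)" by (simp add: \<phi>'_def algebra_simps)
  next
    fix p assume "p \<in> J"
    then show "\<phi>' p \<in> J" by (simp add: \<phi>'_def diff_in mult_in pos_hom_null [OF \<phi>])
  qed
  have \<phi>'\<sigma>: "\<phi>' \<sigma> \<in> J" using \<tau> by (simp add: \<phi>'_def cng_def)
  have \<phi>'\<sigma>': "\<phi>' p \<in> J" if p: "cng p (cst c * \<sigma>)" for p c
  proof -
    have "cng (\<phi>' p) (\<Sum>j\<in>{()}. cst c * \<phi>' \<sigma>)"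
      by (rule pos_hom_comb [OF \<phi>']) (use p \<sigma>0 in simp_all)
    then show ?thesis using \<phi>'\<sigma> by (simp add: cng_in mult_in)
  qed
  have "\<exists>c. cng (\<phi>' a) (cst c * \<sigma>)" if a: "hpart 0 a = 0" for a
  proof (rule deg2)
    show "hpart 0 (\<phi>' a) = 0" using \<phi>0 a by (simp add: \<phi>'_def)
    then show "hpart 1 (\<phi>' a) \<in> J"
    proof (rule soc)
      fix x :: "('x, 'k) mpoly" assume "hpart 0 x = 0"
      then obtain c where "cng (x * a) (cst c * \<sigma>)" using prod a by blast
      then have "\<phi>' (x * a) \<in> J" by (rule \<phi>'\<sigma>')
      then show "x * \<phi>' a \<in> J" using pos_hom_smult [OF \<phi>' a, of x] cng_in cng_sym by blast
    qed
  qed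
  then have "\<forall>j. \<exists>c. j < e \<longrightarrow> cng (\<phi>' (\<beta> j)) (cst c * \<sigma>)" using \<beta>0 by blast
  then obtain \<kappa> where \<kappa>: "\<And>j. j < e \<Longrightarrow> cng (\<phi>' (\<beta> j)) (cst (\<kappa> j) * \<sigma>)" by metis
  have "\<forall>j l. \<exists>c. j < e \<longrightarrow> l < e \<longrightarrow> cng (\<beta> j * \<beta> l) (cst c * \<sigma>)" using prod \<beta>0 by blast
  then obtain N where N: "\<And>j l. j < e \<Longrightarrow> l < e \<Longrightarrow> cng (\<beta> j * \<beta> l) (cst (N j l) * \<sigma>)" by metis
  have pair: "cng (\<beta> l * (\<Sum>j<e. cst (c j) * \<beta> j)) (cst (\<Sum>j<e. c j * N j l) * \<sigma>)" if l: "l < e" for c l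
  proof -
    have "cng (\<Sum>j<e. cst (c j) * (\<beta> j * \<beta> l)) (\<Sum>j<e. cst (c j) * (cst (N j l) * \<sigma>))"
      by (intro cng_sum cng_mult_left N l) simp
    moreover have "(\<Sum>j<e. cst (c j) * (\<beta> j * \<beta> l)) = \<beta> l * (\<Sum>j<e. cst (c j) * \<beta> j)"
      by (simp add: sum_distrib_left ac_simps)
    moreover have "(\<Sum>j<e. cst (c j) * (cst (N j l) * \<sigma>)) = cst (\<Sum>j<e. c j * N j l) * \<sigma>"
      by (simp add: cst_sum cst_mult sum_distrib_right mult.assoc)
    ultimately show ?thesis by simp
  qed
  have expand: "\<exists>d c. cng p ((\<Sum>j<e. cst (d j) * \<beta> j) + cst c * \<sigma>)" if "hpart 0 p = 0" for p
  proof -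
    obtain d where d: "cng (hpart 1 p) (\<Sum>j<e. cst (d j) * \<beta> j)" using hbasis_span [OF \<beta> hpart_homog] .
    obtain c where c: "cng (hpart 2 p) (cst c * \<sigma>)" using \<sigma>span [OF hpart_homog] by blast
    have "cng p (hpart 1 p + hpart 2 p)" using cng_expand [of p] that by simp
    from cng_trans [OF this cng_add [OF d c]] show ?thesis by blast
  qed
  have lin0: "hpart 0 (\<Sum>j<e. cst (c j) * \<beta> j) = 0" for c using \<beta>0 by (simp add: hpart_sum)
  have lin1: "(\<Sum>j<e. cst (c j) * \<beta> j) \<in> homog 1" for c using \<beta>1 by (intro homog_sum homog_cst_mult) simp
  have mult: "cng (p * (\<Sum>j<e. cst (c j) * \<beta> j)) (\<Sum>l<e. cst (d l) * (\<beta> l * (\<Sum>j<e. cst (c j) * \<beta> j)))"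
    if p: "cng p ((\<Sum>j<e. cst (d j) * \<beta> j) + cst c' * \<sigma>)" for p c d c'
  proof -
    let ?s = "\<Sum>j<e. cst (c j) * \<beta> j"
    have "cng (p * ?s) (((\<Sum>j<e. cst (d j) * \<beta> j) + cst c' * \<sigma>) * ?s)" by (rule cng_mult_right [OF p])
    moreover have "((\<Sum>j<e. cst (d j) * \<beta> j) + cst c' * \<sigma>) * ?s =
        (\<Sum>l<e. cst (d l) * (\<beta> l * ?s)) + cst c' * (\<sigma> * ?s)"
      by (simp add: distrib_right sum_distrib_right mult.assoc)
    moreover have "cng ((\<Sum>l<e. cst (d l) * (\<beta> l * ?s)) + cst c' * (\<sigma> * ?s)) ((\<Sum>l<e. cst (d l) * (\<beta> l * ?s)) + 0)"
      by (intro cng_add cng_refl) (simp add: cng_0 mult_in \<sigma>J lin0)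
    ultimately show ?thesis by (auto dest: cng_trans)
  qed
  \<comment> \<open>\<open>N\<close> is the Gram matrix of multiplication on linear forms. A form in
    its kernel is annihilated by the whole maximal ideal, and by \<open>soc\<close> there is no
    nonzero socle in degree one. Solving for \<open>\<kappa>\<close> then gives the linear form
    \<open>?s\<close> whose multiplication is \<open>\<phi>'\<close>.\<close>
  have inj: "\<forall>j\<in>{..<e}. c j = 0" if c: "\<forall>l\<in>{..<e}. (\<Sum>j\<in>{..<e}. c j * N j l) = 0" for c
  proof -
    let ?s = "\<Sum>j<e. cst (c j) * \<beta> j"
    have z: "\<beta> l * ?s \<in> J" if "l < e" for l
      by (rule cng_in [OF pair [OF that]]) (use c that in simp)
    have "hpart 1 ?s \<in> J"
    proof (rule soc [OF lin0])
      fix x :: "('x, 'k) mpoly" assume "hpart 0 x = 0"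
      then obtain d c' where "cng x ((\<Sum>j<e. cst (d j) * \<beta> j) + cst c' * \<sigma>)" using expand by blast
      from mult [OF this, of c] show "x * ?s \<in> J" by (rule cng_in) (intro sum_in mult_in z, simp)
    qed
    then have "?s \<in> J" using homog_hpart [OF lin1, of 1] by simp
    then show ?thesis using hbasis_indep [OF \<beta>] by simp
  qed
  obtain c where c: "\<forall>l\<in>{..<e}. (\<Sum>j\<in>{..<e}. c j * N j l) = \<kappa> l"
    using injective_matrix_surj [where M = N and t = \<kappa> and I = "{..<e}" and J = "{..<e}", OF _ _ inj]
    by auto
  let ?s = "\<Sum>j<e. cst (c j) * \<beta> j"
  have s: "cng (\<phi>' (\<beta> l)) (\<beta> l * ?s)" if "l < e" for l
    using cng_trans [OF \<kappa> [OF that] cng_sym] pair [OF that, of c] c that by simp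
  have "cng (\<phi>' p) (p * ?s)" if p: "hpart 0 p = 0" for p
  proof -
    obtain d c' where d: "cng p ((\<Sum>j<e. cst (d j) * \<beta> j) + cst c' * \<sigma>)" using expand [OF p] by blast
    have "cng (\<phi>' p) (\<phi>' ((\<Sum>j<e. cst (d j) * \<beta> j) + cst c' * \<sigma>))" by (rule pos_hom_cng [OF \<phi>' p d])
    also have "cng \<dots> (\<phi>' (\<Sum>j<e. cst (d j) * \<beta> j) + \<phi>' (cst c' * \<sigma>))"
      by (rule pos_hom_add [OF \<phi>' lin0]) (simp add: \<sigma>0)
    also have "cng \<dots> ((\<Sum>l<e. cst (d l) * (\<beta> l * ?s)) + 0)"
    proof (rule cng_add)
      have "cng (\<phi>' (\<Sum>j<e. cst (d j) * \<beta> j)) (\<Sum>l<e. cst (d l) * \<phi>' (\<beta> l))"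
        by (rule pos_hom_comb [OF \<phi>' _ cng_refl]) (simp add: \<beta>0)
      moreover have "cng (\<Sum>l<e. cst (d l) * \<phi>' (\<beta> l)) (\<Sum>l<e. cst (d l) * (\<beta> l * ?s))"
        by (intro cng_sum cng_mult_left s) simp
      ultimately show "cng (\<phi>' (\<Sum>j<e. cst (d j) * \<beta> j)) (\<Sum>l<e. cst (d l) * (\<beta> l * ?s))"
        by (rule cng_trans)
      show "cng (\<phi>' (cst c' * \<sigma>)) 0" unfolding cng_0 by (rule \<phi>'\<sigma>' [OF cng_refl])
    qed
    finally have "cng (\<phi>' p) (\<Sum>l<e. cst (d l) * (\<beta> l * ?s))" by simp
    from cng_trans [OF this cng_sym [OF mult [OF d, of c]]] show ?thesis .
  qed
  then have "cng (\<phi>' p + cst \<tau> * p) (p * ?s + cst \<tau> * p)" if "hpart 0 p = 0" for p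
    using that by (intro cng_add cng_refl)
  then show "\<exists>c. \<forall>p. hpart 0 p = 0 \<longrightarrow> cng (\<phi> p) (p * c)"
    by (intro exI [of _ "?s + cst \<tau>"]) (simp add: \<phi>'_def distrib_left mult.commute [of _ "cst \<tau>"])
qed

text \<open>Subtracting the two rank equations gives
  \<open>(\<rho> - 1) (r (i+1) - r (i-1)) = 0\<close>, hence period two. Subtracting the resulting
  relations for \<open>i\<close> and \<open>i + 1\<close> gives
  \<open>(\<rho> + 1 + e) (r (i+1) - r i) = 0\<close>, hence constancy. The factors are compared in
  the integers.\<close>

lemma constant_rank:
  assumes pta: "pta r D" and ng: "\<not> mult_ext" and pos: "r i0 > 0"
    and \<beta>: "hbasis 1 e \<beta>" and \<gamma>: "hbasis 2 \<rho> \<gamma>"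
  shows "e = \<rho> + 1" and "\<exists>n>0. r = (\<lambda>_. n)"
proof -
  have eq: "r (i + 1) + \<rho> * r (i - 1) = e * r i" if "pta r D" for i r D
  proof -
    note st = strandD [OF strand_if_pta [OF that ng]]
    show ?thesis
      using strand_count(2) [OF \<beta> \<gamma> st(1) _ _ st(3,5,4), of i] st(1,2) [of "i + 1"] by simp
  qed
  have 1: "r (i + 1) + \<rho> * r (i - 1) = e * r i" for i by (rule eq [OF pta])
  have 2: "r (i - 1) + \<rho> * r (i + 1) = e * r i" for i
    using eq [OF pta_rev [OF pta], of "- i"] by (simp add: rev_rank_def algebra_simps)
  have \<rho>: "\<rho> \<noteq> 1"
  proof
    assume "\<rho> = 1"
    then have mult_ext
      using mult_ext_if_socle_line [OF \<beta> _ socle_degree [OF pta ng pos]] \<gamma> by simp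
    with ng show False ..
  qed
  have "(int \<rho> - 1) * (int (r (i + 1)) - int (r (i - 1))) = 0" for i
    using arg_cong [OF 1 [of i], of int] arg_cong [OF 2 [of i], of int] by (simp add: algebra_simps)
  then have per: "r (i + 1) = r (i - 1)" for i using \<rho> by (simp add: mult_eq_0_iff)
  have 3: "(\<rho> + 1) * r (i + 1) = e * r i" for i using 1 [of i] per [of i] by simp
  have 4: "(\<rho> + 1) * r i = e * r (i + 1)" for i using 3 [of "i + 1"] per [of "i + 1"] by simp
  have "(int \<rho> + 1 + int e) * (int (r (i + 1)) - int (r i)) = 0" for i
    using arg_cong [OF 3 [of i], of int] arg_cong [OF 4 [of i], of int] by (simp add: algebra_simps)
  then have step: "r (i + 1) = r i" for i
    by (metis add.commute add_pos_nonneg less_irrefl mult_eq_0_iff of_nat_0_le_iff of_nat_eq_iff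
        right_minus_eq zero_less_one add_nonneg_pos)
  have const: "r i = r i0" for i
  proof (induct i rule: int_induct [where k = i0])
    case base show ?case by simp
  next
    case (step1 i) then show ?case using step [of i] by simp
  next
    case (step2 i) then show ?case using step [of "i - 1"] by simp
  qed
  then show "\<exists>n>0. r = (\<lambda>_. n)" using pos by blast
  show "e = \<rho> + 1" using 3 [of i0] pos unfolding step by (simp only: mult_cancel2) simp
qed

end

section \<open>Connected sums\<close>

definition hmap :: "(('x::finite, 'k::field) mpoly \<Rightarrow> ('y::finite, 'k) mpoly) \<Rightarrow> bool" where
  "hmap \<phi> \<longleftrightarrow> (\<forall>p q. \<phi> (p + q) = \<phi> p + \<phi> q) \<and> (\<forall>p q. \<phi> (p * q) = \<phi> p * \<phi> q) \<and>
     (\<forall>c. \<phi> (cst c) = cst c) \<and> (\<forall>d p. p \<in> homog d \<longrightarrow> \<phi> p \<in> homog d)"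

lemma
  assumes "hmap \<phi>"
  shows hmap_add: "\<phi> (p + q) = \<phi> p + \<phi> q" and hmap_mult: "\<phi> (p * q) = \<phi> p * \<phi> q"
    and hmap_cst: "\<phi> (cst c) = cst c" and hmap_homog: "p \<in> homog d \<Longrightarrow> \<phi> p \<in> homog d"
  using assms by (simp_all add: hmap_def)

lemma hmap_0: "hmap \<phi> \<Longrightarrow> \<phi> 0 = 0"
  using hmap_cst [of \<phi> 0] by simp
lemma hmap_uminus: "hmap \<phi> \<Longrightarrow> \<phi> (- p) = - \<phi> p"
  using hmap_add [of \<phi> p "- p"] by (metis add.right_inverse hmap_0 minus_unique)
lemma hmap_diff: "hmap \<phi> \<Longrightarrow> \<phi> (p - q) = \<phi> p - \<phi> q"
  using hmap_add [of \<phi> p "- q"] by (simp add: hmap_uminus)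
lemma hmap_sum: "hmap \<phi> \<Longrightarrow> \<phi> (sum h A) = (\<Sum>i\<in>A. \<phi> (h i))"
  by (induct A rule: infinite_finite_induct) (simp_all add: hmap_0 hmap_add)
lemma hmap_mv: "hmap \<phi> \<Longrightarrow> \<phi> (mv n D v p) = mv n (\<lambda>p q. \<phi> (D p q)) (\<lambda>q. \<phi> (v q)) p"
  by (simp add: mv_def hmap_sum hmap_mult)
lemma hmap_mm: "hmap \<phi> \<Longrightarrow> \<phi> (mm n D E p s) = mm n (\<lambda>p q. \<phi> (D p q)) (\<lambda>p q. \<phi> (E p q)) p s"
  by (simp add: mm_def hmap_sum hmap_mult)
lemmas hmap_simps = hmap_add hmap_mult hmap_cst hmap_0 hmap_uminus hmap_diff hmap_sum

text \<open>In the notation of the theorem, \<open>I\<close> and \<open>K\<close> define \<open>R\<^sub>0\<close> and \<open>R\<^sub>1\<close> (or \<open>S\<^sub>0\<close> and \<open>S\<^sub>1\<close>).\<close>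

locale quadric_quotient = I: short_ideal I + K: short_ideal K
  for I K :: "('x::finite, 'k::field) mpoly set" +
  fixes f :: "('x, 'k) mpoly"
  assumes f2: "f \<in> homog 2"
    and K_iff: "p \<in> K \<longleftrightarrow> (\<exists>c. p - cst c * f \<in> I)"
    and f_ind: "cst c * f \<in> I \<Longrightarrow> c = 0"
begin

lemma I_sub_K: "p \<in> I \<Longrightarrow> p \<in> K"
  using K_iff [of p] by (auto intro: exI [of _ 0])

text \<open>The two ideals differ by multiples of a quadric only, so they contain the same linear
  forms; this is why lifting is unique in degree one.\<close>

lemma K_iff_I_1: "p \<in> homog 1 \<Longrightarrow> p \<in> K \<longleftrightarrow> p \<in> I"
proof
  assume p: "p \<in> homog 1" "p \<in> K"
  then obtain c where "p - cst c * f \<in> I" using K_iff by blast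
  then have "hpart 1 (p - cst c * f) \<in> I" by (rule I.hpart_in)
  then show "p \<in> I" using homog_hpart [OF p(1), of 1] homog_hpart [OF homog_cst_mult [OF f2], of 1] by simp
qed (rule I_sub_K)

lemma cng_K_iff_I_1: "p \<in> homog 1 \<Longrightarrow> q \<in> homog 1 \<Longrightarrow> K.cng p q \<longleftrightarrow> I.cng p q"
  unfolding K.cng_def I.cng_def by (intro K_iff_I_1 homog_diff)

lemma mult_K_1_in_I:
  assumes "p \<in> homog 1" "p \<in> K" shows "a * p \<in> I"
  using assms K_iff_I_1 I.mult_in by blast

lemma f_eq: "cst c * f - cst d * f \<in> I \<Longrightarrow> c = d"
  using f_ind [of "c - d"] by (simp add: cst_diff left_diff_distrib)

text \<open>If \<open>P/I\<close> has embedding dimension at most one, then its component of degree two is \<open>k f\<close>.\<close>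

lemma two_le_embdim:
  assumes ng: "\<not> K.mult_ext" and \<beta>: "K.hbasis 1 e \<beta>"
  shows "2 \<le> e"
proof (rule ccontr)
  assume "\<not> 2 \<le> e"
  then have e: "e \<le> 1" by simp
  define b where "b = (if e = 1 then \<beta> 0 else 0)"
  have b1: "b \<in> homog 1" using K.hbasis_homog [OF \<beta>] by (simp add: b_def)
  have lin: "\<exists>c. I.cng p (cst c * b)" if p: "p \<in> homog 1" for p
  proof -
    obtain c where c: "K.cng p (\<Sum>j<e. cst (c j) * \<beta> j)" using K.hbasis_span [OF \<beta> p] .
    have "(\<Sum>j<e. cst (c j) * \<beta> j) = cst (c 0) * b"
    proof (cases "e = 1")
      case False
      then have "e = 0" using e by simp
      then show ?thesis by (simp add: b_def)
    qed (simp add: b_def)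
    then have "I.cng p (cst (c 0) * b)"
      using c cng_K_iff_I_1 [OF p homog_cst_mult [OF b1]] by simp
    then show ?thesis by blast
  qed
  have sq: "\<exists>c. I.cng p (cst c * (b * b))" if p2: "p \<in> homog 2" for p
  proof -
    obtain l where l: "p = (\<Sum>x\<in>UNIV. mvar x * l x)" "\<And>x. l x \<in> homog 1"
      by (rule homog_2_expand [OF p2]) blast
    have "\<forall>x. \<exists>c. I.cng (l x) (cst c * b)" using lin l(2) by blast
    then obtain c where c: "\<And>x. I.cng (l x) (cst (c x) * b)" by metis
    have "\<forall>x. \<exists>d. I.cng (mvar x) (cst d * b)" using lin by simp
    then obtain d where d: "\<And>x. I.cng (mvar x) (cst (d x) * b)" by metis
    have "I.cng p (\<Sum>x\<in>UNIV. (cst (d x) * b) * (cst (c x) * b))"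
      unfolding l(1) by (intro I.cng_sum I.cng_mult c d)
    also have "(\<Sum>x\<in>UNIV. (cst (d x) * b) * (cst (c x) * b)) = cst (\<Sum>x\<in>UNIV. d x * c x) * (b * b)"
      by (simp add: cst_sum cst_mult sum_distrib_left ac_simps)
    finally show ?thesis by blast
  qed
  obtain d where d: "I.cng f (cst d * (b * b))" using sq [OF f2] by blast
  have d0: "d \<noteq> 0"
  proof
    assume "d = 0"
    then have "f \<in> I" using d by (simp add: I.cng_0)
    then show False using f_ind [of 1] by simp
  qed
  \<comment> \<open>Since \<open>f\<close> spans degree two modulo \<open>I\<close>, nothing of
    degree two survives modulo \<open>K\<close>, and \<open>mult_ext_if_small\<close> covers what
    remains.\<close>
  have "p \<in> K" if p2: "p \<in> homog 2" for p
  proof -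
    obtain c where c: "I.cng p (cst c * (b * b))" using sq [OF p2] by blast
    have "cst (c / d) * (cst d * (b * b)) = cst c * (b * b)"
      using d0 by (simp add: mult.assoc [symmetric] cst_mult [symmetric])
    then have "I.cng (cst c * (b * b)) (cst (c / d) * f)"
      using I.cng_mult_left [OF I.cng_sym [OF d], of "cst (c / d)"] by simp
    from I.cng_trans [OF c this] show ?thesis unfolding K_iff I.cng_def by blast
  qed
  then have K.mult_ext by (rule K.mult_ext_if_small [OF \<beta> e])
  with ng show False ..
qed

text \<open>Composites vanish modulo \<open>K\<close>, and modulo \<open>I\<close> this ideal is the
  line spanned by \<open>f\<close>; the coefficients form the constant matrix
  \<open>C\<close>.\<close>

lemma strand_matrix:
  assumes "K.strand_zero m n s A B"
  obtains C where "\<And>p j. p < m \<Longrightarrow> j < s \<Longrightarrow> mm n A B p j - cst (C p j) * f \<in> I"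
proof -
  have "\<forall>p j. \<exists>c. p < m \<longrightarrow> j < s \<longrightarrow> mm n A B p j - cst c * f \<in> I"
    using assms unfolding K.strand_zero_def K_iff by blast
  then show ?thesis using that by metis
qed

lemma mv_mv_matrix:
  assumes C: "\<And>j. j < s \<Longrightarrow> mm n A B p j - cst (C p j) * f \<in> I"
  shows "I.cng (mv n A (mv s B (cvec v)) p) (cst (mv s C v p) * f)"
proof -
  have "I.cng (mv s (mm n A B) (cvec v) p) (mv s (\<lambda>p j. cst (C p j) * f) (cvec v) p)"
    by (rule I.cng_mv2) (simp_all add: I.cng_def C)
  moreover have "mv s (\<lambda>p j. cst (C p j) * f) (cvec v) p = cst (mv s C v p) * f"
    by (simp add: mv_def cvec_def cst_sum cst_mult sum_distrib_left ac_simps)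
  ultimately show ?thesis by (simp add: mv_mv)
qed

text \<open>Modulo \<open>K\<close> the vector \<open>u\<close> is a cycle and thus
  \<open>B v\<close> with \<open>v\<close> constant; as \<open>u\<close> and \<open>B v\<close> are
  linear, this holds modulo \<open>I\<close> as well. Comparing coefficients of \<open>f\<close> in
  \<open>A u\<close> and \<open>A B v\<close> gives \<open>C v = c\<close>. Solving
  \<open>A u = f c\<close> becomes linear algebra with \<open>C\<close>.\<close>

lemma lift_kernel:
  assumes mid: "K.strand_mid m n s A B" and lin: "lin_mat n s B"
    and C: "\<And>p j. p < m \<Longrightarrow> j < s \<Longrightarrow> mm n A B p j - cst (C p j) * f \<in> I"
    and u: "\<And>q. q < n \<Longrightarrow> u q \<in> homog 1"
    and c: "\<And>p. p < m \<Longrightarrow> I.cng (mv n A u p) (cst (c p) * f)"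
  obtains v where "\<And>q. q < n \<Longrightarrow> I.cng (u q) (mv s B (cvec v) q)"
    and "\<And>p. p < m \<Longrightarrow> mv s C v p = c p"
proof -
  have "mv n A u p \<in> K" if "p < m" for p
    unfolding K_iff using c [OF that] by (auto simp: I.cng_def)
  then obtain v where v: "\<And>q. q < n \<Longrightarrow> K.cng (u q) (mv s B (cvec v) q)"
    using mid u unfolding K.strand_mid_def by blast
  have v': "I.cng (u q) (mv s B (cvec v) q)" if q: "q < n" for q
  proof -
    have "mv s B (cvec v) q \<in> homog 1" using lin q by (intro mv_homog_1) (simp add: lin_mat_def)
    then show ?thesis using v [OF q] cng_K_iff_I_1 [OF u [OF q]] by blast
  qed
  have "mv s C v p = c p" if p: "p < m" for p
  proof -
    have 1: "I.cng (mv n A u p) (mv n A (mv s B (cvec v)) p)" by (rule I.cng_mv) (rule v')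
    have 2: "I.cng (mv n A (mv s B (cvec v)) p) (cst (mv s C v p) * f)"
      by (rule mv_mv_matrix) (rule C [OF p])
    have "I.cng (cst (mv s C v p) * f) (cst (c p) * f)"
      using I.cng_trans [OF I.cng_sym [OF I.cng_trans [OF 1 2]] c [OF p]] .
    then show ?thesis by (intro f_eq) (simp add: I.cng_def)
  qed
  with v' that show ?thesis by blast
qed

end

lemma lookup_0_positive:
  "0 < d \<Longrightarrow> p \<in> homog d \<Longrightarrow> Poly_Mapping.lookup (p :: ('x::finite, 'k::field) mpoly) 0 = 0"
  by (auto simp: homog_iff)

lemma sum_lessThan_add:
  "(\<Sum>j<a + b. h j) = (\<Sum>j<a. h j) + (\<Sum>j<b. h (a + j :: nat) :: 'a::comm_monoid_add)"
  by (induct b) (simp_all add: add.assoc)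

text \<open>\<open>\<iota>\<close> and \<open>\<kappa>\<close> are the inclusions of the two polynomial rings, and their left inverses \<open>\<sigma>\<close> and \<open>\<tau>\<close>
  set the variables of the other ring to zero.\<close>

locale connected_sum =
  L: quadric_quotient I1 K1 f + R: quadric_quotient I2 K2 g + J: short_ideal J
  for I1 K1 :: "('x::finite, 'k::field) mpoly set" and f
    and I2 K2 :: "('y::finite, 'k) mpoly set" and g
    and J :: "('z::finite, 'k) mpoly set" +
  fixes \<sigma> :: "('z, 'k) mpoly \<Rightarrow> ('x, 'k) mpoly" and \<iota> :: "('x, 'k) mpoly \<Rightarrow> ('z, 'k) mpoly"
    and \<tau> :: "('z, 'k) mpoly \<Rightarrow> ('y, 'k) mpoly" and \<kappa> :: "('y, 'k) mpoly \<Rightarrow> ('z, 'k) mpoly"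
  assumes \<sigma>: "hmap \<sigma>" and \<iota>: "hmap \<iota>" and \<tau>: "hmap \<tau>" and \<kappa>: "hmap \<kappa>"
    and \<sigma>\<iota>: "\<sigma> (\<iota> p) = p" and \<tau>\<kappa>: "\<tau> (\<kappa> q) = q"
    and \<tau>\<iota>: "\<tau> (\<iota> p) = cst (Poly_Mapping.lookup p 0)"
    and \<sigma>\<kappa>: "\<sigma> (\<kappa> q) = cst (Poly_Mapping.lookup q 0)"
    and J_iff: "s \<in> J \<longleftrightarrow> (\<exists>c. \<sigma> s - cst c * f \<in> I1 \<and> \<tau> s + cst c * g \<in> I2)"
begin

text \<open>Results for the left summand transfer to the right one by this symmetry. It replaces the
  generator \<open>f - g\<close> by its negative, hence \<open>c\<close> by
  \<open>- c\<close>.\<close>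

lemma swap: "connected_sum I2 K2 g I1 K1 f J \<tau> \<kappa> \<sigma> \<iota>"
proof (intro connected_sum.intro connected_sum_axioms.intro)
  fix p :: "('z, 'k) mpoly"
  show "p \<in> J \<longleftrightarrow> (\<exists>c. \<tau> p - cst c * g \<in> I2 \<and> \<sigma> p + cst c * f \<in> I1)"
    unfolding J_iff
  proof
    assume "\<exists>c. \<sigma> p - cst c * f \<in> I1 \<and> \<tau> p + cst c * g \<in> I2"
    then obtain c where "\<sigma> p - cst c * f \<in> I1" "\<tau> p + cst c * g \<in> I2" by blast
    then show "\<exists>c. \<tau> p - cst c * g \<in> I2 \<and> \<sigma> p + cst c * f \<in> I1"
      by (intro exI [of _ "- c"]) (simp add: cst_uminus)
  next
    assume "\<exists>c. \<tau> p - cst c * g \<in> I2 \<and> \<sigma> p + cst c * f \<in> I1"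
    then obtain c where "\<tau> p - cst c * g \<in> I2" "\<sigma> p + cst c * f \<in> I1" by blast
    then show "\<exists>c. \<sigma> p - cst c * f \<in> I1 \<and> \<tau> p + cst c * g \<in> I2"
      by (intro exI [of _ "- c"]) (simp add: cst_uminus)
  qed
qed (fact L.quadric_quotient_axioms R.quadric_quotient_axioms J.short_ideal_axioms \<sigma> \<iota> \<tau> \<kappa> \<sigma>\<iota> \<tau>\<kappa> \<tau>\<iota> \<sigma>\<kappa>)+

lemma \<tau>\<iota>_pos: "0 < d \<Longrightarrow> p \<in> homog d \<Longrightarrow> \<tau> (\<iota> p) = 0"
  by (simp add: \<tau>\<iota> lookup_0_positive)
lemma \<sigma>\<kappa>_pos: "0 < d \<Longrightarrow> p \<in> homog d \<Longrightarrow> \<sigma> (\<kappa> p) = 0"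
  by (simp add: \<sigma>\<kappa> lookup_0_positive)

lemma J_\<sigma>: "p \<in> J \<Longrightarrow> \<sigma> p \<in> K1"
  unfolding J_iff L.K_iff by (elim exE conjE) (rule exI)
lemma J_\<tau>: "p \<in> J \<Longrightarrow> \<tau> p \<in> K2"
proof -
  assume "p \<in> J"
  then obtain c where "\<tau> p + cst c * g \<in> I2" unfolding J_iff by (elim exE conjE)
  then show "\<tau> p \<in> K2" unfolding R.K_iff by (intro exI [of _ "- c"]) (simp add: cst_uminus)
qed
lemma JI: "\<sigma> p \<in> I1 \<Longrightarrow> \<tau> p \<in> I2 \<Longrightarrow> p \<in> J"
  unfolding J_iff by (intro exI [of _ 0]) simp

lemma \<sigma>_mv_cvec: "\<sigma> (mv n D (cvec v) p) = mv n (\<lambda>p q. \<sigma> (D p q)) (cvec v) p"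
  by (simp add: hmap_mv [OF \<sigma>] cvec_def hmap_cst [OF \<sigma>])
lemma \<tau>_mv_cvec: "\<tau> (mv n D (cvec v) p) = mv n (\<lambda>p q. \<tau> (D p q)) (cvec v) p"
  by (simp add: hmap_mv [OF \<tau>] cvec_def hmap_cst [OF \<tau>])

lemma hbasis_1:
  assumes \<beta>1: "L.K.hbasis 1 e1 \<beta>1" and \<beta>2: "R.K.hbasis 1 e2 \<beta>2"
  shows "J.hbasis 1 (e1 + e2) (\<lambda>j. if j < e1 then \<iota> (\<beta>1 j) else \<kappa> (\<beta>2 (j - e1)))"
proof -
  let ?\<beta> = "\<lambda>j. if j < e1 then \<iota> (\<beta>1 j) else \<kappa> (\<beta>2 (j - e1))"
  have sum: "(\<Sum>j<e1 + e2. cst (c j) * ?\<beta> j) =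
      (\<Sum>j<e1. cst (c j) * \<iota> (\<beta>1 j)) + (\<Sum>j<e2. cst (c (e1 + j)) * \<kappa> (\<beta>2 j))" for c
    by (simp add: sum_lessThan_add)
  have z: "\<sigma> (\<kappa> (\<beta>2 j)) = 0" if "j < e2" for j
    using R.K.hbasis_homog [OF \<beta>2 that] by (rule \<sigma>\<kappa>_pos [rotated]) simp
  have z': "\<tau> (\<iota> (\<beta>1 j)) = 0" if "j < e1" for j
    using L.K.hbasis_homog [OF \<beta>1 that] by (rule \<tau>\<iota>_pos [rotated]) simp
  have \<sigma>s: "\<sigma> (\<Sum>j<e1 + e2. cst (c j) * ?\<beta> j) = (\<Sum>j<e1. cst (c j) * \<beta>1 j)" for c
    unfolding sum by (simp add: hmap_simps [OF \<sigma>] \<sigma>\<iota> z)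
  have \<tau>s: "\<tau> (\<Sum>j<e1 + e2. cst (c j) * ?\<beta> j) = (\<Sum>j<e2. cst (c (e1 + j)) * \<beta>2 j)" for c
    unfolding sum by (simp add: hmap_simps [OF \<tau>] \<tau>\<kappa> z')
  show ?thesis
    unfolding J.hbasis_def
  proof (intro conjI allI impI ballI)
    fix j assume "j < e1 + e2"
    then show "?\<beta> j \<in> homog 1"
      using L.K.hbasis_homog [OF \<beta>1, of j] R.K.hbasis_homog [OF \<beta>2, of "j - e1"]
        hmap_homog [OF \<iota>] hmap_homog [OF \<kappa>] by simp
  next
    fix p :: "('z, 'k) mpoly" assume p: "p \<in> homog 1"
    obtain c1 where c1: "L.K.cng (\<sigma> p) (\<Sum>j<e1. cst (c1 j) * \<beta>1 j)"
      using L.K.hbasis_span [OF \<beta>1 hmap_homog [OF \<sigma> p]] .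
    obtain c2 where c2: "R.K.cng (\<tau> p) (\<Sum>j<e2. cst (c2 j) * \<beta>2 j)"
      using R.K.hbasis_span [OF \<beta>2 hmap_homog [OF \<tau> p]] .
    define c where "c j = (if j < e1 then c1 j else c2 (j - e1))" for j
    have c: "(\<Sum>j<e1. cst (c j) * \<beta>1 j) = (\<Sum>j<e1. cst (c1 j) * \<beta>1 j)"
      "(\<Sum>j<e2. cst (c (e1 + j)) * \<beta>2 j) = (\<Sum>j<e2. cst (c2 j) * \<beta>2 j)"
      by (simp_all add: c_def)
    have "L.I.cng (\<sigma> p) (\<Sum>j<e1. cst (c1 j) * \<beta>1 j)"
      by (intro L.cng_K_iff_I_1 [THEN iffD1, OF _ _ c1] hmap_homog [OF \<sigma> p] homog_sum homog_cst_mult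
          L.K.hbasis_homog [OF \<beta>1]) simp
    moreover have "R.I.cng (\<tau> p) (\<Sum>j<e2. cst (c2 j) * \<beta>2 j)"
      by (intro R.cng_K_iff_I_1 [THEN iffD1, OF _ _ c2] hmap_homog [OF \<tau> p] homog_sum homog_cst_mult
          R.K.hbasis_homog [OF \<beta>2]) simp
    ultimately have "p - (\<Sum>j<e1 + e2. cst (c j) * ?\<beta> j) \<in> J"
      unfolding L.I.cng_def R.I.cng_def
      by (intro JI) (simp_all only: hmap_diff [OF \<sigma>] hmap_diff [OF \<tau>] \<sigma>s \<tau>s c)
    then have "J.cng p (\<Sum>j<e1 + e2. cst (c j) * ?\<beta> j)" by (simp only: J.cng_def)
    then show "\<exists>c. J.cng p (\<Sum>j<e1 + e2. cst (c j) * ?\<beta> j)" by blast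
  next
    fix c j assume s: "(\<Sum>j<e1 + e2. cst (c j) * ?\<beta> j) \<in> J" and j: "j < e1 + e2"
    have "\<forall>j<e1. c j = 0"
      using J_\<sigma> [OF s] unfolding \<sigma>s using L.K.hbasis_indep [OF \<beta>1] by blast
    moreover have "c (e1 + j) = 0" if "j < e2" for j
      using J_\<tau> [OF s] unfolding \<tau>s using R.K.hbasis_indep [OF \<beta>2, of "\<lambda>j. c (e1 + j)" j] that by simp
    from this [of "j - e1"] have "\<not> j < e1 \<Longrightarrow> c j = 0" using j by simp
    ultimately show "c j = 0" by blast
  qed
qed

text \<open>Degree two has one dimension more than both summands together: \<open>f\<close> is zero
  in each of them, but it and \<open>g\<close> become the same nonzero quadric in the connected
  sum.\<close>

lemma hbasis_2:
  assumes \<gamma>1: "L.K.hbasis 2 r1 \<gamma>1" and \<gamma>2: "R.K.hbasis 2 r2 \<gamma>2"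
  shows "J.hbasis 2 (r1 + (r2 + 1))
     (\<lambda>j. if j < r1 then \<iota> (\<gamma>1 j) else if j < r1 + r2 then \<kappa> (\<gamma>2 (j - r1)) else \<iota> f)"
proof -
  let ?\<gamma> = "\<lambda>j. if j < r1 then \<iota> (\<gamma>1 j) else if j < r1 + r2 then \<kappa> (\<gamma>2 (j - r1)) else \<iota> f"
  have sum: "(\<Sum>j<r1 + (r2 + 1). cst (c j) * ?\<gamma> j) = (\<Sum>j<r1. cst (c j) * \<iota> (\<gamma>1 j)) +
      ((\<Sum>j<r2. cst (c (r1 + j)) * \<kappa> (\<gamma>2 j)) + cst (c (r1 + r2)) * \<iota> f)" for c
    by (simp add: sum_lessThan_add)
  have z: "\<sigma> (\<kappa> (\<gamma>2 j)) = 0" if "j < r2" for j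
    using R.K.hbasis_homog [OF \<gamma>2 that] by (rule \<sigma>\<kappa>_pos [rotated]) simp
  have z': "\<tau> (\<iota> (\<gamma>1 j)) = 0" if "j < r1" for j
    using L.K.hbasis_homog [OF \<gamma>1 that] by (rule \<tau>\<iota>_pos [rotated]) simp
  have zf: "\<tau> (\<iota> f) = 0" using L.f2 by (rule \<tau>\<iota>_pos [rotated]) simp
  have \<sigma>s: "\<sigma> (\<Sum>j<r1 + (r2 + 1). cst (c j) * ?\<gamma> j) = (\<Sum>j<r1. cst (c j) * \<gamma>1 j) + cst (c (r1 + r2)) * f" for c
    unfolding sum by (simp add: hmap_simps [OF \<sigma>] \<sigma>\<iota> z)
  have \<tau>s: "\<tau> (\<Sum>j<r1 + (r2 + 1). cst (c j) * ?\<gamma> j) = (\<Sum>j<r2. cst (c (r1 + j)) * \<gamma>2 j)" for c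
    unfolding sum by (simp add: hmap_simps [OF \<tau>] \<tau>\<kappa> z' zf)
  show ?thesis
    unfolding J.hbasis_def
  proof (intro conjI allI impI ballI)
    fix j assume "j < r1 + (r2 + 1)"
    then show "?\<gamma> j \<in> homog 2"
      using L.K.hbasis_homog [OF \<gamma>1, of j] R.K.hbasis_homog [OF \<gamma>2, of "j - r1"] L.f2
        hmap_homog [OF \<iota>] hmap_homog [OF \<kappa>] by simp
  next
    fix p :: "('z, 'k) mpoly" assume p: "p \<in> homog 2"
    obtain c1 where "L.K.cng (\<sigma> p) (\<Sum>j<r1. cst (c1 j) * \<gamma>1 j)"
      using L.K.hbasis_span [OF \<gamma>1 hmap_homog [OF \<sigma> p]] .
    then obtain d1 where d1: "\<sigma> p - (\<Sum>j<r1. cst (c1 j) * \<gamma>1 j) - cst d1 * f \<in> I1"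
      unfolding L.K.cng_def L.K_iff by blast
    obtain c2 where "R.K.cng (\<tau> p) (\<Sum>j<r2. cst (c2 j) * \<gamma>2 j)"
      using R.K.hbasis_span [OF \<gamma>2 hmap_homog [OF \<tau> p]] .
    then obtain d2 where d2: "\<tau> p - (\<Sum>j<r2. cst (c2 j) * \<gamma>2 j) - cst d2 * g \<in> I2"
      unfolding R.K.cng_def R.K_iff by blast
    define c where "c j = (if j < r1 then c1 j else if j < r1 + r2 then c2 (j - r1) else d1 + d2)" for j
    have c: "(\<Sum>j<r1. cst (c j) * \<gamma>1 j) = (\<Sum>j<r1. cst (c1 j) * \<gamma>1 j)"
      "(\<Sum>j<r2. cst (c (r1 + j)) * \<gamma>2 j) = (\<Sum>j<r2. cst (c2 j) * \<gamma>2 j)" "c (r1 + r2) = d1 + d2"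
      by (simp_all add: c_def)
    have "J.cng p (\<Sum>j<r1 + (r2 + 1). cst (c j) * ?\<gamma> j)"
      unfolding J.cng_def J_iff
    \<comment> \<open>The term \<open>d2 g\<close> of the right component counts as
      \<open>d2 f\<close> in the connected sum. So \<open>\<iota> f\<close> has the coefficient
      \<open>d1 + d2\<close>, and the multiplier asked for by \<open>J_iff\<close> is
      \<open>- d2\<close>.\<close>
    proof (intro exI [of _ "- d2"] conjI)
      show "\<sigma> (p - (\<Sum>j<r1 + (r2 + 1). cst (c j) * ?\<gamma> j)) - cst (- d2) * f \<in> I1"
        unfolding hmap_diff [OF \<sigma>] \<sigma>s c using d1 by (simp add: cst_add cst_uminus algebra_simps)
      show "\<tau> (p - (\<Sum>j<r1 + (r2 + 1). cst (c j) * ?\<gamma> j)) + cst (- d2) * g \<in> I2"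
        unfolding hmap_diff [OF \<tau>] \<tau>s c using d2 by (simp add: cst_uminus algebra_simps)
    qed
    then show "\<exists>c. J.cng p (\<Sum>j<r1 + (r2 + 1). cst (c j) * ?\<gamma> j)" by blast
  next
    fix c j assume s: "(\<Sum>j<r1 + (r2 + 1). cst (c j) * ?\<gamma> j) \<in> J" and j: "j < r1 + (r2 + 1)"
    obtain b where b1: "(\<Sum>j<r1. cst (c j) * \<gamma>1 j) + cst (c (r1 + r2)) * f - cst b * f \<in> I1"
      and b2: "(\<Sum>j<r2. cst (c (r1 + j)) * \<gamma>2 j) + cst b * g \<in> I2"
      using s unfolding J_iff \<sigma>s \<tau>s by blast
    have "(\<Sum>j<r1. cst (c j) * \<gamma>1 j) \<in> K1"
      unfolding L.K_iff using b1 by (intro exI [of _ "b - c (r1 + r2)"]) (simp add: cst_diff algebra_simps)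
    then have 1: "c j = 0" if "j < r1" for j using L.K.hbasis_indep [OF \<gamma>1] that by blast
    have "(\<Sum>j<r2. cst (c (r1 + j)) * \<gamma>2 j) \<in> K2"
      unfolding R.K_iff using b2 by (intro exI [of _ "- b"]) (simp add: cst_uminus)
    then have 2: "c (r1 + j) = 0" if "j < r2" for j
      using R.K.hbasis_indep [OF \<gamma>2, of "\<lambda>j. c (r1 + j)" j] that by simp
    have "cst b * g \<in> I2" using b2 2 by simp
    then have "b = 0" by (rule R.f_ind)
    then have "cst (c (r1 + r2)) * f \<in> I1" using b1 1 by simp
    then have 3: "c (r1 + r2) = 0" by (rule L.f_ind)
    consider "j < r1" | "j - r1 < r2" "r1 \<le> j" | "j = r1 + r2" using j by linarith
    then show "c j = 0" using 1 2 [of "j - r1"] 3 by cases auto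
  qed
qed

end

section \<open>From the connected sum to its summands\<close>

definition lin_indep_family :: "nat \<Rightarrow> ((nat \<Rightarrow> 'k::field) \<Rightarrow> bool) \<Rightarrow> nat \<Rightarrow> bool" where
  "lin_indep_family n S N \<longleftrightarrow> (\<exists>w. (\<forall>j<N. S (w j)) \<and>
     (\<forall>c. (\<forall>q<n. (\<Sum>j<N. c j * w j q) = 0) \<longrightarrow> (\<forall>j<N. c j = 0)))"

lemma lin_indep_family_le: "lin_indep_family n S N \<Longrightarrow> N \<le> n"
proof -
  assume "lin_indep_family n S N"
  then obtain w where w: "(\<forall>j<N. S (w j)) \<and>
      (\<forall>c. (\<forall>q<n. (\<Sum>j<N. c j * w j q) = 0) \<longrightarrow> (\<forall>j<N. c j = 0))"
    unfolding lin_indep_family_def by (rule exE)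
  have "card {..<N} \<le> card {..<n}"
    by (rule injective_matrix_card [of _ _ w]) (use w in simp_all)
  then show ?thesis by simp
qed

text \<open>The lifting condition of the theorem; for degree reasons it suffices to lift the vectors
  \<open>f e\<^sub>j\<close> to vectors of linear forms.\<close>

definition covers :: "('x::finite, 'k::field) mpoly set \<Rightarrow> ('x, 'k) mpoly \<Rightarrow> nat \<Rightarrow>
    (int \<Rightarrow> nat \<Rightarrow> nat \<Rightarrow> ('x, 'k) mpoly) \<Rightarrow> bool" where
  "covers I f n A \<longleftrightarrow> (\<forall>i. \<forall>j<n. \<exists>u. (\<forall>q<n. u q \<in> homog 1) \<and>
     (\<forall>p<n. mv n (A i) u p - (if p = j then f else 0) \<in> I))"

context connected_sum
begin

lemma grow:
  assumes st: "J.strand (\<lambda>_. n) D"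
    and v: "\<And>p. p < n \<Longrightarrow> mv n (\<lambda>p q. \<sigma> (D i p q)) (cvec v) p \<in> K1"
    and u: "u \<in> homog 1"
  obtains w where "\<And>p. p < n \<Longrightarrow> mv n (\<lambda>p q. \<tau> (D (i + 1) p q)) (cvec w) p \<in> K2"
    and "\<And>p. p < n \<Longrightarrow> L.K.cng (mv n (\<lambda>p q. \<sigma> (D (i + 1) p q)) (cvec w) p) (cst (v p) * u)"
proof -
  have lin: "D i p q \<in> homog 1" if "p < n" "q < n" for p q
    using J.strandD(1) [OF st, of i] that by (simp add: lin_mat_def)
  define y where "y = (\<lambda>q. cst (v q) * \<iota> u)"
  have \<tau>u: "\<tau> (\<iota> u) = 0" using u by (rule \<tau>\<iota>_pos [rotated]) simp
  have y1: "y q \<in> homog 1" for q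
    unfolding y_def by (intro homog_cst_mult hmap_homog [OF \<iota>] u)
  have "mv n (D i) y p \<in> J" if p: "p < n" for p
  proof (rule JI)
    \<comment> \<open>\<open>JI\<close> asks for membership in \<open>I1\<close>, not only in
      \<open>K1\<close>. The entry is a linear form, and for these the two ideals agree.\<close>
    have "mv n (\<lambda>p q. \<sigma> (D i p q)) (cvec v) p \<in> homog 1"
      using lin p by (intro mv_homog_1 hmap_homog [OF \<sigma>])
    then have "u * mv n (\<lambda>p q. \<sigma> (D i p q)) (cvec v) p \<in> I1"
      using v [OF p] by (rule L.mult_K_1_in_I)
    moreover have "\<sigma> (mv n (D i) y p) = u * mv n (\<lambda>p q. \<sigma> (D i p q)) (cvec v) p"
      unfolding y_def by (simp add: hmap_mv [OF \<sigma>] hmap_simps [OF \<sigma>] \<sigma>\<iota> cvec_def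
          mv_scale [symmetric] mult.commute)
    ultimately show "\<sigma> (mv n (D i) y p) \<in> I1" by simp
    have "\<tau> (mv n (D i) y p) = 0"
      by (simp add: y_def hmap_mv [OF \<tau>] hmap_simps [OF \<tau>] \<tau>u)
    then show "\<tau> (mv n (D i) y p) \<in> I2" by simp
  qed
  then obtain w where w: "\<And>q. q < n \<Longrightarrow> J.cng (y q) (mv n (D (i + 1)) (cvec w) q)"
    using J.strandD(4) [OF st, of i] y1 unfolding J.strand_mid_def by blast
  show ?thesis
  proof (rule that [of w])
    fix p assume p: "p < n"
    have d: "y p - mv n (D (i + 1)) (cvec w) p \<in> J" using w [OF p] by (simp add: J.cng_def)
    have "\<tau> (y p) = 0" by (simp add: y_def hmap_simps [OF \<tau>] \<tau>u)
    then show "mv n (\<lambda>p q. \<tau> (D (i + 1) p q)) (cvec w) p \<in> K2"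
      using J_\<tau> [OF d] by (simp add: hmap_diff [OF \<tau>] \<tau>_mv_cvec)
    have "\<sigma> (y p) = cst (v p) * u" by (simp add: y_def hmap_simps [OF \<sigma>] \<sigma>\<iota>)
    then have "L.K.cng (cst (v p) * u) (mv n (\<lambda>p q. \<sigma> (D (i + 1) p q)) (cvec w) p)"
      using J_\<sigma> [OF d] by (simp add: hmap_diff [OF \<sigma>] \<sigma>_mv_cvec L.K.cng_def)
    then show "L.K.cng (mv n (\<lambda>p q. \<sigma> (D (i + 1) p q)) (cvec w) p) (cst (v p) * u)"
      by (rule L.K.cng_sym)
  qed
qed

text \<open>Kernel vectors on one side produce twice as many kernel vectors on the other side, one for each
  of two independent linear forms.\<close>

lemma grow_family:
  assumes st: "J.strand (\<lambda>_. n) D" and \<beta>: "L.K.hbasis 1 e \<beta>" and e: "2 \<le> e"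
    and fam: "lin_indep_family n (\<lambda>v. \<forall>p<n. mv n (\<lambda>p q. \<sigma> (D i p q)) (cvec v) p \<in> K1) N"
  shows "lin_indep_family n (\<lambda>w. \<forall>p<n. mv n (\<lambda>p q. \<tau> (D (i + 1) p q)) (cvec w) p \<in> K2) (N + N)"
proof -
  let ?A = "mv n (\<lambda>p q. \<sigma> (D (i + 1) p q))" and ?B = "mv n (\<lambda>p q. \<tau> (D (i + 1) p q))"
  obtain v where v: "\<And>j p. j < N \<Longrightarrow> p < n \<Longrightarrow> mv n (\<lambda>p q. \<sigma> (D i p q)) (cvec (v j)) p \<in> K1"
    and ind: "\<And>c j. (\<And>q. q < n \<Longrightarrow> (\<Sum>j<N. c j * v j q) = 0) \<Longrightarrow> j < N \<Longrightarrow> c j = 0"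
    using fam unfolding lin_indep_family_def by blast
  have ex: "\<exists>w. j < N \<longrightarrow> (\<forall>p<n. ?B (cvec w) p \<in> K2) \<and>
      (\<forall>p<n. L.K.cng (?A (cvec w) p) (cst (v j p) * \<beta> t))" if t: "t < e" for j t
  proof (cases "j < N")
    case True
    have b: "\<beta> t \<in> homog 1" by (rule L.K.hbasis_homog [OF \<beta> t])
    show ?thesis
    proof (rule grow [OF st v [OF True] b])
      fix w assume "\<And>p. p < n \<Longrightarrow> ?B (cvec w) p \<in> K2"
        and "\<And>p. p < n \<Longrightarrow> L.K.cng (?A (cvec w) p) (cst (v j p) * \<beta> t)"
      then show ?thesis by (intro exI [of _ w]) simp
    qed
  qed simp
  have "\<forall>j. \<exists>w. j < N \<longrightarrow> (\<forall>p<n. ?B (cvec w) p \<in> K2) \<and>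
      (\<forall>p<n. L.K.cng (?A (cvec w) p) (cst (v j p) * \<beta> 0))" using ex e by simp
  then obtain w0 where w0: "\<And>j p. j < N \<Longrightarrow> p < n \<Longrightarrow> ?B (cvec (w0 j)) p \<in> K2"
    "\<And>j p. j < N \<Longrightarrow> p < n \<Longrightarrow> L.K.cng (?A (cvec (w0 j)) p) (cst (v j p) * \<beta> 0)" by metis
  have "\<forall>j. \<exists>w. j < N \<longrightarrow> (\<forall>p<n. ?B (cvec w) p \<in> K2) \<and>
      (\<forall>p<n. L.K.cng (?A (cvec w) p) (cst (v j p) * \<beta> 1))" using ex e by simp
  then obtain w1 where w1: "\<And>j p. j < N \<Longrightarrow> p < n \<Longrightarrow> ?B (cvec (w1 j)) p \<in> K2"
    "\<And>j p. j < N \<Longrightarrow> p < n \<Longrightarrow> L.K.cng (?A (cvec (w1 j)) p) (cst (v j p) * \<beta> 1)" by metis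
  define w where "w j = (if j < N then w0 j else w1 (j - N))" for j
  show ?thesis
    unfolding lin_indep_family_def
  proof (intro exI [of _ w] conjI allI impI)
    fix j p assume "j < N + N" "p < n"
    then show "?B (cvec (w j)) p \<in> K2" using w0(1) [of j] w1(1) [of "j - N"] by (simp add: w_def)
  next
    fix c j assume c: "\<forall>q<n. (\<Sum>j<N + N. c j * w j q) = 0" and j: "j < N + N"
    have s: "(\<Sum>j<N. c j * v j p) = 0 \<and> (\<Sum>j<N. c (N + j) * v j p) = 0" if p: "p < n" for p
    proof -
      \<comment> \<open>Mapping a vanishing combination of the \<open>w j\<close> by the left matrix
        yields a linear form whose coordinates at \<open>\<beta> 0\<close> and
        \<open>\<beta> 1\<close> are combinations of the \<open>v j\<close>, and whose other
        coordinates are zero. Both combinations must vanish.\<close>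
      let ?d = "\<lambda>t::nat. if t = 0 then \<Sum>j<N. c j * v j p else if t = 1 then \<Sum>j<N. c (N + j) * v j p else 0"
      have "?A (\<lambda>q. \<Sum>j<N + N. cst (c j) * cvec (w j) q) p = ?A (\<lambda>q. 0) p"
      proof (rule mv_cong)
        fix q assume "q < n"
        then have "cst (\<Sum>j<N + N. c j * w j q) = 0" using c by simp
        then show "(\<Sum>j<N + N. cst (c j) * cvec (w j) q) = 0"
          by (simp add: cst_sum cst_mult cvec_def)
      qed
      then have s1: "(\<Sum>j<N. cst (c j) * ?A (cvec (w0 j)) p) + (\<Sum>j<N. cst (c (N + j)) * ?A (cvec (w1 j)) p) = 0"
        by (simp add: mv_add mv_sum mv_scale sum_lessThan_add w_def)
      have s2: "L.K.cng ((\<Sum>j<N. cst (c j) * ?A (cvec (w0 j)) p) + (\<Sum>j<N. cst (c (N + j)) * ?A (cvec (w1 j)) p))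
          ((\<Sum>j<N. cst (c j) * (cst (v j p) * \<beta> 0)) + (\<Sum>j<N. cst (c (N + j)) * (cst (v j p) * \<beta> 1)))"
        by (intro L.K.cng_add L.K.cng_sum L.K.cng_mult_left w0 w1 p) simp_all
      have s3: "(\<Sum>j<N. cst (c j) * (cst (v j p) * \<beta> 0)) + (\<Sum>j<N. cst (c (N + j)) * (cst (v j p) * \<beta> 1))
          = cst (?d 0) * \<beta> 0 + cst (?d 1) * \<beta> 1"
        by (simp add: cst_sum cst_mult sum_distrib_right mult.assoc)
      have s4: "(\<Sum>t<e. cst (?d t) * \<beta> t) = cst (?d 0) * \<beta> 0 + cst (?d 1) * \<beta> 1"
      proof -
        obtain e' where "e = 2 + e'" using e le_iff_add by blast
        then have "(\<Sum>t<e. cst (?d t) * \<beta> t) = (\<Sum>t<2. cst (?d t) * \<beta> t) + (\<Sum>t<e'. cst (?d (2 + t)) * \<beta> (2 + t))"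
          by (simp only: sum_lessThan_add)
        also have "(\<Sum>t<e'. cst (?d (2 + t)) * \<beta> (2 + t)) = 0" by (intro sum.neutral) simp
        finally show ?thesis by (simp add: numeral_2_eq_2)
      qed
      have "(\<Sum>t<e. cst (?d t) * \<beta> t) \<in> K1"
        using L.K.cng_sym [OF s2 [unfolded s1 s3 s4 [symmetric]]] by (simp only: L.K.cng_0)
      then have "?d t = 0" if "t < e" for t by (rule L.K.hbasis_indep [OF \<beta> _ that])
      from this [of 0] this [of 1] show ?thesis using e by simp
    qed
    have 0: "c j = 0" if "j < N" for j by (rule ind [OF _ that]) (use s in simp)
    have 1: "c (N + j) = 0" if "j < N" for j by (rule ind [OF _ that]) (use s in simp)
    show "c j = 0" using 0 [of j] 1 [of "j - N"] j by (cases "j < N") auto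
  qed
qed

text \<open>A nonzero kernel vector would produce \<open>2 ^ m\<close> independent kernel vectors
  for every \<open>m\<close>, on alternating sides; for \<open>m = n\<close> these do not fit into
  \<open>k^n\<close>.\<close>

lemma strand_inj_\<sigma>:
  assumes st: "J.strand (\<lambda>_. n) D"
    and \<beta>1: "L.K.hbasis 1 e1 \<beta>1" "2 \<le> e1" and \<beta>2: "R.K.hbasis 1 e2 \<beta>2" "2 \<le> e2"
  shows "L.K.strand_inj n n (\<lambda>p q. \<sigma> (D i p q))"
proof (rule ccontr)
  let ?A = "\<lambda>i. lin_indep_family n (\<lambda>v. \<forall>p<n. mv n (\<lambda>p q. \<sigma> (D i p q)) (cvec v) p \<in> K1)"
  let ?B = "\<lambda>i. lin_indep_family n (\<lambda>v. \<forall>p<n. mv n (\<lambda>p q. \<tau> (D i p q)) (cvec v) p \<in> K2)"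
  assume "\<not> ?thesis"
  then obtain v q where v: "\<forall>p<n. mv n (\<lambda>p q. \<sigma> (D i p q)) (cvec v) p \<in> K1" and q: "q < n" "v q \<noteq> 0"
    unfolding L.K.strand_inj_def by blast
  have base: "?A i 1"
    unfolding lin_indep_family_def
  proof (intro exI [of _ "\<lambda>_. v"] conjI allI impI)
    fix c :: "nat \<Rightarrow> 'k" and j :: nat assume "\<forall>q<n. (\<Sum>j<1. c j * v q) = 0" "j < 1"
    then show "c j = 0" using q by auto
  qed (use v in auto)
  have step: "?B (i + 1) (N + N)" if "?A i N" for i N
    by (rule grow_family [OF st \<beta>1 that])
  have step': "?A (i + 1) (N + N)" if "?B i N" for i N
    by (rule connected_sum.grow_family [OF swap st \<beta>2 that])
  have "\<exists>i. ?A i (2 ^ m) \<or> ?B i (2 ^ m)" for m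
  proof (induct m)
    case 0 then show ?case using base by auto
  next
    case (Suc m)
    then obtain i where "?A i (2 ^ m) \<or> ?B i (2 ^ m)" by (rule exE)
    then have "?A (i + 1) (2 ^ m + 2 ^ m) \<or> ?B (i + 1) (2 ^ m + 2 ^ m)" using step step' by (elim disjE) simp_all
    then show ?case unfolding power_Suc mult_2 by (rule exI)
  qed
  from this [of n] obtain i where "?A i (2 ^ n) \<or> ?B i (2 ^ n)" by (rule exE)
  then have "2 ^ n \<le> n" by (elim disjE) (rule lin_indep_family_le, assumption)+
  then show False using less_exp [of n] by simp
qed

lemma strand_surj_\<sigma>:
  assumes st: "J.strand (\<lambda>_. n) D"
  shows "L.K.strand_surj n n (\<lambda>p q. \<sigma> (D i p q))"
  unfolding L.K.strand_surj_def
proof (intro allI impI)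
  fix z :: "nat \<Rightarrow> ('x, 'k) mpoly" assume z: "\<forall>p<n. z p \<in> homog 2"
  then have "\<forall>p<n. \<iota> (z p) \<in> homog 2" using hmap_homog [OF \<iota>] by blast
  then obtain u where u: "\<And>q. q < n \<Longrightarrow> u q \<in> homog 1" "\<And>p. p < n \<Longrightarrow> J.cng (\<iota> (z p)) (mv n (D i) u p)"
    using J.strandD(3) [OF st, of i, unfolded J.strand_surj_def, rule_format, of "\<lambda>p. \<iota> (z p)"] by blast
  show "\<exists>u. (\<forall>q<n. u q \<in> homog 1) \<and> (\<forall>p<n. L.K.cng (z p) (mv n (\<lambda>p q. \<sigma> (D i p q)) u p))"
  proof (intro exI [of _ "\<lambda>q. \<sigma> (u q)"] conjI allI impI)
    fix q assume "q < n"
    then show "\<sigma> (u q) \<in> homog 1" by (intro hmap_homog [OF \<sigma>] u)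
  next
    fix p assume "p < n"
    from J_\<sigma> [OF u(2) [OF this, unfolded J.cng_def]]
    show "L.K.cng (z p) (mv n (\<lambda>p q. \<sigma> (D i p q)) (\<lambda>q. \<sigma> (u q)) p)"
      by (simp add: L.K.cng_def hmap_diff [OF \<sigma>] hmap_mv [OF \<sigma>] \<sigma>\<iota>)
  qed
qed

lemma strand_zero_\<sigma>:
  assumes st: "J.strand (\<lambda>_. n) D"
  shows "L.K.strand_zero n n n (\<lambda>p q. \<sigma> (D i p q)) (\<lambda>p q. \<sigma> (D (i + 1) p q))"
  unfolding L.K.strand_zero_def
proof (intro allI impI)
  fix p j assume "p < n" "j < n"
  then have "mm n (D i) (D (i + 1)) p j \<in> J"
    using J.strandD(5) [OF st, of i] unfolding J.strand_zero_def by blast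
  from J_\<sigma> [OF this] show "mm n (\<lambda>p q. \<sigma> (D i p q)) (\<lambda>p q. \<sigma> (D (i + 1) p q)) p j \<in> K1"
    by (simp add: hmap_mm [OF \<sigma>])
qed

lemma lin_mat_\<sigma>:
  assumes st: "J.strand (\<lambda>_. n) D"
  shows "lin_mat n n (\<lambda>p q. \<sigma> (D i p q))"
  using J.strandD(1) [OF st, of i] hmap_homog [OF \<sigma>, of _ 1] by (simp add: lin_mat_def)

lemma count_\<sigma>:
  assumes st: "J.strand (\<lambda>_. n) D" and n: "n > 0"
    and \<beta>1: "L.K.hbasis 1 e1 \<beta>1" "2 \<le> e1" and \<beta>2: "R.K.hbasis 1 e2 \<beta>2" "2 \<le> e2"
    and \<gamma>1: "L.K.hbasis 2 r1 \<gamma>1"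
  shows "1 + r1 \<le> e1"
    and "1 + r1 = e1 \<Longrightarrow> L.K.strand_mid n n n (\<lambda>p q. \<sigma> (D i p q)) (\<lambda>p q. \<sigma> (D (i + 1) p q))"
proof -
  note count = L.K.strand_count [OF \<beta>1(1) \<gamma>1 lin_mat_\<sigma> [OF st] lin_mat_\<sigma> [OF st]
      strand_inj_\<sigma> [OF st \<beta>1 \<beta>2] strand_surj_\<sigma> [OF st] strand_zero_\<sigma> [OF st]]
  have "(1 + r1) * n \<le> e1 * n" using count(1) by simp
  then show "1 + r1 \<le> e1" using n mult_le_cancel2 by blast
  show "L.K.strand_mid n n n (\<lambda>p q. \<sigma> (D i p q)) (\<lambda>p q. \<sigma> (D (i + 1) p q))" if "1 + r1 = e1"
    by (rule count(3)) (simp add: that [symmetric])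
qed

text \<open>Injectivity and surjectivity give \<open>1 + r1 \<le> e1\<close> and
  \<open>1 + r2 \<le> e2\<close>. The sums of both sides are equal by the dimension formula for the
  connected sum, so both are equalities, and equality means exactness in the middle.\<close>

lemma strand_\<sigma>:
  assumes st: "J.strand (\<lambda>_. n) D" and n: "n > 0"
    and \<beta>1: "L.K.hbasis 1 e1 \<beta>1" "2 \<le> e1" and \<beta>2: "R.K.hbasis 1 e2 \<beta>2" "2 \<le> e2"
    and \<gamma>1: "L.K.hbasis 2 r1 \<gamma>1" and \<gamma>2: "R.K.hbasis 2 r2 \<gamma>2" and e: "e1 + e2 = r1 + r2 + 2"
  shows "L.K.strand (\<lambda>_. n) (\<lambda>i p q. \<sigma> (D i p q))"
proof -
  have "1 + r1 \<le> e1" by (rule count_\<sigma>(1) [OF st n \<beta>1 \<beta>2 \<gamma>1])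
  moreover have "1 + r2 \<le> e2" by (rule connected_sum.count_\<sigma>(1) [OF swap st n \<beta>2 \<beta>1 \<gamma>2])
  ultimately have "1 + r1 = e1" using e by linarith
  then show ?thesis
    unfolding L.K.strand_def
    using lin_mat_\<sigma> [OF st] strand_inj_\<sigma> [OF st \<beta>1 \<beta>2] strand_surj_\<sigma> [OF st] strand_zero_\<sigma> [OF st]
      count_\<sigma>(2) [OF st n \<beta>1 \<beta>2 \<gamma>1] by blast
qed

text \<open>Let \<open>D u\<close> be congruent to \<open>f e_j\<close> over the connected sum.
  Because \<open>f = g\<close> there, the summands see only \<open>(e_j - c) f\<close> and
  \<open>c g\<close> for some constant vector \<open>c\<close>. Both can be lifted through constant
  vectors, with \<open>C v = e_j - c\<close> on the left and \<open>- C v' = c\<close> on the right,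
  and then \<open>v - v'\<close> solves \<open>C w = e_j\<close>.\<close>

lemma covers_\<sigma>:
  assumes st: "J.strand (\<lambda>_. n) D"
    and st1: "L.K.strand (\<lambda>_. n) (\<lambda>i p q. \<sigma> (D i p q))"
    and st2: "R.K.strand (\<lambda>_. n) (\<lambda>i p q. \<tau> (D i p q))"
    and j: "j < n"
  shows "\<exists>u. (\<forall>q<n. u q \<in> homog 1) \<and>
     (\<forall>p<n. mv n (\<lambda>p q. \<sigma> (D i p q)) u p - (if p = j then f else 0) \<in> I1)"
proof -
  let ?A = "\<lambda>i p q. \<sigma> (D i p q)" and ?B = "\<lambda>i p q. \<tau> (D i p q)"
  have "\<forall>p s. \<exists>c. p < n \<longrightarrow> s < n \<longrightarrow> \<sigma> (mm n (D i) (D (i + 1)) p s) - cst c * f \<in> I1 \<and>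
      \<tau> (mm n (D i) (D (i + 1)) p s) + cst c * g \<in> I2"
    using J.strandD(5) [OF st, of i] unfolding J.strand_zero_def J_iff by blast
  then obtain C where "\<And>p s. p < n \<Longrightarrow> s < n \<Longrightarrow> \<sigma> (mm n (D i) (D (i + 1)) p s) - cst (C p s) * f \<in> I1 \<and>
      \<tau> (mm n (D i) (D (i + 1)) p s) + cst (C p s) * g \<in> I2" by metis
  then have C1: "mm n (?A i) (?A (i + 1)) p s - cst (C p s) * f \<in> I1"
    and C2: "mm n (?B i) (?B (i + 1)) p s - cst (- C p s) * g \<in> I2" if "p < n" "s < n" for p s
    using that by (simp_all add: hmap_mm [OF \<sigma>] hmap_mm [OF \<tau>] cst_uminus)
  let ?z = "\<lambda>p. if p = j then \<iota> f else 0"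
  have \<tau>f: "\<tau> (\<iota> f) = 0" using L.f2 by (rule \<tau>\<iota>_pos [rotated]) simp
  have "\<forall>p<n. ?z p \<in> homog 2" using hmap_homog [OF \<iota> L.f2] by simp
  then obtain u where u: "\<And>q. q < n \<Longrightarrow> u q \<in> homog 1" "\<And>p. p < n \<Longrightarrow> J.cng (?z p) (mv n (D i) u p)"
    using J.strandD(3) [OF st, of i, unfolded J.strand_surj_def, rule_format, of ?z] by blast
  have "\<forall>p. \<exists>c. p < n \<longrightarrow> \<sigma> (?z p - mv n (D i) u p) - cst c * f \<in> I1 \<and>
      \<tau> (?z p - mv n (D i) u p) + cst c * g \<in> I2"
    using u(2) unfolding J.cng_def J_iff by blast
  then obtain c where c: "\<And>p. p < n \<Longrightarrow> \<sigma> (?z p - mv n (D i) u p) - cst (c p) * f \<in> I1 \<and>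
      \<tau> (?z p - mv n (D i) u p) + cst (c p) * g \<in> I2" by metis
  let ?e = "\<lambda>p. if p = j then 1 else 0 :: 'k"
  have \<sigma>u: "L.I.cng (mv n (?A i) (\<lambda>q. \<sigma> (u q)) p) (cst (?e p - c p) * f)" if p: "p < n" for p
  proof -
    have "\<sigma> (?z p) = cst (?e p) * f" by (simp add: \<sigma>\<iota> hmap_0 [OF \<sigma>])
    then have "L.I.cng (cst (?e p - c p) * f) (mv n (?A i) (\<lambda>q. \<sigma> (u q)) p)"
      using c [OF p] by (simp add: L.I.cng_def hmap_diff [OF \<sigma>] hmap_mv [OF \<sigma>] cst_diff algebra_simps)
    then show ?thesis by (rule L.I.cng_sym)
  qed
  have \<tau>u: "R.I.cng (mv n (?B i) (\<lambda>q. \<tau> (u q)) p) (cst (c p) * g)" if p: "p < n" for p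
  proof -
    have "\<tau> (?z p) = 0" by (simp add: \<tau>f hmap_0 [OF \<tau>])
    then have "R.I.cng (cst (c p) * g) (mv n (?B i) (\<lambda>q. \<tau> (u q)) p)"
      using c [OF p] by (simp add: R.I.cng_def hmap_diff [OF \<tau>] hmap_mv [OF \<tau>] algebra_simps)
    then show ?thesis by (rule R.I.cng_sym)
  qed
  obtain v where v: "\<And>p. p < n \<Longrightarrow> mv n C v p = ?e p - c p"
    by (rule L.lift_kernel [where C = C and u = "\<lambda>q. \<sigma> (u q)" and c = "\<lambda>p. ?e p - c p",
          OF L.K.strandD(4) [OF st1, of i] _ C1 hmap_homog [OF \<sigma> u(1)] \<sigma>u])
      (use lin_mat_\<sigma> [OF st] in auto)
  obtain v' where v': "\<And>p. p < n \<Longrightarrow> mv n (\<lambda>p s. - C p s) v' p = c p"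
    by (rule R.lift_kernel [where C = "\<lambda>p s. - C p s" and u = "\<lambda>q. \<tau> (u q)" and c = c,
          OF R.K.strandD(4) [OF st2, of i] _ C2 hmap_homog [OF \<tau> u(1)] \<tau>u])
      (use connected_sum.lin_mat_\<sigma> [OF swap st] in auto)
  \<comment> \<open>The minus sign matches the right summand, whose composite is \<open>- C\<close>
    times \<open>g\<close>.\<close>
  let ?w = "\<lambda>q. v q - v' q"
  have w: "mv n C ?w p = ?e p" if "p < n" for p
  proof -
    have "mv n (\<lambda>p s. - C p s) v' p = - mv n C v' p" by (simp add: mv_def sum_negf)
    then show ?thesis using v [OF that] v' [OF that] by (simp add: mv_diff)
  qed
  show ?thesis
  proof (intro exI [of _ "mv n (?A (i + 1)) (cvec ?w)"] conjI allI impI)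
    fix q assume "q < n"
    then show "mv n (?A (i + 1)) (cvec ?w) q \<in> homog 1"
      using lin_mat_\<sigma> [OF st, of "i + 1"] by (intro mv_homog_1) (simp add: lin_mat_def)
  next
    fix p assume p: "p < n"
    have "L.I.cng (mv n (?A i) (mv n (?A (i + 1)) (cvec ?w)) p) (cst (mv n C ?w p) * f)"
      by (rule L.mv_mv_matrix) (rule C1 [OF p])
    then show "mv n (?A i) (mv n (?A (i + 1)) (cvec ?w)) p - (if p = j then f else 0) \<in> I1"
      unfolding w [OF p] by (simp add: L.I.cng_def split: if_splits)
  qed
qed

lemma summand_bistrand:
  assumes pta: "J.pta r D" and pos: "r i0 > 0"
    and ng: "\<not> J.mult_ext" "\<not> L.K.mult_ext" "\<not> R.K.mult_ext"
  obtains n A where "n > 0" "L.K.bistrand (\<lambda>_. n) A" "covers I1 f n A"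
proof -
  obtain e1 \<beta>1 where \<beta>1: "L.K.hbasis 1 e1 \<beta>1" by (rule L.K.hbasis_exists)
  obtain e2 \<beta>2 where \<beta>2: "R.K.hbasis 1 e2 \<beta>2" by (rule R.K.hbasis_exists)
  obtain r1 \<gamma>1 where \<gamma>1: "L.K.hbasis 2 r1 \<gamma>1" by (rule L.K.hbasis_exists)
  obtain r2 \<gamma>2 where \<gamma>2: "R.K.hbasis 2 r2 \<gamma>2" by (rule R.K.hbasis_exists)
  note rank = J.constant_rank [OF pta ng(1) pos hbasis_1 [OF \<beta>1 \<beta>2] hbasis_2 [OF \<gamma>1 \<gamma>2]]
  have e: "e1 + e2 = r1 + r2 + 2" "e2 + e1 = r2 + r1 + 2" using rank(1) by simp_all
  obtain n where n: "n > 0" "r = (\<lambda>_. n)" using rank(2) by blast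
  have two: "2 \<le> e1" "2 \<le> e2" using L.two_le_embdim [OF ng(2) \<beta>1] R.two_le_embdim [OF ng(3) \<beta>2] .
  define D' where "D' = (\<lambda>i p q. hpart 1 (D i p q))"
  have st: "J.strand (\<lambda>_. n) D'" and st': "J.strand (\<lambda>_. n) (rev_mat D')"
    using J.bistrand_if_pta [OF pta ng(1)] unfolding J.bistrand_def D'_def n(2) rev_rank_def by blast+
  let ?A = "\<lambda>i p q. \<sigma> (D' i p q)"
  note s1 = strand_\<sigma> [OF _ n(1) \<beta>1 two(1) \<beta>2 two(2) \<gamma>1 \<gamma>2 e(1)]
  note s2 = connected_sum.strand_\<sigma> [OF swap _ n(1) \<beta>2 two(2) \<beta>1 two(1) \<gamma>2 \<gamma>1 e(2)]
  have "L.K.bistrand (\<lambda>_. n) ?A"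
    using s1 [OF st] s1 [OF st'] by (simp add: L.K.bistrand_def rev_rank_def rev_mat_def)
  moreover have "covers I1 f n ?A"
    unfolding covers_def using covers_\<sigma> [OF st s1 [OF st] s2 [OF st]] by blast
  ultimately show ?thesis using n(1) that by blast
qed

end

section \<open>From the summands to the connected sum\<close>

definition minv :: "nat \<Rightarrow> (nat \<Rightarrow> nat \<Rightarrow> 'k::field) \<Rightarrow> (nat \<Rightarrow> nat \<Rightarrow> 'k) \<Rightarrow> bool" where
  "minv n M N \<longleftrightarrow> (\<forall>p<n. \<forall>q<n. mm n M N p q = (if p = q then 1 else 0) \<and>
     mm n N M p q = (if p = q then 1 else 0))"

lemma minv_sym: "minv n M N \<Longrightarrow> minv n N M"
  by (simp add: minv_def)

lemma mm_assoc: "mm n (mm m A B) C p q = mm m A (mm n B C) p q"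
  unfolding mm_def sum_distrib_left sum_distrib_right by (subst sum.swap) (simp add: mult.assoc)

lemma mm_cong:
  "(\<And>s. s < n \<Longrightarrow> A p s = A' p s) \<Longrightarrow> (\<And>s. s < n \<Longrightarrow> B s q = B' s q) \<Longrightarrow> mm n A B p q = mm n A' B' p q"
  by (simp add: mm_def)

lemma mm_id_left: "p < n \<Longrightarrow> mm n (\<lambda>p q. if p = q then 1 else 0) A p q = A p q"
proof -
  assume p: "p < n"
  have "mm n (\<lambda>p q. if p = q then 1 else 0) A p q = (\<Sum>s<n. if p = s then A s q else 0)"
    unfolding mm_def by (rule sum.cong) auto
  then show ?thesis using p by simp
qed

lemma mm_id_right: "q < n \<Longrightarrow> mm n A (\<lambda>p q. if p = q then 1 else 0) p q = A p q"
proof -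
  assume q: "q < n"
  have "mm n A (\<lambda>p q. if p = q then 1 else 0) p q = (\<Sum>s<n. if s = q then A p s else 0)"
    unfolding mm_def by (rule sum.cong) auto
  then show ?thesis using q by simp
qed

lemma mm_transpose: "mm n (\<lambda>p q. A q p) (\<lambda>p q. B q p) p q = mm n B A q (p :: nat)"
  by (simp add: mm_def mult.commute)

lemma minv_transpose: "minv n M N \<Longrightarrow> minv n (\<lambda>p q. M q p) (\<lambda>p q. N q p)"
  unfolding minv_def mm_transpose [where A = M and B = N] mm_transpose [where A = N and B = M] by auto

lemma mm_cancel:
  assumes "\<And>q. q < n \<Longrightarrow> mm n M N p q = (if p = q then 1 else 0)" "p < n"
  shows "mm n M (mm n N A) p q = A p q"
proof -
  have "mm n M (mm n N A) p q = mm n (mm n M N) A p q" by (rule mm_assoc [symmetric])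
  also have "\<dots> = mm n (\<lambda>p q. if p = q then 1 else 0) A p q" by (rule mm_cong) (simp_all add: assms)
  finally show ?thesis by (simp add: mm_id_left assms)
qed

lemma minv_mult:
  assumes M: "minv n M N" and T: "minv n T T'"
  shows "minv n (mm n M T) (mm n T' N)"
proof -
  have 1: "mm n (mm n M T) (mm n T' N) p q = (if p = q then 1 else 0)" if "p < n" "q < n" for p q
  proof -
    have "mm n (mm n M T) (mm n T' N) p q = mm n M (mm n T (mm n T' N)) p q" by (rule mm_assoc)
    also have "\<dots> = mm n M N p q"
      by (rule mm_cong) (use T in \<open>simp_all add: mm_cancel minv_def\<close>)
    finally show ?thesis using M that by (simp add: minv_def)
  qed
  have 2: "mm n (mm n T' N) (mm n M T) p q = (if p = q then 1 else 0)" if "p < n" "q < n" for p q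
  proof -
    have "mm n (mm n T' N) (mm n M T) p q = mm n T' (mm n N (mm n M T)) p q" by (rule mm_assoc)
    also have "\<dots> = mm n T' T p q"
      by (rule mm_cong) (use M in \<open>simp_all add: mm_cancel minv_def\<close>)
    finally show ?thesis using T that by (simp add: minv_def)
  qed
  show ?thesis using 1 2 by (simp add: minv_def)
qed

text \<open>\<open>M N = 1\<close> makes \<open>N\<close> injective, and being square it has a right
  inverse \<open>E\<close>. Then \<open>M = M N E = E\<close>, so \<open>N M = 1\<close>
  too.\<close>

lemma minv_if_right_inverse:
  assumes r: "\<And>p q. p < n \<Longrightarrow> q < n \<Longrightarrow> mm n M N p q = (if p = q then 1 else 0)"
  shows "minv n M N"
proof -
  have inj: "\<forall>i\<in>{..<n}. c i = 0" if c: "\<forall>j\<in>{..<n}. (\<Sum>i\<in>{..<n}. c i * N j i) = 0" for c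
  proof
    fix i assume i: "i \<in> {..<n}"
    have "(\<Sum>j<n. M i j * (\<Sum>t<n. c t * N j t)) = (\<Sum>t<n. c t * mm n M N i t)"
      unfolding mm_def sum_distrib_left by (subst sum.swap) (simp add: mult.left_commute)
    also have "\<dots> = (\<Sum>t<n. if i = t then c t else 0)" by (rule sum.cong) (use i r in auto)
    finally show "c i = 0" using i c by simp
  qed
  have "\<forall>q. \<exists>c. \<forall>j\<in>{..<n}. (\<Sum>i\<in>{..<n}. c i * N j i) = (if j = q then 1 else 0)"
    by (rule allI, rule injective_matrix_surj [where M = "\<lambda>i j. N j i", OF _ _ inj]) simp_all
  then obtain c where c: "\<And>q j. j < n \<Longrightarrow> (\<Sum>i<n. c q i * N j i) = (if j = q then 1 else 0)"
    by (metis lessThan_iff)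
  define E where "E i q = c q i" for i q
  have NE: "mm n N E p q = (if p = q then 1 else 0)" if "p < n" for p q
    using c [OF that, of q] by (simp add: mm_def E_def mult.commute)
  have "M p q = E p q" if "p < n" "q < n" for p q
  proof -
    have "M p q = mm n M (mm n N E) p q"
      by (subst mm_cong [of n M p M "mm n N E" q "\<lambda>p q. if p = q then 1 else 0"])
        (simp_all add: NE mm_id_right that)
    also have "\<dots> = E p q" by (rule mm_cancel) (use r that in simp_all)
    finally show ?thesis .
  qed
  then have "mm n N M p q = mm n N E p q" if "p < n" "q < n" for p q
    by (intro mm_cong) (simp_all add: that)
  then show ?thesis using r NE by (simp add: minv_def)
qed

text \<open>Two-sided dependent choice: one sequence runs upwards and one downwards. The condition
  at \<open>n = 0\<close> pins both to the same \<open>x0\<close>, so that they can be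
  joined.\<close>

lemma int_chain:
  assumes ex: "\<exists>x. P x" and up: "\<And>i x. P x \<Longrightarrow> \<exists>y. P y \<and> Q i x y"
    and down: "\<And>i y. P y \<Longrightarrow> \<exists>x. P x \<and> Q i x y"
  shows "\<exists>x :: int \<Rightarrow> 'a. \<forall>i. P (x i) \<and> Q i (x i) (x (i + 1))"
proof -
  obtain x0 where x0: "P x0" using ex by blast
  have "\<exists>u. \<forall>n. P (u n) \<and> (n = 0 \<longrightarrow> u n = x0) \<and> Q (int n) (u n) (u (Suc n))"
    by (rule dependent_nat_choice [where P = "\<lambda>n x. P x \<and> (n = 0 \<longrightarrow> x = x0)"
          and Q = "\<lambda>n x y. Q (int n) x y", simplified conj_assoc]) (use x0 up in auto)
  then obtain u where u: "\<And>n. P (u n)" "u 0 = x0" "\<And>n. Q (int n) (u n) (u (Suc n))" by blast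
  have "\<exists>d. \<forall>n. P (d n) \<and> (n = 0 \<longrightarrow> d n = x0) \<and> Q (- int n - 1) (d (Suc n)) (d n)"
    by (rule dependent_nat_choice [where P = "\<lambda>n x. P x \<and> (n = 0 \<longrightarrow> x = x0)"
          and Q = "\<lambda>n x y. Q (- int n - 1) y x", simplified conj_assoc]) (use x0 down in auto)
  then obtain d where d: "\<And>n. P (d n)" "d 0 = x0" "\<And>n. Q (- int n - 1) (d (Suc n)) (d n)" by blast
  define x where "x i = (if i \<ge> 0 then u (nat i) else d (nat (- i)))" for i
  have "Q i (x i) (x (i + 1))" for i
  proof (cases "i \<ge> 0")
    case True
    then show ?thesis using u(3) [of "nat i"] by (simp add: x_def nat_add_distrib)
  next
    case False
    define n where "n = nat (- i - 1)"
    have i: "i = - int n - 1" using False by (simp add: n_def)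
    have "nat (- i) = Suc n" using i by (simp add: nat_add_distrib)
    then have "x i = d (Suc n)" using False by (simp add: x_def)
    moreover have "x (i + 1) = d n" using u(2) d(2) by (simp add: x_def i)
    ultimately show ?thesis using d(3) [of n] i by simp
  qed
  then show ?thesis using u(1) d(1) by (intro exI [of _ x]) (simp add: x_def)
qed

text \<open>The equation \<open>M i M (i+1) = T i\<close> determines each factor from its neighbour,
  as the inverse of \<open>M i\<close> times \<open>T i\<close> going up and as \<open>T i\<close>
  times the inverse of \<open>M (i+1)\<close> going down. Carrying the inverses along keeps the
  recursion within invertible matrices.\<close>

lemma invertible_chain:
  fixes T T' :: "int \<Rightarrow> nat \<Rightarrow> nat \<Rightarrow> 'k::field"
  assumes T: "\<And>i. minv n (T i) (T' i)"
  obtains M M' where "\<And>i. minv n (M i) (M' i)"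
    and "\<And>i p q. p < n \<Longrightarrow> q < n \<Longrightarrow> mm n (M i) (M (i + 1)) p q = T i p q"
proof -
  let ?P = "\<lambda>(M, N :: nat \<Rightarrow> nat \<Rightarrow> 'k). minv n M N"
  let ?Q = "\<lambda>i (M, N :: nat \<Rightarrow> nat \<Rightarrow> 'k) (M', N' :: nat \<Rightarrow> nat \<Rightarrow> 'k). \<forall>p<n. \<forall>q<n. mm n M M' p q = T i p q"
  have "\<exists>x :: int \<Rightarrow> _. \<forall>i. ?P (x i) \<and> ?Q i (x i) (x (i + 1))"
  proof (rule int_chain)
    let ?I = "\<lambda>p q. if p = q then 1 else 0 :: 'k"
    have "minv n ?I ?I" by (simp add: minv_def mm_id_left)
    then show "\<exists>x. ?P x" by (intro exI [of _ "(?I, ?I)"]) simp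
  next
    fix i and x :: "(nat \<Rightarrow> nat \<Rightarrow> 'k) \<times> (nat \<Rightarrow> nat \<Rightarrow> 'k)" assume x: "?P x"
    obtain M N where xe: "x = (M, N)" by (cases x)
    with x have M: "minv n M N" by simp
    show "\<exists>y. ?P y \<and> ?Q i x y"
    proof (intro exI [of _ "(mm n N (T i), mm n (T' i) M)"] conjI)
      show "?P (mm n N (T i), mm n (T' i) M)" using minv_mult [OF minv_sym [OF M] T] by simp
      show "?Q i x (mm n N (T i), mm n (T' i) M)"
        using M by (simp add: xe mm_cancel minv_def)
    qed
  next
    fix i and y :: "(nat \<Rightarrow> nat \<Rightarrow> 'k) \<times> (nat \<Rightarrow> nat \<Rightarrow> 'k)" assume y: "?P y"
    obtain M N where ye: "y = (M, N)" by (cases y)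
    with y have M: "minv n M N" by simp
    show "\<exists>x. ?P x \<and> ?Q i x y"
    proof (intro exI [of _ "(mm n (T i) N, mm n M (T' i))"] conjI)
      show "?P (mm n (T i) N, mm n M (T' i))" using minv_mult [OF T minv_sym [OF M]] by simp
      have "mm n (mm n (T i) N) M p q = T i p q" if "p < n" "q < n" for p q
      proof -
        have "mm n (mm n (T i) N) M p q = mm n (T i) (mm n N M) p q" by (rule mm_assoc)
        also have "\<dots> = mm n (T i) (\<lambda>p q. if p = q then 1 else 0) p q"
          by (rule mm_cong) (use M that in \<open>simp_all add: minv_def\<close>)
        finally show ?thesis by (simp add: mm_id_right that)
      qed
      then show "?Q i (mm n (T i) N, mm n M (T' i)) y" by (simp add: ye)
    qed
  qed
  then obtain x where x: "\<And>i. ?P (x i) \<and> ?Q i (x i) (x (i + 1))" by blast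
  show ?thesis
  proof (rule that [of "\<lambda>i. fst (x i)" "\<lambda>i. snd (x i)"])
    fix i show "minv n (fst (x i)) (snd (x i))" using x [of i] by (simp add: case_prod_unfold)
  next
    fix i p q assume "p < n" "q < n"
    then show "mm n (fst (x i)) (fst (x (i + 1))) p q = T i p q"
      using x [of i] by (simp add: case_prod_unfold)
  qed
qed

text \<open>A bijection between \<open>{..<N}\<close> and pairs. It is abstract so that exchanging
  the factors gives another instance with the same \<open>N\<close>: the two tensor products to be
  added, one with the constant factor on the right and one with it on the left, then share their
  index set.\<close>

locale index_pairs =
  fixes n m N :: nat and a b :: "nat \<Rightarrow> nat" and idx :: "nat \<Rightarrow> nat \<Rightarrow> nat"
  assumes a_less: "q < N \<Longrightarrow> a q < n" and b_less: "q < N \<Longrightarrow> b q < m"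
    and idx_ab: "q < N \<Longrightarrow> idx (a q) (b q) = q"
    and idx_less: "s < n \<Longrightarrow> t < m \<Longrightarrow> idx s t < N"
    and a_idx: "s < n \<Longrightarrow> t < m \<Longrightarrow> a (idx s t) = s"
    and b_idx: "s < n \<Longrightarrow> t < m \<Longrightarrow> b (idx s t) = t"
begin

lemma index_swap: "index_pairs m n N b a (\<lambda>t s. idx s t)"
  by unfold_locales (simp_all add: a_less b_less idx_ab idx_less a_idx b_idx)

lemma ab_eq_iff: "p < N \<Longrightarrow> q < N \<Longrightarrow> p = q \<longleftrightarrow> a p = a q \<and> b p = b q"
proof -
  assume "p < N" "q < N"
  then have p: "p = idx (a p) (b p)" and q: "q = idx (a q) (b q)" by (simp_all only: idx_ab)
  show "p = q \<longleftrightarrow> a p = a q \<and> b p = b q"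
  proof
    assume "a p = a q \<and> b p = b q"
    then have "idx (a p) (b p) = idx (a q) (b q)" by simp
    from trans [OF trans [OF p this] q [symmetric]] show "p = q" .
  qed simp
qed

lemma sum_idx: "(\<Sum>q<N. G q) = (\<Sum>s<n. \<Sum>t<m. G (idx s t))"
proof -
  have "bij_betw (\<lambda>q. (a q, b q)) {..<N} ({..<n} \<times> {..<m})"
    by (rule bij_betw_byWitness [where f' = "\<lambda>(s, t). idx s t"])
      (auto simp: a_less b_less idx_ab idx_less a_idx b_idx)
  from sum.reindex_bij_betw [OF this, of "\<lambda>(s, t). G (idx s t)"]
  show ?thesis by (simp add: idx_ab sum.cartesian_product)
qed

text \<open>The Kronecker product of \<open>A\<close> and the constant matrix
  \<open>\<alpha>\<close> under this numbering. In the swapped instance the same formula gives the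
  product with the constant factor on the other side.\<close>

definition kron :: "(nat \<Rightarrow> nat \<Rightarrow> ('x, 'k::field) mpoly) \<Rightarrow> (nat \<Rightarrow> nat \<Rightarrow> 'k) \<Rightarrow> nat \<Rightarrow> nat \<Rightarrow> ('x, 'k) mpoly" where
  "kron A \<alpha> p q = A (a p) (a q) * cst (\<alpha> (b p) (b q))"

lemma mv_kron:
  "p < N \<Longrightarrow> mv N (kron A \<alpha>) v p = mv n A (\<lambda>s. \<Sum>t<m. cst (\<alpha> (b p) t) * v (idx s t)) (a p)"
  unfolding mv_def sum_idx kron_def sum_distrib_left
  by (rule sum.cong [OF refl], rule sum.cong [OF refl]) (simp add: a_idx b_idx mult.assoc)

lemma mm_kron:
  assumes "p < N" "q < N"
  shows "mm N (kron A \<alpha>) (kron B \<beta>) p q = mm n A B (a p) (a q) * cst (mm m \<alpha> \<beta> (b p) (b q))"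
proof -
  have "mm N (kron A \<alpha>) (kron B \<beta>) p q =
      (\<Sum>s<n. \<Sum>t<m. (A (a p) s * B s (a q)) * cst (\<alpha> (b p) t * \<beta> t (b q)))"
    unfolding mm_def sum_idx kron_def
    by (intro sum.cong refl) (simp add: a_idx b_idx cst_mult ac_simps)
  then show ?thesis unfolding mm_def by (simp add: cst_sum sum_product)
qed

lemma minv_kron:
  assumes "minv n C C'" "minv m E E'"
  shows "minv N (\<lambda>p q. C (a p) (a q) * E (b p) (b q)) (\<lambda>p q. C' (a p) (a q) * E' (b p) (b q))"
proof -
  have prod: "mm N (\<lambda>p q. C (a p) (a q) * E (b p) (b q)) (\<lambda>p q. C' (a p) (a q) * E' (b p) (b q)) p q =
      mm n C C' (a p) (a q) * mm m E E' (b p) (b q)" if "p < N" "q < N" for p q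
    and C C' E E' :: "nat \<Rightarrow> nat \<Rightarrow> 'k::field"
  proof -
    have "mm N (\<lambda>p q. C (a p) (a q) * E (b p) (b q)) (\<lambda>p q. C' (a p) (a q) * E' (b p) (b q)) p q =
        (\<Sum>s<n. \<Sum>t<m. (C (a p) s * C' s (a q)) * (E (b p) t * E' t (b q)))"
      unfolding mm_def sum_idx by (intro sum.cong refl) (simp add: a_idx b_idx ac_simps)
    then show ?thesis unfolding mm_def by (simp add: sum_product)
  qed
  show ?thesis
    unfolding minv_def
  proof (intro allI impI)
    fix p q assume p: "p < N" and q: "q < N"
    show "mm N (\<lambda>p q. C (a p) (a q) * E (b p) (b q)) (\<lambda>p q. C' (a p) (a q) * E' (b p) (b q)) p q =
          (if p = q then 1 else 0) \<and>
        mm N (\<lambda>p q. C' (a p) (a q) * E' (b p) (b q)) (\<lambda>p q. C (a p) (a q) * E (b p) (b q)) p q =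
          (if p = q then 1 else 0)"
      unfolding prod [OF p q] ab_eq_iff [OF p q]
      using assms a_less [OF p] a_less [OF q] b_less [OF p] b_less [OF q] by (simp add: minv_def)
  qed
qed

end

lemma index_pairs_div_mod:
  assumes "m > 0" shows "index_pairs n m (n * m) (\<lambda>p. p div m) (\<lambda>p. p mod m) (\<lambda>s t. s * m + t)"
proof
  fix q assume "q < n * m"
  then show "q div m < n" by (simp add: less_mult_imp_div_less)
next
  fix s t assume "s < n" "t < m"
  then have "s * m + t < s * m + m" "s * m + m \<le> n * m"
    using mult_le_mono1 [of "Suc s" n m] by auto
  then show "s * m + t < n * m" by simp
qed (use assms in auto)

lemma minv_cst_cancel:
  assumes "minv m M M'" "t < m"
  shows "(\<Sum>t'<m. cst (M t t') * (\<Sum>s<m. cst (M' t' s) * x s)) = (x t :: ('x, 'k::field) mpoly)"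
proof -
  have "(\<Sum>t'<m. cst (M t t') * (\<Sum>s<m. cst (M' t' s) * x s)) = (\<Sum>s<m. cst (mm m M M' t s) * x s)"
    unfolding mm_def sum_distrib_left cst_sum sum_distrib_right
    by (subst sum.swap) (simp add: cst_mult mult.assoc)
  also have "\<dots> = (\<Sum>s<m. if t = s then x s else 0)"
    using assms by (intro sum.cong) (auto simp: minv_def)
  finally show ?thesis using assms by simp
qed

context short_ideal
begin

text \<open>Up to a change of basis in every degree the new strand is a direct sum of
  \<open>m\<close> copies of the old one. Each property is reduced to \<open>A\<close> by applying
  \<open>\<alpha> i\<close> or its inverse to the second index.\<close>

lemma strand_kron:
  assumes "index_pairs n m N a b idx"
    and st: "strand (\<lambda>_. n) A" and inv: "\<And>i. minv m (\<alpha> i) (\<alpha>' i)"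
  shows "strand (\<lambda>_. N) (\<lambda>i. index_pairs.kron a b (A i) (\<alpha> i))"
proof -
  interpret index_pairs n m N a b idx by (rule assms)
  note st' = strandD [OF st]
  show ?thesis
    unfolding strand_def
  proof (intro allI conjI)
    fix i
    show "lin_mat N N (kron (A i) (\<alpha> i))"
      unfolding lin_mat_def
    proof (intro allI impI)
      fix p q assume "p < N" "q < N"
      then have "A i (a p) (a q) \<in> homog 1" using st'(1) [of i] by (simp add: lin_mat_def a_less)
      then show "kron (A i) (\<alpha> i) p q \<in> homog 1"
        unfolding kron_def by (subst mult.commute) (rule homog_cst_mult)
    qed
    show "strand_inj N N (kron (A i) (\<alpha> i))"
      unfolding strand_inj_def
    proof (intro allI impI)
      fix v q assume v: "\<forall>p<N. mv N (kron (A i) (\<alpha> i)) (cvec v) p \<in> J" and q: "q < N"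
      have z: "(\<Sum>t<m. \<alpha> i t' t * v (idx s t)) = 0" if s: "s < n" and t': "t' < m" for s t'
      proof -
        have "mv n (A i) (cvec (\<lambda>s. \<Sum>t<m. \<alpha> i t' t * v (idx s t))) s' \<in> J" if s': "s' < n" for s'
          using v [rule_format, OF idx_less [OF s' t']] mv_kron [OF idx_less [OF s' t'], of "A i" "\<alpha> i" "cvec v"]
          by (simp add: a_idx [OF s' t'] b_idx [OF s' t'] cvec_def cst_sum cst_mult)
        then show ?thesis
          using st'(2) [of i, unfolded strand_inj_def, rule_format, OF _ s, of "\<lambda>s. \<Sum>t<m. \<alpha> i t' t * v (idx s t)"]
          by simp
      qed
      have "cst (v (idx (a q) (b q))) = (\<Sum>t'<m. cst (\<alpha>' i (b q) t') * (\<Sum>t<m. cst (\<alpha> i t' t) * (cst (v (idx (a q) t)) :: ('x, 'k) mpoly)))"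
        by (rule minv_cst_cancel [OF minv_sym [OF inv] b_less [OF q], symmetric])
      also have "\<dots> = (\<Sum>t'<m. cst (\<alpha>' i (b q) t') * cst (\<Sum>t<m. \<alpha> i t' t * v (idx (a q) t)))"
        by (simp add: cst_sum cst_mult)
      also have "\<dots> = 0" using z a_less [OF q] by simp
      finally show "v q = 0" by (simp add: idx_ab [OF q])
    qed
    show "strand_surj N N (kron (A i) (\<alpha> i))"
      unfolding strand_surj_def
    proof (intro allI impI)
      fix z :: "nat \<Rightarrow> ('x, 'k) mpoly" assume z: "\<forall>p<N. z p \<in> homog 2"
      have "\<exists>u. t < m \<longrightarrow> (\<forall>q<n. u q \<in> homog 1) \<and> (\<forall>s<n. cng (z (idx s t)) (mv n (A i) u s))" for t
      proof (cases "t < m")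
        case True
        then have "\<forall>s<n. z (idx s t) \<in> homog 2" using z idx_less by blast
        then show ?thesis
          using st'(3) [of i, unfolded strand_surj_def, rule_format, of "\<lambda>s. z (idx s t)"] by blast
      qed simp
      then obtain u where u: "\<And>t q. t < m \<Longrightarrow> q < n \<Longrightarrow> u t q \<in> homog 1"
        "\<And>t s. t < m \<Longrightarrow> s < n \<Longrightarrow> cng (z (idx s t)) (mv n (A i) (u t) s)" by metis
      \<comment> \<open>The \<open>m\<close> copies are solved separately by \<open>u t\<close>, and
        the inverse of \<open>\<alpha> i\<close> compensates the mixing of copies by the
        matrix.\<close>
      define v where "v q = (\<Sum>t<m. cst (\<alpha>' i (b q) t) * u t (a q))" for q
      show "\<exists>u. (\<forall>q<N. u q \<in> homog 1) \<and> (\<forall>p<N. cng (z p) (mv N (kron (A i) (\<alpha> i)) u p))"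
      proof (intro exI [of _ v] conjI allI impI)
        fix q assume "q < N"
        then show "v q \<in> homog 1" unfolding v_def by (intro homog_sum homog_cst_mult u a_less) simp
      next
        fix p assume p: "p < N"
        have "mv n (A i) (\<lambda>s. \<Sum>t<m. cst (\<alpha> i (b p) t) * v (idx s t)) (a p) = mv n (A i) (u (b p)) (a p)"
        proof (rule mv_cong)
          fix s assume s: "s < n"
          have "(\<Sum>t<m. cst (\<alpha> i (b p) t) * v (idx s t)) =
              (\<Sum>t<m. cst (\<alpha> i (b p) t) * (\<Sum>t'<m. cst (\<alpha>' i t t') * u t' s))"
            by (rule sum.cong) (simp_all add: v_def a_idx b_idx s)
          then show "(\<Sum>t<m. cst (\<alpha> i (b p) t) * v (idx s t)) = u (b p) s"
            by (simp add: minv_cst_cancel [OF inv b_less [OF p]])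
        qed
        then show "cng (z p) (mv N (kron (A i) (\<alpha> i)) v p)"
          using u(2) [OF b_less [OF p] a_less [OF p]] by (simp add: mv_kron p idx_ab)
      qed
    qed
    show "strand_mid N N N (kron (A i) (\<alpha> i)) (kron (A (i + 1)) (\<alpha> (i + 1)))"
      unfolding strand_mid_def
    proof (intro allI impI)
      fix u :: "nat \<Rightarrow> ('x, 'k) mpoly"
      assume u: "\<forall>q<N. u q \<in> homog 1" and k: "\<forall>p<N. mv N (kron (A i) (\<alpha> i)) u p \<in> J"
      define w where "w t' s = (\<Sum>t<m. cst (\<alpha> i t' t) * u (idx s t))" for t' s
      have "\<exists>y. t' < m \<longrightarrow> (\<forall>s<n. cng (w t' s) (mv n (A (i + 1)) (cvec y) s))" for t'
      proof (cases "t' < m")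
        case True
        have "\<forall>s<n. w t' s \<in> homog 1"
          unfolding w_def using u idx_less by (auto intro!: homog_sum homog_cst_mult)
        moreover have "\<forall>s<n. mv n (A i) (w t') s \<in> J"
        proof (intro allI impI)
          fix s assume s: "s < n"
          show "mv n (A i) (w t') s \<in> J"
            using k [rule_format, OF idx_less [OF s True]] mv_kron [OF idx_less [OF s True], of "A i" "\<alpha> i" u]
            by (simp add: a_idx [OF s True] b_idx [OF s True] w_def [abs_def])
        qed
        ultimately show ?thesis
          using st'(4) [of i, unfolded strand_mid_def, rule_format, of "w t'"] by blast
      qed simp
      then obtain y where y: "\<And>t' s. t' < m \<Longrightarrow> s < n \<Longrightarrow> cng (w t' s) (mv n (A (i + 1)) (cvec (y t')) s)"
        by metis
      \<comment> \<open>Two changes of basis are undone: \<open>h\<close> removes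
        \<open>\<alpha> i\<close>, which was applied to the cycle to obtain cycles of
        \<open>A\<close>, and \<open>v\<close> anticipates \<open>\<alpha> (i + 1)\<close> of the
        next matrix.\<close>
      define h where "h t s = (\<Sum>t'<m. \<alpha>' i t t' * y t' s)" for t s
      define v where "v q = (\<Sum>t<m. \<alpha>' (i + 1) (b q) t * h t (a q))" for q
      show "\<exists>v. \<forall>q<N. cng (u q) (mv N (kron (A (i + 1)) (\<alpha> (i + 1))) (cvec v) q)"
      proof (intro exI [of _ v] allI impI)
        fix q assume q: "q < N"
        have "u q = (\<Sum>t'<m. cst (\<alpha>' i (b q) t') * w t' (a q))"
          using minv_cst_cancel [OF minv_sym [OF inv] b_less [OF q], of i "\<lambda>t. u (idx (a q) t)"]
          by (simp add: w_def idx_ab q)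
        moreover have "cng (\<Sum>t'<m. cst (\<alpha>' i (b q) t') * w t' (a q))
            (\<Sum>t'<m. cst (\<alpha>' i (b q) t') * mv n (A (i + 1)) (cvec (y t')) (a q))"
          by (intro cng_sum cng_mult_left y a_less q) simp
        moreover have "(\<Sum>t'<m. cst (\<alpha>' i (b q) t') * mv n (A (i + 1)) (cvec (y t')) (a q)) =
            mv n (A (i + 1)) (cvec (h (b q))) (a q)"
          by (simp add: mv_scale [symmetric] mv_sum [symmetric] cvec_def h_def cst_sum cst_mult)
        moreover have "mv N (kron (A (i + 1)) (\<alpha> (i + 1))) (cvec v) q = mv n (A (i + 1)) (cvec (h (b q))) (a q)"
          unfolding mv_kron [OF q]
        proof (rule mv_cong)
          fix s assume s: "s < n"
          have "(\<Sum>t<m. cst (\<alpha> (i + 1) (b q) t) * cvec v (idx s t)) =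
              (\<Sum>t<m. cst (\<alpha> (i + 1) (b q) t) * (\<Sum>t'<m. cst (\<alpha>' (i + 1) t t') * cst (h t' s)))"
            by (rule sum.cong) (simp_all add: cvec_def v_def a_idx b_idx s cst_sum cst_mult)
          then show "(\<Sum>t<m. cst (\<alpha> (i + 1) (b q) t) * cvec v (idx s t)) = cvec (h (b q)) s"
            by (simp add: minv_cst_cancel [OF inv b_less [OF q]] cvec_def)
        qed
        ultimately show "cng (u q) (mv N (kron (A (i + 1)) (\<alpha> (i + 1))) (cvec v) q)" by simp
      qed
    qed
    show "strand_zero N N N (kron (A i) (\<alpha> i)) (kron (A (i + 1)) (\<alpha> (i + 1)))"
      using st'(5) [of i] by (auto simp: strand_zero_def mm_kron a_less intro!: mult_in')
  qed
qed

end

lemma mv_minv_cancel: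
  assumes "minv n M M'" "p < n" shows "mv n M (mv n M' v) p = v p"
proof -
  have "mv n M (mv n M' v) p = mv n (\<lambda>p q. if p = q then 1 else 0) v p"
    unfolding mv_mv using assms by (simp add: mv_def minv_def)
  also have "\<dots> = (\<Sum>q<n. if p = q then v q else 0)"
    unfolding mv_def by (rule sum.cong) auto
  finally show ?thesis using assms(2) by simp
qed

lemma mv_minv_inj:
  assumes "minv n M M'" "\<And>p. p < n \<Longrightarrow> mv n M v p = mv n M w p" "q < n"
  shows "v q = w q"
proof -
  have "mv n M' (mv n M v) q = mv n M' (mv n M w) q" by (rule mv_cong) (rule assms(2))
  then show ?thesis using mv_minv_cancel [OF minv_sym [OF assms(1)] assms(3)] by simp
qed

context quadric_quotient
begin

text \<open>By the lifting condition each \<open>f e_j\<close> is attained on linear vectors, which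
  \<open>lift_kernel\<close> turns into \<open>C v = e_j\<close>. These \<open>v\<close> are the
  columns of a right inverse.\<close>

lemma strand_invertible_matrix:
  assumes st: "K.strand (\<lambda>_. n) A" and cov: "covers I f n A"
  obtains C C' where "minv n C C'"
    and "\<And>p j. p < n \<Longrightarrow> j < n \<Longrightarrow> mm n (A i) (A (i + 1)) p j - cst (C p j) * f \<in> I"
proof -
  obtain C where C: "\<And>p j. p < n \<Longrightarrow> j < n \<Longrightarrow> mm n (A i) (A (i + 1)) p j - cst (C p j) * f \<in> I"
    by (rule strand_matrix [OF K.strandD(5) [OF st, of i]]) blast
  have "\<exists>v. j < n \<longrightarrow> (\<forall>p<n. mv n C v p = (if p = j then 1 else 0))" for j
  proof (cases "j < n")
    case True
    then obtain u where u: "\<And>q. q < n \<Longrightarrow> u q \<in> homog 1"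
      "\<And>p. p < n \<Longrightarrow> mv n (A i) u p - (if p = j then f else 0) \<in> I"
      using cov unfolding covers_def by blast
    have c: "I.cng (mv n (A i) u p) (cst (if p = j then 1 else 0) * f)" if "p < n" for p
      using u(2) [OF that] by (cases "p = j") (simp_all add: I.cng_def)
    have lin: "lin_mat n n (A (i + 1))" using K.strandD(1) [OF st, of "i + 1"] by simp
    obtain v where "\<And>p. p < n \<Longrightarrow> mv n C v p = (if p = j then 1 else 0)"
      by (rule lift_kernel [where C = C and u = u and c = "\<lambda>p. if p = j then 1 else 0",
            OF K.strandD(4) [OF st, of i] lin C u(1) c]) auto
    then show ?thesis by (intro exI [of _ v]) simp
  qed simp
  then obtain V where V: "\<And>j p. j < n \<Longrightarrow> p < n \<Longrightarrow> mv n C (V j) p = (if p = j then 1 else 0)" by metis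
  have "minv n C (\<lambda>q j. V j q)"
    by (rule minv_if_right_inverse) (use V in \<open>simp add: mm_def mv_def\<close>)
  with C that show ?thesis by blast
qed

end

context connected_sum
begin

text \<open>Opposite signs in \<open>CA\<close> and \<open>CB\<close> make the composites vanish, as
  \<open>f = g\<close>. Injectivity comes from the left summand alone; surjectivity and exactness in
  the middle need \<open>C\<close> to be invertible.\<close>

lemma glue_strand:
  assumes A: "L.K.strand (\<lambda>_. n) A" and B: "R.K.strand (\<lambda>_. n) B"
    and C: "\<And>i. minv n (C i) (C' i)"
    and CA: "\<And>i p q. p < n \<Longrightarrow> q < n \<Longrightarrow> mm n (A i) (A (i + 1)) p q - cst (C i p q) * f \<in> I1"
    and CB: "\<And>i p q. p < n \<Longrightarrow> q < n \<Longrightarrow> mm n (B i) (B (i + 1)) p q + cst (C i p q) * g \<in> I2"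
  shows "J.strand (\<lambda>_. n) (\<lambda>i p q. \<iota> (A i p q) + \<kappa> (B i p q))"
  unfolding J.strand_def
proof (intro allI conjI)
  fix i
  let ?D = "\<lambda>i p q. \<iota> (A i p q) + \<kappa> (B i p q)"
  have A1: "A i p q \<in> homog 1" if "p < n" "q < n" for i p q
    using L.K.strandD(1) [OF A, of i] that by (simp add: lin_mat_def)
  have B1: "B i p q \<in> homog 1" if "p < n" "q < n" for i p q
    using R.K.strandD(1) [OF B, of i] that by (simp add: lin_mat_def)
  have \<sigma>D: "\<sigma> (?D i p q) = A i p q" if "p < n" "q < n" for i p q
    using \<sigma>\<kappa>_pos [OF _ B1 [OF that], of i] by (simp add: hmap_simps [OF \<sigma>] \<sigma>\<iota>)
  have \<tau>D: "\<tau> (?D i p q) = B i p q" if "p < n" "q < n" for i p q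
    using \<tau>\<iota>_pos [OF _ A1 [OF that], of i] by (simp add: hmap_simps [OF \<tau>] \<tau>\<kappa>)
  have \<sigma>mv: "\<sigma> (mv n (?D i) v p) = mv n (A i) (\<lambda>q. \<sigma> (v q)) p" if "p < n" for i v p
    unfolding hmap_mv [OF \<sigma>] using \<sigma>D that by (simp add: mv_def)
  have \<tau>mv: "\<tau> (mv n (?D i) v p) = mv n (B i) (\<lambda>q. \<tau> (v q)) p" if "p < n" for i v p
    unfolding hmap_mv [OF \<tau>] using \<tau>D that by (simp add: mv_def)
  have \<sigma>c: "(\<lambda>q. \<sigma> (cvec v q)) = cvec v" and \<tau>c: "(\<lambda>q. \<tau> (cvec v q)) = cvec v" for v
    by (simp_all add: cvec_def hmap_cst [OF \<sigma>] hmap_cst [OF \<tau>])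
  have CB': "mm n (B i) (B (i + 1)) p q - cst (- C i p q) * g \<in> I2" if "p < n" "q < n" for i p q
    using CB [OF that] by (simp add: cst_uminus)
  have linA: "lin_mat n n (A i)" and linB: "lin_mat n n (B i)" for i
    using A1 B1 by (simp_all add: lin_mat_def)
  show "lin_mat n n (?D i)"
    unfolding lin_mat_def using hmap_homog [OF \<iota> A1] hmap_homog [OF \<kappa> B1] by blast
  show "J.strand_inj n n (?D i)"
    unfolding J.strand_inj_def
  proof (intro allI impI)
    fix v q assume v: "\<forall>p<n. mv n (?D i) (cvec v) p \<in> J" and q: "q < n"
    have "\<forall>p<n. mv n (A i) (cvec v) p \<in> K1"
    proof (intro allI impI)
      fix p assume p: "p < n"
      from J_\<sigma> [OF v [rule_format, OF p]] show "mv n (A i) (cvec v) p \<in> K1"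
        by (simp only: \<sigma>mv [OF p] \<sigma>c)
    qed
    then show "v q = 0" using L.K.strandD(2) [OF A, of i] q unfolding L.K.strand_inj_def by simp
  qed
  show "J.strand_zero n n n (?D i) (?D (i + 1))"
    unfolding J.strand_zero_def
  proof (intro allI impI)
    fix p j assume p: "p < n" and j: "j < n"
    have "\<sigma> (mm n (?D i) (?D (i + 1)) p j) = mm n (A i) (A (i + 1)) p j"
      unfolding hmap_mm [OF \<sigma>] by (rule mm_cong) (simp_all only: \<sigma>D p j)
    moreover have "\<tau> (mm n (?D i) (?D (i + 1)) p j) = mm n (B i) (B (i + 1)) p j"
      unfolding hmap_mm [OF \<tau>] by (rule mm_cong) (simp_all only: \<tau>D p j)
    ultimately show "mm n (?D i) (?D (i + 1)) p j \<in> J"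
      unfolding J_iff using CA [OF p j, of i] CB [OF p j, of i] by (intro exI [of _ "C i p j"]) simp
  qed
  show "J.strand_surj n n (?D i)"
    unfolding J.strand_surj_def
  proof (intro allI impI)
    fix z :: "nat \<Rightarrow> ('z, 'k) mpoly" assume z: "\<forall>p<n. z p \<in> homog 2"
    have "\<forall>p<n. \<sigma> (z p) \<in> homog 2" using z hmap_homog [OF \<sigma>] by simp
    then obtain u where u: "\<And>q. q < n \<Longrightarrow> u q \<in> homog 1" "\<And>p. p < n \<Longrightarrow> L.K.cng (\<sigma> (z p)) (mv n (A i) u p)"
      using L.K.strandD(3) [OF A, of i, unfolded L.K.strand_surj_def, rule_format, of "\<lambda>p. \<sigma> (z p)"] by blast
    have "\<forall>p<n. \<tau> (z p) \<in> homog 2" using z hmap_homog [OF \<tau>] by simp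
    then obtain w where w: "\<And>q. q < n \<Longrightarrow> w q \<in> homog 1" "\<And>p. p < n \<Longrightarrow> R.K.cng (\<tau> (z p)) (mv n (B i) w p)"
      using R.K.strandD(3) [OF B, of i, unfolded R.K.strand_surj_def, rule_format, of "\<lambda>p. \<tau> (z p)"] by blast
    have "\<forall>p. \<exists>d. p < n \<longrightarrow> \<sigma> (z p) - mv n (A i) u p - cst d * f \<in> I1"
      using u(2) unfolding L.K.cng_def L.K_iff by blast
    then obtain d where d: "\<And>p. p < n \<Longrightarrow> \<sigma> (z p) - mv n (A i) u p - cst (d p) * f \<in> I1" by metis
    have "\<forall>p. \<exists>d. p < n \<longrightarrow> \<tau> (z p) - mv n (B i) w p - cst d * g \<in> I2"
      using w(2) unfolding R.K.cng_def R.K_iff by blast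
    then obtain d' where d': "\<And>p. p < n \<Longrightarrow> \<tau> (z p) - mv n (B i) w p - cst (d' p) * g \<in> I2" by metis
    \<comment> \<open>The separate solutions miss \<open>z\<close> by \<open>d f\<close> on the left
      and \<open>d' g\<close> on the right, together \<open>(d + d') f\<close>. The correction
      \<open>A (i + 1) v\<close> in the left component contributes exactly
      \<open>C v f\<close>.\<close>
    define v where "v = mv n (C' i) (\<lambda>p. d p + d' p)"
    have v: "mv n (C i) v p = d p + d' p" if "p < n" for p
      unfolding v_def using mv_minv_cancel [OF C that] .
    define y where "y = (\<lambda>q. u q + mv n (A (i + 1)) (cvec v) q)"
    have y1: "y q \<in> homog 1" if "q < n" for q
      unfolding y_def using u(1) A1 that by (intro homog_add mv_homog_1) simp_all
    show "\<exists>u. (\<forall>q<n. u q \<in> homog 1) \<and> (\<forall>p<n. J.cng (z p) (mv n (?D i) u p))"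
    proof (intro exI [of _ "\<lambda>q. \<iota> (y q) + \<kappa> (w q)"] conjI allI impI)
      fix q assume "q < n"
      then show "\<iota> (y q) + \<kappa> (w q) \<in> homog 1"
        using hmap_homog [OF \<iota> y1] hmap_homog [OF \<kappa> w(1)] by blast
    next
      fix p assume p: "p < n"
      have "\<sigma> (mv n (?D i) (\<lambda>q. \<iota> (y q) + \<kappa> (w q)) p) = mv n (A i) y p"
        unfolding \<sigma>mv [OF p]
        by (rule mv_cong) (use \<sigma>\<kappa>_pos [OF _ w(1)] in \<open>simp add: hmap_simps [OF \<sigma>] \<sigma>\<iota>\<close>)
      also have "\<dots> = mv n (A i) u p + mv n (A i) (mv n (A (i + 1)) (cvec v)) p"
        unfolding y_def by (rule mv_add)
      finally have s: "\<sigma> (mv n (?D i) (\<lambda>q. \<iota> (y q) + \<kappa> (w q)) p) = \<dots>" .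
      have t: "\<tau> (mv n (?D i) (\<lambda>q. \<iota> (y q) + \<kappa> (w q)) p) = mv n (B i) w p"
        unfolding \<tau>mv [OF p]
        by (rule mv_cong) (use \<tau>\<iota>_pos [OF _ y1] in \<open>simp add: hmap_simps [OF \<tau>] \<tau>\<kappa>\<close>)
      have "L.I.cng (mv n (A i) (mv n (A (i + 1)) (cvec v)) p) (cst (mv n (C i) v p) * f)"
        by (rule L.mv_mv_matrix) (rule CA [OF p])
      then have "mv n (A i) (mv n (A (i + 1)) (cvec v)) p - cst (d p + d' p) * f \<in> I1"
        by (simp only: L.I.cng_def v [OF p])
      from L.I.diff_in [OF d [OF p] this]
      have 1: "\<sigma> (z p - mv n (?D i) (\<lambda>q. \<iota> (y q) + \<kappa> (w q)) p) - cst (- d' p) * f \<in> I1"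
        unfolding hmap_diff [OF \<sigma>] s by (simp add: cst_add cst_uminus algebra_simps)
      have 2: "\<tau> (z p - mv n (?D i) (\<lambda>q. \<iota> (y q) + \<kappa> (w q)) p) + cst (- d' p) * g \<in> I2"
        unfolding hmap_diff [OF \<tau>] t using d' [OF p] by (simp add: cst_uminus)
      show "J.cng (z p) (mv n (?D i) (\<lambda>q. \<iota> (y q) + \<kappa> (w q)) p)"
        unfolding J.cng_def J_iff by (rule exI [of _ "- d' p"]) (rule conjI [OF 1 2])
    qed
  qed
  show "J.strand_mid n n n (?D i) (?D (i + 1))"
    unfolding J.strand_mid_def
  proof (intro allI impI)
    fix u :: "nat \<Rightarrow> ('z, 'k) mpoly"
    assume u: "\<forall>q<n. u q \<in> homog 1" and k: "\<forall>p<n. mv n (?D i) u p \<in> J"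
    have "\<forall>p. \<exists>c. p < n \<longrightarrow> \<sigma> (mv n (?D i) u p) - cst c * f \<in> I1 \<and> \<tau> (mv n (?D i) u p) + cst c * g \<in> I2"
      using k unfolding J_iff by blast
    from choice [OF this] obtain c where "\<forall>p. p < n \<longrightarrow> \<sigma> (mv n (?D i) u p) - cst (c p) * f \<in> I1 \<and>
        \<tau> (mv n (?D i) u p) + cst (c p) * g \<in> I2" by (rule exE)
    note c = this [rule_format]
    have c1: "L.I.cng (mv n (A i) (\<lambda>q. \<sigma> (u q)) p) (cst (c p) * f)" if p: "p < n" for p
      using c [OF p] unfolding \<sigma>mv [OF p] by (simp add: L.I.cng_def)
    have c2: "R.I.cng (mv n (B i) (\<lambda>q. \<tau> (u q)) p) (cst (- c p) * g)" if p: "p < n" for p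
      using c [OF p] unfolding \<tau>mv [OF p] by (simp add: R.I.cng_def cst_uminus)
    have u1: "\<sigma> (u q) \<in> homog 1" and u2: "\<tau> (u q) \<in> homog 1" if "q < n" for q
      using u that hmap_homog [OF \<sigma>, of _ 1] hmap_homog [OF \<tau>, of _ 1] by simp_all
    obtain v where v: "\<And>q. q < n \<Longrightarrow> L.I.cng (\<sigma> (u q)) (mv n (A (i + 1)) (cvec v) q)"
      "\<And>p. p < n \<Longrightarrow> mv n (C i) v p = c p"
      by (rule L.lift_kernel [where C = "C i" and u = "\<lambda>q. \<sigma> (u q)" and c = c,
            OF L.K.strandD(4) [OF A, of i] linA CA u1 c1]) auto
    obtain v' where v': "\<And>q. q < n \<Longrightarrow> R.I.cng (\<tau> (u q)) (mv n (B (i + 1)) (cvec v') q)"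
      "\<And>p. p < n \<Longrightarrow> mv n (\<lambda>p q. - C i p q) v' p = - c p"
      by (rule R.lift_kernel [where C = "\<lambda>p q. - C i p q" and u = "\<lambda>q. \<tau> (u q)" and c = "\<lambda>p. - c p",
            OF R.K.strandD(4) [OF B, of i] linB CB' u2 c2]) auto
    have "mv n (C i) v' p = c p" if "p < n" for p
      using v'(2) [OF that] by (simp add: mv_def sum_negf)
    \<comment> \<open>The two sides deliver constant preimages \<open>v\<close> and
      \<open>v'\<close> separately; a preimage for the sum has to be common, and
      \<open>C v = C v'\<close> provides it.\<close>
    then have vv: "v q = v' q" if "q < n" for q
      using mv_minv_inj [OF C, of i v v' q] v(2) that by simp
    show "\<exists>v. \<forall>q<n. J.cng (u q) (mv n (?D (i + 1)) (cvec v) q)"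
    proof (intro exI [of _ v] allI impI)
      fix q assume q: "q < n"
      have "mv n (B (i + 1)) (cvec v) q = mv n (B (i + 1)) (cvec v') q"
        by (rule mv_cong) (simp add: cvec_def vv)
      then show "J.cng (u q) (mv n (?D (i + 1)) (cvec v) q)"
        unfolding J.cng_def using v(1) [OF q] v'(1) [OF q]
        by (intro JI) (simp_all only: hmap_diff [OF \<sigma>] hmap_diff [OF \<tau>] \<sigma>mv [OF q] \<tau>mv [OF q] \<sigma>c \<tau>c
            L.I.cng_def R.I.cng_def)
    qed
  qed
qed

lemma connected_sum_bistrand:
  assumes A: "L.K.bistrand (\<lambda>_. n) A" and covA: "covers I1 f n A" and n: "n > 0"
    and B: "R.K.bistrand (\<lambda>_. m) B" and covB: "covers I2 g m B" and m: "m > 0"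
  obtains N D where "N > 0" "J.bistrand (\<lambda>_. N) D"
proof -
  have stA: "L.K.strand (\<lambda>_. n) A" "L.K.strand (\<lambda>_. n) (rev_mat A)"
    using A by (simp_all add: L.K.bistrand_def rev_rank_def)
  have stB: "R.K.strand (\<lambda>_. m) B" "R.K.strand (\<lambda>_. m) (rev_mat B)"
    using B by (simp_all add: R.K.bistrand_def rev_rank_def)
  have "\<exists>C C'. minv n C C' \<and> (\<forall>p<n. \<forall>j<n. mm n (A i) (A (i + 1)) p j - cst (C p j) * f \<in> I1)" for i
    by (rule L.strand_invertible_matrix [OF stA(1) covA, of i]) blast
  then obtain C C' where C: "\<And>i. minv n (C i) (C' i)"
    "\<And>i p j. p < n \<Longrightarrow> j < n \<Longrightarrow> mm n (A i) (A (i + 1)) p j - cst (C i p j) * f \<in> I1" by metis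
  have "\<exists>C C'. minv m C C' \<and> (\<forall>p<m. \<forall>j<m. mm m (B i) (B (i + 1)) p j - cst (C p j) * g \<in> I2)" for i
    by (rule R.strand_invertible_matrix [OF stB(1) covB, of i]) blast
  then obtain E E' where E: "\<And>i. minv m (E i) (E' i)"
    "\<And>i p j. p < m \<Longrightarrow> j < m \<Longrightarrow> mm m (B i) (B (i + 1)) p j - cst (E i p j) * g \<in> I2" by metis
  have nE: "minv m (\<lambda>p q. - E i p q) (\<lambda>p q. - E' i p q)" for i
    using E(1) [of i] by (simp add: minv_def mm_def)
  obtain \<alpha> \<alpha>' where \<alpha>: "\<And>i. minv m (\<alpha> i) (\<alpha>' i)"
    "\<And>i p q. p < m \<Longrightarrow> q < m \<Longrightarrow> mm m (\<alpha> i) (\<alpha> (i + 1)) p q = - E i p q"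
    by (rule invertible_chain [where T = "\<lambda>i p q. - E i p q", OF nE]) blast
  obtain \<beta> \<beta>' where \<beta>: "\<And>i. minv n (\<beta> i) (\<beta>' i)"
    "\<And>i p q. p < n \<Longrightarrow> q < n \<Longrightarrow> mm n (\<beta> i) (\<beta> (i + 1)) p q = C i p q"
    by (rule invertible_chain [where T = C, OF C(1)]) blast
  define N where "N = n * m"
  define a where "a = (\<lambda>p. p div m)"
  define b where "b = (\<lambda>p. p mod m)"
  define idx where "idx = (\<lambda>s t. s * m + t)"
  have ip: "index_pairs n m N a b idx"
    unfolding N_def a_def b_def idx_def by (rule index_pairs_div_mod [OF m])
  interpret P: index_pairs n m N a b idx by (rule ip)
  interpret S: index_pairs m n N b a "\<lambda>t s. idx s t" by (rule P.index_swap)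
  \<comment> \<open>The common matrix: the product of consecutive left factors is \<open>f\<close>
    times \<open>C \<otimes> (\<alpha> \<alpha>)\<close>, that of the right ones \<open>g\<close>
    times \<open>(\<beta> \<beta>) \<otimes> E\<close>. With the choices made for
    \<open>\<alpha>\<close> and \<open>\<beta>\<close> these are \<open>f G\<close> and
    \<open>- g G\<close>.\<close>
  define G where "G i p q = C i (a p) (a q) * (- E i (b p) (b q))" for i p q
  have G: "minv N (G i) (\<lambda>p q. C' i (a p) (a q) * (- E' i (b p) (b q)))" for i
    unfolding G_def [abs_def] using E(1) [of i]
    by (intro P.minv_kron C(1)) (simp add: minv_def mm_def)
  let ?A = "\<lambda>i. P.kron (A i) (\<alpha> i)" and ?B = "\<lambda>i. S.kron (B i) (\<beta> i)"
  have GA: "mm N (?A i) (?A (i + 1)) p q - cst (G i p q) * f \<in> I1" if "p < N" "q < N" for i p q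
  proof -
    have "mm N (?A i) (?A (i + 1)) p q - cst (G i p q) * f =
        cst (- E i (b p) (b q)) * (mm n (A i) (A (i + 1)) (a p) (a q) - cst (C i (a p) (a q)) * f)"
      unfolding P.mm_kron [OF that] \<alpha>(2) [OF P.b_less [OF that(1)] P.b_less [OF that(2)]] G_def
      by (simp add: cst_mult cst_uminus algebra_simps)
    then show ?thesis using C(2) [OF P.a_less P.a_less, OF that] by (simp only: L.I.mult_in)
  qed
  have GB: "mm N (?B i) (?B (i + 1)) p q + cst (G i p q) * g \<in> I2" if "p < N" "q < N" for i p q
  proof -
    have "mm N (?B i) (?B (i + 1)) p q + cst (G i p q) * g =
        cst (C i (a p) (a q)) * (mm m (B i) (B (i + 1)) (b p) (b q) - cst (E i (b p) (b q)) * g)"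
      unfolding S.mm_kron [OF that] \<beta>(2) [OF P.a_less [OF that(1)] P.a_less [OF that(2)]] G_def
      by (simp add: cst_mult cst_uminus algebra_simps)
    then show ?thesis using E(2) [OF P.b_less P.b_less, OF that] by (simp only: R.I.mult_in)
  qed
  let ?D = "\<lambda>i p q. \<iota> (?A i p q) + \<kappa> (?B i p q)"
  have 1: "J.strand (\<lambda>_. N) ?D"
    by (rule glue_strand [OF L.K.strand_kron [OF ip stA(1) \<alpha>(1)]
          R.K.strand_kron [OF P.index_swap stB(1) \<beta>(1)] G GA GB])
  have rA: "L.K.strand (\<lambda>_. N) (rev_mat ?A)"
  proof -
    have "rev_mat ?A = (\<lambda>i. P.kron (rev_mat A i) (rev_mat \<alpha> i))"
      by (simp add: rev_mat_def P.kron_def fun_eq_iff)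
    moreover have "minv m (rev_mat \<alpha> i) (rev_mat \<alpha>' i)" for i
      unfolding rev_mat_def by (rule minv_transpose) (rule \<alpha>(1))
    ultimately show ?thesis using L.K.strand_kron [OF ip stA(2), of "rev_mat \<alpha>" "rev_mat \<alpha>'"] by simp
  qed
  have rB: "R.K.strand (\<lambda>_. N) (rev_mat ?B)"
  proof -
    have "rev_mat ?B = (\<lambda>i. S.kron (rev_mat B i) (rev_mat \<beta> i))"
      by (simp add: rev_mat_def S.kron_def fun_eq_iff)
    moreover have "minv n (rev_mat \<beta> i) (rev_mat \<beta>' i)" for i
      unfolding rev_mat_def by (rule minv_transpose) (rule \<beta>(1))
    ultimately show ?thesis using R.K.strand_kron [OF P.index_swap stB(2), of "rev_mat \<beta>" "rev_mat \<beta>'"] by simp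
  qed
  \<comment> \<open>Consecutive matrices of the dual complex multiply to the transpose of a product
    of the original ones, so the dual is glued along the transposes of \<open>G (- i)\<close> and no
    lifting condition for the dual complexes has to be checked.\<close>
  have rev_mm: "mm N (rev_mat M i) (rev_mat M (i + 1)) p q = mm N (M (- i)) (M (- i + 1)) q p"
    for M :: "int \<Rightarrow> nat \<Rightarrow> nat \<Rightarrow> ('u, 'k) mpoly" and i p q
    by (simp add: rev_mat_def mm_transpose [of N "M (1 - i)" "M (- i)"])
  have 2: "J.strand (\<lambda>_. N) (\<lambda>i p q. \<iota> (rev_mat ?A i p q) + \<kappa> (rev_mat ?B i p q))"
    by (rule glue_strand [where C = "\<lambda>i p q. G (- i) q p", OF rA rB minv_transpose [OF G]])
      (simp_all only: rev_mm GA GB)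
  have "J.bistrand (\<lambda>_. N) ?D"
    using 1 2 by (simp add: J.bistrand_def rev_rank_def rev_mat_def)
  moreover have "N > 0" using n m by (simp add: N_def)
  ultimately show ?thesis using that by blast
qed

end

section \<open>The defining ideals\<close>

lemma cring_ideal_genideal: "cring_ideal (Idl\<^bsub>mpoly_ring\<^esub> (S :: ('x, 'k::field) mpoly set))"
  using ring.genideal_ideal [OF cring.axioms(1) [OF mpoly_cring], of S] by (simp add: ideal_iff_cring_ideal)

lemma genideal_incl: "p \<in> S \<Longrightarrow> p \<in> Idl\<^bsub>mpoly_ring\<^esub> (S :: ('x, 'k::field) mpoly set)"
  using ring.genideal_self [OF cring.axioms(1) [OF mpoly_cring], of S] by auto

lemma genideal_least:
  "cring_ideal T \<Longrightarrow> S \<subseteq> T \<Longrightarrow> Idl\<^bsub>mpoly_ring\<^esub> (S :: ('x, 'k::field) mpoly set) \<subseteq> T"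
  using ring.genideal_minimal [OF cring.axioms(1) [OF mpoly_cring], of T S]
  by (simp add: ideal_iff_cring_ideal)

lemma genideal_mono: "S \<subseteq> S' \<Longrightarrow> Idl\<^bsub>mpoly_ring\<^esub> S \<subseteq> Idl\<^bsub>mpoly_ring\<^esub> (S' :: ('x, 'k::field) mpoly set)"
  by (rule genideal_least [OF cring_ideal_genideal]) (use genideal_incl in blast)

lemma mem_set_add:
  "p \<in> S <+>\<^bsub>mpoly_ring\<^esub> (T :: ('x, 'k::field) mpoly set) \<longleftrightarrow> (\<exists>s\<in>S. \<exists>t\<in>T. p = s + t)"
  by (auto simp: set_add_def')

lemma mem_genideal_singleton: "p \<in> Idl\<^bsub>mpoly_ring\<^esub> {f :: ('x, 'k::field) mpoly} \<longleftrightarrow> (\<exists>q. p = q * f)"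
proof
  have "cring_ideal {p. \<exists>q. p = q * f}"
  proof
    show "0 \<in> {p. \<exists>q. p = q * f}" by (auto intro: exI [of _ 0])
    show "p + q \<in> {p. \<exists>q. p = q * f}" if "p \<in> {p. \<exists>q. p = q * f}" "q \<in> {p. \<exists>q. p = q * f}" for p q
      using that by (auto simp: distrib_right [symmetric])
    show "a * p \<in> {p. \<exists>q. p = q * f}" if "p \<in> {p. \<exists>q. p = q * f}" for a p
      using that by (auto simp: mult.assoc [symmetric])
  qed
  moreover have "{f} \<subseteq> {p. \<exists>q. p = q * f}" by (auto intro: exI [of _ 1])
  ultimately have "Idl\<^bsub>mpoly_ring\<^esub> {f} \<subseteq> {p. \<exists>q. p = q * f}" by (rule genideal_least)
  then show "p \<in> Idl\<^bsub>mpoly_ring\<^esub> {f} \<Longrightarrow> \<exists>q. p = q * f" by blast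
next
  assume "\<exists>q. p = q * f"
  then show "p \<in> Idl\<^bsub>mpoly_ring\<^esub> {f}"
    using cring_ideal.mult_in [OF cring_ideal_genideal genideal_incl [of f "{f}"]] by auto
qed

lemma mem_irrelevant_prod:
  fixes f :: "('x::finite, 'k::field) mpoly"
  shows "p \<in> irrelevant_ideal \<cdot>\<^bsub>mpoly_ring\<^esub> (Idl\<^bsub>mpoly_ring\<^esub> {f}) \<longleftrightarrow> (\<exists>q. hpart 0 q = 0 \<and> p = q * f)"
proof
  assume "p \<in> irrelevant_ideal \<cdot>\<^bsub>mpoly_ring\<^esub> (Idl\<^bsub>mpoly_ring\<^esub> {f})"
  then show "\<exists>q. hpart 0 q = 0 \<and> p = q * f"
  proof (induct p rule: ideal_prod.induct)
    case (prod i j)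
    then obtain q where "j = q * f" by (auto simp: mem_genideal_singleton)
    with prod show ?case by (intro exI [of _ "i * q"]) (simp add: irrelevant_ideal_eq mult.assoc)
  next
    case (sum s1 s2)
    then obtain q1 q2 where "hpart 0 q1 = 0" "s1 = q1 * f" "hpart 0 q2 = 0" "s2 = q2 * f" by blast
    then show ?case by (intro exI [of _ "q1 + q2"]) (simp add: distrib_right)
  qed
next
  assume "\<exists>q. hpart 0 q = 0 \<and> p = q * f"
  then obtain q where "hpart 0 q = 0" "p = q * f" by blast
  then show "p \<in> irrelevant_ideal \<cdot>\<^bsub>mpoly_ring\<^esub> (Idl\<^bsub>mpoly_ring\<^esub> {f})"
    using ideal_prod.prod [of q irrelevant_ideal f "Idl\<^bsub>mpoly_ring\<^esub> {f}" mpoly_ring] genideal_incl [of f "{f}"]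
    by (simp add: irrelevant_ideal_eq)
qed

text \<open>The polynomials all of whose components lie in the ideal form an ideal themselves, and
  it contains the homogeneous generators.\<close>

lemma hpart_genideal:
  fixes G :: "('x::finite, 'k::field) mpoly set"
  assumes G: "\<And>p. p \<in> G \<Longrightarrow> \<exists>d. p \<in> homog d" and p: "p \<in> Idl\<^bsub>mpoly_ring\<^esub> G"
  shows "hpart d p \<in> Idl\<^bsub>mpoly_ring\<^esub> G"
proof -
  interpret S: cring_ideal "Idl\<^bsub>mpoly_ring\<^esub> G" by (rule cring_ideal_genideal)
  let ?T = "{p. \<forall>d. hpart d p \<in> Idl\<^bsub>mpoly_ring\<^esub> G}"
  have "cring_ideal ?T"
  proof
    fix a p assume p: "p \<in> ?T"
    have "hpart d (a * p) \<in> Idl\<^bsub>mpoly_ring\<^esub> G" for d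
    proof -
      obtain N where N: "p = (\<Sum>j<N. hpart j p)" by (rule hpart_expand)
      have "a * p = (\<Sum>j<N. a * hpart j p)" by (subst N) (simp add: sum_distrib_left)
      then have "hpart d (a * p) = (\<Sum>j<N. hpart d (a * hpart j p))" by (simp add: hpart_sum)
      also have "\<dots> \<in> Idl\<^bsub>mpoly_ring\<^esub> G"
        using p by (intro S.sum_in) (simp add: hpart_mult_homog [OF hpart_homog] S.mult_in)
      finally show ?thesis .
    qed
    then show "a * p \<in> ?T" by blast
  qed (auto intro: S.add_in)
  moreover have "G \<subseteq> ?T"
  proof
    fix p assume p: "p \<in> G"
    then obtain e where "p \<in> homog e" using G by blast
    then show "p \<in> ?T" using genideal_incl [OF p] by (simp add: homog_hpart)
  qed
  ultimately have "Idl\<^bsub>mpoly_ring\<^esub> G \<subseteq> ?T" by (rule genideal_least)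
  with p show ?thesis by blast
qed

lemma homog_3_in_ideal:
  fixes p :: "('x::finite, 'k::field) mpoly"
  assumes K: "cring_ideal K" and var: "\<And>x y z. mvar x * mvar y * mvar z \<in> K"
    and p: "p \<in> homog d" and d: "3 \<le> d"
  shows "p \<in> K"
proof -
  interpret cring_ideal K by (rule K)
  have "Poly_Mapping.single \<mu> c \<in> K" if \<mu>: "mdeg \<mu> = d" for \<mu> and c :: 'k
  proof -
    have "\<mu> \<noteq> 0" using \<mu> d by auto
    then obtain x \<mu>1 where 1: "\<mu> = Poly_Mapping.single x 1 + \<mu>1" by (rule exponent_nonzero_split)
    then have "\<mu>1 \<noteq> 0" using \<mu> d by auto
    then obtain y \<mu>2 where 2: "\<mu>1 = Poly_Mapping.single y 1 + \<mu>2" by (rule exponent_nonzero_split)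
    then have "\<mu>2 \<noteq> 0" using 1 \<mu> d by auto
    then obtain z \<mu>3 where 3: "\<mu>2 = Poly_Mapping.single z 1 + \<mu>3" by (rule exponent_nonzero_split)
    have "Poly_Mapping.single \<mu> c = mvar x * mvar y * mvar z * Poly_Mapping.single \<mu>3 c"
      by (simp add: 1 2 3 mvar_def mult_single add.assoc)
    then show ?thesis using mult_in' [OF var] by simp
  qed
  then have "(\<Sum>\<mu>\<in>Poly_Mapping.keys p. Poly_Mapping.single \<mu> (Poly_Mapping.lookup p \<mu>)) \<in> K"
    using p by (intro sum_in) (simp add: homog_iff in_keys_iff)
  then show ?thesis by (simp only: mpoly_expand [symmetric])
qed

lemma cube_zero_vars:
  fixes K :: "('x::finite, 'k::field) mpoly set"
  assumes K: "cring_ideal K"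
    and cube: "quot_max K \<cdot>\<^bsub>mpoly_ring Quot K\<^esub> quot_max K \<cdot>\<^bsub>mpoly_ring Quot K\<^esub> quot_max K
      = {\<zero>\<^bsub>mpoly_ring Quot K\<^esub>}"
  shows "mvar x * mvar y * mvar z \<in> K"
proof -
  interpret mpoly_ideal K using K by (simp add: mpoly_ideal_def)
  have v: "coset (mvar x) \<in> quot_max K" for x
    by (auto simp: quot_max_def irrelevant_ideal_eq)
  have "coset (mvar x) \<otimes>\<^bsub>Q\<^esub> coset (mvar y) \<otimes>\<^bsub>Q\<^esub> coset (mvar z)
      \<in> quot_max K \<cdot>\<^bsub>Q\<^esub> quot_max K \<cdot>\<^bsub>Q\<^esub> quot_max K"
    by (intro ideal_prod.prod v)
  then show ?thesis unfolding cube by (simp add: coset_mult coset_eq_zero_iff)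
qed

text \<open>Minimality of the generators has two consequences: \<open>a 1\<close> does not lie in
  \<open>I\<close>, so that \<open>K\<close> is larger than \<open>I\<close> by exactly the line of
  \<open>a 1\<close>, and \<open>K\<close> is a proper ideal.\<close>

lemma minimal_generators_quadric_quotient:
  fixes a :: "nat \<Rightarrow> ('x::finite, 'k::field) mpoly"
  assumes t: "t \<ge> 1" and a: "minimal_homogeneous_generators a t" and f2: "a 1 \<in> homog 2"
    and K: "K = Idl\<^bsub>mpoly_ring\<^esub> (a ` {1..t})"
    and cube: "quot_max K \<cdot>\<^bsub>mpoly_ring Quot K\<^esub> quot_max K \<cdot>\<^bsub>mpoly_ring Quot K\<^esub> quot_max K
      = {\<zero>\<^bsub>mpoly_ring Quot K\<^esub>}"
    and I: "I = (irrelevant_ideal \<cdot>\<^bsub>mpoly_ring\<^esub> (Idl\<^bsub>mpoly_ring\<^esub> {a 1}))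
       <+>\<^bsub>mpoly_ring\<^esub> Idl\<^bsub>mpoly_ring\<^esub> (a ` {2..t})"
  shows "quadric_quotient I K (a 1)"
proof -
  define S where "S = Idl\<^bsub>mpoly_ring\<^esub> (a ` {2..t})"
  interpret S: cring_ideal S unfolding S_def by (rule cring_ideal_genideal)
  interpret K: cring_ideal K unfolding K by (rule cring_ideal_genideal)
  have hom: "\<exists>d. p \<in> homog d" if "p \<in> a ` {1..t}" for p
    using a that by (auto simp: minimal_homogeneous_generators_def)
  have hom2: "\<exists>d. p \<in> homog d" if "p \<in> a ` {2..t}" for p
    using hom that by auto
  have minimal: "Idl\<^bsub>mpoly_ring\<^esub> (a ` T) \<noteq> K" if "T \<subset> {1..t}" for T
    using a that by (auto simp: minimal_homogeneous_generators_def K)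
  have S_hpart: "p \<in> S \<Longrightarrow> hpart d p \<in> S" for p d
    unfolding S_def by (rule hpart_genideal) (use hom2 in auto)
  have K_hpart: "p \<in> K \<Longrightarrow> hpart d p \<in> K" for p d
    unfolding K by (rule hpart_genideal) (use hom in auto)
  have I_iff: "p \<in> I \<longleftrightarrow> (\<exists>q s. hpart 0 q = 0 \<and> s \<in> S \<and> p = q * a 1 + s)" for p
    unfolding I mem_set_add S_def [symmetric] Bex_def mem_irrelevant_prod by blast
  interpret I: cring_ideal I
  proof
    show "0 \<in> I" unfolding I_iff by (intro exI [of _ 0]) simp
  next
    fix p q assume "p \<in> I" "q \<in> I"
    then obtain b s b' s' where "hpart 0 b = 0" "s \<in> S" "p = b * a 1 + s"
      "hpart 0 b' = 0" "s' \<in> S" "q = b' * a 1 + s'" unfolding I_iff by blast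
    then show "p + q \<in> I"
      unfolding I_iff by (intro exI [of _ "b + b'"] exI [of _ "s + s'"]) (simp add: S.add_in algebra_simps)
  next
    fix p c :: "('x, 'k) mpoly" assume "p \<in> I"
    then obtain b s where "hpart 0 b = 0" "s \<in> S" "p = b * a 1 + s" unfolding I_iff by blast
    then show "c * p \<in> I"
      unfolding I_iff by (intro exI [of _ "c * b"] exI [of _ "c * s"]) (simp add: S.mult_in algebra_simps)
  qed
  have S_I: "s \<in> I" if "s \<in> S" for s
    unfolding I_iff using that by (intro exI [of _ 0] exI [of _ s]) simp
  have mf_I: "q * a 1 \<in> I" if "hpart 0 q = 0" for q
    unfolding I_iff using that by (intro exI [of _ q] exI [of _ 0]) simp
  have f_K: "a 1 \<in> K" unfolding K using t by (intro genideal_incl) auto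
  have S_K: "S \<subseteq> K" unfolding S_def K by (intro genideal_mono image_mono) auto
  have I_K: "p \<in> K" if "p \<in> I" for p
    using that f_K S_K unfolding I_iff by (auto intro!: K.add_in K.mult_in)
  have K_iff: "p \<in> K \<longleftrightarrow> (\<exists>c. p - cst c * a 1 \<in> I)" for p
  proof
    have "cring_ideal {p. \<exists>c. p - cst c * a 1 \<in> I}"
    proof
      show "0 \<in> {p. \<exists>c. p - cst c * a 1 \<in> I}" by (auto intro: exI [of _ 0])
    next
      fix p q assume "p \<in> {p. \<exists>c. p - cst c * a 1 \<in> I}" "q \<in> {p. \<exists>c. p - cst c * a 1 \<in> I}"
      then obtain c d where "p - cst c * a 1 \<in> I" "q - cst d * a 1 \<in> I" by blast
      from I.add_in [OF this] show "p + q \<in> {p. \<exists>c. p - cst c * a 1 \<in> I}"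
        by (intro CollectI exI [of _ "c + d"]) (simp add: cst_add algebra_simps)
    next
      fix p b :: "('x, 'k) mpoly" assume "p \<in> {p. \<exists>c. p - cst c * a 1 \<in> I}"
      then obtain c where c: "p - cst c * a 1 \<in> I" by blast
      obtain b0 where b0: "hpart 0 b = cst b0" using homog_0E [OF hpart_homog] .
      \<comment> \<open>Modulo \<open>I\<close> multiplication by \<open>b\<close> acts on
        \<open>a 1\<close> through its constant term, since the positive part times
        \<open>a 1\<close> lies in \<open>I\<close>; the new coefficient is
        \<open>b0 * c\<close>.\<close>
      have "(b - cst b0) * cst c * a 1 \<in> I" by (rule mf_I) (simp add: b0)
      from I.add_in [OF I.mult_in [OF c, of b] this]
      show "b * p \<in> {p. \<exists>c. p - cst c * a 1 \<in> I}"
        by (intro CollectI exI [of _ "b0 * c"]) (simp add: cst_mult algebra_simps)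
    qed
    moreover have "a ` {1..t} \<subseteq> {p. \<exists>c. p - cst c * a 1 \<in> I}"
    proof
      fix p assume "p \<in> a ` {1..t}"
      then obtain i where i: "i \<in> {1..t}" "p = a i" by blast
      show "p \<in> {p. \<exists>c. p - cst c * a 1 \<in> I}"
      proof (cases "i = 1")
        case True
        then show ?thesis using i by (intro CollectI exI [of _ 1]) simp
      next
        case False
        then have "p \<in> S" unfolding S_def using i by (intro genideal_incl) auto
        then show ?thesis using S_I by (intro CollectI exI [of _ 0]) simp
      qed
    qed
    ultimately have "K \<subseteq> {p. \<exists>c. p - cst c * a 1 \<in> I}" unfolding K by (rule genideal_least)
    then show "p \<in> K \<Longrightarrow> \<exists>c. p - cst c * a 1 \<in> I" by blast
  next
    assume "\<exists>c. p - cst c * a 1 \<in> I"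
    then obtain c where "p - cst c * a 1 \<in> I" by blast
    from K.add_in [OF I_K [OF this] K.mult_in [OF f_K, of "cst c"]] show "p \<in> K" by simp
  qed
  have I_hpart: "hpart d p \<in> I" if p: "p \<in> I" for p d
  proof -
    obtain b s where b: "hpart 0 b = 0" "s \<in> S" "p = b * a 1 + s" using p unfolding I_iff by blast
    have "hpart 0 (if 2 \<le> d then hpart (d - 2) b else 0) = 0" using b(1) by simp
    from I.add_in [OF mf_I [OF this] S_I [OF S_hpart [OF b(2), of d]]]
    show ?thesis unfolding b(3) hpart_add hpart_mult_homog [OF f2] by (simp split: if_splits)
  qed
  have f_ind: "c = 0" if c: "cst c * a 1 \<in> I" for c
  proof (rule ccontr)
    assume "c \<noteq> 0"
    then have "cst (1 / c) * (cst c * a 1) = a 1"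
      using cst_inverse [of c "a 1"] by (simp add: mult.left_commute)
    then have "a 1 \<in> I" using I.mult_in [OF c, of "cst (1 / c)"] by simp
    then obtain b s where b: "hpart 0 b = 0" "s \<in> S" "a 1 = b * a 1 + s" unfolding I_iff by blast
    \<comment> \<open>In degree two the term \<open>b * a 1\<close> disappears because
      \<open>b\<close> has no constant term. This leaves \<open>a 1\<close> in the ideal of the
      other generators, against minimality.\<close>
    have "a 1 = hpart 2 (a 1)" using f2 by (simp add: homog_hpart)
    also have "\<dots> = hpart 2 (b * a 1) + hpart 2 s" using b(3) by (metis hpart_add)
    also have "hpart 2 (b * a 1) = 0" using b(1) unfolding hpart_mult_homog [OF f2] by simp
    finally have f_S: "a 1 \<in> S" using S_hpart [OF b(2), of 2] by simp
    have "a ` {1..t} \<subseteq> S"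
    proof
      fix p assume "p \<in> a ` {1..t}"
      then obtain i where i: "i \<in> {1..t}" "p = a i" by blast
      show "p \<in> S"
      proof (cases "i = 1")
        case False
        then show ?thesis unfolding S_def using i by (intro genideal_incl) auto
      qed (use i f_S in simp)
    qed
    then have "K \<subseteq> S" unfolding K by (rule genideal_least [OF S.cring_ideal_axioms])
    with S_K have "S = K" by simp
    moreover have "{2..t} \<subset> {1..t}" using t by (intro psubsetI) auto
    ultimately show False using minimal [of "{2..t}"] by (simp add: S_def)
  qed
  have K_proper: "hpart 0 p = 0" if p: "p \<in> K" for p
  proof (rule ccontr)
    assume nz: "hpart 0 p \<noteq> 0"
    have "\<exists>i\<in>{1..t}. hpart 0 (a i) \<noteq> 0"
    proof (rule ccontr)
      assume "\<not> ?thesis"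
      then have "a ` {1..t} \<subseteq> {p. hpart 0 p = 0}" by auto
      moreover have "cring_ideal {p :: ('x, 'k) mpoly. hpart 0 p = 0}" by unfold_locales auto
      ultimately have "K \<subseteq> {p. hpart 0 p = 0}" unfolding K by (intro genideal_least)
      with p nz show False by blast
    qed
    then obtain i where i: "i \<in> {1..t}" "hpart 0 (a i) \<noteq> 0" by blast
    obtain d where d: "a i \<in> homog d" using hom i(1) by blast
    have "d = 0" using homog_hpart [OF d, of 0] i(2) by (cases "d = 0") auto
    with d obtain c where c: "a i = cst c" using homog_0E by blast
    with i(2) have c0: "c \<noteq> 0" by auto
    \<comment> \<open>A constant generator would generate the unit ideal on its own. It differs from
      the quadric \<open>a 1\<close>, so omitting the latter would leave \<open>K\<close>
      unchanged.\<close>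
    have i1: "i \<noteq> 1" using i(2) homog_hpart [OF f2, of 0] by auto
    interpret S': cring_ideal "Idl\<^bsub>mpoly_ring\<^esub> (a ` {i})" by (rule cring_ideal_genideal)
    have "q \<in> Idl\<^bsub>mpoly_ring\<^esub> (a ` {i})" for q
      using S'.mult_in' [OF genideal_incl [of "a i" "a ` {i}"], of "cst (1 / c) * q"]
      by (simp add: c cst_inverse [OF c0])
    then have "Idl\<^bsub>mpoly_ring\<^esub> (a ` {i}) = K"
      using genideal_mono [of "a ` {i}" "a ` {1..t}"] i(1) unfolding K by auto
    moreover have "{i} \<subset> {1..t}" using i(1) i1 t by (intro psubsetI) auto
    ultimately show False using minimal by blast
  qed
  have K_deg3: "p \<in> K" if "p \<in> homog d" "3 \<le> d" for p d
    by (rule homog_3_in_ideal [OF K.cring_ideal_axioms cube_zero_vars [OF K.cring_ideal_axioms cube] that])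
  have I_deg3: "p \<in> I" if p: "p \<in> homog d" "3 \<le> d" for p d
  proof -
    obtain c where "p - cst c * a 1 \<in> I" using K_deg3 [OF p] K_iff by blast
    \<comment> \<open>Taking the component of degree \<open>d \<ge> 3\<close> removes the multiple
      of the quadric.\<close>
    from I_hpart [OF this, of d] show ?thesis
      using p homog_hpart [OF p(1), of d] homog_hpart [OF homog_cst_mult [OF f2, of c], of d] by simp
  qed
  show ?thesis
  proof (intro quadric_quotient.intro short_ideal.intro short_ideal_axioms.intro quadric_quotient_axioms.intro)
    show "cring_ideal I" by (rule I.cring_ideal_axioms)
    show "cring_ideal K" by (rule K.cring_ideal_axioms)
    show "a 1 \<in> homog 2" by (rule f2)
    fix p d
    show "hpart d p \<in> I" if "p \<in> I" using that by (rule I_hpart)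
    show "hpart d p \<in> K" if "p \<in> K" using that by (rule K_hpart)
    show "hpart 0 p = 0" if "p \<in> I" using that by (rule K_proper [OF I_K])
    show "hpart 0 p = 0" if "p \<in> K" using that by (rule K_proper)
    show "p \<in> I" if "p \<in> homog d" "3 \<le> d" using that by (rule I_deg3)
    show "p \<in> K" if "p \<in> homog d" "3 \<le> d" using that by (rule K_deg3)
    show "p \<in> K \<longleftrightarrow> (\<exists>c. p - cst c * a 1 \<in> I)" by (rule K_iff)
    show "c = 0" if "cst c * a 1 \<in> I" for c using that by (rule f_ind)
  qed
qed

subsection \<open>The ideal of the connected sum\<close>

lemma homog_power:
  fixes p :: "('x::finite, 'k::field) mpoly"
  assumes "p \<in> homog 1" shows "p ^ n \<in> homog n"
proof (induct n)
  case 0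
  show ?case using homog_cst [of 1] by simp
next
  case (Suc n)
  then show ?case using homog_mult [OF assms Suc] by simp
qed

lemma homog_prod:
  fixes h :: "'i \<Rightarrow> ('x::finite, 'k::field) mpoly"
  assumes "finite A" "\<And>i. i \<in> A \<Longrightarrow> h i \<in> homog (e i)"
  shows "(\<Prod>i\<in>A. h i) \<in> homog (\<Sum>i\<in>A. e i)"
  using assms
proof (induct A rule: finite_induct)
  case empty
  show ?case using homog_cst [of 1] by simp
qed auto

lemma hmap_meval:
  fixes h :: "'x::finite \<Rightarrow> ('y::finite, 'k::field) mpoly"
  assumes h: "\<And>x. h x \<in> homog 1" shows "hmap (meval h)"
proof -
  have "meval h p \<in> homog d" if p: "p \<in> homog d" for p d
    unfolding meval_def
  proof (intro homog_sum homog_cst_mult)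
    fix \<mu> assume "\<mu> \<in> Poly_Mapping.keys p"
    then have "mdeg \<mu> = d" using p by (simp add: homog_iff in_keys_iff)
    moreover have "(\<Prod>x\<in>UNIV. h x ^ Poly_Mapping.lookup \<mu> x) \<in> homog (mdeg \<mu>)"
      unfolding mdeg_def by (intro homog_prod homog_power h) simp
    ultimately show "(\<Prod>x\<in>UNIV. h x ^ Poly_Mapping.lookup \<mu> x) \<in> homog d" by simp
  qed
  then show ?thesis by (simp add: hmap_def)
qed

lemma hmap_hpart:
  assumes \<phi>: "hmap \<phi>" shows "\<phi> (hpart d p) = hpart d (\<phi> p)"
proof -
  obtain N where N: "p = (\<Sum>j<N. hpart j p)" by (rule hpart_expand)
  have h: "hpart d (\<phi> (hpart j p)) = (if d = j then \<phi> (hpart j p) else 0)" for j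
    by (rule homog_hpart) (rule hmap_homog [OF \<phi> hpart_homog])
  have "hpart d (\<phi> p) = hpart d (\<phi> (\<Sum>j<N. hpart j p))" using N by simp
  also have "\<dots> = (\<Sum>j<N. if d = j then \<phi> (hpart j p) else 0)" by (simp add: hmap_sum [OF \<phi>] hpart_sum h)
  also have "\<dots> = \<phi> (hpart d (\<Sum>j<N. hpart j p))"
    by (simp add: hmap_sum [OF \<phi>] hmap_0 [OF \<phi>] hpart_sum)
  finally show ?thesis using N by simp
qed

definition proj_left :: "('x::finite + 'y::finite, 'k::field) mpoly \<Rightarrow> ('x, 'k) mpoly" where
  "proj_left = meval (case_sum mvar (\<lambda>_. 0))"

definition proj_right :: "('x::finite + 'y::finite, 'k::field) mpoly \<Rightarrow> ('y, 'k) mpoly" where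
  "proj_right = meval (case_sum (\<lambda>_. 0) mvar)"

lemma hmap_proj: "hmap proj_left" "hmap proj_right"
  unfolding proj_left_def proj_right_def by (rule hmap_meval; simp split: sum.split)+

lemma hmap_rename: "hmap (rename h :: ('x::finite, 'k::field) mpoly \<Rightarrow> ('z::finite, 'k) mpoly)"
proof -
  have "hmap (meval (\<lambda>x. mvar (h x)) :: ('x, 'k) mpoly \<Rightarrow> ('z, 'k) mpoly)" by (rule hmap_meval) simp
  then show ?thesis by (simp add: rename_eq_meval [abs_def])
qed

lemma lookup_cst [simp]: "Poly_Mapping.lookup (cst c) 0 = c" by (simp add: cst_def)

lemma meval_zero:
  "meval (\<lambda>_. 0) p = (cst (Poly_Mapping.lookup p 0) :: ('z, 'k) mpoly)"
  for p :: "('x::finite, 'k::field) mpoly"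
proof (induct p rule: mpoly_induct)
  case (cst c) then show ?case by simp
next
  case (add p q) then show ?case by (simp add: cst_add lookup_add)
next
  case (var x p)
  have "cst (Poly_Mapping.lookup (mvar x * p) 0) = (0 :: ('x, 'k) mpoly)" by (simp add: cst_lookup_0)
  then show ?case by (simp add: meval_mvar_mult)
qed

lemma proj_rename:
  "proj_left (rename Inl p) = p" "proj_right (rename Inr q) = q"
  "proj_right (rename Inl p) = cst (Poly_Mapping.lookup p 0)"
  "proj_left (rename Inr q) = cst (Poly_Mapping.lookup q 0)"
  by (simp_all add: proj_left_def proj_right_def rename_eq_meval meval_meval meval_ident meval_zero)

text \<open>Modulo the products of variables from different sets a polynomial is the sum of its two
  pure parts. The constant term belongs to both of them, so it has been subtracted twice and is
  added back once.\<close>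

lemma mixed_ideal:
  fixes p :: "('x::finite + 'y::finite, 'k::field) mpoly"
  assumes D: "cring_ideal D" and xy: "\<And>i j. mvar (Inl i) * mvar (Inr j) \<in> D"
  shows "p - rename Inl (proj_left p) - rename Inr (proj_right p) + hpart 0 p \<in> D"
proof -
  interpret cring_ideal D by (rule D)
  have l: "mvar (Inl i) * (rename Inr s - cst (Poly_Mapping.lookup s 0)) \<in> D" for i and s :: "('y, 'k) mpoly"
  proof (induct s rule: mpoly_induct)
    case (cst c) then show ?case by (simp add: hmap_cst [OF hmap_rename])
  next
    case (add p q)
    from add_in [OF this] show ?case
      by (simp add: hmap_add [OF hmap_rename] lookup_add cst_add algebra_simps)
  next
    case (var j s)
    have "Poly_Mapping.lookup (mvar j * s) 0 = 0" using cst_lookup_0 [of "mvar j * s"] by simp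
    then show ?case using mult_in' [OF xy, of i j "rename Inr s"]
      by (simp add: hmap_mult [OF hmap_rename] rename_eq_meval mult.assoc)
  qed
  have r: "mvar (Inr j) * (rename Inl s - cst (Poly_Mapping.lookup s 0)) \<in> D" for j and s :: "('x, 'k) mpoly"
  proof (induct s rule: mpoly_induct)
    case (cst c) then show ?case by (simp add: hmap_cst [OF hmap_rename])
  next
    case (add p q)
    from add_in [OF this] show ?case
      by (simp add: hmap_add [OF hmap_rename] lookup_add cst_add algebra_simps)
  next
    case (var i s)
    have "Poly_Mapping.lookup (mvar i * s) 0 = 0" using cst_lookup_0 [of "mvar i * s"] by simp
    then show ?case using mult_in' [OF xy, of i j "rename Inl s"]
      by (simp add: hmap_mult [OF hmap_rename] rename_eq_meval ac_simps)
  qed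
  have c: "cst (Poly_Mapping.lookup (proj_left p) 0) = hpart 0 p"
    "cst (Poly_Mapping.lookup (proj_right p) 0) = hpart 0 p" for p :: "('x + 'y, 'k) mpoly"
  proof -
    obtain c where c: "hpart 0 p = cst c" using homog_0E [OF hpart_homog] .
    have "cst (Poly_Mapping.lookup (proj_left p) 0) = (cst c :: ('x, 'k) mpoly)"
      using hmap_hpart [OF hmap_proj(1), of 0 p] by (simp add: cst_lookup_0 c hmap_cst [OF hmap_proj(1)])
    then show "cst (Poly_Mapping.lookup (proj_left p) 0) = hpart 0 p" by (simp add: c)
    have "cst (Poly_Mapping.lookup (proj_right p) 0) = (cst c :: ('y, 'k) mpoly)"
      using hmap_hpart [OF hmap_proj(2), of 0 p] by (simp add: cst_lookup_0 c hmap_cst [OF hmap_proj(2)])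
    then show "cst (Poly_Mapping.lookup (proj_right p) 0) = hpart 0 p" by (simp add: c)
  qed
  show ?thesis
  proof (induct p rule: mpoly_induct)
    case (cst c)
    then show ?case by (simp add: hmap_cst [OF hmap_rename] hmap_cst [OF hmap_proj(1)] hmap_cst [OF hmap_proj(2)])
  next
    case (add p q)
    from add_in [OF this] show ?case
      by (simp add: hmap_add [OF hmap_rename] hmap_add [OF hmap_proj(1)] hmap_add [OF hmap_proj(2)] algebra_simps)
  next
    case (var z p)
    let ?\<delta> = "p - rename Inl (proj_left p) - rename Inr (proj_right p) + hpart 0 p"
    show ?case
    proof (cases z)
      case (Inl i)
      have "mvar z * p - rename Inl (proj_left (mvar z * p)) - rename Inr (proj_right (mvar z * p)) + hpart 0 (mvar z * p)
          = mvar z * ?\<delta> + mvar (Inl i) * (rename Inr (proj_right p) - hpart 0 p)"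
        by (simp add: Inl proj_left_def proj_right_def rename_eq_meval algebra_simps)
      then show ?thesis using add_in [OF mult_in [OF var] l [of i "proj_right p"]] by (simp add: c)
    next
      case (Inr j)
      have "mvar z * p - rename Inl (proj_left (mvar z * p)) - rename Inr (proj_right (mvar z * p)) + hpart 0 (mvar z * p)
          = mvar z * ?\<delta> + mvar (Inr j) * (rename Inl (proj_left p) - hpart 0 p)"
        by (simp add: Inr proj_left_def proj_right_def rename_eq_meval algebra_simps)
      then show ?thesis using add_in [OF mult_in [OF var] r [of j "proj_left p"]] by (simp add: c)
    qed
  qed
qed

text \<open>\<open>T\<close> is a membership test by projection to the summands. It is an ideal
  containing the generators of \<open>J\<close>; conversely an element of \<open>T\<close> is
  recovered from its two projections, a multiple of \<open>f - g\<close> and mixed terms.\<close>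

lemma connected_sum_ideal:
  fixes I1 K1 :: "('x::finite, 'k::field) mpoly set" and I2 K2 :: "('y::finite, 'k) mpoly set"
  assumes L: "quadric_quotient I1 K1 f" and R: "quadric_quotient I2 K2 g"
    and J: "J = Idl\<^bsub>mpoly_ring\<^esub> (rename Inl ` I1) <+>\<^bsub>mpoly_ring\<^esub> Idl\<^bsub>mpoly_ring\<^esub> (rename Inr ` I2)
        <+>\<^bsub>mpoly_ring\<^esub> Idl\<^bsub>mpoly_ring\<^esub> {rename Inl f - rename Inr g}
        <+>\<^bsub>mpoly_ring\<^esub> Idl\<^bsub>mpoly_ring\<^esub> {mvar (Inl i) * mvar (Inr j) |i j. True}"
  shows "connected_sum I1 K1 f I2 K2 g J proj_left (rename Inl) proj_right (rename Inr)"
proof -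
  interpret L: quadric_quotient I1 K1 f by (rule L)
  interpret R: quadric_quotient I2 K2 g by (rule R)
  note ps = hmap_simps [OF hmap_proj(1)] hmap_simps [OF hmap_proj(2)]
  define T where "T = {p. \<exists>c. proj_left p - cst c * f \<in> I1 \<and> proj_right p + cst c * g \<in> I2}"
  have f0: "hpart 0 f = 0" "hpart 0 g = 0" using L.f2 R.f2 by (auto intro: homog_positive [of 2])
  have low: "hpart 0 (proj_left p) = 0" "hpart 0 (proj_right p) = 0" "hpart 0 p = 0" if p: "p \<in> T" for p
  proof -
    obtain c where "proj_left p - cst c * f \<in> I1" "proj_right p + cst c * g \<in> I2"
      using p unfolding T_def by blast
    then have "hpart 0 (proj_left p - cst c * f) = 0" "hpart 0 (proj_right p + cst c * g) = 0"
      by (simp_all only: L.I.proper R.I.proper)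
    then show 1: "hpart 0 (proj_left p) = 0" "hpart 0 (proj_right p) = 0" by (simp_all add: f0)
    obtain d where d: "hpart 0 p = cst d" using homog_0E [OF hpart_homog] .
    have "cst d = (0 :: ('x, 'k) mpoly)"
      using hmap_hpart [OF hmap_proj(1), of 0 p] 1 by (simp add: d ps)
    then show "hpart 0 p = 0" by (simp add: d)
  qed
  interpret T: cring_ideal T
  proof
    show "0 \<in> T" unfolding T_def by (intro CollectI exI [of _ 0]) (simp add: ps)
  next
    fix p q assume "p \<in> T" "q \<in> T"
    then obtain c d where c: "proj_left p - cst c * f \<in> I1" "proj_right p + cst c * g \<in> I2"
      and d: "proj_left q - cst d * f \<in> I1" "proj_right q + cst d * g \<in> I2" unfolding T_def by blast
    show "p + q \<in> T"
      unfolding T_def using L.I.add_in [OF c(1) d(1)] R.I.add_in [OF c(2) d(2)]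
      by (intro CollectI exI [of _ "c + d"]) (simp add: ps cst_add algebra_simps)
  next
    fix p b :: "('x + 'y, 'k) mpoly" assume "p \<in> T"
    then obtain c where c: "proj_left p - cst c * f \<in> I1" "proj_right p + cst c * g \<in> I2"
      unfolding T_def by blast
    \<comment> \<open>Only the constant term of \<open>b\<close> affects the multiplier
      \<open>c\<close>: products of \<open>f\<close> or \<open>g\<close> with forms of positive
      degree have degree at least three and lie in \<open>I1\<close> or \<open>I2\<close>.\<close>
    obtain b0 where b0: "hpart 0 b = cst b0" using homog_0E [OF hpart_homog] .
    have 1: "proj_left b * cst c * f - cst (b0 * c) * f \<in> I1"
    proof -
      have "hpart 0 (proj_left b - cst b0) = 0"
        using hmap_hpart [OF hmap_proj(1), of 0 b] by (simp add: b0 ps)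
      then have "(proj_left b - cst b0) * (cst c * f) \<in> I1"
        using homog_hpart [OF L.f2, of "Suc 0"] f0
        by (subst L.I.in_iff_hpart) (simp add: hpart_1_mult hpart_2_mult)
      then show ?thesis by (simp add: cst_mult algebra_simps)
    qed
    have 2: "proj_right b * cst c * g - cst (b0 * c) * g \<in> I2"
    proof -
      have "hpart 0 (proj_right b - cst b0) = 0"
        using hmap_hpart [OF hmap_proj(2), of 0 b] by (simp add: b0 ps)
      then have "(proj_right b - cst b0) * (cst c * g) \<in> I2"
        using homog_hpart [OF R.f2, of "Suc 0"] f0
        by (subst R.I.in_iff_hpart) (simp add: hpart_1_mult hpart_2_mult)
      then show ?thesis by (simp add: cst_mult algebra_simps)
    qed
    show "b * p \<in> T"
      unfolding T_def
      using L.I.add_in [OF L.I.mult_in [OF c(1), of "proj_left b"] 1]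
        R.I.diff_in [OF R.I.mult_in [OF c(2), of "proj_right b"] 2]
      by (intro CollectI exI [of _ "b0 * c"]) (simp add: ps algebra_simps)
  qed
  have J_T: "J = T"
  proof
    have 1: "Idl\<^bsub>mpoly_ring\<^esub> (rename Inl ` I1) \<subseteq> T"
    proof (rule genideal_least [OF T.cring_ideal_axioms], rule image_subsetI)
      fix p assume p: "p \<in> I1"
      then have "cst (Poly_Mapping.lookup p 0) = (0 :: ('x, 'k) mpoly)"
        using L.I.proper by (simp add: cst_lookup_0)
      then show "rename Inl p \<in> T"
        unfolding T_def using p by (intro CollectI exI [of _ 0]) (simp add: proj_rename)
    qed
    have 2: "Idl\<^bsub>mpoly_ring\<^esub> (rename Inr ` I2) \<subseteq> T"
    proof (rule genideal_least [OF T.cring_ideal_axioms], rule image_subsetI)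
      fix p assume p: "p \<in> I2"
      then have "cst (Poly_Mapping.lookup p 0) = (0 :: ('y, 'k) mpoly)"
        using R.I.proper by (simp add: cst_lookup_0)
      then show "rename Inr p \<in> T"
        unfolding T_def using p by (intro CollectI exI [of _ 0]) (simp add: proj_rename)
    qed
    have 3: "Idl\<^bsub>mpoly_ring\<^esub> {rename Inl f - rename Inr g} \<subseteq> T"
    proof (rule genideal_least [OF T.cring_ideal_axioms])
      have "rename Inl f - rename Inr g \<in> T"
        unfolding T_def
        by (intro CollectI exI [of _ 1]) (simp add: ps proj_rename lookup_0_positive [OF _ L.f2] lookup_0_positive [OF _ R.f2])
      then show "{rename Inl f - rename Inr g} \<subseteq> T" by simp
    qed
    have 4: "Idl\<^bsub>mpoly_ring\<^esub> {mvar (Inl i) * mvar (Inr j) |i j. True} \<subseteq> T"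
    proof (rule genideal_least [OF T.cring_ideal_axioms])
      have "mvar (Inl i) * mvar (Inr j) \<in> T" for i j
        unfolding T_def by (intro CollectI exI [of _ 0]) (simp add: ps proj_left_def proj_right_def)
      then show "{mvar (Inl i) * mvar (Inr j) |i j. True} \<subseteq> T" by blast
    qed
    show "J \<subseteq> T"
    proof
      fix p assume "p \<in> J"
      then obtain p1 p2 p3 p4 where "p1 \<in> Idl\<^bsub>mpoly_ring\<^esub> (rename Inl ` I1)"
        "p2 \<in> Idl\<^bsub>mpoly_ring\<^esub> (rename Inr ` I2)"
        "p3 \<in> Idl\<^bsub>mpoly_ring\<^esub> {rename Inl f - rename Inr g}"
        "p4 \<in> Idl\<^bsub>mpoly_ring\<^esub> {mvar (Inl i) * mvar (Inr j) |i j. True}"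
        "p = p1 + p2 + p3 + p4"
        unfolding J mem_set_add Bex_def by blast
      with 1 2 3 4 show "p \<in> T" by (simp add: T.add_in subset_iff)
    qed
  next
    show "T \<subseteq> J"
    proof
      fix p assume p: "p \<in> T"
      then obtain c where c: "proj_left p - cst c * f \<in> I1" "proj_right p + cst c * g \<in> I2"
        unfolding T_def by blast
      let ?\<delta> = "p - rename Inl (proj_left p) - rename Inr (proj_right p) + hpart 0 p"
      have "?\<delta> \<in> Idl\<^bsub>mpoly_ring\<^esub> {mvar (Inl i) * mvar (Inr j) |i j. True}"
        by (rule mixed_ideal [OF cring_ideal_genideal]) (rule genideal_incl, blast)
      moreover have "rename Inl (proj_left p - cst c * f) \<in> Idl\<^bsub>mpoly_ring\<^esub> (rename Inl ` I1)"
        using c(1) by (intro genideal_incl imageI)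
      moreover have "rename Inr (proj_right p + cst c * g) \<in> Idl\<^bsub>mpoly_ring\<^esub> (rename Inr ` I2)"
        using c(2) by (intro genideal_incl imageI)
      moreover have "cst c * (rename Inl f - rename Inr g) \<in> Idl\<^bsub>mpoly_ring\<^esub> {rename Inl f - rename Inr g}"
        unfolding mem_genideal_singleton by blast
      \<comment> \<open>The multiples of \<open>f\<close> and \<open>g\<close> that correct the two
        projections add up to the multiple of \<open>f - g\<close>; the constant term in
        \<open>?\<delta>\<close> is zero.\<close>
      moreover have "p = rename Inl (proj_left p - cst c * f) + rename Inr (proj_right p + cst c * g) +
          cst c * (rename Inl f - rename Inr g) + ?\<delta>"
        using low(3) [OF p] by (simp add: hmap_simps [OF hmap_rename] algebra_simps)
      ultimately show "p \<in> J" unfolding J mem_set_add Bex_def by blast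
    qed
  qed
  have "short_ideal J"
    unfolding J_T
  proof (intro short_ideal.intro short_ideal_axioms.intro)
    fix p :: "('x + 'y, 'k) mpoly" and d assume "p \<in> T"
    then obtain c where c: "proj_left p - cst c * f \<in> I1" "proj_right p + cst c * g \<in> I2"
      unfolding T_def by blast
    have h: "hpart d (cst c * f) = cst (if d = 2 then c else 0) * f"
      "hpart d (cst c * g) = cst (if d = 2 then c else 0) * g"
      using homog_hpart [OF homog_cst_mult [OF L.f2, of c], of d]
        homog_hpart [OF homog_cst_mult [OF R.f2, of c], of d] by simp_all
    show "hpart d p \<in> T"
      unfolding T_def using L.I.hpart_in [OF c(1), of d] R.I.hpart_in [OF c(2), of d]
      by (intro CollectI exI [of _ "if d = 2 then c else 0"])
        (simp only: hpart_diff hpart_add h hmap_hpart [OF hmap_proj(1)] hmap_hpart [OF hmap_proj(2)])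
  next
    fix p assume "p \<in> T" then show "hpart 0 p = 0" by (rule low)
  next
    fix p :: "('x + 'y, 'k) mpoly" and d assume p: "p \<in> homog d" "3 \<le> d"
    have "proj_left p \<in> I1" "proj_right p \<in> I2"
      by (rule L.I.deg3 [OF hmap_homog [OF hmap_proj(1) p(1)] p(2)],
          rule R.I.deg3 [OF hmap_homog [OF hmap_proj(2) p(1)] p(2)])
    then show "p \<in> T" unfolding T_def by (intro CollectI exI [of _ 0]) simp
  qed (rule T.cring_ideal_axioms)
  then show ?thesis
    by (intro connected_sum.intro connected_sum_axioms.intro L R hmap_proj hmap_rename)
      (simp_all add: proj_rename J_T T_def)
qed

section \<open>The lifting condition\<close>

context mpoly_ideal
begin

lemma matrix_map_eq_mat:
  assumes "\<And>p q. p < m \<Longrightarrow> q < n \<Longrightarrow> A p q = coset (D p q)"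
  shows "matrix_map Q m n A = mat m n D"
  unfolding matrix_map_def
proof (intro restrict_ext Q.finsum_cong' refl)
  fix v p q assume "v \<in> carrier (free_module Q n)" "p \<in> {..<m}" "q \<in> {..<n}"
  then show "A p q \<otimes>\<^bsub>Q\<^esub> v q = coset (D p q) \<otimes>\<^bsub>Q\<^esub> v q" using assms by simp
qed (auto simp: free_module_def)

lemma mem_principal: "x \<in> Idl\<^bsub>Q\<^esub> {coset f} \<longleftrightarrow> (\<exists>q. x = coset (q * f))"
proof -
  have "Idl\<^bsub>Q\<^esub> {coset f} = PIdl\<^bsub>Q\<^esub> (coset f)"
    by (rule Q.cgenideal_eq_genideal [symmetric]) simp
  moreover have "x \<in> PIdl\<^bsub>Q\<^esub> (coset f) \<longleftrightarrow> (\<exists>q. x = coset q \<otimes>\<^bsub>Q\<^esub> coset f)"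
    by (auto simp: cgenideal_def carrier_Q)
  ultimately show ?thesis by (simp only: coset_mult)
qed

lemma mem_ideal_free_principal:
  "x \<in> ideal_free (Idl\<^bsub>Q\<^esub> {coset f}) n \<longleftrightarrow> (\<exists>q. x = fvec n (\<lambda>p. q p * f))"
proof
  assume x: "x \<in> ideal_free (Idl\<^bsub>Q\<^esub> {coset f}) n"
  then have "\<forall>p. \<exists>q. p < n \<longrightarrow> x p = coset (q * f)"
    by (auto simp: ideal_free_def mem_principal PiE_iff)
  from choice [OF this] obtain q where "\<forall>p. p < n \<longrightarrow> x p = coset (q p * f)" by (rule exE)
  moreover have "x \<in> extensional {..<n}" using x by (simp add: ideal_free_def PiE_iff)
  ultimately have "x = fvec n (\<lambda>p. q p * f)"
    unfolding free_vec_def by (intro extensionalityI [where A = "{..<n}"]) auto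
  then show "\<exists>q. x = fvec n (\<lambda>p. q p * f)" by blast
qed (auto simp: ideal_free_def mem_principal PiE_iff free_vec_def)

end

section \<open>Complexes over the quotient rings as polynomial matrices\<close>

lemma (in short_ideal) exists_mta_iff_pta:
  "(\<exists>r d. minimal_totally_acyclic Q (quot_max J) r d) \<longleftrightarrow> (\<exists>r D. pta r D \<and> (\<exists>i. r i > 0))"
proof
  assume "\<exists>r d. minimal_totally_acyclic Q (quot_max J) r d"
  then obtain r d where d: "minimal_totally_acyclic Q (quot_max J) r d" by blast
  obtain D where "d = (\<lambda>i. mat (r (i - 1)) (r i) (D i))" by (rule mta_obtain [OF d])
  with d have "pta r D \<and> (\<exists>i. r i > 0)" by (simp only: mta_mat_iff)
  then show "\<exists>r D. pta r D \<and> (\<exists>i. r i > 0)" by blast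
next
  assume "\<exists>r D. pta r D \<and> (\<exists>i. r i > 0)"
  then show "\<exists>r d. minimal_totally_acyclic Q (quot_max J) r d"
    unfolding mta_mat_iff [symmetric] by blast
qed

context quadric_quotient
begin

lemma quot_proj_coset: "quot_proj K (I.coset p) = K.coset p"
proof (rule Set.set_eqI)
  fix q
  have "q \<in> quot_proj K (I.coset p) \<longleftrightarrow> (\<exists>k\<in>K. \<exists>s. s - p \<in> I \<and> q = k + s)"
    unfolding quot_proj_def mem_set_add Bex_def I.mem_coset I.cng_def by simp
  also have "\<dots> \<longleftrightarrow> q - p \<in> K"
  proof
    assume "\<exists>k\<in>K. \<exists>s. s - p \<in> I \<and> q = k + s"
    then obtain k s where "k \<in> K" "s - p \<in> I" "q = k + s" by blast
    then show "q - p \<in> K" using K.add_in [of k "s - p"] I_sub_K by (simp add: add_diff_eq)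
  next
    assume "q - p \<in> K"
    then show "\<exists>k\<in>K. \<exists>s. s - p \<in> I \<and> q = k + s" by (intro bexI [of _ "q - p"] exI [of _ p]) simp_all
  qed
  also have "\<dots> \<longleftrightarrow> q \<in> K.coset p" unfolding K.mem_coset K.cng_def ..
  finally show "q \<in> quot_proj K (I.coset p) \<longleftrightarrow> q \<in> K.coset p" .
qed

text \<open>The inverse taken in \<open>lift_matrix\<close> is meaningful because the projection is
  injective on linear forms; it sends a class to that of the same linear polynomial.\<close>

lemma lift_coset:
  assumes p: "p \<in> homog 1"
  shows "the_inv_into (quot_comp I 1) (quot_proj K) (K.coset p) = I.coset p"
proof (rule the_inv_into_f_eq)
  show "inj_on (quot_proj K) (quot_comp I 1)"
    by (auto simp: inj_on_def quot_comp_def quot_proj_coset K.coset_eq_iff I.coset_eq_iff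
        cng_K_iff_I_1 simp del: One_nat_def)
  show "quot_proj K (I.coset p) = K.coset p" by (rule quot_proj_coset)
  show "I.coset p \<in> quot_comp I 1" unfolding quot_comp_def by (rule imageI) (rule p)
qed

lemma matrix_map_lift:
  assumes "\<And>p q. p < n \<Longrightarrow> q < n \<Longrightarrow> A p q = K.coset (D p q)"
    and "\<And>p q. p < n \<Longrightarrow> q < n \<Longrightarrow> D p q \<in> homog 1"
  shows "matrix_map I.Q n n (lift_matrix I K A) = I.mat n n D"
  by (rule I.matrix_map_eq_mat) (simp only: lift_matrix_def assms lift_coset)

text \<open>The matrices are linear, so replacing a preimage of \<open>f e_j\<close> by its linear
  part amounts to taking degree two components. In the other direction linear combinations of these
  preimages reach every vector with entries in the ideal of \<open>f\<close>.\<close>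

lemma lift_condition_iff_covers:
  assumes D: "\<And>i p q. p < n \<Longrightarrow> q < n \<Longrightarrow> D i p q \<in> homog 1"
  shows "(\<forall>i. ideal_free (Idl\<^bsub>I.Q\<^esub> {I.coset f}) n \<subseteq> I.mat n n (D i) ` carrier (free_module I.Q n))
    \<longleftrightarrow> covers I f n D"
proof
  assume h: "\<forall>i. ideal_free (Idl\<^bsub>I.Q\<^esub> {I.coset f}) n \<subseteq> I.mat n n (D i) ` carrier (free_module I.Q n)"
  show "covers I f n D"
    unfolding covers_def
  proof (intro allI impI)
    fix i and j :: nat assume "j < n"
    have "I.fvec n (\<lambda>p. (if p = j then 1 else 0) * f) \<in> I.mat n n (D i) ` carrier (free_module I.Q n)"
      by (rule subsetD [OF h [rule_format]]) (unfold I.mem_ideal_free_principal, rule exI, rule refl)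
    then obtain w where "\<forall>p<n. I.cng ((if p = j then 1 else 0) * f) (mv n (D i) w p)"
      by (auto simp: I.carrier_free I.mat_fvec I.fvec_eq_iff)
    note w = this [rule_format]
    have "mv n (D i) (\<lambda>q. hpart (Suc 0) (w q)) p - (if p = j then f else 0) \<in> I" if p: "p < n" for p
    proof -
      have "I.cng (hpart 2 (mv n (D i) w p)) (hpart 2 ((if p = j then 1 else 0) * f))"
        by (rule I.cng_hpart [OF I.cng_sym [OF w [OF p]]])
      moreover have "hpart 2 (mv n (D i) w p) = mv n (D i) (\<lambda>q. hpart (Suc 0) (w q)) p"
        by (rule hpart_mv_homog) (rule D [OF p])
      ultimately show ?thesis
        using homog_hpart [OF f2, of 2] by (simp add: I.cng_def split: if_splits)
    qed
    then show "\<exists>u. (\<forall>q<n. u q \<in> homog 1) \<and> (\<forall>p<n. mv n (D i) u p - (if p = j then f else 0) \<in> I)"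
      using hpart_homog [of 1] by (intro exI [of _ "\<lambda>q. hpart (Suc 0) (w q)"]) simp
  qed
next
  assume c: "covers I f n D"
  show "\<forall>i. ideal_free (Idl\<^bsub>I.Q\<^esub> {I.coset f}) n \<subseteq> I.mat n n (D i) ` carrier (free_module I.Q n)"
  proof (intro allI subsetI)
    fix i x assume "x \<in> ideal_free (Idl\<^bsub>I.Q\<^esub> {I.coset f}) n"
    then obtain a where x: "x = I.fvec n (\<lambda>p. a p * f)" unfolding I.mem_ideal_free_principal by blast
    have "\<forall>j. \<exists>u. j < n \<longrightarrow> (\<forall>p<n. mv n (D i) u p - (if p = j then f else 0) \<in> I)"
      using c unfolding covers_def by blast
    from choice [OF this] obtain u where
      "\<forall>j. j < n \<longrightarrow> (\<forall>p<n. mv n (D i) (u j) p - (if p = j then f else 0) \<in> I)" by (rule exE)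
    note u = this [rule_format]
    have "I.cng (mv n (D i) (\<lambda>q. \<Sum>j<n. a j * u j q) p) (a p * f)" if p: "p < n" for p
    proof -
      have "(\<Sum>j<n. a j * (if p = j then f else 0)) = a p * f"
        using p by (simp add: if_distrib [of "(*) _"] cong: if_cong)
      then have "mv n (D i) (\<lambda>q. \<Sum>j<n. a j * u j q) p - a p * f
          = (\<Sum>j<n. a j * (mv n (D i) (u j) p - (if p = j then f else 0)))"
        unfolding mv_sum mv_scale right_diff_distrib sum_subtractf by simp
      moreover have "(\<Sum>j<n. a j * (mv n (D i) (u j) p - (if p = j then f else 0))) \<in> I"
        by (intro I.sum_in I.mult_in u [OF _ p]) simp
      ultimately show ?thesis by (simp only: I.cng_def)
    qed
    then have "x = I.mat n n (D i) (I.fvec n (\<lambda>q. \<Sum>j<n. a j * u j q))"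
      unfolding x I.mat_fvec I.fvec_eq_iff by (blast intro: I.cng_sym)
    then show "x \<in> I.mat n n (D i) ` carrier (free_module I.Q n)" by (simp only: imageI I.fvec_in)
  qed
qed

theorem lifted_complex_iff_bistrand:
  assumes ng: "\<not> gorenstein K.Q"
  shows "(\<exists>n A. (\<forall>i. \<forall>p<n. \<forall>q<n. A i p q \<in> quot_comp K 1) \<and>
      minimal_totally_acyclic K.Q (quot_max K) (\<lambda>_. n) (\<lambda>i. matrix_map K.Q n n (A i)) \<and>
      (\<forall>i. ideal_free (Idl\<^bsub>I.Q\<^esub> {I.coset f}) n
        \<subseteq> matrix_map I.Q n n (lift_matrix I K (A i)) ` carrier (free_module I.Q n)))
    \<longleftrightarrow> (\<exists>n D. n > 0 \<and> K.bistrand (\<lambda>_. n) D \<and> covers I f n D)"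
    (is "?lhs \<longleftrightarrow> ?rhs")
proof
  assume ?lhs
  then obtain n :: nat and A where A: "\<forall>i. \<forall>p<n. \<forall>q<n. A i p q \<in> quot_comp K 1"
    and mta: "minimal_totally_acyclic K.Q (quot_max K) (\<lambda>_. n) (\<lambda>i. matrix_map K.Q n n (A i))"
    and lift: "\<forall>i. ideal_free (Idl\<^bsub>I.Q\<^esub> {I.coset f}) n
        \<subseteq> matrix_map I.Q n n (lift_matrix I K (A i)) ` carrier (free_module I.Q n)" by blast
  \<comment> \<open>Linear representatives of the entries; the same polynomials represent the lifted
    matrix modulo \<open>I\<close>.\<close>
  define D where "D i p q = (SOME d. d \<in> homog 1 \<and> A i p q = K.coset d)" for i p q
  have D: "D i p q \<in> homog 1 \<and> A i p q = K.coset (D i p q)" if "p < n" "q < n" for i p q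
  proof -
    have "A i p q \<in> quot_comp K 1" using A that by blast
    then obtain d where "d \<in> homog 1 \<and> A i p q = K.coset d" unfolding quot_comp_def by blast
    then show ?thesis unfolding D_def by (rule someI)
  qed
  have eq: "matrix_map K.Q n n (A i) = K.mat n n (D i)"
    "matrix_map I.Q n n (lift_matrix I K (A i)) = I.mat n n (D i)" for i
    by (rule K.matrix_map_eq_mat, simp only: D) (rule matrix_map_lift, simp_all only: D)
  have "K.pta (\<lambda>_. n) D \<and> (\<exists>i::int. n > 0)"
    using mta K.mta_mat_iff [of "\<lambda>_. n" D] by (simp add: eq)
  then have n: "n > 0" and pta: "K.pta (\<lambda>_. n) D" by auto
  from K.bistrand_if_pta [OF pta] ng have b: "K.bistrand (\<lambda>_. n) (\<lambda>i p q. hpart 1 (D i p q))"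
    using K.gorenstein_if_mult_ext by blast
  \<comment> \<open>Passing to linear parts changes nothing inside the range of indices. Outside of
    it the entries of \<open>D\<close> are arbitrary, which is why the matrices are compared through
    \<open>mv\<close> and not as functions.\<close>
  have h: "hpart 1 (D i p q) = D i p q" if "p < n" "q < n" for i p q
    using D [OF that, of i] homog_hpart [of "D i p q" 1 1] by simp
  have mv_h: "mv n (\<lambda>p q. hpart 1 (D i p q)) u p = mv n (D i) u p" if "p < n" for i u p
    unfolding mv_def by (intro sum.cong refl) (simp only: h [OF that] lessThan_iff)
  have "covers I f n D"
    using lift lift_condition_iff_covers [of n D] D by (simp add: eq)
  then have "covers I f n (\<lambda>i p q. hpart 1 (D i p q))"
    unfolding covers_def by (simp add: mv_h del: One_nat_def)
  with n b show ?rhs by blast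
next
  assume ?rhs
  then obtain n D where n: "n > 0" and b: "K.bistrand (\<lambda>_. n) D" and c: "covers I f n D" by blast
  have D: "D i p q \<in> homog 1" if "p < n" "q < n" for i p q
    using b K.strandD(1) [of "\<lambda>_. n" D i] that by (simp add: K.bistrand_def lin_mat_def)
  let ?A = "\<lambda>i p q. K.coset (D i p q)"
  have "\<forall>i. \<forall>p<n. \<forall>q<n. ?A i p q \<in> quot_comp K 1"
    unfolding quot_comp_def by (intro allI impI imageI D)
  moreover have "minimal_totally_acyclic K.Q (quot_max K) (\<lambda>_. n) (\<lambda>i. K.mat n n (D i))"
    using n K.pta_if_bistrand [OF b] K.mta_mat_iff [of "\<lambda>_. n" D] by simp
  moreover have "matrix_map I.Q n n (lift_matrix I K (?A i)) = I.mat n n (D i)" for i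
    by (rule matrix_map_lift [OF refl D])
  then have "\<forall>i. ideal_free (Idl\<^bsub>I.Q\<^esub> {I.coset f}) n
        \<subseteq> matrix_map I.Q n n (lift_matrix I K (?A i)) ` carrier (free_module I.Q n)"
    using lift_condition_iff_covers [of n D] D c by simp
  ultimately show ?lhs by (intro exI [of _ n] exI [of _ ?A]) simp
qed

end

section \<open>The equivalence for connected sums\<close>

theorem (in connected_sum) pta_iff_bistrands:
  assumes ng: "\<not> J.mult_ext" "\<not> L.K.mult_ext" "\<not> R.K.mult_ext"
  shows "(\<exists>r D. J.pta r D \<and> (\<exists>i. r i > 0)) \<longleftrightarrow>
    (\<exists>n A. n > 0 \<and> L.K.bistrand (\<lambda>_. n) A \<and> covers I1 f n A) \<and>
    (\<exists>n B. n > 0 \<and> R.K.bistrand (\<lambda>_. n) B \<and> covers I2 g n B)"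
proof
  assume "\<exists>r D. J.pta r D \<and> (\<exists>i. r i > 0)"
  then obtain r D i where pta: "J.pta r D" "r i > 0" by blast
  obtain n A where "n > 0" "L.K.bistrand (\<lambda>_. n) A" "covers I1 f n A"
    by (rule summand_bistrand [OF pta ng])
  moreover obtain m B where "m > 0" "R.K.bistrand (\<lambda>_. m) B" "covers I2 g m B"
    by (rule connected_sum.summand_bistrand [OF swap pta ng(1) ng(3) ng(2)])
  ultimately show "(\<exists>n A. n > 0 \<and> L.K.bistrand (\<lambda>_. n) A \<and> covers I1 f n A) \<and>
    (\<exists>n B. n > 0 \<and> R.K.bistrand (\<lambda>_. n) B \<and> covers I2 g n B)" by blast
next
  assume "(\<exists>n A. n > 0 \<and> L.K.bistrand (\<lambda>_. n) A \<and> covers I1 f n A) \<and>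
    (\<exists>n B. n > 0 \<and> R.K.bistrand (\<lambda>_. n) B \<and> covers I2 g n B)"
  then obtain n A m B where A: "L.K.bistrand (\<lambda>_. n) A" "covers I1 f n A" "n > 0"
    and B: "R.K.bistrand (\<lambda>_. m) B" "covers I2 g m B" "m > 0" by blast
  obtain N D where N: "N > 0" "J.bistrand (\<lambda>_. N) D" by (rule connected_sum_bistrand [OF A B])
  from J.pta_if_bistrand [OF N(2)] N(1) show "\<exists>r D. J.pta r D \<and> (\<exists>i. r i > 0)"
    by (intro exI [of _ "\<lambda>_. N"] exI [of _ D]) simp
qed

theorem corollary3p7:
  fixes a :: "nat \<Rightarrow> ('x::finite, 'k::field) mpoly" and t :: nat
    and b :: "nat \<Rightarrow> ('y::finite, 'k) mpoly" and u :: nat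
    and f :: "('x, 'k) mpoly" and g :: "('y, 'k) mpoly"
    and K\<^sub>1 I\<^sub>1 :: "('x, 'k) mpoly set" and K\<^sub>2 I\<^sub>2 :: "('y, 'k) mpoly set"
    and J :: "('x + 'y, 'k) mpoly set"
    and R\<^sub>0 R\<^sub>1 :: "('x, 'k) mpoly set ring" and S\<^sub>0 S\<^sub>1 :: "('y, 'k) mpoly set ring"
    and R :: "('x + 'y, 'k) mpoly set ring"
  assumes t: "t \<ge> 1" and u: "u \<ge> 1"
    and a: "minimal_homogeneous_generators a t"
    and b: "minimal_homogeneous_generators b u"
    and K\<^sub>1: "K\<^sub>1 = Idl\<^bsub>mpoly_ring\<^esub> (a ` {1..t})"
    and K\<^sub>2: "K\<^sub>2 = Idl\<^bsub>mpoly_ring\<^esub> (b ` {1..u})"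
    and R\<^sub>1: "R\<^sub>1 = mpoly_ring Quot K\<^sub>1"
    and S\<^sub>1: "S\<^sub>1 = mpoly_ring Quot K\<^sub>2"
    and R\<^sub>1_not_gorenstein: "\<not> gorenstein R\<^sub>1"
    and S\<^sub>1_not_gorenstein: "\<not> gorenstein S\<^sub>1"
    and R\<^sub>1_cube_zero: "quot_max K\<^sub>1 \<cdot>\<^bsub>R\<^sub>1\<^esub> quot_max K\<^sub>1 \<cdot>\<^bsub>R\<^sub>1\<^esub> quot_max K\<^sub>1 = {\<zero>\<^bsub>R\<^sub>1\<^esub>}"
    and S\<^sub>1_cube_zero: "quot_max K\<^sub>2 \<cdot>\<^bsub>S\<^sub>1\<^esub> quot_max K\<^sub>2 \<cdot>\<^bsub>S\<^sub>1\<^esub> quot_max K\<^sub>2 = {\<zero>\<^bsub>S\<^sub>1\<^esub>}"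
    and f: "f = a 1" "f \<in> homog 2"
    and g: "g = b 1" "g \<in> homog 2"
    and I\<^sub>1: "I\<^sub>1 = (irrelevant_ideal \<cdot>\<^bsub>mpoly_ring\<^esub> (Idl\<^bsub>mpoly_ring\<^esub> {a 1}))
                   <+>\<^bsub>mpoly_ring\<^esub> Idl\<^bsub>mpoly_ring\<^esub> (a ` {2..t})"
    and I\<^sub>2: "I\<^sub>2 = (irrelevant_ideal \<cdot>\<^bsub>mpoly_ring\<^esub> (Idl\<^bsub>mpoly_ring\<^esub> {b 1}))
                   <+>\<^bsub>mpoly_ring\<^esub> Idl\<^bsub>mpoly_ring\<^esub> (b ` {2..u})"
    and R\<^sub>0: "R\<^sub>0 = mpoly_ring Quot I\<^sub>1"
    and S\<^sub>0: "S\<^sub>0 = mpoly_ring Quot I\<^sub>2"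
    and J: "J = Idl\<^bsub>mpoly_ring\<^esub> (rename Inl ` I\<^sub>1) <+>\<^bsub>mpoly_ring\<^esub> Idl\<^bsub>mpoly_ring\<^esub> (rename Inr ` I\<^sub>2)
                <+>\<^bsub>mpoly_ring\<^esub> Idl\<^bsub>mpoly_ring\<^esub> {rename Inl f - rename Inr g}
                <+>\<^bsub>mpoly_ring\<^esub> Idl\<^bsub>mpoly_ring\<^esub> {mvar (Inl i) * mvar (Inr j) |i j. True}"
    and R: "R = mpoly_ring Quot J"
    and R_not_gorenstein: "\<not> gorenstein R"
  shows "(\<exists>r d. minimal_totally_acyclic R (quot_max J) r d) \<longleftrightarrow>
    (\<exists>n A.
       (\<forall>i. \<forall>p<n. \<forall>q<n. A i p q \<in> quot_comp K\<^sub>1 1) \<and>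
       minimal_totally_acyclic R\<^sub>1 (quot_max K\<^sub>1) (\<lambda>_. n) (\<lambda>i. matrix_map R\<^sub>1 n n (A i)) \<and>
       (\<forall>i. ideal_free (Idl\<^bsub>R\<^sub>0\<^esub> {I\<^sub>1 +>\<^bsub>mpoly_ring\<^esub> f}) n
              \<subseteq> matrix_map R\<^sub>0 n n (lift_matrix I\<^sub>1 K\<^sub>1 (A i)) ` carrier (free_module R\<^sub>0 n))) \<and>
    (\<exists>n B.
       (\<forall>i. \<forall>p<n. \<forall>q<n. B i p q \<in> quot_comp K\<^sub>2 1) \<and>
       minimal_totally_acyclic S\<^sub>1 (quot_max K\<^sub>2) (\<lambda>_. n) (\<lambda>i. matrix_map S\<^sub>1 n n (B i)) \<and>
       (\<forall>i. ideal_free (Idl\<^bsub>S\<^sub>0\<^esub> {I\<^sub>2 +>\<^bsub>mpoly_ring\<^esub> g}) n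
              \<subseteq> matrix_map S\<^sub>0 n n (lift_matrix I\<^sub>2 K\<^sub>2 (B i)) ` carrier (free_module S\<^sub>0 n)))"
proof -
  have "quadric_quotient I\<^sub>1 K\<^sub>1 (a 1)"
    by (rule minimal_generators_quadric_quotient [OF t a _ K\<^sub>1 R\<^sub>1_cube_zero [unfolded R\<^sub>1] I\<^sub>1]) (use f in simp)
  moreover have "quadric_quotient I\<^sub>2 K\<^sub>2 (b 1)"
    by (rule minimal_generators_quadric_quotient [OF u b _ K\<^sub>2 S\<^sub>1_cube_zero [unfolded S\<^sub>1] I\<^sub>2]) (use g in simp)
  ultimately interpret connected_sum I\<^sub>1 K\<^sub>1 f I\<^sub>2 K\<^sub>2 g J proj_left "rename Inl" proj_right "rename Inr"
    unfolding f(1) [symmetric] g(1) [symmetric] by (rule connected_sum_ideal [OF _ _ J])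
  show ?thesis
    unfolding R R\<^sub>0 R\<^sub>1 S\<^sub>0 S\<^sub>1 J.exists_mta_iff_pta
      L.lifted_complex_iff_bistrand [OF R\<^sub>1_not_gorenstein [unfolded R\<^sub>1]]
      R.lifted_complex_iff_bistrand [OF S\<^sub>1_not_gorenstein [unfolded S\<^sub>1]]
  proof (rule pta_iff_bistrands)
    \<comment> \<open>All three rings enter through Baer's criterion: if every homomorphism on the
      maximal ideal were a multiplication, the ring would be Gorenstein.\<close>
    show "\<not> J.mult_ext" using R_not_gorenstein J.gorenstein_if_mult_ext by (simp only: R) blast
    show "\<not> L.K.mult_ext" using R\<^sub>1_not_gorenstein L.K.gorenstein_if_mult_ext by (simp only: R\<^sub>1) blast
    show "\<not> R.K.mult_ext" using S\<^sub>1_not_gorenstein R.K.gorenstein_if_mult_ext by (simp only: S\<^sub>1) blast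
  qed
qed

end
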